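(* Let $c>0$ and let $p,q\in\mathbb{N}$ with $2\le p<q$. Then the following hold for the equation $$D_x\phi+c\phi+\phi^p-\phi^q=0,\quad x\in\mathbb{R}.\qquad(\mathrm{SP})$$ (1) Assume that $p$ is odd and $q$ is odd. Then there exists a ground state which is positive, even, and decreasing in $|x|$. There also exists a ground state which is negative, even, and increasing in $|x|$. (2) Assume that $p$ is odd and $q$ is even. Then there exists a ground state which is positive, even, and decreasing in $|x|$, while there do not exist any negative solutions. (3) Assume that $p$ is even and $q$ is odd. Then there exists a solution which is positive, even, and decreasing in $|x|$. Moreover, there exists a ground state which is negative, even, and increasing in $|x|$. In addition, none of the positive solutions is a ground state. (4) Assume that $p$ is even and $q$ is even. Then there exists a solution which is positive, even, and decreasing in $|x|$. Moreover, there exists a solution which is negative, even, and increasing in $|x|$ if $c\in(0,c_0)$, where $$c_0:=\frac{2(q-p)(p-1)^{\beta}(q+1)^{\beta}}{(p+1)^{\alpha}(q-1)^{\alpha}},\qquad \alpha:=\frac{q-1}{q-p},\quad \beta:=\frac{p-1}{q-p}.$$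
   Context: All functions are real-valued on $\mathbb{R}$. $D_x:=\mathscr{F}^{-1}|\xi|\mathscr{F}$, where $\mathscr{F}$ is the Fourier transform (with kernel $e^{-i\xi x}$); similarly $D_x^{1/2}:=\mathscr{F}^{-1}|\xi|^{1/2}\mathscr{F}$. For $u\in H^{1/2}(\mathbb{R})$ the action functional corresponding to $(\mathrm{SP})$ is $$S(u)=\tfrac12\|D_x^{1/2}u\|_{L^2}^2+\tfrac c2\|u\|_{L^2}^2+\tfrac1{p+1}\int_{\mathbb{R}}u^{p+1}\,dx-\tfrac1{q+1}\int_{\mathbb{R}}u^{q+1}\,dx.$$ It is of class $C^1$ on $H^{1/2}(\mathbb{R})$, with $S'(u)=D_xu+cu+u^p-u^q$, and $u\in H^{1/2}(\mathbb{R})$ is called a solution of $(\mathrm{SP})$ if $S'(u)=0$. Let $\mathcal{N}:=\{v\in H^{1/2}(\mathbb{R})\setminus\{0\}: S'(v)=0\}$. A ground state is an element $\phi\in\mathcal{N}$ such that $S(\phi)\le S(v)$ for all $v\in\mathcal{N}$. "Decreasing (increasing) in $|x|$" is meant in the sense of symmetric decreasing rearrangements (non-increasing, respectively non-decreasing, as a function of $|x|$). *)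

theory Defs
  imports "HOL-Analysis.Analysis"
begin

text \<open>
  Elements of the function spaces below are Borel functions rather than classes of almost
  everywhere equal functions; every class of Lebesgue measurable functions has a Borel
  representative, and all notions up to \<open>ground_state\<close> are invariant under a.e. modification.
\<close>

definition L2 :: "(real \<Rightarrow> 'a::{banach, second_countable_topology}) set" where
  "L2 = {f \<in> borel_measurable lborel. integrable lborel (\<lambda>x. (norm (f x))\<^sup>2)}"

definition L2_norm :: "(real \<Rightarrow> 'a::{banach, second_countable_topology}) \<Rightarrow> real" where
  "L2_norm f = sqrt (LINT x|lborel. (norm (f x))\<^sup>2)"

definition truncated_fourier :: "real \<Rightarrow> (real \<Rightarrow> complex) \<Rightarrow> real \<Rightarrow> complex" where
  "truncated_fourier R f \<xi> = (LINT x:{-R..R}|lborel. exp (- \<i> * of_real \<xi> * of_real x) * f x)"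

text \<open>
  The Fourier transform on \<open>L2\<close>, with kernel \<open>exp (- \<i> \<xi> x)\<close> and no prefactor, as the
  limit in \<open>L2\<close> of the truncated transforms. The limit is determined up to a null set. The
  extended integral is used since the Bochner integral of a non-integrable function is 0.
\<close>

definition is_fourier :: "(real \<Rightarrow> complex) \<Rightarrow> (real \<Rightarrow> complex) \<Rightarrow> bool" where
  "is_fourier f g \<longleftrightarrow> f \<in> L2 \<and> g \<in> L2 \<and>
     ((\<lambda>R. \<integral>\<^sup>+ \<xi>. ennreal ((norm (truncated_fourier R f \<xi> - g \<xi>))\<^sup>2) \<partial>lborel) \<longlongrightarrow> 0) at_top"

definition fourier :: "(real \<Rightarrow> complex) \<Rightarrow> real \<Rightarrow> complex" where
  "fourier f = (SOME g. is_fourier f g)"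

definition inv_fourier :: "(real \<Rightarrow> complex) \<Rightarrow> real \<Rightarrow> complex" where
  "inv_fourier g = (SOME f. is_fourier f g)"

definition Dx_half :: "(real \<Rightarrow> real) \<Rightarrow> real \<Rightarrow> complex" where
  "Dx_half u = inv_fourier (\<lambda>\<xi>. of_real (\<bar>\<xi>\<bar> powr (1/2)) * fourier (\<lambda>x. of_real (u x)) \<xi>)"

definition Hhalf :: "(real \<Rightarrow> real) set" where
  "Hhalf = {u \<in> L2. integrable lborel
     (\<lambda>\<xi>. (1 + \<xi>\<^sup>2) powr (1/2) * (norm (fourier (\<lambda>x. of_real (u x)) \<xi>))\<^sup>2)}"

definition Hhalf_norm :: "(real \<Rightarrow> real) \<Rightarrow> real" where
  "Hhalf_norm u = sqrt (LINT \<xi>|lborel.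
     (1 + \<xi>\<^sup>2) powr (1/2) * (norm (fourier (\<lambda>x. of_real (u x)) \<xi>))\<^sup>2)"

definition action :: "real \<Rightarrow> nat \<Rightarrow> nat \<Rightarrow> (real \<Rightarrow> real) \<Rightarrow> real" where
  "action c p q u =
     1/2 * (L2_norm (Dx_half u))\<^sup>2 + c/2 * (L2_norm u)\<^sup>2
     + 1 / (real p + 1) * (LINT x|lborel. u x ^ (p + 1))
     - 1 / (real q + 1) * (LINT x|lborel. u x ^ (q + 1))"

text \<open>
  Frechet derivative of a functional on \<open>Hhalf\<close> with respect to \<open>Hhalf_norm\<close>. The library's
  \<open>has_derivative\<close> does not apply, as \<open>Hhalf\<close> is not a type of class \<open>real_normed_vector\<close>.
\<close>

definition has_Hhalf_derivative ::
    "((real \<Rightarrow> real) \<Rightarrow> real) \<Rightarrow> ((real \<Rightarrow> real) \<Rightarrow> real) \<Rightarrow> (real \<Rightarrow> real) \<Rightarrow> bool" where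
  "has_Hhalf_derivative F L u \<longleftrightarrow>
     (\<forall>g\<in>Hhalf. \<forall>h\<in>Hhalf. L (\<lambda>x. g x + h x) = L g + L h) \<and>
     (\<forall>a. \<forall>h\<in>Hhalf. L (\<lambda>x. a * h x) = a * L h) \<and>
     (\<exists>K. \<forall>h\<in>Hhalf. \<bar>L h\<bar> \<le> K * Hhalf_norm h) \<and>
     (\<forall>\<epsilon>>0. \<exists>\<delta>>0. \<forall>h\<in>Hhalf. Hhalf_norm h < \<delta> \<longrightarrow>
        \<bar>F (\<lambda>x. u x + h x) - F u - L h\<bar> \<le> \<epsilon> * Hhalf_norm h)"

text \<open>
  A solution of \<open>D\<^sub>x u + c u + u^p - u^q = 0\<close> is a critical point of the action: the left-hand
  side, an element of the dual of \<open>Hhalf\<close>, is the Frechet derivative of the action at \<open>u\<close>.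
\<close>

definition SP_solution :: "real \<Rightarrow> nat \<Rightarrow> nat \<Rightarrow> (real \<Rightarrow> real) \<Rightarrow> bool" where
  "SP_solution c p q u \<longleftrightarrow> u \<in> Hhalf \<and> has_Hhalf_derivative (action c p q) (\<lambda>h. 0) u"

definition nontrivial_solutions :: "real \<Rightarrow> nat \<Rightarrow> nat \<Rightarrow> (real \<Rightarrow> real) set" where
  "nontrivial_solutions c p q = {v. SP_solution c p q v \<and> \<not> (AE x in lborel. v x = 0)}"

definition ground_state :: "real \<Rightarrow> nat \<Rightarrow> nat \<Rightarrow> (real \<Rightarrow> real) \<Rightarrow> bool" where
  "ground_state c p q \<phi> \<longleftrightarrow> \<phi> \<in> nontrivial_solutions c p q \<and>
     (\<forall>v \<in> nontrivial_solutions c p q. action c p q \<phi> \<le> action c p q v)"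

definition even_function :: "(real \<Rightarrow> real) \<Rightarrow> bool" where
  "even_function u \<longleftrightarrow> (\<forall>x. u (- x) = u x)"

definition decreasing_in_abs :: "(real \<Rightarrow> real) \<Rightarrow> bool" where
  "decreasing_in_abs u \<longleftrightarrow> (\<forall>x y. \<bar>x\<bar> \<le> \<bar>y\<bar> \<longrightarrow> u y \<le> u x)"

definition increasing_in_abs :: "(real \<Rightarrow> real) \<Rightarrow> bool" where
  "increasing_in_abs u \<longleftrightarrow> (\<forall>x y. \<bar>x\<bar> \<le> \<bar>y\<bar> \<longrightarrow> u x \<le> u y)"

definition c0 :: "nat \<Rightarrow> nat \<Rightarrow> real" where
  "c0 p q =
     (let \<alpha> = (real q - 1) / (real q - real p); \<beta> = (real p - 1) / (real q - real p)
      in 2 * (real q - real p) * (real p - 1) powr \<beta> * (real q + 1) powr \<beta>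
         / ((real p + 1) powr \<alpha> * (real q - 1) powr \<alpha>))"

end

theory Submission imports Defs "HOL-Probability.Probability" begin

text \<open>
  By Plancherel, \<open>\<parallel>D\<^sub>x\<^sup>1\<^sup>/\<^sup>2 u\<parallel>\<^sup>2\<close> is a constant \<open>kap\<close> times the Gagliardo form \<open>gs u\<close>, the integral of
  \<open>(u x - u y)\<^sup>2 / (x - y)\<^sup>2\<close>. This form decreases under symmetric decreasing rearrangement, and radially
  decreasing functions of bounded energy are precompact in \<open>L\<^sup>m\<close> for \<open>m \<ge> 3\<close>, so constrained minimisers exist
  and may be taken decreasing. If \<open>p\<close> is odd, a minimiser of the action on the Nehari set of the positive
  problem is a ground state, since the remaining sign changes only increase the Nehari functional of a
  competitor; if \<open>p\<close> is even and \<open>q\<close> is odd, the same holds for the negative problem, and the Nehari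
  functional of that problem is strictly negative at positive solutions. For two even powers the
  negative problem is of Berestycki-Lions type: \<open>c < c\<^sub>0\<close> says exactly that its potential energy density is
  negative somewhere; one minimises the Gagliardo form subject to nonpositive potential energy and removes the
  Lagrange multiplier by a dilation. Minimisers are bounded because the equation controls
  \<open>u(r) - u(2 r)\<close> by \<open>sqrt r\<close>, and positive because the form is nonlocal.
\<close>

section \<open>Square-integrable functions\<close>

text \<open>Defined by Fourier multipliers, the energy says nothing about pointwise operations,
  whereas rearrangement, truncation and the test functions built from \<open>u\<close> all act
  pointwise. This is why the problem is transferred to difference quotients. The variational
  problems are posed with the integrals of |u|^m, not of u^m. The former are invariant under
  rearrangement, agree with the latter on nonnegative functions, and admit sign-changing
  competitors, so that a minimiser can be perturbed in every direction. Constraints are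
  inequalities, because rearrangement and a.e. limits can only lower the two quadratic terms: an
  equation would be lost, an inequality with nonnegative quadratic coefficients is kept. Compactness
  fails for m = 2, so the masses are never claimed to converge to the mass of the limit. Functions
  of finite energy may be unbounded. As the profile has to be real-valued and decreasing at every
  point, including the origin, an a priori bound is required, and it comes from the
  equation.\<close>

definition nsq :: "(real \<Rightarrow> 'a::real_normed_vector) \<Rightarrow> ennreal" where
  "nsq f = (\<integral>\<^sup>+x. ennreal ((norm (f x))\<^sup>2) \<partial>lborel)"

lemma L2_measurable [measurable_dest]: "f \<in> L2 \<Longrightarrow> f \<in> borel_measurable borel"
  by (simp add: L2_def)

lemma L2_integrable: "f \<in> L2 \<Longrightarrow> integrable lborel (\<lambda>x. (norm (f x))\<^sup>2)"
  by (simp add: L2_def)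

text \<open>An upper bound for the extended integral already proves membership. A bound for
  \<open>L2_norm\<close> would not, since the integral of a non-integrable function is 0.\<close>

lemma L2_iff_nsq: "f \<in> L2 \<longleftrightarrow> f \<in> borel_measurable borel \<and> nsq f < \<infinity>"
  unfolding L2_def nsq_def by (auto simp: integrable_iff_bounded)

lemma nsq_L2_norm: "f \<in> L2 \<Longrightarrow> nsq f = ennreal ((L2_norm f)\<^sup>2)"
  unfolding nsq_def L2_norm_def
  by (subst nn_integral_eq_integral[OF L2_integrable]) auto

lemma L2_norm_nonneg [simp]: "0 \<le> L2_norm f"
  unfolding L2_norm_def by simp

lemma L2_norm_sq: "(L2_norm f)\<^sup>2 = (LINT x|lborel. (norm (f x))\<^sup>2)"
  unfolding L2_norm_def by simp

lemma norm_add_sq_le: "(norm (a + b))\<^sup>2 \<le> 2 * (norm a)\<^sup>2 + 2 * (norm b :: real)\<^sup>2"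
proof -
  have "(norm (a + b))\<^sup>2 \<le> (norm a + norm b)\<^sup>2"
    by (simp add: norm_triangle_ineq power_mono)
  also have "\<dots> \<le> 2 * (norm a)\<^sup>2 + 2 * (norm b)\<^sup>2"
    using sum_squares_bound[of "norm a" "norm b"] by (simp add: power2_sum)
  finally show ?thesis .
qed

lemma nsq_add_le:
  assumes [measurable]: "f \<in> borel_measurable borel" "g \<in> borel_measurable borel"
  shows "nsq (\<lambda>x. f x + g x) \<le> 2 * nsq f + 2 * nsq g"
proof -
  have "nsq (\<lambda>x. f x + g x) \<le> (\<integral>\<^sup>+x. 2 * ennreal ((norm (f x))\<^sup>2) + 2 * ennreal ((norm (g x))\<^sup>2) \<partial>lborel)"
    unfolding nsq_def
  proof (intro nn_integral_mono)
    fix x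
    have "ennreal ((norm (f x + g x))\<^sup>2) \<le> ennreal (2 * (norm (f x))\<^sup>2 + 2 * (norm (g x))\<^sup>2)"
      by (intro ennreal_leI norm_add_sq_le)
    also have "\<dots> = 2 * ennreal ((norm (f x))\<^sup>2) + 2 * ennreal ((norm (g x))\<^sup>2)"
      by (simp add: ennreal_mult)
    finally show "ennreal ((norm (f x + g x))\<^sup>2) \<le> 2 * ennreal ((norm (f x))\<^sup>2) + 2 * ennreal ((norm (g x))\<^sup>2)" .
  qed
  also have "\<dots> = 2 * nsq f + 2 * nsq g"
    unfolding nsq_def by (simp add: nn_integral_add nn_integral_cmult)
  finally show ?thesis .
qed

lemma nsq_uminus [simp]: "nsq (\<lambda>x. - f x) = nsq f"
  by (simp add: nsq_def)

lemma nsq_diff_commute: "nsq (\<lambda>x. f x - g x) = nsq (\<lambda>x. g x - f x)"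
  by (simp add: nsq_def norm_minus_commute)

lemma L2_add:
  assumes f: "f \<in> L2" and g: "g \<in> L2"
  shows "(\<lambda>x. f x + g x) \<in> L2"
proof -
  have "nsq (\<lambda>x. f x + g x) \<le> 2 * nsq f + 2 * nsq g"
    using f g by (intro nsq_add_le) (auto simp: L2_iff_nsq)
  also have "\<dots> < \<infinity>"
    using f g by (simp add: L2_iff_nsq ennreal_mult_less_top)
  finally show ?thesis using f g by (auto simp: L2_iff_nsq intro!: borel_measurable_add)
qed

lemma L2_uminus: "f \<in> L2 \<Longrightarrow> (\<lambda>x. - f x) \<in> L2"
  by (simp add: L2_iff_nsq)

lemma L2_diff: "f \<in> L2 \<Longrightarrow> g \<in> L2 \<Longrightarrow> (\<lambda>x. f x - g x) \<in> L2"
  using L2_add[OF _ L2_uminus, of f g] by simp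

lemma nsq_mono:
  "(\<And>x. norm (f x) \<le> norm (g x)) \<Longrightarrow> nsq f \<le> nsq g"
  unfolding nsq_def by (intro nn_integral_mono ennreal_leI power_mono) auto

lemma L2_bound:
  assumes "g \<in> L2" "f \<in> borel_measurable borel" "\<And>x. norm (f x) \<le> norm (g x)"
  shows "f \<in> L2"
  using assms nsq_mono[of f g] by (auto simp: L2_iff_nsq)

lemma L2_norm_scale: "L2_norm (\<lambda>x. c *\<^sub>R f x) = \<bar>c\<bar> * L2_norm f"
  unfolding L2_norm_def by (simp add: power_mult_distrib real_sqrt_mult)

lemma L2_scaleR: "f \<in> L2 \<Longrightarrow> (\<lambda>x. c *\<^sub>R f x) \<in> L2"
  unfolding L2_def by (auto simp: power_mult_distrib)

lemma L2_of_real: "u \<in> L2 \<Longrightarrow> (\<lambda>x. complex_of_real (u x)) \<in> L2"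
  unfolding L2_def by auto

lemma L2_cnj: "f \<in> L2 \<Longrightarrow> (\<lambda>x. cnj (f x)) \<in> L2"
  unfolding L2_def by (auto intro: measurable_compose[OF _ borel_measurable_continuous_onI] continuous_intros)

text \<open>The two codomains differ so that a real weight can be paired with a complex function, as
  in \<open>L2_complete\<close>.\<close>

lemma Cauchy_Schwarz_L2:
  fixes f :: "real \<Rightarrow> 'a::{banach, second_countable_topology}"
    and g :: "real \<Rightarrow> 'b::{banach, second_countable_topology}"
  assumes f: "f \<in> L2" and g: "g \<in> L2"
  shows "integrable lborel (\<lambda>x. norm (f x) * norm (g x))"
    and "(LINT x|lborel. norm (f x) * norm (g x)) \<le> L2_norm f * L2_norm g"
proof -
  note [measurable] = L2_measurable[OF f] L2_measurable[OF g]
  show i: "integrable lborel (\<lambda>x. norm (f x) * norm (g x))"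
  proof (rule Bochner_Integration.integrable_bound)
    show "integrable lborel (\<lambda>x. (norm (f x))\<^sup>2 + (norm (g x))\<^sup>2)"
      by (intro Bochner_Integration.integrable_add L2_integrable f g)
    show "AE x in lborel. norm (norm (f x) * norm (g x)) \<le> norm ((norm (f x))\<^sup>2 + (norm (g x))\<^sup>2)"
    proof (intro AE_I2)
      fix x
      have "2 * (norm (f x) * norm (g x)) \<le> (norm (f x))\<^sup>2 + (norm (g x))\<^sup>2"
        using sum_squares_bound[of "norm (f x)" "norm (g x)"] by simp
      moreover have "0 \<le> norm (f x) * norm (g x)" by simp
      ultimately show "norm (norm (f x) * norm (g x)) \<le> norm ((norm (f x))\<^sup>2 + (norm (g x))\<^sup>2)"
        by (simp only: real_norm_def)
    qed
  qed measurable
  have "(\<integral>\<^sup>+x. ennreal (norm (f x)) * ennreal (norm (g x)) \<partial>lborel)\<^sup>2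
     \<le> (\<integral>\<^sup>+x. (ennreal (norm (f x)))\<^sup>2 \<partial>lborel) * (\<integral>\<^sup>+x. (ennreal (norm (g x)))\<^sup>2 \<partial>lborel)"
    by (rule Cauchy_Schwarz_nn_integral) auto
  also have "\<dots> = nsq f * nsq g" unfolding nsq_def by (simp add: ennreal_power)
  also have "\<dots> = ennreal ((L2_norm f * L2_norm g)\<^sup>2)"
    using f g by (simp add: nsq_L2_norm ennreal_mult power_mult_distrib)
  also have "(\<integral>\<^sup>+x. ennreal (norm (f x)) * ennreal (norm (g x)) \<partial>lborel)
     = ennreal (LINT x|lborel. norm (f x) * norm (g x))"
    using i by (subst nn_integral_eq_integral[symmetric]) (auto simp: ennreal_mult)
  finally have "(LINT x|lborel. norm (f x) * norm (g x))\<^sup>2 \<le> (L2_norm f * L2_norm g)\<^sup>2"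
    by (simp add: ennreal_power)
  then show "(LINT x|lborel. norm (f x) * norm (g x)) \<le> L2_norm f * L2_norm g"
    by (rule power2_le_imp_le) simp
qed

lemma L2_mult_integrable:
  fixes f g :: "real \<Rightarrow> 'a::{real_normed_div_algebra, banach, second_countable_topology}"
  assumes "f \<in> L2" "g \<in> L2"
  shows "integrable lborel (\<lambda>x. f x * g x)"
proof (rule Bochner_Integration.integrable_bound[OF Cauchy_Schwarz_L2(1)[OF assms]])
  show "(\<lambda>x. f x * g x) \<in> borel_measurable lborel"
    using assms by (auto dest: L2_measurable)
qed (simp add: norm_mult)

lemma L2_norm_integral_mult_le:
  fixes f g :: "real \<Rightarrow> 'a::{real_normed_field, banach, second_countable_topology}"
  assumes "f \<in> L2" "g \<in> L2"
  shows "norm (LINT x|lborel. f x * g x) \<le> L2_norm f * L2_norm g"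
proof -
  have "norm (LINT x|lborel. f x * g x) \<le> (LINT x|lborel. norm (f x * g x))"
    by (rule integral_norm_bound)
  also have "\<dots> \<le> L2_norm f * L2_norm g"
    using Cauchy_Schwarz_L2(2)[OF assms] by (simp add: norm_mult)
  finally show ?thesis .
qed

lemma L2_norm_triangle:
  assumes f: "f \<in> L2" and g: "g \<in> L2"
  shows "L2_norm (\<lambda>x. f x + g x) \<le> L2_norm f + L2_norm g"
proof -
  note cs = Cauchy_Schwarz_L2[OF f g]
  have "(L2_norm (\<lambda>x. f x + g x))\<^sup>2 = (LINT x|lborel. (norm (f x + g x))\<^sup>2)" by (rule L2_norm_sq)
  also have "\<dots> \<le> (LINT x|lborel. ((norm (f x))\<^sup>2 + 2 * (norm (f x) * norm (g x))) + (norm (g x))\<^sup>2)"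
  proof (rule integral_mono)
    show "(norm (f x + g x))\<^sup>2 \<le> (norm (f x))\<^sup>2 + 2 * (norm (f x) * norm (g x)) + (norm (g x))\<^sup>2" for x
      using power_mono[OF norm_triangle_ineq[of "f x" "g x"], of 2] by (simp add: power2_sum)
  qed (intro Bochner_Integration.integrable_add integrable_mult_right cs L2_integrable L2_add f g)+
  also have "\<dots> = (L2_norm f)\<^sup>2 + 2 * (LINT x|lborel. norm (f x) * norm (g x)) + (L2_norm g)\<^sup>2"
    using cs(1) L2_integrable[OF f] L2_integrable[OF g] by (simp add: L2_norm_sq)
  also have "\<dots> \<le> (L2_norm f + L2_norm g)\<^sup>2"
    using cs(2) by (simp add: power2_sum)
  finally show ?thesis by (rule power2_le_imp_le) simp
qed

lemma L2_norm_diff_triangle: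
  assumes f: "f \<in> L2" and g: "g \<in> L2"
  shows "\<bar>L2_norm f - L2_norm g\<bar> \<le> L2_norm (\<lambda>x. f x - g x)"
proof -
  have "L2_norm f \<le> L2_norm (\<lambda>x. f x - g x) + L2_norm g"
    using L2_norm_triangle[OF L2_diff[OF f g] g] by simp
  moreover have "L2_norm g \<le> L2_norm (\<lambda>x. g x - f x) + L2_norm f"
    using L2_norm_triangle[OF L2_diff[OF g f] f] by simp
  moreover have "L2_norm (\<lambda>x. g x - f x) = L2_norm (\<lambda>x. f x - g x)"
    by (simp add: L2_norm_def norm_minus_commute)
  ultimately show ?thesis by linarith
qed

lemma nsq_tendsto_zero_iff:
  assumes "\<And>n. (\<lambda>x. f n x) \<in> L2"
  shows "((\<lambda>n. nsq (f n)) \<longlongrightarrow> 0) F \<longleftrightarrow> ((\<lambda>n. L2_norm (f n)) \<longlongrightarrow> 0) F"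
proof -
  have "((\<lambda>n. nsq (f n)) \<longlongrightarrow> 0) F \<longleftrightarrow> ((\<lambda>n. ennreal ((L2_norm (f n))\<^sup>2)) \<longlongrightarrow> ennreal 0) F"
    using assms by (simp add: nsq_L2_norm)
  also have "\<dots> \<longleftrightarrow> ((\<lambda>n. (L2_norm (f n))\<^sup>2) \<longlongrightarrow> 0) F"
    by (rule tendsto_ennreal_iff) auto
  also have "\<dots> \<longleftrightarrow> ((\<lambda>n. L2_norm (f n)) \<longlongrightarrow> 0) F"
  proof
    assume "((\<lambda>n. (L2_norm (f n))\<^sup>2) \<longlongrightarrow> 0) F"
    from tendsto_real_sqrt[OF this] show "((\<lambda>n. L2_norm (f n)) \<longlongrightarrow> 0) F" by simp
  next
    assume "((\<lambda>n. L2_norm (f n)) \<longlongrightarrow> 0) F"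
    from tendsto_power[OF this, of 2] show "((\<lambda>n. (L2_norm (f n))\<^sup>2) \<longlongrightarrow> 0) F" by simp
  qed
  finally show ?thesis .
qed

lemma L2_norm_tendsto:
  assumes "\<And>n. f n \<in> L2" "g \<in> L2" "((\<lambda>n. nsq (\<lambda>x. f n x - g x)) \<longlongrightarrow> 0) F"
  shows "((\<lambda>n. L2_norm (f n)) \<longlongrightarrow> L2_norm g) F"
proof -
  have "((\<lambda>n. L2_norm (\<lambda>x. f n x - g x)) \<longlongrightarrow> 0) F"
    using assms by (subst nsq_tendsto_zero_iff[symmetric]) (auto intro: L2_diff)
  then have "((\<lambda>n. L2_norm (f n) - L2_norm g) \<longlongrightarrow> 0) F"
    by (rule Lim_null_comparison[rotated]) (use L2_norm_diff_triangle[OF assms(1,2)] in auto)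
  then show ?thesis by (simp add: LIM_zero_iff)
qed

lemma integral_mult_tendsto_L2:
  fixes f g :: "nat \<Rightarrow> real \<Rightarrow> complex"
  assumes f: "\<And>n. f n \<in> L2" "f' \<in> L2" "(\<lambda>n. nsq (\<lambda>x. f n x - f' x)) \<longlonglongrightarrow> 0"
    and g: "\<And>n. g n \<in> L2" "g' \<in> L2" "(\<lambda>n. nsq (\<lambda>x. g n x - g' x)) \<longlonglongrightarrow> 0"
  shows "(\<lambda>n. LINT x|lborel. f n x * g n x) \<longlonglongrightarrow> (LINT x|lborel. f' x * g' x)"
proof -
  have df: "(\<lambda>n. L2_norm (\<lambda>x. f n x - f' x)) \<longlonglongrightarrow> 0"
    using f by (subst nsq_tendsto_zero_iff[symmetric]) (auto intro: L2_diff)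
  have dg: "(\<lambda>n. L2_norm (\<lambda>x. g n x - g' x)) \<longlonglongrightarrow> 0"
    using g by (subst nsq_tendsto_zero_iff[symmetric]) (auto intro: L2_diff)
  have ng: "(\<lambda>n. L2_norm (g n)) \<longlonglongrightarrow> L2_norm g'" by (rule L2_norm_tendsto[OF g])
  have "(\<lambda>n. L2_norm (\<lambda>x. f n x - f' x) * L2_norm (g n) + L2_norm f' * L2_norm (\<lambda>x. g n x - g' x)) \<longlonglongrightarrow> 0 * L2_norm g' + L2_norm f' * 0"
    by (intro tendsto_intros df dg ng)
  moreover have "norm ((LINT x|lborel. f n x * g n x) - (LINT x|lborel. f' x * g' x))
     \<le> L2_norm (\<lambda>x. f n x - f' x) * L2_norm (g n) + L2_norm f' * L2_norm (\<lambda>x. g n x - g' x)" for n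
  proof -
    have "(LINT x|lborel. f n x * g n x) - (LINT x|lborel. f' x * g' x)
        = (LINT x|lborel. (f n x - f' x) * g n x) + (LINT x|lborel. f' x * (g n x - g' x))"
      using L2_mult_integrable[OF f(1) g(1), of n n] L2_mult_integrable[OF f(2) g(2)] L2_mult_integrable[OF f(2) g(1), of n]
      unfolding left_diff_distrib right_diff_distrib
      by (simp add: Bochner_Integration.integral_diff)
    also have "norm \<dots> \<le> L2_norm (\<lambda>x. f n x - f' x) * L2_norm (g n) + L2_norm f' * L2_norm (\<lambda>x. g n x - g' x)"
      by (intro order.trans[OF norm_triangle_ineq] add_mono L2_norm_integral_mult_le L2_diff f g)
    finally show ?thesis .
  qed
  ultimately have "(\<lambda>n. (LINT x|lborel. f n x * g n x) - (LINT x|lborel. f' x * g' x)) \<longlonglongrightarrow> 0"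
    by (metis (no_types, lifting) Lim_null_comparison always_eventually mult_zero_left mult_zero_right add_0_left)
  then show ?thesis by (simp add: LIM_zero_iff)
qed

text \<open>By Cauchy-Schwarz, a strictly positive weight \<open>w\<close> in L2 turns the sequence
  into a Cauchy sequence in L1. This provides an a.e. convergent subsequence, the weight is divided
  out, and Fatou upgrades the a.e. limit to a limit in L2.\<close>

lemma L2_complete:
  fixes f :: "nat \<Rightarrow> real \<Rightarrow> complex"
  assumes f: "\<And>n. f n \<in> L2"
    and cauchy: "\<And>e. e > 0 \<Longrightarrow> \<exists>N. \<forall>i\<ge>N. \<forall>j\<ge>N. L2_norm (\<lambda>x. f i x - f j x) < e"
  shows "\<exists>g\<in>L2. (\<lambda>n. nsq (\<lambda>x. f n x - g x)) \<longlonglongrightarrow> 0"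
proof -
  note [measurable] = L2_measurable[OF f]
  \<comment> \<open>The square of \<open>w\<close> is a probability density, hence \<open>w\<close>
    is in L2, and it vanishes nowhere.\<close>
  define w :: "real \<Rightarrow> real" where "w x = sqrt (std_normal_density x)" for x
  have w_pos: "w x > 0" for x by (simp add: w_def std_normal_density_def)
  have [measurable]: "w \<in> borel_measurable borel" unfolding w_def[abs_def] by measurable
  have "(norm (w x))\<^sup>2 = std_normal_density x" for x by (simp add: w_def)
  then have w: "w \<in> L2" unfolding L2_def by simp
  define s where "s n x = of_real (w x) * f n x" for n x
  have s_int: "integrable lborel (s n)" for n
    unfolding s_def by (rule L2_mult_integrable[OF L2_of_real[OF w] f])
  have "\<exists>N. \<forall>i\<ge>N. \<forall>j\<ge>N. LINT x|lborel. norm (s i x - s j x) < e" if "e > 0" for e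
  proof -
    have w0: "L2_norm w + 1 > 0" by (intro add_nonneg_pos) auto
    then obtain N where N: "\<forall>i\<ge>N. \<forall>j\<ge>N. L2_norm (\<lambda>x. f i x - f j x) < e / (L2_norm w + 1)"
      using cauchy[of "e / (L2_norm w + 1)"] \<open>e > 0\<close> by auto
    have "LINT x|lborel. norm (s i x - s j x) < e" if "i \<ge> N" "j \<ge> N" for i j
    proof -
      have "(LINT x|lborel. norm (s i x - s j x)) = (LINT x|lborel. norm (w x) * norm (f i x - f j x))"
        by (intro Bochner_Integration.integral_cong) (auto simp: s_def norm_mult simp flip: right_diff_distrib)
      also have "\<dots> \<le> L2_norm w * L2_norm (\<lambda>x. f i x - f j x)"
        by (rule Cauchy_Schwarz_L2(2)[OF w L2_diff[OF f f]])
      also have "\<dots> \<le> L2_norm w * (e / (L2_norm w + 1))"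
        by (rule mult_left_mono) (use N that in \<open>auto simp: less_imp_le\<close>)
      also have "\<dots> < e" using w0 \<open>e > 0\<close> by (simp add: field_simps)
      finally show ?thesis .
    qed
    then show ?thesis by blast
  qed
  from cauchy_L1_AE_cauchy_subseq[OF s_int this] obtain r where
    r: "strict_mono r" "AE x in lborel. Cauchy (\<lambda>i. s (r i) x)" by auto
  define g where "g x = lim (\<lambda>i. f (r i) x)" for x
  have [measurable]: "g \<in> borel_measurable borel" unfolding g_def by measurable
  have conv: "AE x in lborel. (\<lambda>i. f (r i) x) \<longlonglongrightarrow> g x"
    using r(2)
  proof eventually_elim
    fix x assume "Cauchy (\<lambda>i. s (r i) x)"
    then have "convergent (\<lambda>i. s (r i) x)" by (simp add: Cauchy_convergent_iff)
    then obtain l where "(\<lambda>i. s (r i) x) \<longlonglongrightarrow> l" by (auto simp: convergent_def)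
    then have "(\<lambda>i. s (r i) x / of_real (w x)) \<longlonglongrightarrow> l / of_real (w x)"
      by (intro tendsto_divide) (use w_pos[of x] in auto)
    moreover have "s (r i) x / of_real (w x) = f (r i) x" for i
      using w_pos[of x] by (simp add: s_def)
    ultimately have "convergent (\<lambda>i. f (r i) x)" by (auto simp: convergent_def)
    then show "(\<lambda>i. f (r i) x) \<longlonglongrightarrow> g x" unfolding g_def by (simp add: convergent_LIMSEQ_iff)
  qed
  \<comment> \<open>Fatou's lemma along the subsequence: the Cauchy bound between \<open>f n\<close>
    and \<open>f (r i)\<close> passes to the limit in i with n fixed.\<close>
  have bound: "nsq (\<lambda>x. f n x - g x) \<le> ennreal (e\<^sup>2)"
    if "e > 0" and N: "\<forall>i\<ge>N. \<forall>j\<ge>N. L2_norm (\<lambda>x. f i x - f j x) < e" and "n \<ge> N" for e n N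
  proof -
    have "nsq (\<lambda>x. f n x - g x) = (\<integral>\<^sup>+x. liminf (\<lambda>i. ennreal ((norm (f n x - f (r i) x))\<^sup>2)) \<partial>lborel)"
      unfolding nsq_def
    proof (rule nn_integral_cong_AE, use conv in eventually_elim)
      fix x assume "(\<lambda>i. f (r i) x) \<longlonglongrightarrow> g x"
      then have "(\<lambda>i. ennreal ((norm (f n x - f (r i) x))\<^sup>2)) \<longlonglongrightarrow> ennreal ((norm (f n x - g x))\<^sup>2)"
        by (intro tendsto_intros)
      from lim_imp_Liminf[OF _ this] show "ennreal ((norm (f n x - g x))\<^sup>2) = liminf (\<lambda>i. ennreal ((norm (f n x - f (r i) x))\<^sup>2))"
        by simp
    qed
    also have "\<dots> \<le> liminf (\<lambda>i. nsq (\<lambda>x. f n x - f (r i) x))"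
      unfolding nsq_def by (rule nn_integral_liminf) measurable
    also have "\<dots> \<le> liminf (\<lambda>i::nat. ennreal (e\<^sup>2))"
    proof (rule Liminf_mono)
      show "\<forall>\<^sub>F i in sequentially. nsq (\<lambda>x. f n x - f (r i) x) \<le> ennreal (e\<^sup>2)"
        using eventually_ge_at_top[of N]
      proof eventually_elim
        fix i assume "i \<ge> N"
        then have "r i \<ge> N" using seq_suble[OF r(1), of i] by linarith
        then have "L2_norm (\<lambda>x. f n x - f (r i) x) \<le> e" using N \<open>n \<ge> N\<close> by (auto simp: less_imp_le)
        then show "nsq (\<lambda>x. f n x - f (r i) x) \<le> ennreal (e\<^sup>2)"
          by (subst nsq_L2_norm[OF L2_diff[OF f f]]) (auto intro!: ennreal_leI power_mono)
      qed
    qed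
    also have "\<dots> = ennreal (e\<^sup>2)" by (rule Liminf_const) simp
    finally show ?thesis .
  qed
  have g: "g \<in> L2"
  proof -
    obtain N where N: "\<forall>i\<ge>N. \<forall>j\<ge>N. L2_norm (\<lambda>x. f i x - f j x) < 1" using cauchy[of 1] by auto
    have "nsq (\<lambda>x. f N x - g x) < \<infinity>"
      using bound[OF _ N, of N] by (auto intro: le_less_trans)
    then have "(\<lambda>x. f N x - g x) \<in> L2" by (simp add: L2_iff_nsq)
    from L2_diff[OF f[of N] this] show ?thesis by simp
  qed
  have "(\<lambda>n. L2_norm (\<lambda>x. f n x - g x)) \<longlonglongrightarrow> 0"
  proof (rule LIMSEQ_I)
    fix e :: real assume "e > 0"
    then obtain N where N: "\<forall>i\<ge>N. \<forall>j\<ge>N. L2_norm (\<lambda>x. f i x - f j x) < e / 2" using cauchy[of "e/2"] by auto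
    have "norm (L2_norm (\<lambda>x. f n x - g x) - 0) < e" if "n \<ge> N" for n
    proof -
      have "(L2_norm (\<lambda>x. f n x - g x))\<^sup>2 \<le> (e/2)\<^sup>2"
        using bound[OF _ N that] \<open>e > 0\<close> nsq_L2_norm[OF L2_diff[OF f[of n] g]] by simp
      then have "L2_norm (\<lambda>x. f n x - g x) \<le> e / 2" by (rule power2_le_imp_le) (use \<open>e > 0\<close> in auto)
      then show ?thesis using \<open>e > 0\<close> by simp
    qed
    then show "\<exists>no. \<forall>n\<ge>no. norm (L2_norm (\<lambda>x. f n x - g x) - 0) < e" by blast
  qed
  then have "(\<lambda>n. nsq (\<lambda>x. f n x - g x)) \<longlonglongrightarrow> 0"
    by (subst nsq_tendsto_zero_iff) (auto intro: L2_diff f g)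
  with g show ?thesis by blast
qed

section \<open>The Fourier transform on the real line\<close>

lemma borel_measurable_cnj [measurable (raw)]:
  "f \<in> borel_measurable M \<Longrightarrow> (\<lambda>x. cnj (f x)) \<in> borel_measurable M"
  by (rule measurable_compose[OF _ borel_measurable_continuous_onI]) (auto intro!: continuous_intros)

lemma integrable_pair_bound:
  fixes F :: "real \<times> real \<Rightarrow> 'a::{banach, second_countable_topology}"
  assumes [measurable]: "F \<in> borel_measurable (lborel \<Otimes>\<^sub>M lborel)"
    and a: "integrable lborel a" and b: "integrable lborel b"
    and bound: "\<And>x y. norm (F (x, y)) \<le> a x * (b y :: real)"
  shows "integrable (lborel \<Otimes>\<^sub>M lborel) F"
proof (rule integrableI_bounded)
  have [measurable]: "a \<in> borel_measurable borel" "b \<in> borel_measurable borel"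
    using a b by (auto dest: borel_measurable_integrable)
  have "(\<integral>\<^sup>+z. norm (F z) \<partial>(lborel \<Otimes>\<^sub>M lborel)) = (\<integral>\<^sup>+x. (\<integral>\<^sup>+y. norm (F (x, y)) \<partial>lborel) \<partial>lborel)"
    by (rule lborel.nn_integral_fst[symmetric]) measurable
  also have "\<dots> \<le> (\<integral>\<^sup>+x. (\<integral>\<^sup>+y. ennreal (norm (a x)) * ennreal (norm (b y)) \<partial>lborel) \<partial>lborel)"
  proof (intro nn_integral_mono)
    fix x y
    have "norm (F (x, y)) \<le> norm (a x) * norm (b y)"
      using bound[of x y] by (metis abs_ge_self abs_mult order.trans real_norm_def)
    then show "ennreal (norm (F (x, y))) \<le> ennreal (norm (a x)) * ennreal (norm (b y))"
      by (metis ennreal_leI ennreal_mult' norm_ge_zero)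
  qed
  also have "\<dots> = (\<integral>\<^sup>+x. ennreal (norm (a x)) \<partial>lborel) * (\<integral>\<^sup>+y. ennreal (norm (b y)) \<partial>lborel)"
    by (simp add: nn_integral_cmult nn_integral_multc)
  also have "\<dots> < \<infinity>"
    using a b by (auto simp: integrable_iff_bounded ennreal_mult_less_top)
  finally show "(\<integral>\<^sup>+z. norm (F z) \<partial>(lborel \<Otimes>\<^sub>M lborel)) < \<infinity>" .
qed measurable

section \<open>The transform of integrable functions and Plancherel's identity for it\<close>

definition F1 :: "(real \<Rightarrow> complex) \<Rightarrow> real \<Rightarrow> complex" where
  "F1 f \<xi> = (LINT x|lborel. exp (- \<i> * of_real \<xi> * of_real x) * f x)"

lemma norm_exp_i_real [simp]: "cmod (exp (- \<i> * of_real a * of_real b)) = 1" 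
  "cmod (exp (- (\<i> * of_real a * of_real b))) = 1" "cmod (exp (\<i> * of_real a * of_real b)) = 1"
  by (simp_all add: norm_exp_eq_Re)

lemma F1_integrable:
  assumes "integrable lborel f" shows "integrable lborel (\<lambda>x. exp (- \<i> * of_real \<xi> * of_real x) * f x)"
  by (rule Bochner_Integration.integrable_bound[OF assms])
     (use assms in \<open>auto simp: norm_mult dest: borel_measurable_integrable\<close>)

lemma F1_measurable:
  assumes "integrable lborel f" shows "F1 f \<in> borel_measurable borel"
proof -
  have [measurable]: "f \<in> borel_measurable borel" using assms by (auto dest: borel_measurable_integrable)
  show ?thesis unfolding F1_def[abs_def] by measurable
qed

lemma F1_bound: "cmod (F1 f \<xi>) \<le> (LINT x|lborel. cmod (f x))"
  unfolding F1_def by (rule order.trans[OF integral_norm_bound]) (simp add: norm_mult)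

lemma F1_diff:
  assumes "integrable lborel f" "integrable lborel g"
  shows "F1 (\<lambda>x. f x - g x) \<xi> = F1 f \<xi> - F1 g \<xi>"
  using assms F1_integrable by (simp add: F1_def right_diff_distrib)

text \<open>This is the characteristic function of the standard normal distribution at - s /
  \<epsilon>, with the integration variable scaled by \<epsilon>. The right-hand side is written as
  a density because it acts as an approximate identity, up to the factor 2 pi.\<close>

lemma gauss_fourier:
  assumes "\<epsilon> > 0"
  shows "(LINT \<xi>|lborel. exp (- \<i> * of_real \<xi> * of_real s) * of_real (exp (- (\<epsilon> * \<xi>)\<^sup>2 / 2)))
    = of_real (2 * pi * normal_density 0 \<epsilon> s)"
proof -
  define t where "t = - s / \<epsilon>"
  have "(LINT \<xi>|lborel. std_normal_density \<xi> *\<^sub>R iexp (t * \<xi>)) = complex_of_real (exp (- t\<^sup>2 / 2))"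
  proof -
    have "char std_normal_distribution t = (LINT \<xi>|lborel. std_normal_density \<xi> *\<^sub>R iexp (t * \<xi>))"
      unfolding char_def by (subst integral_density) auto
    then show ?thesis by (simp add: char_std_normal_distribution)
  qed
  also have "(LINT \<xi>|lborel. std_normal_density \<xi> *\<^sub>R iexp (t * \<xi>))
     = \<bar>\<epsilon>\<bar> *\<^sub>R (LINT \<xi>|lborel. std_normal_density (0 + \<epsilon> * \<xi>) *\<^sub>R iexp (t * (0 + \<epsilon> * \<xi>)))"
    by (rule lborel_integral_real_affine) (use assms in auto)
  also have "\<dots> = (\<epsilon> / sqrt (2 * pi)) *\<^sub>R (LINT \<xi>|lborel. exp (- \<i> * of_real \<xi> * of_real s) * of_real (exp (- (\<epsilon> * \<xi>)\<^sup>2 / 2)))"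
  proof -
    have "(LINT \<xi>|lborel. std_normal_density (0 + \<epsilon> * \<xi>) *\<^sub>R iexp (t * (0 + \<epsilon> * \<xi>)))
      = (LINT \<xi>|lborel. (1 / sqrt (2 * pi)) *\<^sub>R (exp (- \<i> * of_real \<xi> * of_real s) * of_real (exp (- (\<epsilon> * \<xi>)\<^sup>2 / 2))))"
    proof (intro Bochner_Integration.integral_cong refl)
      fix \<xi> :: real
      have "t * (0 + \<epsilon> * \<xi>) = - (\<xi> * s)" using assms by (simp add: t_def)
      then have "iexp (t * (0 + \<epsilon> * \<xi>)) = exp (- \<i> * of_real \<xi> * of_real s)"
        by (simp add: mult.assoc)
      then show "std_normal_density (0 + \<epsilon> * \<xi>) *\<^sub>R iexp (t * (0 + \<epsilon> * \<xi>))
         = (1 / sqrt (2 * pi)) *\<^sub>R (exp (- \<i> * of_real \<xi> * of_real s) * of_real (exp (- (\<epsilon> * \<xi>)\<^sup>2 / 2)))"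
        by (simp add: std_normal_density_def scaleR_conv_of_real mult_ac)
    qed
    then show ?thesis using assms by (simp add: scaleR_conv_of_real)
  qed
  finally have e: "complex_of_real (\<epsilon> / sqrt (2 * pi)) * (LINT \<xi>|lborel. exp (- \<i> * of_real \<xi> * of_real s) * of_real (exp (- (\<epsilon> * \<xi>)\<^sup>2 / 2)))
     = of_real (exp (- t\<^sup>2 / 2))" by (simp add: scaleR_conv_of_real)
  have "2 * pi * normal_density 0 \<epsilon> s = (sqrt (2 * pi) / \<epsilon>) * exp (- t\<^sup>2 / 2)"
  proof -
    have "exp (- t\<^sup>2 / 2) = exp (- s\<^sup>2 / (2 * \<epsilon>\<^sup>2))" by (simp add: t_def power_divide)
    moreover have "2 * pi * (1 / sqrt (2 * pi * \<epsilon>\<^sup>2)) = sqrt (2 * pi) / \<epsilon>"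
    proof -
      have "sqrt (2 * pi * \<epsilon>\<^sup>2) = sqrt (2 * pi) * \<epsilon>" using assms by (simp add: real_sqrt_mult)
      moreover have "2 * pi = sqrt (2 * pi) * sqrt (2 * pi)" by simp
      ultimately show ?thesis using assms by (simp add: field_simps)
    qed
    moreover have "2 * pi * normal_density 0 \<epsilon> s = (2 * pi * (1 / sqrt (2 * pi * \<epsilon>\<^sup>2))) * exp (- (s - 0)\<^sup>2 / (2 * \<epsilon>\<^sup>2))"
      by (simp only: normal_density_def mult.assoc)
    ultimately show ?thesis by (simp only: diff_zero)
  qed
  then have "complex_of_real (2 * pi * normal_density 0 \<epsilon> s) = of_real (sqrt (2 * pi) / \<epsilon>) * of_real (exp (- t\<^sup>2 / 2))"
    by (simp only: of_real_mult)
  also have "\<dots> = of_real (sqrt (2 * pi) / \<epsilon>) * (complex_of_real (\<epsilon> / sqrt (2 * pi)) * (LINT \<xi>|lborel. exp (- \<i> * of_real \<xi> * of_real s) * of_real (exp (- (\<epsilon> * \<xi>)\<^sup>2 / 2))))"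
    by (simp only: e)
  also have "\<dots> = (LINT \<xi>|lborel. exp (- \<i> * of_real \<xi> * of_real s) * of_real (exp (- (\<epsilon> * \<xi>)\<^sup>2 / 2)))"
    using assms by (simp add: field_simps)
  finally show ?thesis by simp
qed

lemma integrable_gauss:
  assumes "\<epsilon> > 0" shows "integrable lborel (\<lambda>\<xi>. exp (- (\<epsilon> * \<xi>)\<^sup>2 / 2) :: real)"
proof -
  have "integrable lborel (\<lambda>\<xi>. sqrt (2 * pi) * std_normal_density (0 + \<epsilon> * \<xi>))"
    using assms by (intro integrable_mult_right lborel_integrable_real_affine) auto
  moreover have "sqrt (2 * pi) * std_normal_density (0 + \<epsilon> * \<xi>) = exp (- (\<epsilon> * \<xi>)\<^sup>2 / 2)" for \<xi>
    by (simp add: std_normal_density_def)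
  ultimately show ?thesis by (simp only:)
qed

lemma L2_affine:
  assumes "f \<in> L2" "c \<noteq> 0"
  shows "(\<lambda>x. f (t + c * x)) \<in> L2"
proof -
  note [measurable] = L2_measurable[OF assms(1)]
  show ?thesis using lborel_integrable_real_affine[OF L2_integrable[OF assms(1)] assms(2), of t]
    unfolding L2_def by simp
qed

lemma L2_norm_translate:
  "L2_norm (\<lambda>x. f (t + x)) = L2_norm f"
  unfolding L2_norm_def
  using lborel_integral_real_affine[of 1 "\<lambda>x. (norm (f x))\<^sup>2" t] by simp

text \<open>The Gaussian damping makes every exchange of integrals absolutely convergent. Integrated
  over \<xi> it becomes a Gaussian of width \<epsilon> that averages the autocorrelation of
  \<open>f\<close>. The correlation is expressed through the norm of a difference, so that the limit
  of vanishing damping rests on continuity of translations.\<close>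

lemma plancherel_gauss:
  assumes i: "integrable lborel f" and f: "f \<in> L2" and e: "\<epsilon> > 0"
  shows "(LINT \<xi>|lborel. exp (- (\<epsilon> * \<xi>)\<^sup>2 / 2) * (cmod (F1 f \<xi>))\<^sup>2)
    = 2 * pi * (LINT z|lborel. std_normal_density z * ((L2_norm f)\<^sup>2 - 1/2 * (L2_norm (\<lambda>x. f x - f (- \<epsilon> * z + x)))\<^sup>2))"
proof -
  note [measurable] = L2_measurable[OF f] F1_measurable[OF i]
  let ?C = "LINT x|lborel. cmod (f x)"
  define \<gamma> where "\<gamma> \<xi> = exp (- (\<epsilon> * \<xi>)\<^sup>2 / 2)" for \<xi> :: real
  have [measurable]: "\<gamma> \<in> borel_measurable borel" unfolding \<gamma>_def[abs_def] by measurable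
  have \<gamma>_int: "integrable lborel \<gamma>" unfolding \<gamma>_def[abs_def] by (rule integrable_gauss[OF e])
  have \<gamma>_nn: "\<gamma> \<xi> \<ge> 0" for \<xi> by (simp add: \<gamma>_def)
  have ni: "integrable lborel (\<lambda>x. cmod (f x))" using i by simp
  define E where "E \<xi> x = exp (- \<i> * complex_of_real \<xi> * complex_of_real x)" for \<xi> x
  have [measurable]: "case_prod E \<in> borel_measurable (borel \<Otimes>\<^sub>M borel)"
    unfolding E_def split_def by measurable
  have [measurable]: "E \<xi> \<in> borel_measurable borel" for \<xi> unfolding E_def[abs_def] by measurable
  have nE: "cmod (E \<xi> x) = 1" for \<xi> x by (simp add: E_def)
  define n where "n = std_normal_density"
  have [measurable]: "n \<in> borel_measurable borel" and n_int: "integrable lborel n" and n_nn: "n x \<ge> 0" for x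
    by (simp_all add: n_def)
  have A: "(LINT \<xi>|lborel. (of_real (\<gamma> \<xi>) * cnj (F1 f \<xi>)) * F1 f \<xi>)
    = (LINT x|lborel. f x * (LINT \<xi>|lborel. of_real (\<gamma> \<xi>) * cnj (F1 f \<xi>) * E \<xi> x))"
  proof -
    have "(LINT \<xi>|lborel. (of_real (\<gamma> \<xi>) * cnj (F1 f \<xi>)) * F1 f \<xi>)
      = (LINT \<xi>|lborel. (LINT x|lborel. (of_real (\<gamma> \<xi>) * cnj (F1 f \<xi>)) * (E \<xi> x * f x)))"
      by (simp add: F1_def E_def)
    also have "\<dots> = (LINT x|lborel. (LINT \<xi>|lborel. (of_real (\<gamma> \<xi>) * cnj (F1 f \<xi>)) * (E \<xi> x * f x)))"
    proof (rule lborel_pair.Fubini_integral[symmetric])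
      show "integrable (lborel \<Otimes>\<^sub>M lborel) (\<lambda>(\<xi>, x). of_real (\<gamma> \<xi>) * cnj (F1 f \<xi>) * (E \<xi> x * f x))"
      proof (rule integrable_pair_bound[where a = "\<lambda>\<xi>. \<gamma> \<xi> * ?C" and b = "\<lambda>x. cmod (f x)"])
        show "integrable lborel (\<lambda>\<xi>. \<gamma> \<xi> * ?C)" using \<gamma>_int by simp
        show "norm (case (\<xi>, x) of (\<xi>, x) \<Rightarrow> of_real (\<gamma> \<xi>) * cnj (F1 f \<xi>) * (E \<xi> x * f x)) \<le> \<gamma> \<xi> * ?C * cmod (f x)" for \<xi> x
          using F1_bound[of f \<xi>] \<gamma>_nn[of \<xi>] by (auto simp: norm_mult nE intro!: mult_mono)
      qed (use ni in \<open>auto simp: split_def\<close>)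
    qed
    also have "\<dots> = (LINT x|lborel. f x * (LINT \<xi>|lborel. of_real (\<gamma> \<xi>) * cnj (F1 f \<xi>) * E \<xi> x))"
      by (intro Bochner_Integration.integral_cong refl) (simp flip: integral_mult_right_zero add: mult_ac)
    finally show ?thesis .
  qed
  \<comment> \<open>The \<xi>-integral of the phases is the Gaussian of \<open>gauss_fourier\<close>
    at x - y; substituting y = x - \<epsilon> z makes the weight independent of \<epsilon>.\<close>
  have B: "(LINT \<xi>|lborel. of_real (\<gamma> \<xi>) * cnj (F1 f \<xi>) * E \<xi> x)
     = 2 * pi * (LINT z|lborel. of_real (n z) * cnj (f (- \<epsilon> * z + x)))" for x
  proof -
    have "(LINT \<xi>|lborel. of_real (\<gamma> \<xi>) * cnj (F1 f \<xi>) * E \<xi> x)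
      = (LINT \<xi>|lborel. (LINT y|lborel. of_real (\<gamma> \<xi>) * E \<xi> (x - y) * cnj (f y)))"
    proof (intro Bochner_Integration.integral_cong refl)
      fix \<xi>
      have "cnj (F1 f \<xi>) = (LINT y|lborel. cnj (E \<xi> y) * cnj (f y))"
        by (simp only: F1_def E_def Bochner_Integration.integral_cnj[symmetric] complex_cnj_mult)
      moreover have "E \<xi> (x - y) = E \<xi> x * cnj (E \<xi> y)" for y
        by (simp add: E_def exp_add[symmetric] algebra_simps exp_cnj)
      ultimately show "of_real (\<gamma> \<xi>) * cnj (F1 f \<xi>) * E \<xi> x = (LINT y|lborel. of_real (\<gamma> \<xi>) * E \<xi> (x - y) * cnj (f y))"
        by (simp flip: integral_mult_right_zero integral_mult_left_zero add: mult_ac)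
    qed
    also have "\<dots> = (LINT y|lborel. (LINT \<xi>|lborel. of_real (\<gamma> \<xi>) * E \<xi> (x - y) * cnj (f y)))"
    proof (rule lborel_pair.Fubini_integral[symmetric])
      show "integrable (lborel \<Otimes>\<^sub>M lborel) (\<lambda>(\<xi>, y). of_real (\<gamma> \<xi>) * E \<xi> (x - y) * cnj (f y))"
      proof (rule integrable_pair_bound[where a = \<gamma> and b = "\<lambda>x. cmod (f x)"])
        show "norm (case (\<xi>, y) of (\<xi>, y) \<Rightarrow> of_real (\<gamma> \<xi>) * E \<xi> (x - y) * cnj (f y)) \<le> \<gamma> \<xi> * cmod (f y)" for \<xi> y
          using \<gamma>_nn[of \<xi>] by (auto simp: norm_mult nE)
        show "(\<lambda>(\<xi>, y). of_real (\<gamma> \<xi>) * E \<xi> (x - y) * cnj (f y)) \<in> borel_measurable (lborel \<Otimes>\<^sub>M lborel)"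
          unfolding E_def split_def by measurable
      qed (use ni \<gamma>_int in auto)
    qed
    also have "\<dots> = (LINT y|lborel. (LINT \<xi>|lborel. E \<xi> (x - y) * of_real (\<gamma> \<xi>)) * cnj (f y))"
      by (intro Bochner_Integration.integral_cong refl) (simp flip: integral_mult_left_zero add: mult_ac)
    also have "\<dots> = (LINT y|lborel. of_real (2 * pi * normal_density 0 \<epsilon> (x - y)) * cnj (f y))"
      unfolding E_def \<gamma>_def gauss_fourier[OF e] ..
    also have "\<dots> = \<bar>- \<epsilon>\<bar> *\<^sub>R (LINT z|lborel. of_real (2 * pi * normal_density 0 \<epsilon> (x - (x + - \<epsilon> * z))) * cnj (f (x + - \<epsilon> * z)))"
      by (rule lborel_integral_real_affine) (use e in auto)
    also have "\<dots> = 2 * pi * (LINT z|lborel. of_real (n z) * cnj (f (- \<epsilon> * z + x)))"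
    proof -
      have "\<epsilon> * normal_density 0 \<epsilon> (\<epsilon> * z) = n z" for z
        using e by (simp add: normal_density_def n_def real_sqrt_mult power_mult_distrib)
      then have k: "complex_of_real (n z) = of_real \<epsilon> * of_real (normal_density 0 \<epsilon> (x - (x + - \<epsilon> * z)))" for z
        by (metis add_diff_cancel_left' diff_minus_eq_add minus_diff_eq minus_mult_left of_real_mult uminus_add_conv_diff add.commute)
      have k2: "of_real \<epsilon> * (of_real (2 * pi * normal_density 0 \<epsilon> (x - (x + - \<epsilon> * z))) * cnj (f (x + - \<epsilon> * z)))
        = complex_of_real (2 * pi) * (of_real (n z) * cnj (f (- \<epsilon> * z + x)))" for z
        unfolding k add.commute[of x "- \<epsilon> * z"] by (simp only: of_real_mult of_real_numeral mult_ac)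
      have "\<bar>- \<epsilon>\<bar> = \<epsilon>" using e by simp
      then show ?thesis
        by (simp only: scaleR_conv_of_real integral_mult_right_zero[symmetric] k2)
    qed
    finally show ?thesis .
  qed
  have fz: "(\<lambda>x. f (- \<epsilon> * z + x)) \<in> L2" for z using L2_affine[OF f, of 1 "- \<epsilon> * z"] by simp
  have D: "(LINT x|lborel. f x * (LINT z|lborel. of_real (n z) * cnj (f (- \<epsilon> * z + x))))
     = (LINT z|lborel. of_real (n z) * (LINT x|lborel. f x * cnj (f (- \<epsilon> * z + x))))"
  proof -
    have "(LINT x|lborel. f x * (LINT z|lborel. of_real (n z) * cnj (f (- \<epsilon> * z + x))))
       = (LINT x|lborel. (LINT z|lborel. of_real (n z) * (f x * cnj (f (- \<epsilon> * z + x)))))"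
      by (intro Bochner_Integration.integral_cong refl) (simp flip: integral_mult_right_zero add: mult_ac)
    also have "\<dots> = (LINT z|lborel. (LINT x|lborel. of_real (n z) * (f x * cnj (f (- \<epsilon> * z + x)))))"
    proof (rule lborel_pair.Fubini_integral)
      show "integrable (lborel \<Otimes>\<^sub>M lborel) (\<lambda>(z, x). of_real (n z) * (f x * cnj (f (- \<epsilon> * z + x))))"
      proof (rule lborel_pair.Fubini_integrable)
        show "(\<lambda>(z, x). of_real (n z) * (f x * cnj (f (- \<epsilon> * z + x)))) \<in> borel_measurable (lborel \<Otimes>\<^sub>M lborel)"
          unfolding split_def by measurable
        have I: "integrable lborel (\<lambda>x. of_real (n z) * (f x * cnj (f (- \<epsilon> * z + x))))" for z
          by (intro integrable_mult_right L2_mult_integrable f L2_cnj fz)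
        then show "AE z in lborel. integrable lborel (\<lambda>x. case (z, x) of (z, x) \<Rightarrow> of_real (n z) * (f x * cnj (f (- \<epsilon> * z + x))))"
          by simp
        show "integrable lborel (\<lambda>z. LINT x|lborel. norm (case (z, x) of (z, x) \<Rightarrow> of_real (n z) * (f x * cnj (f (- \<epsilon> * z + x)))))"
        proof (rule Bochner_Integration.integrable_bound)
          show "integrable lborel (\<lambda>z. n z * (L2_norm f * L2_norm f))" using n_int by simp
          show "(\<lambda>z. LINT x|lborel. norm (case (z, x) of (z, x) \<Rightarrow> of_real (n z) * (f x * cnj (f (- \<epsilon> * z + x))))) \<in> borel_measurable lborel"
            by measurable
          show "AE z in lborel. norm (LINT x|lborel. norm (case (z, x) of (z, x) \<Rightarrow> of_real (n z) * (f x * cnj (f (- \<epsilon> * z + x))))) \<le> norm (n z * (L2_norm f * L2_norm f))"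
          proof (rule AE_I2)
            fix z
            have "(LINT x|lborel. norm (of_real (n z) * (f x * cnj (f (- \<epsilon> * z + x))))) = n z * (LINT x|lborel. norm (f x) * norm (f (- \<epsilon> * z + x)))"
              using n_nn[of z] by (simp add: norm_mult)
            also have "\<dots> \<le> n z * (L2_norm f * L2_norm f)"
              using Cauchy_Schwarz_L2(2)[OF f fz, of z] n_nn[of z] L2_norm_translate[of f "- \<epsilon> * z"] by (auto intro!: mult_left_mono)
            finally show "norm (LINT x|lborel. norm (case (z, x) of (z, x) \<Rightarrow> of_real (n z) * (f x * cnj (f (- \<epsilon> * z + x))))) \<le> norm (n z * (L2_norm f * L2_norm f))"
              using n_nn[of z] by (simp add: integral_nonneg_AE)
          qed
        qed
      qed
    qed
    also have "\<dots> = (LINT z|lborel. of_real (n z) * (LINT x|lborel. f x * cnj (f (- \<epsilon> * z + x))))"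
      by simp
    finally show ?thesis .
  qed
  \<comment> \<open>Polarisation. Norms give access to the real part only, and the left-hand side of
    the claim is real.\<close>
  have Re_inner: "Re (LINT x|lborel. f x * cnj (f (- \<epsilon> * z + x))) = (L2_norm f)\<^sup>2 - 1/2 * (L2_norm (\<lambda>x. f x - f (- \<epsilon> * z + x)))\<^sup>2" for z
  proof -
    let ?g = "\<lambda>x. f (- \<epsilon> * z + x)"
    have g: "?g \<in> L2" by (rule fz)
    have fg: "integrable lborel (\<lambda>x. f x * cnj (?g x))" by (intro L2_mult_integrable f L2_cnj fz)
    define c where "c x = Re (f x * cnj (?g x))" for x
    have c: "integrable lborel c" "integral\<^sup>L lborel c = Re (LINT x|lborel. f x * cnj (?g x))"
      unfolding c_def[abs_def] using integrable_Re[OF fg] integral_Re[OF fg] by auto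
    have "(L2_norm (\<lambda>x. f x - ?g x))\<^sup>2 = (LINT x|lborel. ((cmod (f x))\<^sup>2 + (cmod (?g x))\<^sup>2) - 2 * c x)"
      unfolding L2_norm_sq c_def
    proof (intro Bochner_Integration.integral_cong refl)
      fix x show "(cmod (f x - ?g x))\<^sup>2 = (cmod (f x))\<^sup>2 + (cmod (?g x))\<^sup>2 - 2 * Re (f x * cnj (?g x))"
        by (simp only: cmod_power2) (simp add: power2_eq_square algebra_simps)
    qed
    also have "\<dots> = (L2_norm f)\<^sup>2 + (L2_norm ?g)\<^sup>2 - 2 * Re (LINT x|lborel. f x * cnj (?g x))"
      using c(1) L2_integrable[OF f] L2_integrable[OF g] by (simp add: L2_norm_sq c(2))
    also have "L2_norm ?g = L2_norm f" by (rule L2_norm_translate)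
    finally show ?thesis by (simp add: field_simps)
  qed
  have "of_real (LINT \<xi>|lborel. \<gamma> \<xi> * (cmod (F1 f \<xi>))\<^sup>2) = (LINT \<xi>|lborel. (of_real (\<gamma> \<xi>) * cnj (F1 f \<xi>)) * F1 f \<xi>)"
    unfolding integral_complex_of_real[symmetric]
    by (intro Bochner_Integration.integral_cong refl) (simp only: of_real_mult complex_norm_square mult_ac)
  also have "\<dots> = (LINT x|lborel. (2 * pi) * (f x * (LINT z|lborel. of_real (n z) * cnj (f (- \<epsilon> * z + x)))))"
    unfolding A B by (intro Bochner_Integration.integral_cong refl) (simp add: mult_ac)
  also have "\<dots> = (2 * pi) * (LINT z|lborel. of_real (n z) * (LINT x|lborel. f x * cnj (f (- \<epsilon> * z + x))))"
    unfolding D[symmetric] by simp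
  finally have "(LINT \<xi>|lborel. \<gamma> \<xi> * (cmod (F1 f \<xi>))\<^sup>2) = Re ((2 * pi) * (LINT z|lborel. of_real (n z) * (LINT x|lborel. f x * cnj (f (- \<epsilon> * z + x)))))"
    by (metis Re_complex_of_real)
  also have "\<dots> = (2 * pi) * Re (LINT z|lborel. of_real (n z) * (LINT x|lborel. f x * cnj (f (- \<epsilon> * z + x))))"
    by simp
  also have "Re (LINT z|lborel. of_real (n z) * (LINT x|lborel. f x * cnj (f (- \<epsilon> * z + x))))
     = (LINT z|lborel. Re (of_real (n z) * (LINT x|lborel. f x * cnj (f (- \<epsilon> * z + x)))))"
  proof (rule integral_Re[symmetric], rule Bochner_Integration.integrable_bound)
    show "integrable lborel (\<lambda>z. n z * (L2_norm f * L2_norm f))" using n_int by simp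
    show "AE z in lborel. norm (of_real (n z) * (LINT x|lborel. f x * cnj (f (- \<epsilon> * z + x)))) \<le> norm (n z * (L2_norm f * L2_norm f))"
    proof (rule AE_I2)
      fix z
      have "cmod (LINT x|lborel. f x * cnj (f (- \<epsilon> * z + x))) \<le> L2_norm f * L2_norm (\<lambda>x. cnj (f (- \<epsilon> * z + x)))"
        by (rule L2_norm_integral_mult_le[OF f L2_cnj[OF fz]])
      also have "L2_norm (\<lambda>x. cnj (f (- \<epsilon> * z + x))) = L2_norm f"
        using L2_norm_translate[of f "- \<epsilon> * z"] by (simp add: L2_norm_def)
      finally show "norm (of_real (n z) * (LINT x|lborel. f x * cnj (f (- \<epsilon> * z + x)))) \<le> norm (n z * (L2_norm f * L2_norm f))"
        using n_nn[of z] by (simp add: norm_mult mult_left_mono)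
    qed
  qed measurable
  finally show ?thesis unfolding n_def \<gamma>_def using Re_inner by simp
qed

text \<open>Truncation in space and height makes \<open>f\<close> bounded with bounded support. A
  measurable function is an a.e. limit of continuous ones; clipping these in height and in space
  supplies the common majorant for dominated convergence.\<close>

lemma L2_approx_continuous:
  fixes f :: "real \<Rightarrow> complex"
  assumes f: "f \<in> L2" and "\<eta> > 0"
  shows "\<exists>g N C. continuous_on UNIV g \<and> (\<forall>x. \<bar>x\<bar> > N \<longrightarrow> g x = 0) \<and> (\<forall>x. norm (g x) \<le> C) \<and> g \<in> L2 \<and> nsq (\<lambda>x. f x - g x) < ennreal \<eta>"
proof -
  note [measurable] = L2_measurable[OF f]
  define F where "F n x = (if \<bar>x\<bar> \<le> real n \<and> norm (f x) \<le> real n then f x else 0)" for n x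
  have [measurable]: "F n \<in> borel_measurable borel" for n unfolding F_def[abs_def] by measurable
  have "(\<lambda>n. nsq (\<lambda>x. f x - F n x)) \<longlonglongrightarrow> (\<integral>\<^sup>+(x::real). 0 \<partial>lborel)"
    unfolding nsq_def
  proof (rule nn_integral_dominated_convergence)
    show "(\<integral>\<^sup>+x. ennreal ((norm (f x))\<^sup>2) \<partial>lborel) < \<infinity>"
      using f by (simp add: L2_iff_nsq nsq_def)
    show "AE x in lborel. ennreal ((norm (f x - F n x))\<^sup>2) \<le> ennreal ((norm (f x))\<^sup>2)" for n
      by (auto simp: F_def)
    show "AE x in lborel. (\<lambda>n. ennreal ((norm (f x - F n x))\<^sup>2)) \<longlonglongrightarrow> 0"
    proof (rule AE_I2, rule tendsto_eventually)
      fix x :: real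
      obtain m :: nat where m: "\<bar>x\<bar> \<le> real m" "norm (f x) \<le> real m"
        by (metis real_arch_simple max.bounded_iff)
      show "\<forall>\<^sub>F n in sequentially. ennreal ((norm (f x - F n x))\<^sup>2) = 0"
        using eventually_ge_at_top[of m] by eventually_elim (use m in \<open>auto simp: F_def\<close>)
    qed
  qed measurable
  then have "\<forall>\<^sub>F n in sequentially. nsq (\<lambda>x. f x - F n x) < ennreal (\<eta> / 4)"
    using \<open>\<eta> > 0\<close> by (intro order_tendstoD(2)[where y = 0]) auto
  then obtain n where n: "nsq (\<lambda>x. f x - F n x) < ennreal (\<eta> / 4)"
    by (auto simp: eventually_sequentially)
  define N where "N = real n + 1"
  have N: "N > 0" by (simp add: N_def)
  have F_bd: "norm (F n x) \<le> N" "\<bar>x\<bar> > real n \<Longrightarrow> F n x = 0" for x by (auto simp: F_def N_def)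
  have "F n \<in> borel_measurable lebesgue" by (simp add: measurable_completion)
  then have "F n measurable_on UNIV" by (rule lebesgue_measurable_imp_measurable_on) auto
  then obtain Z g where Z: "negligible Z" and g: "\<And>k. continuous_on UNIV (g k)"
    and lim: "\<And>x. x \<notin> Z \<Longrightarrow> (\<lambda>k. g k x) \<longlonglongrightarrow> F n x"
    unfolding measurable_on_def by auto
  \<comment> \<open>The radial retraction onto the ball of radius \<open>N\<close>: continuous, and
    the identity on the values of \<open>F n\<close>.\<close>
  define cl where "cl w = (N / max N (norm w)) *\<^sub>R w" for w :: complex
  have cl_cont: "continuous_on UNIV cl"
    unfolding cl_def using N by (intro continuous_intros) auto
  have cl_bd: "norm (cl w) \<le> N" for w
    using N by (auto simp: cl_def max_def field_simps)
  have cl_id: "norm w \<le> N \<Longrightarrow> cl w = w" for w using N by (auto simp: cl_def max_def)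
  define \<psi> where "\<psi> x = max 0 (min 1 (N + 1 - \<bar>x\<bar>))" for x :: real
  have \<psi>: "\<bar>x\<bar> \<le> N \<Longrightarrow> \<psi> x = 1" "\<bar>x\<bar> > N + 1 \<Longrightarrow> \<psi> x = 0" "0 \<le> \<psi> x" "\<psi> x \<le> 1" for x
    by (auto simp: \<psi>_def)
  define G where "G k x = \<psi> x *\<^sub>R cl (g k x)" for k x
  have Gc: "continuous_on UNIV (G k)" for k
    unfolding G_def \<psi>_def
    by (intro continuous_intros continuous_on_compose2[OF cl_cont g]) auto
  have [measurable]: "G k \<in> borel_measurable borel" for k
    using Gc by (rule borel_measurable_continuous_onI)
  have Gbd: "norm (G k x) \<le> N" for k x
    using \<psi>(3,4)[of x] cl_bd[of "g k x"] N by (simp add: G_def) (metis mult_le_one mult_left_le_one_le norm_ge_zero order.trans)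
  have G0: "\<bar>x\<bar> > N + 1 \<Longrightarrow> G k x = 0" for k x using \<psi>(2) by (simp add: G_def)
  have fin: "(\<integral>\<^sup>+x. ennreal ((2 * N)\<^sup>2) * indicator {- (N + 1)..N + 1} x \<partial>lborel) < \<infinity>"
    using N by (simp add: nn_integral_cmult_indicator ennreal_mult_less_top)
  have GL2: "G k \<in> L2" for k
  proof -
    have "nsq (G k) \<le> (\<integral>\<^sup>+x. ennreal ((2 * N)\<^sup>2) * indicator {- (N + 1)..N + 1} x \<partial>lborel)"
      unfolding nsq_def
    proof (intro nn_integral_mono)
      fix x
      have "(norm (G k x))\<^sup>2 \<le> (2 * N)\<^sup>2" using Gbd[of k x] N by (intro power_mono) auto
      then show "ennreal ((norm (G k x))\<^sup>2) \<le> ennreal ((2 * N)\<^sup>2) * indicator {- (N + 1)..N + 1} x"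
        using G0[of x k] by (auto simp: indicator_def intro!: ennreal_leI)
    qed
    then show ?thesis using fin by (auto simp: L2_iff_nsq intro: le_less_trans)
  qed
  have "(\<lambda>k. nsq (\<lambda>x. F n x - G k x)) \<longlonglongrightarrow> (\<integral>\<^sup>+(x::real). 0 \<partial>lborel)"
    unfolding nsq_def
  proof (rule nn_integral_dominated_convergence[OF _ _ _ _ fin])
    show "AE x in lborel. ennreal ((norm (F n x - G k x))\<^sup>2) \<le> ennreal ((2 * N)\<^sup>2) * indicator {- (N + 1)..N + 1} x" for k
    proof (rule AE_I2)
      fix x
      have "norm (F n x - G k x) \<le> 2 * N" using F_bd(1)[of x] Gbd[of k x] norm_triangle_ineq4[of "F n x" "G k x"] by linarith
      then have "(norm (F n x - G k x))\<^sup>2 \<le> (2 * N)\<^sup>2" by (intro power_mono) auto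
      then show "ennreal ((norm (F n x - G k x))\<^sup>2) \<le> ennreal ((2 * N)\<^sup>2) * indicator {- (N + 1)..N + 1} x"
        using G0[of x k] F_bd(2)[of x] by (auto simp: indicator_def N_def intro!: ennreal_leI)
    qed
    have "AE x in lebesgue. x \<notin> Z"
      using Z by (simp add: AE_not_in negligible_iff_null_sets)
    then have "AE x in lborel. x \<notin> Z" by (simp add: AE_completion_iff)
    then show "AE x in lborel. (\<lambda>k. ennreal ((norm (F n x - G k x))\<^sup>2)) \<longlonglongrightarrow> 0"
    proof eventually_elim
      fix x assume "x \<notin> Z"
      have "isCont cl (F n x)" using cl_cont by (simp add: continuous_on_eq_continuous_at)
      then have "(\<lambda>k. cl (g k x)) \<longlonglongrightarrow> cl (F n x)" by (rule isCont_tendsto_compose[OF _ lim[OF \<open>x \<notin> Z\<close>]])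
      then have "(\<lambda>k. G k x) \<longlonglongrightarrow> \<psi> x *\<^sub>R cl (F n x)" unfolding G_def by (intro tendsto_intros)
      also have "\<psi> x *\<^sub>R cl (F n x) = F n x"
        using \<psi>(1)[of x] F_bd[of x] cl_id[of "F n x"] by (cases "\<bar>x\<bar> \<le> N") (auto simp: N_def)
      finally have "(\<lambda>k. ennreal ((norm (F n x - G k x))\<^sup>2)) \<longlonglongrightarrow> ennreal ((norm (F n x - F n x))\<^sup>2)"
        by (intro tendsto_intros)
      then show "(\<lambda>k. ennreal ((norm (F n x - G k x))\<^sup>2)) \<longlonglongrightarrow> 0" by simp
    qed
  qed measurable
  then have "\<forall>\<^sub>F k in sequentially. nsq (\<lambda>x. F n x - G k x) < ennreal (\<eta> / 4)"
    using \<open>\<eta> > 0\<close> by (intro order_tendstoD(2)[where y = 0]) auto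
  then obtain k where k: "nsq (\<lambda>x. F n x - G k x) < ennreal (\<eta> / 4)"
    by (auto simp: eventually_sequentially)
  have "nsq (\<lambda>x. f x - G k x) = nsq (\<lambda>x. (f x - F n x) + (F n x - G k x))" by simp
  also have "\<dots> \<le> 2 * nsq (\<lambda>x. f x - F n x) + 2 * nsq (\<lambda>x. F n x - G k x)"
    by (rule nsq_add_le) measurable
  also have "\<dots> < 2 * ennreal (\<eta> / 4) + 2 * ennreal (\<eta> / 4)"
    using n k by (intro add_strict_mono ennreal_mult_strict_left_mono) auto
  also have "\<dots> = ennreal \<eta>"
    using \<open>\<eta> > 0\<close> by (simp flip: ennreal_numeral ennreal_mult' ennreal_plus)
  finally show ?thesis using Gc[of k] Gbd G0 GL2 by blast
qed

lemma L2_translate: "f \<in> L2 \<Longrightarrow> (\<lambda>x. f (t + x)) \<in> L2"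
  using L2_affine[of f 1 t] by simp

lemma L2_norm_less:
  assumes "f \<in> L2" "e > 0" "nsq f < ennreal (e\<^sup>2)"
  shows "L2_norm f < e"
  using assms by (intro power2_less_imp_less[of "L2_norm f"]) (auto simp: nsq_L2_norm ennreal_less_iff)

text \<open>A three-term estimate: translations are isometries, so it is enough to treat a
  continuous function of bounded support, for which dominated convergence applies.\<close>

lemma L2_translation_continuous:
  fixes f :: "real \<Rightarrow> complex"
  assumes f: "f \<in> L2" and h: "h \<longlonglongrightarrow> 0"
  shows "(\<lambda>n. L2_norm (\<lambda>x. f x - f (h n + x))) \<longlonglongrightarrow> 0"
proof (rule LIMSEQ_I)
  fix e :: real assume e: "e > 0"
  obtain g N C where g: "continuous_on UNIV g" "\<And>x. \<bar>x\<bar> > N \<Longrightarrow> g x = 0" "\<And>x. norm (g x) \<le> C" "g \<in> L2"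
    and fg: "nsq (\<lambda>x. f x - g x) < ennreal ((e / 3)\<^sup>2)"
    using L2_approx_continuous[OF f, of "(e / 3)\<^sup>2"] e by auto
  note [measurable] = L2_measurable[OF g(4)]
  obtain B where B: "\<And>n. \<bar>h n\<bar> \<le> B" using convergent_imp_Bseq[of h] h by (auto simp: convergent_def Bseq_def)
  have "(\<lambda>n. nsq (\<lambda>x. g x - g (h n + x))) \<longlonglongrightarrow> (\<integral>\<^sup>+(x::real). 0 \<partial>lborel)"
    unfolding nsq_def
  proof (rule nn_integral_dominated_convergence)
    show "(\<integral>\<^sup>+x. ennreal ((2 * C)\<^sup>2) * indicator {- (N + B)..N + B} x \<partial>lborel) < \<infinity>"
      by (simp add: nn_integral_cmult_indicator ennreal_mult_less_top emeasure_lborel_Icc_eq)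
    show "AE x in lborel. ennreal ((norm (g x - g (h n + x)))\<^sup>2) \<le> ennreal ((2 * C)\<^sup>2) * indicator {- (N + B)..N + B} x" for n
    proof (rule AE_I2)
      fix x
      have "norm (g x - g (h n + x)) \<le> 2 * C" using g(3)[of x] g(3)[of "h n + x"] norm_triangle_ineq4[of "g x" "g (h n + x)"] by linarith
      then have "(norm (g x - g (h n + x)))\<^sup>2 \<le> (2 * C)\<^sup>2" by (intro power_mono) auto
      moreover have "g x = 0 \<and> g (h n + x) = 0" if "x \<notin> {- (N + B)..N + B}"
        using that B[of n] by (intro conjI g(2)) auto
      ultimately show "ennreal ((norm (g x - g (h n + x)))\<^sup>2) \<le> ennreal ((2 * C)\<^sup>2) * indicator {- (N + B)..N + B} x"
        by (auto simp: indicator_def intro!: ennreal_leI)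
    qed
    show "AE x in lborel. (\<lambda>n. ennreal ((norm (g x - g (h n + x)))\<^sup>2)) \<longlonglongrightarrow> 0"
    proof (rule AE_I2)
      fix x
      have "isCont g x" using g(1) by (simp add: continuous_on_eq_continuous_at)
      moreover have "(\<lambda>n. h n + x) \<longlonglongrightarrow> 0 + x" by (intro tendsto_intros h)
      ultimately have "(\<lambda>n. g (h n + x)) \<longlonglongrightarrow> g x" by (intro isCont_tendsto_compose[of x g]) auto
      then have "(\<lambda>n. ennreal ((norm (g x - g (h n + x)))\<^sup>2)) \<longlonglongrightarrow> ennreal ((norm (g x - g x))\<^sup>2)"
        by (intro tendsto_intros)
      then show "(\<lambda>n. ennreal ((norm (g x - g (h n + x)))\<^sup>2)) \<longlonglongrightarrow> 0" by simp
    qed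
  qed measurable
  then have "(\<lambda>n. L2_norm (\<lambda>x. g x - g (h n + x))) \<longlonglongrightarrow> 0"
    by (subst nsq_tendsto_zero_iff[symmetric]) (auto intro: L2_diff[OF g(4) L2_translate[OF g(4)]])
  then have "\<forall>\<^sub>F n in sequentially. L2_norm (\<lambda>x. g x - g (h n + x)) < e / 3"
    using e by (intro order_tendstoD(2)[where y = 0]) auto
  then obtain n0 where n0: "\<And>n. n \<ge> n0 \<Longrightarrow> L2_norm (\<lambda>x. g x - g (h n + x)) < e / 3"
    by (auto simp: eventually_sequentially)
  have fg': "L2_norm (\<lambda>x. f x - g x) < e / 3"
    using fg e by (intro L2_norm_less) (auto intro: L2_diff f g(4))
  have "norm (L2_norm (\<lambda>x. f x - f (h n + x)) - 0) < e" if "n \<ge> n0" for n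
  proof -
    have "L2_norm (\<lambda>x. f x - f (h n + x)) = L2_norm (\<lambda>x. (f x - g x) + ((g x - g (h n + x)) + (g (h n + x) - f (h n + x))))"
      by simp
    also have "\<dots> \<le> L2_norm (\<lambda>x. f x - g x) + L2_norm (\<lambda>x. (g x - g (h n + x)) + (g (h n + x) - f (h n + x)))"
      by (intro L2_norm_triangle L2_diff L2_add f g(4) L2_translate)
    also have "L2_norm (\<lambda>x. (g x - g (h n + x)) + (g (h n + x) - f (h n + x))) \<le> L2_norm (\<lambda>x. g x - g (h n + x)) + L2_norm (\<lambda>x. g (h n + x) - f (h n + x))"
      by (intro L2_norm_triangle L2_diff L2_add f g(4) L2_translate)
    also have "L2_norm (\<lambda>x. g (h n + x) - f (h n + x)) = L2_norm (\<lambda>x. g x - f x)"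
      by (rule L2_norm_translate[of "\<lambda>x. g x - f x"])
    also have "\<dots> = L2_norm (\<lambda>x. f x - g x)" by (simp add: L2_norm_def norm_minus_commute)
    finally have "L2_norm (\<lambda>x. f x - f (h n + x)) < e" using fg' n0[OF that] by linarith
    then show ?thesis by simp
  qed
  then show "\<exists>no. \<forall>n\<ge>no. norm (L2_norm (\<lambda>x. f x - f (h n + x)) - 0) < e" by blast
qed

text \<open>The damping is removed by monotone convergence on the frequency side and by dominated
  convergence on the side of translations. The frequency side stays in the extended reals, because
  square integrability of \<open>F1 f\<close> is part of what is being proved.\<close>

theorem plancherel_L1_L2:
  assumes i: "integrable lborel f" and f: "f \<in> L2"
  shows "nsq (F1 f) = ennreal (2 * pi) * nsq f"
proof -
  note [measurable] = L2_measurable[OF f] F1_measurable[OF i]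
  define \<gamma> where "\<gamma> n \<xi> = exp (- (1 / real (Suc n) * \<xi>)\<^sup>2 / 2)" for n \<xi>
  have [measurable]: "\<gamma> n \<in> borel_measurable borel" for n unfolding \<gamma>_def[abs_def] by measurable
  have \<gamma>_int: "integrable lborel (\<gamma> n)" for n unfolding \<gamma>_def[abs_def] by (rule integrable_gauss) simp
  have \<gamma>F: "integrable lborel (\<lambda>\<xi>. \<gamma> n \<xi> * (cmod (F1 f \<xi>))\<^sup>2)" for n
  proof (rule Bochner_Integration.integrable_bound)
    show "integrable lborel (\<lambda>\<xi>. \<gamma> n \<xi> * (LINT x|lborel. cmod (f x))\<^sup>2)" using \<gamma>_int[of n] by simp
    show "AE \<xi> in lborel. norm (\<gamma> n \<xi> * (cmod (F1 f \<xi>))\<^sup>2) \<le> norm (\<gamma> n \<xi> * (LINT x|lborel. cmod (f x))\<^sup>2)"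
      using F1_bound[of f] by (auto simp: abs_mult intro!: mult_left_mono power_mono)
  qed measurable
  define b where "b n = (LINT \<xi>|lborel. \<gamma> n \<xi> * (cmod (F1 f \<xi>))\<^sup>2)" for n
  have "(\<lambda>n. LINT z|lborel. std_normal_density z * ((L2_norm f)\<^sup>2 - 1/2 * (L2_norm (\<lambda>x. f x - f (- (1 / real (Suc n)) * z + x)))\<^sup>2))
      \<longlonglongrightarrow> (LINT z|lborel. std_normal_density z * (L2_norm f)\<^sup>2)"
  proof (rule integral_dominated_convergence)
    show "integrable lborel (\<lambda>z. std_normal_density z * (3 * (L2_norm f)\<^sup>2))" by simp
    show "AE z in lborel. (\<lambda>n. std_normal_density z * ((L2_norm f)\<^sup>2 - 1/2 * (L2_norm (\<lambda>x. f x - f (- (1 / real (Suc n)) * z + x)))\<^sup>2))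
      \<longlonglongrightarrow> std_normal_density z * (L2_norm f)\<^sup>2"
    proof (rule AE_I2)
      fix z
      have "(\<lambda>n. - (1 / real (Suc n)) * z) \<longlonglongrightarrow> - 0 * z"
        by (intro tendsto_intros LIMSEQ_Suc[OF lim_1_over_n])
      then have "(\<lambda>n. L2_norm (\<lambda>x. f x - f (- (1 / real (Suc n)) * z + x))) \<longlonglongrightarrow> 0"
        by (intro L2_translation_continuous[OF f]) simp
      then have "(\<lambda>n. std_normal_density z * ((L2_norm f)\<^sup>2 - 1/2 * (L2_norm (\<lambda>x. f x - f (- (1 / real (Suc n)) * z + x)))\<^sup>2))
        \<longlonglongrightarrow> std_normal_density z * ((L2_norm f)\<^sup>2 - 1/2 * 0\<^sup>2)"
        by (intro tendsto_intros)
      then show "(\<lambda>n. std_normal_density z * ((L2_norm f)\<^sup>2 - 1/2 * (L2_norm (\<lambda>x. f x - f (- (1 / real (Suc n)) * z + x)))\<^sup>2))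
        \<longlonglongrightarrow> std_normal_density z * (L2_norm f)\<^sup>2" by simp
    qed
    show "AE z in lborel. norm (std_normal_density z * ((L2_norm f)\<^sup>2 - 1/2 * (L2_norm (\<lambda>x. f x - f (- (1 / real (Suc n)) * z + x)))\<^sup>2))
      \<le> std_normal_density z * (3 * (L2_norm f)\<^sup>2)" for n
    proof (rule AE_I2)
      fix z
      have "L2_norm (\<lambda>x. f x - f (- (1 / real (Suc n)) * z + x)) \<le> L2_norm f + L2_norm (\<lambda>x. - f (- (1 / real (Suc n)) * z + x))"
        using L2_norm_triangle[OF f L2_uminus[OF L2_translate[OF f]], of "- (1 / real (Suc n)) * z"] by simp
      also have "L2_norm (\<lambda>x. - f (- (1 / real (Suc n)) * z + x)) = L2_norm f"
        using L2_norm_translate[of f "- (1 / real (Suc n)) * z"] by (simp add: L2_norm_def)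
      finally have "(L2_norm (\<lambda>x. f x - f (- (1 / real (Suc n)) * z + x)))\<^sup>2 \<le> (2 * L2_norm f)\<^sup>2"
        by (intro power_mono) auto
      then have 4: "(L2_norm (\<lambda>x. f x - f (- (1 / real (Suc n)) * z + x)))\<^sup>2 \<le> 4 * (L2_norm f)\<^sup>2"
        by (simp only: power_mult_distrib) simp
      have "\<bar>A - 1/2 * B\<bar> \<le> 3 * A" if "B \<le> 4 * A" "0 \<le> B" "0 \<le> A" for A B :: real
        using that by (auto simp: abs_le_iff)
      from this[OF 4] have "\<bar>(L2_norm f)\<^sup>2 - 1/2 * (L2_norm (\<lambda>x. f x - f (- (1 / real (Suc n)) * z + x)))\<^sup>2\<bar> \<le> 3 * (L2_norm f)\<^sup>2"
        by simp
      then show "norm (std_normal_density z * ((L2_norm f)\<^sup>2 - 1/2 * (L2_norm (\<lambda>x. f x - f (- (1 / real (Suc n)) * z + x)))\<^sup>2))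
        \<le> std_normal_density z * (3 * (L2_norm f)\<^sup>2)"
        by (simp only: real_norm_def abs_mult) (intro mult_mono, auto)
    qed
    show "(\<lambda>z. std_normal_density z * ((L2_norm f)\<^sup>2 - 1/2 * (L2_norm (\<lambda>x. f x - f (- (1 / real (Suc n)) * z + x)))\<^sup>2)) \<in> borel_measurable lborel" for n
      unfolding L2_norm_sq by measurable
  qed simp
  from tendsto_mult_left[OF this, of "2 * pi"]
  have "b \<longlonglongrightarrow> 2 * pi * (L2_norm f)\<^sup>2"
    unfolding b_def[abs_def] \<gamma>_def by (subst plancherel_gauss[OF i f]) auto
  then have lim1: "(\<lambda>n. ennreal (b n)) \<longlonglongrightarrow> ennreal (2 * pi * (L2_norm f)\<^sup>2)" by (intro tendsto_intros)
  let ?q = "\<lambda>n \<xi>. ennreal (\<gamma> n \<xi> * (cmod (F1 f \<xi>))\<^sup>2)"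
  have inc: "incseq ?q"
  proof (intro incseq_SucI le_funI ennreal_leI mult_right_mono)
    fix n \<xi>
    have "(1 / real (Suc (Suc n)) * \<xi>)\<^sup>2 \<le> (1 / real (Suc n) * \<xi>)\<^sup>2"
      unfolding power_mult_distrib by (intro mult_right_mono power_mono) (auto simp: field_simps)
    then show "\<gamma> n \<xi> \<le> \<gamma> (Suc n) \<xi>" by (simp add: \<gamma>_def)
  qed simp
  have sup: "(SUP n. ?q n \<xi>) = ennreal ((cmod (F1 f \<xi>))\<^sup>2)" for \<xi>
  proof (rule LIMSEQ_unique)
    show "(\<lambda>n. ?q n \<xi>) \<longlonglongrightarrow> (SUP n. ?q n \<xi>)"
      using inc by (intro LIMSEQ_SUP) (auto simp: incseq_def le_fun_def)
    have "(\<lambda>n. ?q n \<xi>) \<longlonglongrightarrow> ennreal (exp (- (0 * \<xi>)\<^sup>2 / 2) * (cmod (F1 f \<xi>))\<^sup>2)"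
      unfolding \<gamma>_def by (intro tendsto_intros LIMSEQ_Suc[OF lim_1_over_n]) auto
    then show "(\<lambda>n. ?q n \<xi>) \<longlonglongrightarrow> ennreal ((cmod (F1 f \<xi>))\<^sup>2)" by simp
  qed
  have "(\<lambda>n. integral\<^sup>N lborel (?q n)) \<longlonglongrightarrow> (SUP n. integral\<^sup>N lborel (?q n))"
    using inc by (intro LIMSEQ_SUP) (auto simp: incseq_def le_fun_def intro!: nn_integral_mono)
  also have "(SUP n. integral\<^sup>N lborel (?q n)) = (\<integral>\<^sup>+\<xi>. (SUP n. ?q n \<xi>) \<partial>lborel)"
    by (rule nn_integral_monotone_convergence_SUP[symmetric, OF inc]) measurable
  also have "\<dots> = nsq (F1 f)" unfolding sup nsq_def ..
  also have "(\<lambda>n. integral\<^sup>N lborel (?q n)) = (\<lambda>n. ennreal (b n))"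
    unfolding b_def by (intro ext nn_integral_eq_integral \<gamma>F) (auto simp: \<gamma>_def)
  finally have "nsq (F1 f) = ennreal (2 * pi * (L2_norm f)\<^sup>2)"
    using lim1 by (rule LIMSEQ_unique)
  then show ?thesis using f by (simp add: nsq_L2_norm ennreal_mult)
qed

section \<open>Extension of the transform to square-integrable functions\<close>

definition cut :: "real \<Rightarrow> (real \<Rightarrow> complex) \<Rightarrow> real \<Rightarrow> complex" where
  "cut R f x = indicator {- R..R} x *\<^sub>R f x"

lemma truncated_fourier_eq: "truncated_fourier R f = F1 (cut R f)"
  unfolding truncated_fourier_def F1_def cut_def set_lebesgue_integral_def by (intro ext) simp

lemma tendsto_zero_le_ennreal:
  fixes f g :: "'a \<Rightarrow> ennreal"
  assumes "\<And>n. f n \<le> g n" "(g \<longlongrightarrow> 0) F"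
  shows "(f \<longlongrightarrow> 0) F"
  by (rule tendsto_sandwich[OF _ _ tendsto_const assms(2)]) (use assms(1) in auto)

lemma cut_L2:
  assumes "f \<in> L2" shows "cut R f \<in> L2"
proof (rule L2_bound[OF assms])
  note [measurable] = L2_measurable[OF assms]
  show "cut R f \<in> borel_measurable borel" unfolding cut_def[abs_def] by measurable
qed (auto simp: cut_def indicator_def)

lemma indicator_Icc_L2: "(indicator {a..b} :: real \<Rightarrow> real) \<in> L2"
  unfolding L2_iff_nsq
proof
  have "nsq (indicator {a..b} :: real \<Rightarrow> real) = (\<integral>\<^sup>+x. indicator {a..b} x \<partial>lborel)"
    unfolding nsq_def by (intro nn_integral_cong) (auto simp: indicator_def)
  then show "nsq (indicator {a..b} :: real \<Rightarrow> real) < \<infinity>" by (simp add: emeasure_lborel_Icc_eq)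
qed simp

lemma cut_integrable: "f \<in> L2 \<Longrightarrow> integrable lborel (cut R f)"
  using L2_mult_integrable[OF L2_of_real[OF indicator_Icc_L2[of "-R" R]], of f]
  by (simp add: cut_def[abs_def] scaleR_conv_of_real)

lemma cut_tendsto:
  assumes f: "f \<in> L2"
  shows "((\<lambda>R. nsq (\<lambda>x. cut R f x - f x)) \<longlongrightarrow> 0) at_top"
proof (rule tendsto_at_topI_sequentially)
  fix X :: "nat \<Rightarrow> real" assume X: "filterlim X at_top sequentially"
  note [measurable] = L2_measurable[OF f] L2_measurable[OF cut_L2[OF f]]
  have "(\<lambda>n. nsq (\<lambda>x. cut (X n) f x - f x)) \<longlonglongrightarrow> (\<integral>\<^sup>+(x::real). 0 \<partial>lborel)"
    unfolding nsq_def
  proof (rule nn_integral_dominated_convergence)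
    show "(\<integral>\<^sup>+x. ennreal ((norm (f x))\<^sup>2) \<partial>lborel) < \<infinity>"
      using f by (simp add: L2_iff_nsq nsq_def)
    show "AE x in lborel. ennreal ((norm (cut (X n) f x - f x))\<^sup>2) \<le> ennreal ((norm (f x))\<^sup>2)" for n
      by (auto simp: cut_def indicator_def)
    show "AE x in lborel. (\<lambda>n. ennreal ((norm (cut (X n) f x - f x))\<^sup>2)) \<longlonglongrightarrow> 0"
    proof (rule AE_I2, rule tendsto_eventually)
      fix x :: real
      have "\<forall>\<^sub>F n in sequentially. \<bar>x\<bar> \<le> X n" using X by (auto simp: filterlim_at_top)
      then show "\<forall>\<^sub>F n in sequentially. ennreal ((norm (cut (X n) f x - f x))\<^sup>2) = 0"
        by eventually_elim (auto simp: cut_def indicator_def)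
    qed
  qed measurable
  then show "(\<lambda>n. nsq (\<lambda>x. cut (X n) f x - f x)) \<longlonglongrightarrow> 0" by simp
qed

lemma F1_L2:
  assumes "integrable lborel f" "f \<in> L2"
  shows "F1 f \<in> L2"
  using plancherel_L1_L2[OF assms] assms F1_measurable[OF assms(1)]
  by (simp add: L2_iff_nsq ennreal_mult_less_top)

lemma L2_norm_F1:
  assumes "integrable lborel f" "f \<in> L2"
  shows "L2_norm (F1 f) = sqrt (2 * pi) * L2_norm f"
proof -
  have "ennreal ((L2_norm (F1 f))\<^sup>2) = ennreal ((sqrt (2 * pi) * L2_norm f)\<^sup>2)"
    using plancherel_L1_L2[OF assms] nsq_L2_norm[OF F1_L2[OF assms]] nsq_L2_norm[OF assms(2)]
    by (simp add: power_mult_distrib ennreal_mult)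
  then have "(L2_norm (F1 f))\<^sup>2 = (sqrt (2 * pi) * L2_norm f)\<^sup>2" by simp
  then show ?thesis by (rule power2_eq_imp_eq) auto
qed

lemma is_fourier_iff:
  "is_fourier f g \<longleftrightarrow> f \<in> L2 \<and> g \<in> L2 \<and> ((\<lambda>R. nsq (\<lambda>\<xi>. F1 (cut R f) \<xi> - g \<xi>)) \<longlongrightarrow> 0) at_top"
  unfolding is_fourier_def truncated_fourier_eq nsq_def ..

lemma is_fourier_seq:
  "is_fourier f g \<Longrightarrow> (\<lambda>n. nsq (\<lambda>\<xi>. F1 (cut (real n) f) \<xi> - g \<xi>)) \<longlonglongrightarrow> 0"
  unfolding is_fourier_iff using filterlim_compose[OF _ filterlim_real_sequentially] by blast

lemma cut_seq: "f \<in> L2 \<Longrightarrow> (\<lambda>n. nsq (\<lambda>x. cut (real n) f x - f x)) \<longlonglongrightarrow> 0"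
  using filterlim_compose[OF cut_tendsto filterlim_real_sequentially] by blast

lemma F1_cut_L2: "f \<in> L2 \<Longrightarrow> F1 (cut R f) \<in> L2"
  by (intro F1_L2 cut_L2 cut_integrable)

text \<open>By Plancherel the transforms of two truncations are as close as the truncations
  themselves, up to sqrt (2 pi), so completeness gives a limit along the integers. Since the
  estimate compares arbitrary real radii, convergence holds along all of them.\<close>

lemma is_fourier_exists:
  assumes f: "f \<in> L2" shows "\<exists>g. is_fourier f g"
proof -
  define d where "d R = L2_norm (\<lambda>x. cut R f x - f x)" for R
  have d: "(d \<longlongrightarrow> 0) at_top"
    unfolding d_def using cut_tendsto[OF f] by (subst nsq_tendsto_zero_iff[symmetric]) (auto intro: L2_diff[OF cut_L2[OF f] f])
  have dn: "(\<lambda>n. d (real n)) \<longlonglongrightarrow> 0" by (rule filterlim_compose[OF d filterlim_real_sequentially])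
  have est: "L2_norm (\<lambda>\<xi>. F1 (cut R f) \<xi> - F1 (cut S f) \<xi>) \<le> sqrt (2 * pi) * (d R + d S)" for R S
  proof -
    have "L2_norm (\<lambda>\<xi>. F1 (cut R f) \<xi> - F1 (cut S f) \<xi>) = L2_norm (F1 (\<lambda>x. cut R f x - cut S f x))"
      by (intro arg_cong[where f = L2_norm] ext F1_diff[symmetric] cut_integrable f)
    also have "\<dots> = sqrt (2 * pi) * L2_norm (\<lambda>x. cut R f x - cut S f x)"
      by (intro L2_norm_F1 L2_diff Bochner_Integration.integrable_diff cut_integrable cut_L2 f)
    also have "L2_norm (\<lambda>x. cut R f x - cut S f x) = L2_norm (\<lambda>x. (cut R f x - f x) + (f x - cut S f x))" by simp
    also have "\<dots> \<le> d R + L2_norm (\<lambda>x. f x - cut S f x)"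
      unfolding d_def by (intro L2_norm_triangle L2_diff cut_L2 f)
    also have "L2_norm (\<lambda>x. f x - cut S f x) = d S"
      unfolding d_def by (simp add: L2_norm_def norm_minus_commute)
    finally show ?thesis by simp
  qed
  have "\<exists>g\<in>L2. (\<lambda>n. nsq (\<lambda>x. F1 (cut (real n) f) x - g x)) \<longlonglongrightarrow> 0"
  proof (rule L2_complete[OF F1_cut_L2[OF f]])
    fix e :: real assume "e > 0"
    then have "e / (2 * sqrt (2 * pi)) > 0" by simp
    then have "\<forall>\<^sub>F n in sequentially. d (real n) < e / (2 * sqrt (2 * pi))"
      by (intro order_tendstoD(2)[OF dn])
    then obtain N where N: "\<And>n. n \<ge> N \<Longrightarrow> d (real n) < e / (2 * sqrt (2 * pi))"
      by (auto simp: eventually_sequentially)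
    have "L2_norm (\<lambda>x. F1 (cut (real i) f) x - F1 (cut (real j) f) x) < e" if "i \<ge> N" "j \<ge> N" for i j
    proof -
      have "sqrt (2 * pi) * (d i + d j) < sqrt (2 * pi) * (e / (2 * sqrt (2 * pi)) + e / (2 * sqrt (2 * pi)))"
        using N[OF that(1)] N[OF that(2)] by (intro mult_strict_left_mono add_strict_mono) auto
      also have "\<dots> = e" by (simp add: field_simps)
      finally show ?thesis using est[of "real i" "real j"] by linarith
    qed
    then show "\<exists>N. \<forall>i\<ge>N. \<forall>j\<ge>N. L2_norm (\<lambda>x. F1 (cut (real i) f) x - F1 (cut (real j) f) x) < e" by blast
  qed
  then obtain g where g: "g \<in> L2" and lim: "(\<lambda>n. nsq (\<lambda>x. F1 (cut (real n) f) x - g x)) \<longlonglongrightarrow> 0" by blast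
  have lim': "(\<lambda>n. L2_norm (\<lambda>x. F1 (cut (real n) f) x - g x)) \<longlonglongrightarrow> 0"
    using lim by (subst nsq_tendsto_zero_iff[symmetric]) (auto intro: L2_diff[OF F1_cut_L2[OF f] g])
  \<comment> \<open>In \<open>est\<close> the integer radius tends to infinity while the real radius
    \<open>R\<close> stays fixed.\<close>
  have bd: "L2_norm (\<lambda>\<xi>. F1 (cut R f) \<xi> - g \<xi>) \<le> sqrt (2 * pi) * d R" for R
  proof (rule LIMSEQ_le_const)
    show "(\<lambda>n. sqrt (2 * pi) * (d R + d (real n)) + L2_norm (\<lambda>x. F1 (cut (real n) f) x - g x)) \<longlonglongrightarrow> sqrt (2 * pi) * d R"
      by (rule tendsto_eq_intros dn lim' refl | simp)+
    have "L2_norm (\<lambda>\<xi>. F1 (cut R f) \<xi> - g \<xi>) \<le> sqrt (2 * pi) * (d R + d (real n)) + L2_norm (\<lambda>x. F1 (cut (real n) f) x - g x)" for n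
    proof -
      have "L2_norm (\<lambda>\<xi>. F1 (cut R f) \<xi> - g \<xi>) = L2_norm (\<lambda>\<xi>. (F1 (cut R f) \<xi> - F1 (cut (real n) f) \<xi>) + (F1 (cut (real n) f) \<xi> - g \<xi>))"
        by simp
      also have "\<dots> \<le> L2_norm (\<lambda>\<xi>. F1 (cut R f) \<xi> - F1 (cut (real n) f) \<xi>) + L2_norm (\<lambda>\<xi>. F1 (cut (real n) f) \<xi> - g \<xi>)"
        by (intro L2_norm_triangle L2_diff F1_cut_L2 f g)
      finally show ?thesis using est[of R "real n"] by linarith
    qed
    then show "\<exists>N. \<forall>n\<ge>N. L2_norm (\<lambda>\<xi>. F1 (cut R f) \<xi> - g \<xi>) \<le> sqrt (2 * pi) * (d R + d (real n)) + L2_norm (\<lambda>x. F1 (cut (real n) f) x - g x)"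
      by blast
  qed
  have "((\<lambda>R. sqrt (2 * pi) * d R) \<longlongrightarrow> 0) at_top" using tendsto_mult_left[OF d, of "sqrt (2 * pi)"] by simp
  then have "((\<lambda>R. L2_norm (\<lambda>\<xi>. F1 (cut R f) \<xi> - g \<xi>)) \<longlongrightarrow> 0) at_top"
    by (rule Lim_null_comparison[OF always_eventually, rotated]) (use bd in auto)
  then have "((\<lambda>R. nsq (\<lambda>\<xi>. F1 (cut R f) \<xi> - g \<xi>)) \<longlongrightarrow> 0) at_top"
    by (subst nsq_tendsto_zero_iff) (auto intro: L2_diff[OF F1_cut_L2[OF f] g])
  then show ?thesis using f g by (auto simp: is_fourier_iff)
qed

lemma is_fourier_norm:
  assumes "is_fourier f g" shows "nsq g = ennreal (2 * pi) * nsq f"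
proof -
  have f: "f \<in> L2" and g: "g \<in> L2" using assms by (auto simp: is_fourier_iff)
  have "(\<lambda>n. L2_norm (F1 (cut (real n) f))) \<longlonglongrightarrow> L2_norm g"
    by (rule L2_norm_tendsto[OF F1_cut_L2[OF f] g is_fourier_seq[OF assms]])
  moreover have "(\<lambda>n. sqrt (2 * pi) * L2_norm (cut (real n) f)) \<longlonglongrightarrow> sqrt (2 * pi) * L2_norm f"
    by (intro tendsto_intros L2_norm_tendsto[OF cut_L2[OF f] f cut_seq[OF f]])
  moreover have "L2_norm (F1 (cut (real n) f)) = sqrt (2 * pi) * L2_norm (cut (real n) f)" for n
    by (intro L2_norm_F1 cut_integrable cut_L2 f)
  ultimately have "L2_norm g = sqrt (2 * pi) * L2_norm f" by (simp add: LIMSEQ_unique)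
  then show ?thesis using f g by (simp add: nsq_L2_norm power_mult_distrib ennreal_mult)
qed

lemma F1_translate:
  "F1 (\<lambda>x. f (h + x)) \<xi> = exp (\<i> * of_real h * of_real \<xi>) * F1 f \<xi>"
proof -
  have "F1 f \<xi> = \<bar>1::real\<bar> *\<^sub>R (LINT x|lborel. exp (- \<i> * of_real \<xi> * of_real (h + 1 * x)) * f (h + 1 * x))"
    unfolding F1_def by (rule lborel_integral_real_affine) simp
  also have "\<dots> = (LINT x|lborel. exp (- \<i> * of_real h * of_real \<xi>) * (exp (- \<i> * of_real \<xi> * of_real x) * f (h + x)))"
    by (simp only: abs_one scaleR_one mult_1, intro Bochner_Integration.integral_cong refl)
      (simp add: algebra_simps flip: exp_add)
  also have "\<dots> = exp (- \<i> * of_real h * of_real \<xi>) * F1 (\<lambda>x. f (h + x)) \<xi>"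
    by (simp add: F1_def)
  finally have "exp (\<i> * of_real h * of_real \<xi>) * F1 f \<xi> = (exp (\<i> * of_real h * of_real \<xi>) * exp (- \<i> * of_real h * of_real \<xi>)) * F1 (\<lambda>x. f (h + x)) \<xi>"
    by (simp add: mult.assoc)
  also have "exp (\<i> * of_real h * of_real \<xi>) * exp (- \<i> * of_real h * of_real \<xi>) = 1"
    by (simp add: exp_add[symmetric])
  finally show ?thesis by simp
qed

text \<open>A translation by h multiplies the transform by exp (i h \<xi>). This multiplier minus
  one is bounded by 2, so multiplication by it is continuous on L2 and the identity passes from
  truncations to \<open>f\<close>.\<close>

lemma fourier_translation_norm:
  assumes "is_fourier f g"
  shows "ennreal (2 * pi) * nsq (\<lambda>x. f (h + x) - f x)
    = nsq (\<lambda>\<xi>. (exp (\<i> * of_real h * of_real \<xi>) - 1) * g \<xi>)"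
proof -
  have f: "f \<in> L2" and g: "g \<in> L2" using assms by (auto simp: is_fourier_iff)
  note [measurable] = L2_measurable[OF g] L2_measurable[OF F1_cut_L2[OF f]]
  define m where "m \<xi> = exp (\<i> * of_real h * of_real \<xi>) - (1::complex)" for \<xi> :: real
  have [measurable]: "m \<in> borel_measurable borel" unfolding m_def[abs_def] by measurable
  have m2: "cmod (m \<xi>) \<le> 2" for \<xi>
    unfolding m_def using norm_triangle_ineq4[of "exp (\<i> * of_real h * of_real \<xi>)" 1] by simp
  have mult_nsq: "nsq (\<lambda>\<xi>. m \<xi> * k \<xi>) \<le> 4 * nsq k" if [measurable]: "k \<in> borel_measurable borel" for k
  proof -
    have "nsq (\<lambda>\<xi>. m \<xi> * k \<xi>) \<le> (\<integral>\<^sup>+\<xi>. 4 * ennreal ((cmod (k \<xi>))\<^sup>2) \<partial>lborel)"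
      unfolding nsq_def
    proof (intro nn_integral_mono)
      fix \<xi>
      have "(cmod (m \<xi>))\<^sup>2 \<le> 2\<^sup>2" using m2 by (intro power_mono) auto
      then have "(cmod (m \<xi> * k \<xi>))\<^sup>2 \<le> 4 * (cmod (k \<xi>))\<^sup>2"
        by (simp add: norm_mult power_mult_distrib mult_right_mono)
      then show "ennreal ((cmod (m \<xi> * k \<xi>))\<^sup>2) \<le> 4 * ennreal ((cmod (k \<xi>))\<^sup>2)"
        by (metis ennreal_leI ennreal_mult' ennreal_numeral zero_le_numeral)
    qed
    also have "\<dots> = 4 * nsq k" unfolding nsq_def by (rule nn_integral_cmult) measurable
    finally show ?thesis .
  qed
  have mL2: "(\<lambda>\<xi>. m \<xi> * k \<xi>) \<in> L2" if "k \<in> L2" for k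
  proof -
    note [measurable] = L2_measurable[OF that]
    have "4 * nsq k < \<infinity>" using that by (simp add: L2_iff_nsq ennreal_mult_less_top)
    then show ?thesis using mult_nsq[of k] by (auto simp: L2_iff_nsq intro: le_less_trans)
  qed
  let ?c = "\<lambda>n. cut (real n) f"
  have "(\<lambda>n. L2_norm (\<lambda>\<xi>. m \<xi> * F1 (?c n) \<xi>)) \<longlonglongrightarrow> L2_norm (\<lambda>\<xi>. m \<xi> * g \<xi>)"
  proof (rule L2_norm_tendsto)
    show "(\<lambda>n. nsq (\<lambda>\<xi>. m \<xi> * F1 (?c n) \<xi> - m \<xi> * g \<xi>)) \<longlonglongrightarrow> 0"
    proof (rule tendsto_zero_le_ennreal)
      show "(\<lambda>n. 4 * nsq (\<lambda>\<xi>. F1 (?c n) \<xi> - g \<xi>)) \<longlonglongrightarrow> 0"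
        using ennreal_tendsto_cmult[OF _ is_fourier_seq[OF assms], of 4] by simp
      show "nsq (\<lambda>\<xi>. m \<xi> * F1 (?c n) \<xi> - m \<xi> * g \<xi>) \<le> 4 * nsq (\<lambda>\<xi>. F1 (?c n) \<xi> - g \<xi>)" for n
        unfolding right_diff_distrib[symmetric] by (intro mult_nsq) measurable
    qed
  qed (intro mL2 F1_cut_L2 f g)+
  moreover have "L2_norm (\<lambda>\<xi>. m \<xi> * F1 (?c n) \<xi>) = sqrt (2 * pi) * L2_norm (\<lambda>x. ?c n (h + x) - ?c n x)" for n
  proof -
    have ci: "integrable lborel (\<lambda>x. ?c n (h + x))"
      using lborel_integrable_real_affine[OF cut_integrable[OF f], of 1 "real n" h] by simp
    have "m \<xi> * F1 (?c n) \<xi> = F1 (\<lambda>x. ?c n (h + x) - ?c n x) \<xi>" for \<xi>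
      unfolding F1_diff[OF ci cut_integrable[OF f]] F1_translate m_def by (simp only: left_diff_distrib mult_1)
    then have "L2_norm (\<lambda>\<xi>. m \<xi> * F1 (?c n) \<xi>) = L2_norm (F1 (\<lambda>x. ?c n (h + x) - ?c n x))" by simp
    also have "\<dots> = sqrt (2 * pi) * L2_norm (\<lambda>x. ?c n (h + x) - ?c n x)"
      by (intro L2_norm_F1 L2_diff L2_translate Bochner_Integration.integrable_diff ci cut_integrable cut_L2 f)
    finally show ?thesis .
  qed
  moreover have "(\<lambda>n. sqrt (2 * pi) * L2_norm (\<lambda>x. ?c n (h + x) - ?c n x)) \<longlonglongrightarrow> sqrt (2 * pi) * L2_norm (\<lambda>x. f (h + x) - f x)"
  proof (intro tendsto_intros, rule L2_norm_tendsto)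
    have "nsq (\<lambda>x. ?c n (h + x) - ?c n x - (f (h + x) - f x)) \<le> 4 * nsq (\<lambda>x. ?c n x - f x)" for n
    proof -
      note [measurable] = L2_measurable[OF f] L2_measurable[OF cut_L2[OF f]]
      have "nsq (\<lambda>x. ?c n (h + x) - ?c n x - (f (h + x) - f x)) = nsq (\<lambda>x. (?c n (h + x) - f (h + x)) + (f x - ?c n x))"
        by (simp add: algebra_simps)
      also have "\<dots> \<le> 2 * nsq (\<lambda>x. ?c n (h + x) - f (h + x)) + 2 * nsq (\<lambda>x. f x - ?c n x)"
        by (rule nsq_add_le) measurable
      also have "nsq (\<lambda>x. ?c n (h + x) - f (h + x)) = nsq (\<lambda>x. ?c n x - f x)"
        unfolding nsq_def using nn_integral_real_affine[of "\<lambda>x. ennreal ((cmod (?c n x - f x))\<^sup>2)" 1 h] by simp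
      also have "nsq (\<lambda>x. f x - ?c n x) = nsq (\<lambda>x. ?c n x - f x)" by (rule nsq_diff_commute)
      finally show ?thesis by (simp flip: distrib_right)
    qed
    moreover have "(\<lambda>n. 4 * nsq (\<lambda>x. ?c n x - f x)) \<longlonglongrightarrow> 0"
      using ennreal_tendsto_cmult[OF _ cut_seq[OF f], of 4] by simp
    ultimately show "(\<lambda>n. nsq (\<lambda>x. ?c n (h + x) - ?c n x - (f (h + x) - f x))) \<longlonglongrightarrow> 0"
      by (rule tendsto_zero_le_ennreal)
  qed (intro L2_diff L2_translate cut_L2 f)+
  ultimately have "L2_norm (\<lambda>\<xi>. m \<xi> * g \<xi>) = sqrt (2 * pi) * L2_norm (\<lambda>x. f (h + x) - f x)"
    by (simp add: LIMSEQ_unique)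
  then have "nsq (\<lambda>\<xi>. m \<xi> * g \<xi>) = ennreal (2 * pi) * nsq (\<lambda>x. f (h + x) - f x)"
    using mL2[OF g] L2_diff[OF L2_translate[OF f] f, of h]
    by (simp add: nsq_L2_norm power_mult_distrib ennreal_mult)
  then show ?thesis unfolding m_def by simp
qed

lemma F1_mult_formula:
  assumes f: "integrable lborel f" and g: "integrable lborel g"
  shows "(LINT \<xi>|lborel. F1 f \<xi> * g \<xi>) = (LINT x|lborel. f x * F1 g x)"
proof -
  have [measurable]: "f \<in> borel_measurable borel" "g \<in> borel_measurable borel"
    using f g by (auto dest: borel_measurable_integrable)
  have "(LINT \<xi>|lborel. F1 f \<xi> * g \<xi>) = (LINT \<xi>|lborel. (LINT x|lborel. exp (- \<i> * of_real \<xi> * of_real x) * f x * g \<xi>))"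
    unfolding F1_def by simp
  also have "\<dots> = (LINT x|lborel. (LINT \<xi>|lborel. exp (- \<i> * of_real \<xi> * of_real x) * f x * g \<xi>))"
  proof (rule lborel_pair.Fubini_integral[symmetric])
    show "integrable (lborel \<Otimes>\<^sub>M lborel) (\<lambda>(\<xi>, x). exp (- \<i> * of_real \<xi> * of_real x) * f x * g \<xi>)"
    proof (rule integrable_pair_bound[where a = "\<lambda>\<xi>. cmod (g \<xi>)" and b = "\<lambda>x. cmod (f x)"])
      show "(\<lambda>(\<xi>, x). exp (- \<i> * of_real \<xi> * of_real x) * f x * g \<xi>) \<in> borel_measurable (lborel \<Otimes>\<^sub>M lborel)"
        unfolding split_def by measurable
    qed (use f g in \<open>auto simp: norm_mult\<close>)
  qed
  also have "\<dots> = (LINT x|lborel. f x * F1 g x)"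
    unfolding F1_def by (intro Bochner_Integration.integral_cong refl) (simp flip: integral_mult_right_zero add: mult_ac)
  finally show ?thesis .
qed

lemma is_fourier_mult_formula:
  assumes F: "is_fourier f F" and G: "is_fourier g G"
  shows "(LINT x|lborel. F x * g x) = (LINT x|lborel. f x * G x)"
proof (rule LIMSEQ_unique)
  have L: "f \<in> L2" "F \<in> L2" "g \<in> L2" "G \<in> L2" using F G by (auto simp: is_fourier_iff)
  show "(\<lambda>n. LINT x|lborel. F1 (cut (real n) f) x * cut (real n) g x) \<longlonglongrightarrow> (LINT x|lborel. F x * g x)"
    by (intro integral_mult_tendsto_L2 F1_cut_L2 cut_L2 L is_fourier_seq[OF F] cut_seq)
  show "(\<lambda>n. LINT x|lborel. F1 (cut (real n) f) x * cut (real n) g x) \<longlonglongrightarrow> (LINT x|lborel. f x * G x)"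
    unfolding F1_mult_formula[OF cut_integrable[OF L(1)] cut_integrable[OF L(3)]]
    by (intro integral_mult_tendsto_L2 F1_cut_L2 cut_L2 L is_fourier_seq[OF G] cut_seq)
qed

text \<open>The candidate is the expected inverse transform: the conjugate of the transform of the
  conjugate, divided by 2 pi. It is verified through the equality case of Cauchy-Schwarz: its
  transform \<open>G\<close> has the norm of \<open>g\<close>, and by the multiplication formula the
  inner product of \<open>G\<close> with \<open>g\<close> is that norm squared, so the difference
  has norm 0.\<close>

lemma is_fourier_surj:
  assumes g: "g \<in> L2" shows "\<exists>f. is_fourier f g"
proof -
  define b where "b x = cnj (g x)" for x
  have b: "b \<in> L2" unfolding b_def[abs_def] by (rule L2_cnj[OF g])
  obtain k where k: "is_fourier b k" using is_fourier_exists[OF b] by blast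
  then have kL: "k \<in> L2" by (auto simp: is_fourier_iff)
  define f where "f x = (1 / (2 * pi)) *\<^sub>R cnj (k x)" for x
  have f: "f \<in> L2" unfolding f_def[abs_def] by (intro L2_scaleR L2_cnj kL)
  obtain G where G: "is_fourier f G" using is_fourier_exists[OF f] by blast
  then have GL: "G \<in> L2" by (auto simp: is_fourier_iff)
  have norm_b: "L2_norm b = L2_norm g" by (simp add: L2_norm_def b_def)
  have norm_f: "L2_norm f = L2_norm k / (2 * pi)"
    unfolding f_def[abs_def] L2_norm_scale by (simp add: L2_norm_def)
  have nk: "(L2_norm k)\<^sup>2 = 2 * pi * (L2_norm g)\<^sup>2"
    using is_fourier_norm[OF k] b kL norm_b by (simp add: nsq_L2_norm flip: ennreal_mult)
  have nG: "(L2_norm G)\<^sup>2 = (L2_norm g)\<^sup>2"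
  proof -
    have "(L2_norm G)\<^sup>2 = 2 * pi * (L2_norm f)\<^sup>2"
      using is_fourier_norm[OF G] f GL by (simp add: nsq_L2_norm flip: ennreal_mult)
    also have "\<dots> = (L2_norm g)\<^sup>2" unfolding norm_f power_divide nk by (simp add: power2_eq_square)
    finally show ?thesis .
  qed
  have Gb: "integrable lborel (\<lambda>x. G x * b x)" by (rule L2_mult_integrable[OF GL b])
  have "(LINT x|lborel. G x * b x) = (LINT x|lborel. f x * k x)"
    by (rule is_fourier_mult_formula[OF G k])
  also have "\<dots> = of_real (LINT x|lborel. (1 / (2 * pi)) * (cmod (k x))\<^sup>2)"
    unfolding integral_complex_of_real[symmetric]
  proof (intro Bochner_Integration.integral_cong refl)
    fix x
    have "complex_of_real ((cmod (k x))\<^sup>2) = k x * cnj (k x)" by (rule complex_norm_square)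
    then show "f x * k x = complex_of_real (1 / (2 * pi) * (cmod (k x))\<^sup>2)"
      unfolding f_def of_real_mult scaleR_conv_of_real by (simp only: mult_ac)
  qed
  also have "(LINT x|lborel. (1 / (2 * pi)) * (cmod (k x))\<^sup>2) = (L2_norm g)\<^sup>2"
    using nk by (simp add: L2_norm_sq)
  finally have re: "Re (LINT x|lborel. G x * b x) = (L2_norm g)\<^sup>2" by simp
  define c where "c x = Re (G x * b x)" for x
  have c: "integrable lborel c" "integral\<^sup>L lborel c = (L2_norm g)\<^sup>2"
    unfolding c_def[abs_def] using integrable_Re[OF Gb] integral_Re[OF Gb] re by auto
  have "(L2_norm (\<lambda>x. G x - g x))\<^sup>2 = (LINT x|lborel. ((cmod (G x))\<^sup>2 + (cmod (g x))\<^sup>2) - 2 * c x)"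
    unfolding L2_norm_sq
  proof (intro Bochner_Integration.integral_cong refl)
    fix x show "(cmod (G x - g x))\<^sup>2 = (cmod (G x))\<^sup>2 + (cmod (g x))\<^sup>2 - 2 * c x"
      unfolding c_def b_def by (simp only: cmod_power2) (simp add: power2_eq_square algebra_simps)
  qed
  also have "\<dots> = (L2_norm G)\<^sup>2 + (L2_norm g)\<^sup>2 - 2 * (L2_norm g)\<^sup>2"
    using c L2_integrable[OF GL] L2_integrable[OF g] by (simp add: L2_norm_sq)
  finally have Gg: "L2_norm (\<lambda>x. G x - g x) = 0" using nG by simp
  have "((\<lambda>R. L2_norm (\<lambda>\<xi>. F1 (cut R f) \<xi> - g \<xi>)) \<longlongrightarrow> 0) at_top"
  proof (rule Lim_null_comparison[OF always_eventually])
    have "((\<lambda>R. nsq (\<lambda>\<xi>. F1 (cut R f) \<xi> - G \<xi>)) \<longlongrightarrow> 0) at_top" using G by (simp add: is_fourier_iff)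
    then show "((\<lambda>R. L2_norm (\<lambda>\<xi>. F1 (cut R f) \<xi> - G \<xi>)) \<longlongrightarrow> 0) at_top"
      by (subst nsq_tendsto_zero_iff[symmetric]) (auto intro: L2_diff[OF F1_cut_L2[OF f] GL])
    show "\<forall>R. norm (L2_norm (\<lambda>\<xi>. F1 (cut R f) \<xi> - g \<xi>)) \<le> L2_norm (\<lambda>\<xi>. F1 (cut R f) \<xi> - G \<xi>)"
    proof
      fix R
      have "L2_norm (\<lambda>\<xi>. F1 (cut R f) \<xi> - g \<xi>) = L2_norm (\<lambda>\<xi>. (F1 (cut R f) \<xi> - G \<xi>) + (G \<xi> - g \<xi>))" by simp
      also have "\<dots> \<le> L2_norm (\<lambda>\<xi>. F1 (cut R f) \<xi> - G \<xi>) + L2_norm (\<lambda>\<xi>. G \<xi> - g \<xi>)"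
        by (intro L2_norm_triangle L2_diff F1_cut_L2 f g GL)
      finally show "norm (L2_norm (\<lambda>\<xi>. F1 (cut R f) \<xi> - g \<xi>)) \<le> L2_norm (\<lambda>\<xi>. F1 (cut R f) \<xi> - G \<xi>)"
        using Gg by simp
    qed
  qed
  then have "((\<lambda>R. nsq (\<lambda>\<xi>. F1 (cut R f) \<xi> - g \<xi>)) \<longlongrightarrow> 0) at_top"
    by (subst nsq_tendsto_zero_iff) (auto intro: L2_diff[OF F1_cut_L2[OF f] g])
  then show ?thesis using f g by (auto simp: is_fourier_iff)
qed

lemma is_fourier_fourier: "f \<in> L2 \<Longrightarrow> is_fourier f (fourier f)"
  unfolding fourier_def using someI_ex[OF is_fourier_exists] by blast

lemma is_fourier_inv_fourier: "g \<in> L2 \<Longrightarrow> is_fourier (inv_fourier g) g"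
  unfolding inv_fourier_def using someI_ex[OF is_fourier_surj] by blast

section \<open>The Gagliardo form of the half-order energy\<close>

text \<open>On the diagonal, which is a null set, division by zero gives the value 0.\<close>

definition dq :: "(real \<Rightarrow> real) \<Rightarrow> real \<times> real \<Rightarrow> real" where
  "dq u z = (u (fst z) - u (snd z)) / (fst z - snd z)"

text \<open>H^(1/2) described by difference quotients; \<open>Hhalf_eq_HH\<close> identifies it with
  \<open>Hhalf\<close>.\<close>

definition HH :: "(real \<Rightarrow> real) set" where
  "HH = {u \<in> L2. integrable lborel (\<lambda>z. (dq u z)\<^sup>2)}"

definition gs :: "(real \<Rightarrow> real) \<Rightarrow> real" where "gs u = (LINT z|lborel. (dq u z)\<^sup>2)"

definition ms :: "(real \<Rightarrow> real) \<Rightarrow> real" where "ms u = (LINT x|lborel. (u x)\<^sup>2)"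

definition gn :: "(real \<Rightarrow> real) \<Rightarrow> ennreal" where "gn u = (\<integral>\<^sup>+z. ennreal ((dq u z)\<^sup>2) \<partial>lborel)"

lemma dq_measurable [measurable]:
  assumes [measurable]: "u \<in> borel_measurable borel" shows "dq u \<in> borel_measurable borel"
proof -
  have "dq u \<in> borel_measurable (borel \<Otimes>\<^sub>M borel)" unfolding dq_def[abs_def] by measurable
  then show ?thesis by (simp add: borel_prod)
qed

lemma nn_integral_R2:
  fixes F :: "real \<times> real \<Rightarrow> ennreal"
  assumes "F \<in> borel_measurable borel"
  shows "(\<integral>\<^sup>+z. F z \<partial>lborel) = (\<integral>\<^sup>+x. (\<integral>\<^sup>+y. F (x, y) \<partial>lborel) \<partial>lborel)"
  using lborel.nn_integral_fst[of F lborel] assms by (simp add: lborel_prod borel_prod)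

lemma HH_L2: "u \<in> HH \<Longrightarrow> u \<in> L2" by (simp add: HH_def)

lemma HH_measurable [measurable_dest]: "u \<in> HH \<Longrightarrow> u \<in> borel_measurable borel"
  by (simp add: HH_def L2_measurable)

lemma HH_iff: "u \<in> HH \<longleftrightarrow> u \<in> L2 \<and> gn u < \<infinity>"
  unfolding HH_def gn_def by (auto simp: integrable_iff_bounded dest: L2_measurable)

lemma gn_eq: "u \<in> HH \<Longrightarrow> gn u = ennreal (gs u)"
  unfolding gn_def gs_def by (rule nn_integral_eq_integral) (auto simp: HH_def)

lemma gs_nonneg [simp]: "0 \<le> gs u" unfolding gs_def by simp

lemma ms_nonneg [simp]: "0 \<le> ms u" unfolding ms_def by simp

lemma ms_L2_norm: "ms u = (L2_norm u)\<^sup>2" by (simp add: ms_def L2_norm_sq)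

lemma nsq_ms: "u \<in> L2 \<Longrightarrow> nsq u = ennreal (ms u)" by (simp add: nsq_L2_norm ms_L2_norm)

text \<open>The substitution y = x + h separates the kernel from the function: the form becomes an
  average of squared translation differences, and Plancherel applies to each of them.\<close>

lemma gn_translates:
  assumes [measurable]: "u \<in> borel_measurable borel"
  shows "gn u = (\<integral>\<^sup>+h. ennreal (1 / h\<^sup>2) * nsq (\<lambda>x. u (h + x) - u x) \<partial>lborel)"
proof -
  have "gn u = (\<integral>\<^sup>+x. (\<integral>\<^sup>+y. ennreal ((dq u (x, y))\<^sup>2) \<partial>lborel) \<partial>lborel)"
    unfolding gn_def by (rule nn_integral_R2) measurable
  also have "\<dots> = (\<integral>\<^sup>+x. (\<integral>\<^sup>+h. ennreal (((u (h + x) - u x) / h)\<^sup>2) \<partial>lborel) \<partial>lborel)"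
  proof (rule nn_integral_cong)
    fix x :: real
    have "(\<lambda>y. ennreal ((dq u (x, y))\<^sup>2)) \<in> borel_measurable borel"
      unfolding dq_def fst_conv snd_conv by measurable
    from nn_integral_real_affine[OF this, of 1 x]
    show "(\<integral>\<^sup>+y. ennreal ((dq u (x, y))\<^sup>2) \<partial>lborel) = (\<integral>\<^sup>+h. ennreal (((u (h + x) - u x) / h)\<^sup>2) \<partial>lborel)"
      by (simp add: dq_def power_divide add.commute power2_commute)
  qed
  also have "\<dots> = (\<integral>\<^sup>+h. (\<integral>\<^sup>+x. ennreal (((u (h + x) - u x) / h)\<^sup>2) \<partial>lborel) \<partial>lborel)"
    by (rule lborel_pair.Fubini') measurable
  also have "\<dots> = (\<integral>\<^sup>+h. ennreal (1 / h\<^sup>2) * nsq (\<lambda>x. u (h + x) - u x) \<partial>lborel)"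
    unfolding nsq_def
    by (intro nn_integral_cong, subst nn_integral_cmult[symmetric])
       (auto intro!: nn_integral_cong simp: power_divide simp flip: ennreal_mult)
  finally show ?thesis .
qed

text \<open>The constant that arises when the translation multiplier is averaged against h^(-2). Its
  classical value is 2 pi; the argument relies on its being positive and finite.\<close>

definition K1 :: ennreal where
  "K1 = (\<integral>\<^sup>+s. ennreal ((cmod (exp (\<i> * of_real s) - 1))\<^sup>2 / s\<^sup>2) \<partial>lborel)"

text \<open>The substitution s = \<xi> h. The kernel has degree -2 and the measure degree 1, which
  leaves one power of |\<xi>|: the symbol of the operator.\<close>

lemma K1_scale:
  "(\<integral>\<^sup>+h. ennreal ((cmod (exp (\<i> * of_real h * of_real \<xi>) - 1))\<^sup>2 / h\<^sup>2) \<partial>lborel) = ennreal \<bar>\<xi>\<bar> * K1"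
proof (cases "\<xi> = 0")
  case False
  let ?G = "\<lambda>s. ennreal ((cmod (exp (\<i> * of_real s) - 1))\<^sup>2 / s\<^sup>2)"
  have "K1 = ennreal \<bar>\<xi>\<bar> * (\<integral>\<^sup>+h. ?G (0 + \<xi> * h) \<partial>lborel)"
    unfolding K1_def by (rule nn_integral_real_affine) (use False in auto)
  then have "ennreal \<bar>\<xi>\<bar> * K1 = (ennreal \<bar>\<xi>\<bar> * ennreal \<bar>\<xi>\<bar>) * (\<integral>\<^sup>+h. ?G (0 + \<xi> * h) \<partial>lborel)"
    by (simp only: mult.assoc)
  also have "\<dots> = ennreal (\<xi>\<^sup>2) * (\<integral>\<^sup>+h. ?G (0 + \<xi> * h) \<partial>lborel)"
    by (simp only: ennreal_mult[symmetric] abs_ge_zero abs_mult_self_eq power2_eq_square)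
  also have "\<dots> = (\<integral>\<^sup>+h. ennreal (\<xi>\<^sup>2) * ?G (0 + \<xi> * h) \<partial>lborel)"
    by (rule nn_integral_cmult[symmetric]) measurable
  also have "\<dots> = (\<integral>\<^sup>+h. ennreal ((cmod (exp (\<i> * of_real h * of_real \<xi>) - 1))\<^sup>2 / h\<^sup>2) \<partial>lborel)"
    using False by (intro nn_integral_cong) (simp add: power_mult_distrib mult_ac flip: ennreal_mult)
  finally show ?thesis ..
qed simp

lemma cmod_exp_i_minus_one: "(cmod (exp (\<i> * of_real s) - 1))\<^sup>2 = 2 - 2 * cos s"
proof -
  have "(cmod (exp (\<i> * of_real s) - 1))\<^sup>2 = (cos s - 1)\<^sup>2 + (sin s)\<^sup>2"
    by (simp add: cmod_power2 exp_Euler cos_of_real sin_of_real)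
  also have "\<dots> = 2 - 2 * cos s"
    using sin_cos_squared_add[of s] by (simp add: power2_eq_square algebra_simps)
  finally show ?thesis .
qed

text \<open>The numerator is at most s^2 and at most 4, so the integrand is dominated by a multiple
  of 1 / (1 + s^2).\<close>

lemma K1_finite: "K1 < \<infinity>"
proof -
  have "K1 \<le> (\<integral>\<^sup>+s. ennreal (8 * inverse (1 + s\<^sup>2)) \<partial>lborel)"
    unfolding K1_def
  proof (intro nn_integral_mono ennreal_leI)
    fix s :: real
    have "cmod (exp (\<i> * of_real s) - 1) \<le> \<bar>s\<bar>"
      using iexp_approx1[of s 0] by simp
    then have 1: "(cmod (exp (\<i> * of_real s) - 1))\<^sup>2 \<le> s\<^sup>2" by (metis abs_le_square_iff abs_norm_cancel)
    have 2: "(cmod (exp (\<i> * of_real s) - 1))\<^sup>2 \<le> 4"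
      unfolding cmod_exp_i_minus_one using cos_ge_minus_one[of s] by linarith
    show "(cmod (exp (\<i> * of_real s) - 1))\<^sup>2 / s\<^sup>2 \<le> 8 * inverse (1 + s\<^sup>2)"
    proof (cases "s = 0")
      case False
      have p: "s\<^sup>2 > 0" "1 + s\<^sup>2 > 0" using False by (auto intro: add_pos_nonneg)
      have "(cmod (exp (\<i> * of_real s) - 1))\<^sup>2 * (1 + s\<^sup>2) = (cmod (exp (\<i> * of_real s) - 1))\<^sup>2 + (cmod (exp (\<i> * of_real s) - 1))\<^sup>2 * s\<^sup>2"
        by (simp add: algebra_simps)
      also have "\<dots> \<le> s\<^sup>2 + 4 * s\<^sup>2" using 1 2 by (intro add_mono mult_right_mono) auto
      also have "\<dots> \<le> 8 * s\<^sup>2" using p by simp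
      finally show ?thesis using p by (simp add: field_simps)
    qed simp
  qed
  also have "\<dots> < \<infinity>"
  proof -
    have "integrable lborel (\<lambda>s::real. inverse (1 + s\<^sup>2))"
      using integrable_inverse_1_plus_square by (simp add: set_integrable_def)
    from integrable_mult_right[OF this, of 8] have "(\<integral>\<^sup>+s. ennreal (norm (8 * inverse (1 + s\<^sup>2 :: real))) \<partial>lborel) < \<infinity>"
      unfolding integrable_iff_bounded by blast
    moreover have "norm (8 * inverse (1 + s\<^sup>2)) = 8 * inverse (1 + s\<^sup>2)" for s :: real
      by (simp add: abs_mult add_nonneg_nonneg)
    ultimately show ?thesis by (simp only:)
  qed
  finally show ?thesis .
qed

lemma K1_pos: "K1 > 0"
proof -
  have c1: "cos 1 < (1::real)" using cos_monotone_0_pi[of 0 1] pi_gt3 by simp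
  have "0 < ennreal ((2 - 2 * cos 1) / 4) * emeasure lborel {1..2::real}"
    using c1 by (simp add: ennreal_zero_less_mult_iff)
  also have "\<dots> = (\<integral>\<^sup>+s. ennreal ((2 - 2 * cos 1) / 4) * indicator {1..2::real} s \<partial>lborel)"
    by (simp add: nn_integral_cmult_indicator)
  also have "\<dots> \<le> K1"
    unfolding K1_def
  proof (intro nn_integral_mono)
    fix s :: real
    show "ennreal ((2 - 2 * cos 1) / 4) * indicator {1..2::real} s \<le> ennreal ((cmod (exp (\<i> * of_real s) - 1))\<^sup>2 / s\<^sup>2)"
    proof (cases "s \<in> {1..2}")
      case True
      have "cos s \<le> cos 1" using True pi_gt3 by (intro cos_monotone_0_pi_le) auto
      moreover have "s\<^sup>2 \<le> 4" using True power_mono[of s 2 2] by auto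
      moreover have "s\<^sup>2 > 0" using True by simp
      ultimately have "(2 - 2 * cos 1) / 4 \<le> (cmod (exp (\<i> * of_real s) - 1))\<^sup>2 / s\<^sup>2"
        unfolding cmod_exp_i_minus_one using c1 by (intro frac_le) auto
      then show ?thesis using True by (auto intro: ennreal_leI)
    qed simp
  qed
  finally show ?thesis .
qed

text \<open>Plancherel for each translation, Tonelli, and the homogeneity of
  \<open>K1_scale\<close>. In extended reals the identity also shows that the two energies are
  finite simultaneously.\<close>

lemma gn_fourier:
  assumes u: "u \<in> L2" and g: "is_fourier (\<lambda>x. of_real (u x)) g"
  shows "ennreal (2 * pi) * gn u = K1 * (\<integral>\<^sup>+\<xi>. ennreal (\<bar>\<xi>\<bar> * (cmod (g \<xi>))\<^sup>2) \<partial>lborel)"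
proof -
  note [measurable] = L2_measurable[OF u]
  have [measurable]: "g \<in> borel_measurable borel" using g by (auto simp: is_fourier_iff L2_measurable)
  have "ennreal (2 * pi) * gn u = (\<integral>\<^sup>+h. ennreal (2 * pi) * (ennreal (1 / h\<^sup>2) * nsq (\<lambda>x. u (h + x) - u x)) \<partial>lborel)"
    unfolding gn_translates[OF L2_measurable[OF u]]
    by (rule nn_integral_cmult[symmetric]) (simp add: nsq_def)
  also have "\<dots> = (\<integral>\<^sup>+h. (\<integral>\<^sup>+\<xi>. ennreal (1 / h\<^sup>2) * ennreal ((cmod ((exp (\<i> * of_real h * of_real \<xi>) - 1) * g \<xi>))\<^sup>2) \<partial>lborel) \<partial>lborel)"
  proof (intro nn_integral_cong)
    fix h
    have "nsq (\<lambda>x. u (h + x) - u x) = nsq (\<lambda>x. complex_of_real (u (h + x)) - of_real (u x))"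
      unfolding nsq_def by (simp flip: of_real_diff)
    then have "ennreal (2 * pi) * nsq (\<lambda>x. u (h + x) - u x) = nsq (\<lambda>\<xi>. (exp (\<i> * of_real h * of_real \<xi>) - 1) * g \<xi>)"
      using fourier_translation_norm[OF g, of h] by simp
    then have "ennreal (2 * pi) * (ennreal (1 / h\<^sup>2) * nsq (\<lambda>x. u (h + x) - u x)) = ennreal (1 / h\<^sup>2) * nsq (\<lambda>\<xi>. (exp (\<i> * of_real h * of_real \<xi>) - 1) * g \<xi>)"
      by (metis mult.left_commute)
    also have "\<dots> = (\<integral>\<^sup>+\<xi>. ennreal (1 / h\<^sup>2) * ennreal ((cmod ((exp (\<i> * of_real h * of_real \<xi>) - 1) * g \<xi>))\<^sup>2) \<partial>lborel)"
      unfolding nsq_def by (rule nn_integral_cmult[symmetric]) measurable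
    finally show "ennreal (2 * pi) * (ennreal (1 / h\<^sup>2) * nsq (\<lambda>x. u (h + x) - u x))
       = (\<integral>\<^sup>+\<xi>. ennreal (1 / h\<^sup>2) * ennreal ((cmod ((exp (\<i> * of_real h * of_real \<xi>) - 1) * g \<xi>))\<^sup>2) \<partial>lborel)" .
  qed
  also have "\<dots> = (\<integral>\<^sup>+\<xi>. (\<integral>\<^sup>+h. ennreal (1 / h\<^sup>2) * ennreal ((cmod ((exp (\<i> * of_real h * of_real \<xi>) - 1) * g \<xi>))\<^sup>2) \<partial>lborel) \<partial>lborel)"
    by (rule lborel_pair.Fubini') measurable
  also have "\<dots> = (\<integral>\<^sup>+\<xi>. ennreal ((cmod (g \<xi>))\<^sup>2) * (ennreal \<bar>\<xi>\<bar> * K1) \<partial>lborel)"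
  proof (intro nn_integral_cong)
    fix \<xi>
    have "(\<integral>\<^sup>+h. ennreal (1 / h\<^sup>2) * ennreal ((cmod ((exp (\<i> * of_real h * of_real \<xi>) - 1) * g \<xi>))\<^sup>2) \<partial>lborel)
      = (\<integral>\<^sup>+h. ennreal ((cmod (g \<xi>))\<^sup>2) * ennreal ((cmod (exp (\<i> * of_real h * of_real \<xi>) - 1))\<^sup>2 / h\<^sup>2) \<partial>lborel)"
      by (intro nn_integral_cong) (simp add: norm_mult power_mult_distrib mult_ac flip: ennreal_mult)
    also have "\<dots> = ennreal ((cmod (g \<xi>))\<^sup>2) * (ennreal \<bar>\<xi>\<bar> * K1)"
      unfolding K1_scale[symmetric] by (rule nn_integral_cmult) measurable
    finally show "(\<integral>\<^sup>+h. ennreal (1 / h\<^sup>2) * ennreal ((cmod ((exp (\<i> * of_real h * of_real \<xi>) - 1) * g \<xi>))\<^sup>2) \<partial>lborel)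
      = ennreal ((cmod (g \<xi>))\<^sup>2) * (ennreal \<bar>\<xi>\<bar> * K1)" .
  qed
  also have "\<dots> = (\<integral>\<^sup>+\<xi>. K1 * ennreal (\<bar>\<xi>\<bar> * (cmod (g \<xi>))\<^sup>2) \<partial>lborel)"
    by (intro nn_integral_cong) (simp add: ennreal_mult mult_ac)
  also have "\<dots> = K1 * (\<integral>\<^sup>+\<xi>. ennreal (\<bar>\<xi>\<bar> * (cmod (g \<xi>))\<^sup>2) \<partial>lborel)"
    by (rule nn_integral_cmult) measurable
  finally show ?thesis .
qed

text \<open>Normalised so that \<open>kap * gs u\<close> is the squared norm of
  \<open>Dx_half u\<close>.\<close>

definition kap :: real where "kap = 1 / enn2real K1"

lemma kap_pos: "kap > 0"
  using K1_pos K1_finite unfolding kap_def by (simp add: enn2real_positive_iff)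

lemma K1_kap: "K1 = ennreal (1 / kap)"
  using K1_finite unfolding kap_def by simp

lemma weight_bounds:
  fixes \<xi> :: real
  shows "1 \<le> (1 + \<xi>\<^sup>2) powr (1/2)" "\<bar>\<xi>\<bar> \<le> (1 + \<xi>\<^sup>2) powr (1/2)" "(1 + \<xi>\<^sup>2) powr (1/2) \<le> 1 + \<bar>\<xi>\<bar>"
proof -
  have e: "(1 + \<xi>\<^sup>2) powr (1/2) = sqrt (1 + \<xi>\<^sup>2)" by (rule powr_half_sqrt) (simp add: add_nonneg_nonneg)
  show "1 \<le> (1 + \<xi>\<^sup>2) powr (1/2)" unfolding e by simp
  show "\<bar>\<xi>\<bar> \<le> (1 + \<xi>\<^sup>2) powr (1/2)" unfolding e by (rule real_le_rsqrt) simp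
  show "(1 + \<xi>\<^sup>2) powr (1/2) \<le> 1 + \<bar>\<xi>\<bar>" unfolding e by (rule real_le_lsqrt) (auto simp: power2_sum)
qed

text \<open>The weight lies between max 1 |\<xi>| and 1 + |\<xi>|, so its integral is comparable
  with mass plus form. \<open>fourier\<close> and \<open>inv_fourier\<close> are choices up to null
  sets, which leave all the norms concerned unchanged.\<close>

lemma Hhalf_facts:
  assumes u: "u \<in> L2"
  defines "g \<equiv> fourier (\<lambda>x. of_real (u x))"
  shows "u \<in> Hhalf \<longleftrightarrow> u \<in> HH"
    and "u \<in> HH \<Longrightarrow> (L2_norm (Dx_half u))\<^sup>2 = kap * gs u"
    and "u \<in> HH \<Longrightarrow> 2 * pi * ms u \<le> (Hhalf_norm u)\<^sup>2"
    and "u \<in> HH \<Longrightarrow> 2 * pi * kap * gs u \<le> (Hhalf_norm u)\<^sup>2"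
    and "u \<in> HH \<Longrightarrow> (Hhalf_norm u)\<^sup>2 \<le> 2 * pi * (ms u + kap * gs u)"
proof -
  have U: "(\<lambda>x. complex_of_real (u x)) \<in> L2" by (rule L2_of_real[OF u])
  have g: "is_fourier (\<lambda>x. of_real (u x)) g" unfolding g_def by (rule is_fourier_fourier[OF U])
  then have gL: "g \<in> L2" by (simp add: is_fourier_iff)
  note [measurable] = L2_measurable[OF gL]
  define A where "A = (\<integral>\<^sup>+\<xi>. ennreal (\<bar>\<xi>\<bar> * (cmod (g \<xi>))\<^sup>2) \<partial>lborel)"
  define W where "W = (\<integral>\<^sup>+\<xi>. ennreal ((1 + \<xi>\<^sup>2) powr (1/2) * (cmod (g \<xi>))\<^sup>2) \<partial>lborel)"
  have gn: "ennreal (2 * pi) * gn u = K1 * A" unfolding A_def by (rule gn_fourier[OF u g])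
  have nsq_u: "nsq (\<lambda>x. complex_of_real (u x)) = ennreal (ms u)"
    using nsq_ms[OF u] by (simp add: nsq_def)
  have ng: "nsq g = ennreal (2 * pi * ms u)"
    using is_fourier_norm[OF g] unfolding nsq_u by (simp add: ennreal_mult)
  have W_up: "W \<le> nsq g + A"
  proof -
    have "W \<le> (\<integral>\<^sup>+\<xi>. ennreal ((cmod (g \<xi>))\<^sup>2) + ennreal (\<bar>\<xi>\<bar> * (cmod (g \<xi>))\<^sup>2) \<partial>lborel)"
      unfolding W_def
    proof (intro nn_integral_mono)
      fix \<xi>
      have "(1 + \<xi>\<^sup>2) powr (1/2) * (cmod (g \<xi>))\<^sup>2 \<le> (1 + \<bar>\<xi>\<bar>) * (cmod (g \<xi>))\<^sup>2"
        by (intro mult_right_mono weight_bounds) simp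
      then show "ennreal ((1 + \<xi>\<^sup>2) powr (1/2) * (cmod (g \<xi>))\<^sup>2) \<le> ennreal ((cmod (g \<xi>))\<^sup>2) + ennreal (\<bar>\<xi>\<bar> * (cmod (g \<xi>))\<^sup>2)"
        by (auto dest!: ennreal_leI simp: distrib_right)
    qed
    also have "\<dots> = nsq g + A" unfolding nsq_def A_def by (rule nn_integral_add) measurable
    finally show ?thesis .
  qed
  have W_g: "nsq g \<le> W"
    unfolding nsq_def W_def using mult_right_mono[OF weight_bounds(1)]
    by (intro nn_integral_mono ennreal_leI) fastforce
  have W_A: "A \<le> W"
    unfolding A_def W_def by (intro nn_integral_mono ennreal_leI mult_right_mono weight_bounds) simp
  have "u \<in> Hhalf \<longleftrightarrow> W < \<infinity>"
    using u unfolding Hhalf_def W_def mem_Collect_eq g_def[symmetric] by (simp add: integrable_iff_bounded abs_mult)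
  also have "\<dots> \<longleftrightarrow> A < \<infinity>"
    using W_up W_A ng by (auto intro: le_less_trans simp: ennreal_add_less_top)
  also have "\<dots> \<longleftrightarrow> K1 * A < \<infinity>"
    using K1_pos K1_finite by (auto simp: ennreal_mult_less_top)
  also have "\<dots> \<longleftrightarrow> gn u < \<infinity>"
    unfolding gn[symmetric] by (auto simp: ennreal_mult_less_top)
  also have "\<dots> \<longleftrightarrow> u \<in> HH" using u by (simp add: HH_iff)
  finally show HH_eq: "u \<in> Hhalf \<longleftrightarrow> u \<in> HH" .
  assume uH: "u \<in> HH"
  have Afin: "A = ennreal (2 * pi * kap * gs u)"
  proof -
    have "ennreal kap * (ennreal (2 * pi) * ennreal (gs u)) = (ennreal kap * ennreal (1 / kap)) * A"
      using gn unfolding gn_eq[OF uH] K1_kap by (simp add: mult.assoc)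
    also have "ennreal kap * ennreal (1 / kap) = 1"
      using kap_pos by (simp flip: ennreal_mult)
    finally show ?thesis using kap_pos by (simp add: mult_ac flip: ennreal_mult)
  qed
  have Wn: "W = ennreal ((Hhalf_norm u)\<^sup>2)"
  proof -
    have "integrable lborel (\<lambda>\<xi>. (1 + \<xi>\<^sup>2) powr (1/2) * (norm (g \<xi>))\<^sup>2)"
      using uH HH_eq unfolding Hhalf_def g_def by simp
    then have "W = ennreal (LINT \<xi>|lborel. (1 + \<xi>\<^sup>2) powr (1/2) * (norm (g \<xi>))\<^sup>2)"
      unfolding W_def by (rule nn_integral_eq_integral) simp
    then show ?thesis unfolding Hhalf_norm_def g_def by simp
  qed
  show "2 * pi * ms u \<le> (Hhalf_norm u)\<^sup>2" using W_g unfolding ng Wn by simp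
  show "2 * pi * kap * gs u \<le> (Hhalf_norm u)\<^sup>2" using W_A unfolding Afin Wn by simp
  have "ennreal ((Hhalf_norm u)\<^sup>2) \<le> ennreal (2 * pi * ms u + 2 * pi * kap * gs u)"
    using W_up kap_pos unfolding ng Wn Afin by simp
  then have "(Hhalf_norm u)\<^sup>2 \<le> 2 * pi * ms u + 2 * pi * kap * gs u"
    using kap_pos by (subst (asm) ennreal_le_iff) auto
  then show "(Hhalf_norm u)\<^sup>2 \<le> 2 * pi * (ms u + kap * gs u)" by (simp add: algebra_simps)
  \<comment> \<open>The squared norm of \<open>m\<close> is \<open>A\<close>, hence finite;
    \<open>m\<close> therefore has an inverse transform, and Plancherel for this pair computes the
    norm of \<open>Dx_half u\<close>.\<close>
  define m where "m \<xi> = complex_of_real (\<bar>\<xi>\<bar> powr (1/2)) * g \<xi>" for \<xi>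
  have nm: "nsq m = A"
    unfolding nsq_def A_def m_def
  proof (intro nn_integral_cong arg_cong[where f = ennreal])
    fix \<xi> :: real
    have "(\<bar>\<xi>\<bar> powr (1/2))\<^sup>2 = \<bar>\<xi>\<bar>" by (simp add: powr_half_sqrt)
    then show "(cmod (complex_of_real (\<bar>\<xi>\<bar> powr (1/2)) * g \<xi>))\<^sup>2 = \<bar>\<xi>\<bar> * (cmod (g \<xi>))\<^sup>2"
      by (simp add: norm_mult power_mult_distrib)
  qed
  have "m \<in> L2"
    unfolding L2_iff_nsq nm Afin by (simp add: m_def[abs_def])
  then have D: "is_fourier (Dx_half u) m"
    unfolding Dx_half_def m_def[abs_def] g_def by (rule is_fourier_inv_fourier)
  then have "ennreal (2 * pi * kap * gs u) = ennreal (2 * pi) * ennreal ((L2_norm (Dx_half u))\<^sup>2)"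
    using is_fourier_norm[OF D] nsq_L2_norm[of "Dx_half u"] unfolding nm Afin by (simp add: is_fourier_iff)
  then have "2 * pi * kap * gs u = 2 * pi * (L2_norm (Dx_half u))\<^sup>2"
    using kap_pos by (simp flip: ennreal_mult)
  then show "(L2_norm (Dx_half u))\<^sup>2 = kap * gs u" by simp
qed

lemma Hhalf_eq_HH: "Hhalf = HH"
  using Hhalf_facts(1) HH_L2 by (auto simp: Hhalf_def)

section \<open>A Riesz rearrangement inequality for interval kernels\<close>

text \<open>The distribution function of \<open>B\<close>. It is nondecreasing and 1-Lipschitz,
  which reduces statements about the position of \<open>B\<close> to real analysis.\<close>

definition cumul :: "real set \<Rightarrow> real \<Rightarrow> real" where
  "cumul B y = measure lborel (B \<inter> {..y})"

locale finite_set_lborel =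
  fixes B :: "real set"
  assumes B_borel [measurable]: "B \<in> sets borel" and B_finite: "emeasure lborel B < \<infinity>"
begin

lemma sub_finite: "emeasure lborel (B \<inter> S) < \<infinity>" if "S \<in> sets borel"
  using emeasure_mono[of "B \<inter> S" B lborel] B_finite by (auto intro: le_less_trans)

lemma cumul_diff:
  assumes "x \<le> y" shows "measure lborel (B \<inter> {x<..y}) = cumul B y - cumul B x"
proof -
  have "B \<inter> {..y} = (B \<inter> {..x}) \<union> (B \<inter> {x<..y})" using assms by auto
  then have "measure lborel (B \<inter> {..y}) = measure lborel (B \<inter> {..x}) + measure lborel (B \<inter> {x<..y})"
    using sub_finite[of "{..x}"] sub_finite[of "{x<..y}"] by (simp only:) (intro measure_Union, auto)
  then show ?thesis by (simp add: cumul_def)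
qed

lemma emeasure_cumul:
  assumes "x \<le> y" shows "emeasure lborel (B \<inter> {x<..y}) = ennreal (cumul B y - cumul B x)"
  using cumul_diff[OF assms] sub_finite[of "{x<..y}"] by (simp add: emeasure_eq_ennreal_measure less_top)

lemma cumul_mono: "x \<le> y \<Longrightarrow> cumul B x \<le> cumul B y"
  using cumul_diff[of x y] measure_nonneg[of lborel "B \<inter> {x<..y}"] by linarith

lemma cumul_lip: "x \<le> y \<Longrightarrow> cumul B y - cumul B x \<le> y - x"
proof -
  assume "x \<le> y"
  have "measure lborel (B \<inter> {x<..y}) \<le> measure lborel {x<..y}"
    using \<open>x \<le> y\<close> by (intro measure_mono_fmeasurable) (auto simp: fmeasurable_def)
  then show ?thesis using \<open>x \<le> y\<close> cumul_diff[of x y] by simp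
qed

lemma cumul_continuous: "continuous_on UNIV (cumul B)"
  unfolding continuous_on_iff
proof (intro ballI allI impI)
  fix x e :: real assume "e > 0"
  have "dist (cumul B x') (cumul B x) < e" if "dist x' x < e" for x'
    using cumul_lip[of x x'] cumul_lip[of x' x] cumul_mono[of x x'] cumul_mono[of x' x] that
    by (cases "x \<le> x'") (auto simp: dist_real_def)
  then show "\<exists>d>0. \<forall>x'\<in>UNIV. dist x' x < d \<longrightarrow> dist (cumul B x') (cumul B x) < e" using \<open>e > 0\<close> by blast
qed

lemma cumul_measurable [measurable]: "cumul B \<in> borel_measurable borel"
  by (rule borel_measurable_continuous_onI[OF cumul_continuous])

lemma cumul_nonneg: "0 \<le> cumul B x" by (simp add: cumul_def)

lemma cumul_le: "cumul B x \<le> measure lborel B"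
  unfolding cumul_def using B_finite by (intro measure_mono_fmeasurable) (auto simp: fmeasurable_def)

lemma cumul_top: "(\<lambda>n. cumul B (real n)) \<longlonglongrightarrow> measure lborel B"
proof -
  have "(\<lambda>n. measure lborel (B \<inter> {..real n})) \<longlonglongrightarrow> measure lborel (\<Union>n. B \<inter> {..real n})"
  proof (rule Lim_measure_incseq)
    have "(\<Union>n. B \<inter> {..real n}) = B" using real_arch_simple by auto
    then show "emeasure lborel (\<Union>n. B \<inter> {..real n}) \<noteq> \<infinity>" using B_finite by simp
  qed (auto simp: incseq_def)
  moreover have "(\<Union>n. B \<inter> {..real n}) = B" using real_arch_simple by auto
  ultimately show ?thesis by (simp add: cumul_def)
qed

lemma cumul_bot: "(\<lambda>n. cumul B (- real n)) \<longlonglongrightarrow> 0"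
proof -
  have "(\<lambda>n. measure lborel (B \<inter> {..- real n})) \<longlonglongrightarrow> measure lborel (\<Inter>n. B \<inter> {..- real n})"
    using sub_finite by (intro Lim_measure_decseq) (auto simp: decseq_def less_top)
  moreover have "(\<Inter>n. B \<inter> {..- real n}) = {}"
  proof -
    have "\<exists>n. \<not> x \<le> - real n" for x
    proof -
      obtain n where "- x < real n" using reals_Archimedean2[of "-x"] by blast
      then have "\<not> x \<le> - real n" by linarith
      then show ?thesis by blast
    qed
    then show ?thesis by auto
  qed
  ultimately show ?thesis by (simp add: cumul_def)
qed

lemma cumul_attains:
  assumes "0 < \<tau>" "\<tau> < measure lborel B"
  shows "\<exists>y. cumul B y = \<tau>"
proof -
  obtain n where n: "cumul B (real n) > \<tau>"
    using order_tendstoD(1)[OF cumul_top assms(2)] by (auto simp: eventually_sequentially)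
  obtain k where k: "cumul B (- real k) < \<tau>"
    using order_tendstoD(2)[OF cumul_bot assms(1)] by (auto simp: eventually_sequentially)
  have "- real k \<le> real n" by simp
  moreover have "\<forall>x. - real k \<le> x \<and> x \<le> real n \<longrightarrow> isCont (cumul B) x"
    using cumul_continuous by (simp add: continuous_on_eq_continuous_at)
  ultimately show ?thesis using IVT[of "cumul B" "- real k" \<tau> "real n"] n k by auto
qed

text \<open>
  For \<open>y \<in> B\<close> the set of \<open>x \<in> [y - L, y)\<close> with \<open>|B \<inter> (x, y]| < \<tau>\<close> has measure at least \<open>\<tau>\<close>, and
  it is the whole interval if less than \<open>\<tau>\<close> of \<open>B\<close> lies to the left of \<open>y\<close>.
\<close>

lemma pollard:
  assumes \<tau>: "0 \<le> \<tau>" "\<tau> \<le> L" "\<tau> \<le> measure lborel B"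
  shows "ennreal (\<tau> * (measure lborel B + L - \<tau>)) \<le> (\<integral>\<^sup>+x. ennreal (min (cumul B (x + L) - cumul B x) \<tau>) \<partial>lborel)"
proof -
  let ?b = "measure lborel B"
  define C where "C x y \<longleftrightarrow> y \<in> B \<and> x < y \<and> y \<le> x + L \<and> cumul B y - cumul B x < \<tau>" for x y
  have Cm: "{y. C x y} \<in> sets borel" for x unfolding C_def by measurable
  have L: "0 \<le> L" using \<tau> by simp
  \<comment> \<open>The points counted for a given x lie in \<open>B\<close> between x and their
    supremum \<open>S\<close>. By the Lipschitz bound for \<open>cumul\<close> this part of
    \<open>B\<close> has measure at most \<tau>, although \<open>S\<close> itself need not be
    counted.\<close>
  have upper: "emeasure lborel {y. C x y} \<le> ennreal (min (cumul B (x + L) - cumul B x) \<tau>)" for x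
  proof (cases "{y. C x y} = {}")
    case True
    have "0 \<le> min (cumul B (x + L) - cumul B x) \<tau>" using cumul_mono[of x "x + L"] L \<tau> by simp
    then show ?thesis unfolding True by simp
  next
    case False
    define S where "S = Sup {y. C x y}"
    have bdd: "bdd_above {y. C x y}" by (rule bdd_aboveI[of _ "x + L"]) (auto simp: C_def)
    have yS: "y \<le> S" if "C x y" for y unfolding S_def using that bdd by (intro cSup_upper) auto
    have SL: "S \<le> x + L" unfolding S_def using False by (intro cSup_least) (auto simp: C_def)
    obtain y0 where y0: "C x y0" using False by blast
    then have xS: "x < S" using yS[OF y0] by (simp add: C_def)
    have S\<tau>: "cumul B S - cumul B x \<le> \<tau>"
    proof (rule field_le_epsilon)
      fix e :: real assume "e > 0"
      then have "S - e < Sup {y. C x y}" by (simp add: S_def)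
      then obtain y where y: "C x y" "S - e < y"
        unfolding less_cSup_iff[OF False bdd] by blast
      then show "cumul B S - cumul B x \<le> \<tau> + e"
        using cumul_lip[of y S] yS[OF y(1)] by (auto simp: C_def)
    qed
    have "emeasure lborel {y. C x y} \<le> emeasure lborel (B \<inter> {x<..S})"
      using yS by (intro emeasure_mono) (auto simp: C_def)
    also have "\<dots> = ennreal (cumul B S - cumul B x)" using xS by (intro emeasure_cumul) simp
    also have "\<dots> \<le> ennreal (min (cumul B (x + L) - cumul B x) \<tau>)"
      using S\<tau> cumul_mono[OF SL] by (intro ennreal_leI) auto
    finally show ?thesis .
  qed
  \<comment> \<open>The leftmost part of \<open>B\<close>. If its measure were below \<tau>,
    \<open>cumul\<close> would attain a value strictly between, at a point left of which
    \<open>B\<close> is contained in \<open>B0\<close>. For y in \<open>B0\<close> the whole window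
    of length \<open>L\<close> is counted.\<close>
  define B0 where "B0 = {y \<in> B. cumul B y < \<tau>}"
  have [measurable]: "B0 \<in> sets borel" unfolding B0_def by measurable
  have B0fin: "emeasure lborel B0 = ennreal (measure lborel B0)"
  proof (rule emeasure_eq_ennreal_measure)
    have "emeasure lborel B0 \<le> emeasure lborel B" by (rule emeasure_mono) (auto simp: B0_def)
    then show "emeasure lborel B0 \<noteq> \<top>" using B_finite by (auto simp: top_unique)
  qed
  have B0: "\<tau> \<le> measure lborel B0"
  proof (rule ccontr)
    assume "\<not> \<tau> \<le> measure lborel B0"
    then have lt: "measure lborel B0 < \<tau>" by simp
    define \<sigma> where "\<sigma> = (measure lborel B0 + \<tau>) / 2"
    have \<sigma>: "measure lborel B0 < \<sigma>" "\<sigma> < \<tau>" "0 < \<sigma>"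
    proof -
      have "c < (c + \<tau>) / 2 \<and> (c + \<tau>) / 2 < \<tau> \<and> 0 < (c + \<tau>) / 2" if "c < \<tau>" "0 \<le> c" for c
        using that by auto
      from this[OF lt] show "measure lborel B0 < \<sigma>" "\<sigma> < \<tau>" "0 < \<sigma>" by (auto simp: \<sigma>_def)
    qed
    obtain y where y: "cumul B y = \<sigma>" using cumul_attains[of \<sigma>] \<sigma> \<tau> by auto
    have "B \<inter> {..y} \<subseteq> B0"
    proof
      fix z assume "z \<in> B \<inter> {..y}"
      then show "z \<in> B0" using cumul_mono[of z y] y \<sigma> by (simp add: B0_def)
    qed
    then have "cumul B y \<le> measure lborel B0"
      unfolding cumul_def using B0fin by (intro measure_mono_fmeasurable) (auto simp: fmeasurable_def)
    then show False using y \<sigma> by simp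
  qed
  have lower: "ennreal \<tau> * indicator B y + ennreal (L - \<tau>) * indicator B0 y \<le> (\<integral>\<^sup>+x. indicator {p. C (fst p) (snd p)} (x, y) \<partial>lborel)" for y
  proof (cases "y \<in> B")
    case yB: True
    have Cy: "{x. C x y} \<in> sets borel" unfolding C_def by measurable
    have "(\<lambda>x. indicator {p. C (fst p) (snd p)} (x, y) :: ennreal) = indicator {x. C x y}"
      by (auto simp: indicator_def fun_eq_iff)
    then have eq: "(\<integral>\<^sup>+x. indicator {p. C (fst p) (snd p)} (x, y) \<partial>lborel) = emeasure lborel {x. C x y}"
      using Cy by simp
    show ?thesis
    proof (cases "y \<in> B0")
      case True
      have "{y - L..<y} \<subseteq> {x. C x y}"
      proof
        fix x assume "x \<in> {y - L..<y}"
        then show "x \<in> {x. C x y}" using cumul_nonneg[of x] True by (simp add: C_def B0_def)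
      qed
      then have "emeasure lborel {y - L..<y} \<le> emeasure lborel {x. C x y}" using Cy by (intro emeasure_mono) auto
      moreover have "emeasure lborel {y - L..<y} = ennreal L" using L by simp
      moreover have "ennreal \<tau> + ennreal (L - \<tau>) = ennreal L" using \<tau> by (simp flip: ennreal_plus)
      ultimately show ?thesis unfolding eq using yB True by simp
    next
      case False
      have "{y - \<tau><..<y} \<subseteq> {x. C x y}"
      proof
        fix x assume "x \<in> {y - \<tau><..<y}"
        then show "x \<in> {x. C x y}" using cumul_lip[of x y] \<tau> yB by (auto simp: C_def)
      qed
      then have "emeasure lborel {y - \<tau><..<y} \<le> emeasure lborel {x. C x y}" using Cy by (intro emeasure_mono) auto
      then show ?thesis unfolding eq using yB False \<tau> by simp
    qed
  next
    case False
    then have "y \<notin> B0" by (auto simp: B0_def)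
    then show ?thesis using False by simp
  qed
  have "Measurable.pred (borel \<Otimes>\<^sub>M borel) (\<lambda>p. C (fst p) (snd p))"
    unfolding C_def by measurable
  then have pm: "{p. C (fst p) (snd p)} \<in> sets (borel \<Otimes>\<^sub>M borel)"
    by (simp add: pred_def space_pair_measure)
  have sets_eq: "sets (borel \<Otimes>\<^sub>M borel) = sets (lborel \<Otimes>\<^sub>M lborel :: (real \<times> real) measure)"
    by (rule sets_pair_measure_cong[OF sets_lborel[symmetric] sets_lborel[symmetric]])
  have [measurable]: "{p. C (fst p) (snd p)} \<in> sets (lborel \<Otimes>\<^sub>M lborel)" by (rule pm[unfolded sets_eq])
  \<comment> \<open>The pairs are counted in both orders: each y in \<open>B\<close> contributes at
    least \<tau>, each y in \<open>B0\<close> a further L - \<tau>, and each x at most the truncated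
    minimum.\<close>
  have "ennreal (\<tau> * (?b + L - \<tau>)) = ennreal (\<tau> * ?b) + ennreal ((L - \<tau>) * \<tau>)"
    using \<tau> by (subst ennreal_plus[symmetric]) (auto simp: algebra_simps intro: mult_right_mono)
  also have "\<dots> \<le> ennreal (\<tau> * ?b) + ennreal ((L - \<tau>) * measure lborel B0)"
    using \<tau> B0 by (intro add_left_mono ennreal_leI mult_left_mono) auto
  also have "\<dots> = ennreal \<tau> * emeasure lborel B + ennreal (L - \<tau>) * emeasure lborel B0"
  proof -
    have "emeasure lborel B = ennreal ?b" using B_finite by (intro emeasure_eq_ennreal_measure) auto
    then show ?thesis unfolding B0fin using \<tau> by (simp add: ennreal_mult)
  qed
  also have "\<dots> = (\<integral>\<^sup>+y. ennreal \<tau> * indicator B y + ennreal (L - \<tau>) * indicator B0 y \<partial>lborel)"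
    by (subst nn_integral_add) (auto simp: nn_integral_cmult_indicator)
  also have "\<dots> \<le> (\<integral>\<^sup>+y. (\<integral>\<^sup>+x. indicator {p. C (fst p) (snd p)} (x, y) \<partial>lborel) \<partial>lborel)"
    by (intro nn_integral_mono lower)
  also have "\<dots> = (\<integral>\<^sup>+x. (\<integral>\<^sup>+y. indicator {p. C (fst p) (snd p)} (x, y) \<partial>lborel) \<partial>lborel)"
    by (rule lborel_pair.Fubini) measurable
  also have "\<dots> = (\<integral>\<^sup>+x. emeasure lborel {y. C x y} \<partial>lborel)"
  proof (rule nn_integral_cong)
    fix x
    have "(\<lambda>y. indicator {p. C (fst p) (snd p)} (x, y) :: ennreal) = indicator {y. C x y}"
      by (auto simp: indicator_def fun_eq_iff)
    then show "(\<integral>\<^sup>+y. indicator {p. C (fst p) (snd p)} (x, y) \<partial>lborel) = emeasure lborel {y. C x y}"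
      using Cm[of x] by simp
  qed
  also have "\<dots> \<le> (\<integral>\<^sup>+x. ennreal (min (cumul B (x + L) - cumul B x) \<tau>) \<partial>lborel)"
    by (intro nn_integral_mono upper)
  finally show ?thesis .
qed

text \<open>The convolution of the indicator of \<open>B\<close> with that of a centred interval of
  length \<open>L\<close>.\<close>

definition slide :: "real \<Rightarrow> real \<Rightarrow> real" where
  "slide L x = cumul B (x + L / 2) - cumul B (x - L / 2)"

lemma slide_bounds:
  assumes "0 \<le> L"
  shows "0 \<le> slide L x" "slide L x \<le> L" "slide L x \<le> measure lborel B"
  using assms cumul_mono[of "x - L/2" "x + L/2"] cumul_lip[of "x - L/2" "x + L/2"] cumul_le[of "x + L/2"] cumul_nonneg[of "x - L/2"]
  by (auto simp: slide_def)

lemma slide_measurable [measurable]: "slide L \<in> borel_measurable borel"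
  unfolding slide_def[abs_def] by measurable

lemma slide_nn_integral:
  assumes "0 \<le> L"
  shows "(\<integral>\<^sup>+x. ennreal (slide L x) \<partial>lborel) = ennreal (L * measure lborel B)"
proof -
  have "(\<integral>\<^sup>+x. ennreal (slide L x) \<partial>lborel) = (\<integral>\<^sup>+x. (\<integral>\<^sup>+y. indicator B y * (if x - L/2 < y \<and> y \<le> x + L/2 then 1 else 0) \<partial>lborel) \<partial>lborel)"
  proof (rule nn_integral_cong)
    fix x
    have "ennreal (slide L x) = emeasure lborel (B \<inter> {x - L/2<..x + L/2})"
      unfolding slide_def using assms by (intro emeasure_cumul[symmetric]) simp
    also have "\<dots> = (\<integral>\<^sup>+y. indicator (B \<inter> {x - L/2<..x + L/2}) y \<partial>lborel)" by simp
    also have "\<dots> = (\<integral>\<^sup>+y. indicator B y * (if x - L/2 < y \<and> y \<le> x + L/2 then 1 else 0) \<partial>lborel)"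
      by (intro nn_integral_cong) (auto simp: indicator_def)
    finally show "ennreal (slide L x) = (\<integral>\<^sup>+y. indicator B y * (if x - L/2 < y \<and> y \<le> x + L/2 then 1 else 0) \<partial>lborel)" .
  qed
  also have "\<dots> = (\<integral>\<^sup>+y. (\<integral>\<^sup>+x. indicator B y * (if x - L/2 < y \<and> y \<le> x + L/2 then 1 else 0) \<partial>lborel) \<partial>lborel)"
    by (rule lborel_pair.Fubini') measurable
  also have "\<dots> = (\<integral>\<^sup>+y. ennreal L * indicator B y \<partial>lborel)"
  proof (rule nn_integral_cong)
    fix y
    have "(\<integral>\<^sup>+x. indicator B y * (if x - L/2 < y \<and> y \<le> x + L/2 then 1 else 0) \<partial>lborel) = (\<integral>\<^sup>+x. indicator B y * indicator {y - L/2..<y + L/2} x \<partial>lborel)"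
      by (intro nn_integral_cong) (auto simp: indicator_def)
    also have "\<dots> = indicator B y * emeasure lborel {y - L/2..<y + L/2}"
      by (rule nn_integral_cmult_indicator) simp
    also have "\<dots> = ennreal L * indicator B y" using assms by (simp add: mult.commute)
    finally show "(\<integral>\<^sup>+x. indicator B y * (if x - L/2 < y \<and> y \<le> x + L/2 then 1 else 0) \<partial>lborel) = ennreal L * indicator B y" .
  qed
  also have "\<dots> = ennreal L * emeasure lborel B" by (rule nn_integral_cmult_indicator) simp
  also have "\<dots> = ennreal (L * measure lborel B)"
    using assms B_finite by (simp add: ennreal_mult emeasure_eq_ennreal_measure less_top)
  finally show ?thesis .
qed

lemma slide_integrable: "0 \<le> L \<Longrightarrow> integrable lborel (slide L)"
  using slide_nn_integral[of L] slide_bounds(1)[of L] by (simp add: integrable_iff_bounded)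

lemma slide_integral: "0 \<le> L \<Longrightarrow> integral\<^sup>L lborel (slide L) = L * measure lborel B"
  using slide_nn_integral[of L] slide_bounds(1)[of L] by (simp add: integral_eq_nn_integral)

text \<open>Cutting \<open>slide\<close> at height \<tau> splits it into a part bounded by \<tau>,
  which contributes at most \<tau> times the measure of \<open>A\<close>, and an excess, whose
  integral over the whole line is the total mass minus the truncated mass estimated in
  \<open>pollard\<close>. That estimate is a continuous form of Pollard's inequality for sumsets,
  one summand being an interval.\<close>

lemma slide_set_integral_le:
  assumes A [measurable]: "A \<in> sets borel" "emeasure lborel A < \<infinity>" and L: "0 \<le> L"
    and \<tau>: "0 \<le> \<tau>" "\<tau> \<le> L" "\<tau> \<le> measure lborel B"
  shows "(LINT x|lborel. indicator A x * slide L x)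
    \<le> \<tau> * measure lborel A + L * measure lborel B - \<tau> * (measure lborel B + L - \<tau>)"
proof -
  have mi: "integrable lborel (\<lambda>x. min (slide L x) \<tau>)"
    by (rule Bochner_Integration.integrable_bound[OF slide_integrable[OF L]]) (use slide_bounds(1)[OF L] \<tau> in auto)
  have "ennreal (\<tau> * (measure lborel B + L - \<tau>)) \<le> (\<integral>\<^sup>+x. ennreal (min (cumul B (x + L) - cumul B x) \<tau>) \<partial>lborel)"
    by (rule pollard[OF \<tau>])
  also have "\<dots> = (\<integral>\<^sup>+x. ennreal (min (slide L x) \<tau>) \<partial>lborel)"
    using nn_integral_real_affine[of "\<lambda>x. ennreal (min (cumul B (x + L) - cumul B x) \<tau>)" 1 "- L/2"]
    by (simp add: slide_def algebra_simps)
  also have "\<dots> = ennreal (LINT x|lborel. min (slide L x) \<tau>)"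
    using slide_bounds(1)[OF L] \<tau> by (intro nn_integral_eq_integral mi) auto
  finally have p: "\<tau> * (measure lborel B + L - \<tau>) \<le> (LINT x|lborel. min (slide L x) \<tau>)"
    using slide_bounds(1)[OF L] \<tau> by (subst (asm) ennreal_le_iff) (auto intro!: integral_nonneg_AE)
  have Ai: "integrable lborel (\<lambda>x. \<tau> * indicator A x)" using A by (intro integrable_mult_right integrable_real_indicator) auto
  have "(LINT x|lborel. indicator A x * slide L x) \<le> (LINT x|lborel. \<tau> * indicator A x + (slide L x - min (slide L x) \<tau>))"
  proof (rule integral_mono)
    show "integrable lborel (\<lambda>x. indicator A x * slide L x)"
      by (rule Bochner_Integration.integrable_bound[OF slide_integrable[OF L]]) (auto simp: indicator_def)
    show "integrable lborel (\<lambda>x. \<tau> * indicator A x + (slide L x - min (slide L x) \<tau>))"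
      using Ai slide_integrable[OF L] mi by simp
  qed (use \<tau> slide_bounds(1)[OF L] in \<open>auto simp: indicator_def\<close>)
  also have "\<dots> = \<tau> * measure lborel A + (L * measure lborel B - (LINT x|lborel. min (slide L x) \<tau>))"
    using Ai slide_integrable[OF L] mi slide_integral[OF L] A by simp
  finally show ?thesis using p by linarith
qed

end

lemma finite_set_lborel_Ioo: "finite_set_lborel {- b / 2<..<b / 2}"
proof
  have "emeasure lborel {- b / 2<..<b / 2} \<le> emeasure lborel {- b / 2..b / 2}"
    by (rule emeasure_mono) auto
  then show "emeasure lborel {- b / 2<..<b / 2} < \<infinity>"
    by (auto simp: emeasure_lborel_Icc_eq intro: le_less_trans)
qed simp

lemma measure_lborel_Ioo_max: "measure lborel {l<..<u::real} = max 0 (u - l)"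
  by (cases "l \<le> u") auto

text \<open>The overlap of two intervals is a trapezoid in x, of height min b L and with feet at
  distance (b + L) / 2 from the origin. The half-open window differs from an open one by a null
  set.\<close>

lemma slide_Ioo:
  assumes "0 \<le> b" "0 \<le> L"
  shows "finite_set_lborel.slide {- b / 2<..<b / 2} L x = max 0 (min (min b L) ((b + L) / 2 - \<bar>x\<bar>))"
proof -
  interpret finite_set_lborel "{- b / 2<..<b / 2}" by (rule finite_set_lborel_Ioo)
  have "slide L x = measure lborel ({- b / 2<..<b / 2} \<inter> {x - L/2<..x + L/2})"
    unfolding slide_def using assms by (intro cumul_diff[symmetric]) simp
  also have "\<dots> = measure lborel {max (- b / 2) (x - L/2)<..<min (b / 2) (x + L/2)}"
  proof (rule measure_eq_AE)
    have "AE y in lborel. y \<noteq> x + L/2" by (rule AE_lborel_singleton)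
    then show "AE y in lborel. (y \<in> {- b / 2<..<b / 2} \<inter> {x - L/2<..x + L/2}) = (y \<in> {max (- b / 2) (x - L/2)<..<min (b / 2) (x + L/2)})"
      by eventually_elim auto
  qed auto
  also have "\<dots> = max 0 (min (b / 2) (x + L/2) - max (- b / 2) (x - L/2))"
    by (rule measure_lborel_Ioo_max)
  also have "\<dots> = max 0 (min (min b L) ((b + L) / 2 - \<bar>x\<bar>))"
  proof -
    have "min (b / 2) (x + L/2) - max (- b / 2) (x - L/2) = min (min b L) ((b + L) / 2 - \<bar>x\<bar>)"
    proof -
      have "min h (x + k) - max (- h) (x - k) = min (min (2 * h) (2 * k)) ((h + k) - \<bar>x\<bar>)" for h k :: real
        by (cases "0 \<le> x") (auto simp: min_def max_def)
      from this[of "b / 2" "L / 2"] show ?thesis by (simp add: add_divide_distrib)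
    qed
    then show ?thesis by simp
  qed
  finally show ?thesis .
qed

text \<open>Two right triangles with legs \<tau>, one on each side of the origin; s - \<tau> \<ge> 0
  keeps them from overlapping.\<close>

lemma integral_tail:
  fixes s \<tau> :: real
  assumes "0 \<le> \<tau>" "0 \<le> s - \<tau>"
  shows "(LINT x|lborel. indicator {x. s - \<tau> \<le> \<bar>x\<bar>} x * max 0 (s - \<bar>x\<bar>)) = \<tau>\<^sup>2"
    and "integrable lborel (\<lambda>x. indicator {x. s - \<tau> \<le> \<bar>x\<bar>} x * max 0 (s - \<bar>x\<bar>))"
proof -
  let ?f = "\<lambda>x. indicator {x. s - \<tau> \<le> \<bar>x\<bar>} x * max 0 (s - \<bar>x\<bar>)"
  let ?g = "\<lambda>x. indicator {s - \<tau>..s} x *\<^sub>R (s - x)"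
  have g: "has_bochner_integral lborel ?g (- ((s - s)\<^sup>2 / 2) - - ((s - (s - \<tau>))\<^sup>2 / 2))"
  proof -
    have "((\<lambda>x. - ((s - x)\<^sup>2 / 2)) has_real_derivative s - x) (at x)" for x
      by (auto intro!: derivative_eq_intros simp: field_simps)
    moreover have "continuous (at x) (\<lambda>x. s - x)" for x by (intro continuous_intros)
    ultimately have "has_bochner_integral lborel (\<lambda>x. (s - x) * indicator {s - \<tau>..s} x) (- ((s - s)\<^sup>2 / 2) - - ((s - (s - \<tau>))\<^sup>2 / 2))"
      using assms by (intro has_bochner_integral_FTC_Icc_real) auto
    then show ?thesis by (simp only: real_scaleR_def mult.commute)
  qed
  have g2: "has_bochner_integral lborel (\<lambda>x. ?g (0 + (-1) * x)) (\<bar>1 / (-1)\<bar> *\<^sub>R (- ((s - s)\<^sup>2 / 2) - - ((s - (s - \<tau>))\<^sup>2 / 2)))"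
    using g lborel_has_bochner_integral_real_affine_iff[of "-1" ?g _ 0] by simp
  have "has_bochner_integral lborel (\<lambda>x. ?g x + ?g (0 + (-1) * x)) ((- ((s - s)\<^sup>2 / 2) - - ((s - (s - \<tau>))\<^sup>2 / 2)) + (\<bar>1 / (-1)\<bar> *\<^sub>R (- ((s - s)\<^sup>2 / 2) - - ((s - (s - \<tau>))\<^sup>2 / 2))))"
    by (rule has_bochner_integral_add[OF g g2])
  then have h: "has_bochner_integral lborel (\<lambda>x. ?g x + ?g (0 + (-1) * x)) (\<tau>\<^sup>2)" by simp
  have ae: "AE x in lborel. ?f x = ?g x + ?g (0 + (-1) * x)"
    using AE_lborel_singleton[of 0] by eventually_elim (use assms in \<open>auto simp: indicator_def abs_if\<close>)
  have fm: "?f \<in> borel_measurable lborel" by measurable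
  have "has_bochner_integral lborel ?f (\<tau>\<^sup>2)"
    using h fm ae by (subst has_bochner_integral_cong_AE[OF fm _ ae]) auto
  then show "integral\<^sup>L lborel ?f = \<tau>\<^sup>2" "integrable lborel ?f"
    by (auto dest: has_bochner_integral_integral_eq simp: has_bochner_integral_iff)
qed

text \<open>The bound of \<open>slide_set_integral_le\<close> is available for every \<tau> between
  0 and \<open>m\<close>. For centred intervals it becomes an equality if \<tau> is the height at
  which the trapezoid has width a, namely s - a / 2. If a exceeds the base or is below the width of
  the top, the extreme values 0 and \<open>m\<close> take this role.\<close>

theorem riesz_interval_kernel:
  assumes A: "A \<in> sets borel" "emeasure lborel A < \<infinity>"
    and B: "B \<in> sets borel" "emeasure lborel B < \<infinity>" and L: "0 < L"
  defines "a \<equiv> measure lborel A" and "b \<equiv> measure lborel B"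
  shows "(LINT x|lborel. indicator A x * finite_set_lborel.slide B L x)
    \<le> (LINT x|lborel. indicator {- a / 2<..<a / 2} x * finite_set_lborel.slide {- b / 2<..<b / 2} L x)"
proof -
  interpret B: finite_set_lborel B using B by unfold_locales
  interpret S: finite_set_lborel "{- b / 2<..<b / 2}" by (rule finite_set_lborel_Ioo)
  have ab: "0 \<le> a" "0 \<le> b" by (simp_all add: a_def b_def)
  define s where "s = (b + L) / 2"
  define m where "m = min b L"
  have m: "0 \<le> m" "m \<le> s" using ab L by (auto simp: m_def s_def)
  have mb: "m * (b + L - m) = L * b" by (auto simp: m_def min_def)
  define f where "f = S.slide L"
  have sl: "f x = max 0 (min m (s - \<bar>x\<bar>))" for x
    unfolding f_def m_def s_def using ab L by (intro slide_Ioo) auto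
  have mS: "measure lborel {- b / 2<..<b / 2} = b" using ab by simp
  define I where "I = (LINT x|lborel. indicator {- a / 2<..<a / 2} x * f x)"
  have upper: "(LINT x|lborel. indicator A x * B.slide L x) \<le> \<tau> * a + L * b - \<tau> * (b + L - \<tau>)" if "0 \<le> \<tau>" "\<tau> \<le> m" for \<tau>
    unfolding a_def b_def using that A L by (intro B.slide_set_integral_le) (auto simp: m_def b_def)
  have Sint: "integrable lborel f" unfolding f_def using L by (intro S.slide_integrable) simp
  have Stot: "integral\<^sup>L lborel f = L * b" unfolding f_def using S.slide_integral[of L] L mS by simp
  consider "a \<ge> 2 * s" | "a \<le> 2 * (s - m)" | "2 * (s - m) < a" "a < 2 * s" by linarith
  then have "(LINT x|lborel. indicator A x * B.slide L x) \<le> I"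
  proof cases
    case 1
    have "I = integral\<^sup>L lborel f"
      unfolding I_def
    proof (rule Bochner_Integration.integral_cong)
      fix x show "indicator {- a / 2<..<a / 2} x * f x = f x"
        using 1 by (auto simp: indicator_def sl)
    qed simp
    then show ?thesis using upper[of 0] m Stot by simp
  next
    case 2
    have "I = (LINT x|lborel. m * indicator {- a / 2<..<a / 2} x)"
      unfolding I_def using 2 m by (intro Bochner_Integration.integral_cong) (auto simp: indicator_def sl)
    also have "\<dots> = m * a" using ab by simp
    finally show ?thesis using upper[of m] m mb by simp
  next
    case 3
    define \<tau> where "\<tau> = s - a / 2"
    have \<tau>: "0 \<le> \<tau>" "\<tau> \<le> m" "0 \<le> s - \<tau>" using 3 ab by (auto simp: \<tau>_def)
    have "L * b - \<tau>\<^sup>2 = (LINT x|lborel. f x - indicator {x. s - \<tau> \<le> \<bar>x\<bar>} x * max 0 (s - \<bar>x\<bar>))"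
      using Sint Stot integral_tail[OF \<tau>(1) \<tau>(3)] by simp
    also have "\<dots> = I"
      unfolding I_def using \<tau> by (intro Bochner_Integration.integral_cong) (auto simp: indicator_def sl \<tau>_def)
    finally have "I = L * b - \<tau>\<^sup>2" ..
    moreover have "\<tau> * a + L * b - \<tau> * (b + L - \<tau>) = L * b - \<tau>\<^sup>2"
      by (simp add: \<tau>_def s_def power2_eq_square field_simps)
    ultimately show ?thesis using upper[OF \<tau>(1,2)] by simp
  qed
  then show ?thesis unfolding I_def f_def .
qed

section \<open>Symmetric decreasing rearrangement\<close>

text \<open>The window is half-open in order to match differences of \<open>cumul\<close>.\<close>

definition kern :: "real \<Rightarrow> real \<Rightarrow> real \<Rightarrow> ennreal" where
  "kern r x y = (if x - r < y \<and> y \<le> x + r then 1 else 0)"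

lemma kern_measurable [measurable]:
  "(\<lambda>z. kern (r z) (f z) (g z)) \<in> borel_measurable M"
  if [measurable]: "r \<in> borel_measurable M" "f \<in> borel_measurable M" "g \<in> borel_measurable M"
  unfolding kern_def by measurable

text \<open>The extended-integral form, ready to be integrated over pairs of levels in
  \<open>Pk_srearr\<close>.\<close>

lemma riesz_nn:
  assumes A [measurable]: "A \<in> sets borel" and Af: "emeasure lborel A < \<infinity>"
    and B [measurable]: "B \<in> sets borel" and Bf: "emeasure lborel B < \<infinity>" and r: "0 < r"
  defines "a \<equiv> measure lborel A" and "b \<equiv> measure lborel B"
  shows "(\<integral>\<^sup>+x. (\<integral>\<^sup>+y. indicator A x * indicator B y * kern r x y \<partial>lborel) \<partial>lborel)
    \<le> (\<integral>\<^sup>+x. (\<integral>\<^sup>+y. indicator {- a / 2<..<a / 2} x * indicator {- b / 2<..<b / 2} y * kern r x y \<partial>lborel) \<partial>lborel)"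
proof -
  have eq: "(\<integral>\<^sup>+x. (\<integral>\<^sup>+y. indicator A x * indicator B y * kern r x y \<partial>lborel) \<partial>lborel)
     = ennreal (LINT x|lborel. indicator A x * finite_set_lborel.slide B (2 * r) x)"
    if [measurable]: "A \<in> sets borel" and "finite_set_lborel B" for A B
  proof -
    interpret finite_set_lborel B by fact
    have "(\<integral>\<^sup>+x. (\<integral>\<^sup>+y. indicator A x * indicator B y * kern r x y \<partial>lborel) \<partial>lborel) = (\<integral>\<^sup>+x. ennreal (indicator A x * slide (2 * r) x) \<partial>lborel)"
    proof (rule nn_integral_cong)
      fix x
      have "(\<integral>\<^sup>+y. indicator A x * indicator B y * kern r x y \<partial>lborel) = (\<integral>\<^sup>+y. indicator A x * indicator (B \<inter> {x - r<..x + r}) y \<partial>lborel)"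
        by (intro nn_integral_cong) (auto simp: kern_def indicator_def)
      also have "\<dots> = indicator A x * emeasure lborel (B \<inter> {x - r<..x + r})"
        by (rule nn_integral_cmult_indicator) simp
      also have "emeasure lborel (B \<inter> {x - r<..x + r}) = ennreal (slide (2 * r) x)"
        unfolding slide_def using r by (subst emeasure_cumul) auto
      also have "indicator A x * ennreal (slide (2 * r) x) = ennreal (indicator A x * slide (2 * r) x)"
        by (auto simp: indicator_def)
      finally show "(\<integral>\<^sup>+y. indicator A x * indicator B y * kern r x y \<partial>lborel) = ennreal (indicator A x * slide (2 * r) x)" .
    qed
    also have "\<dots> = ennreal (LINT x|lborel. indicator A x * slide (2 * r) x)"
    proof (rule nn_integral_eq_integral)
      show "integrable lborel (\<lambda>x. indicator A x * slide (2 * r) x)"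
        by (rule Bochner_Integration.integrable_bound[OF slide_integrable[of "2 * r"]]) (use r in \<open>auto simp: indicator_def\<close>)
    qed (use slide_bounds(1)[of "2 * r"] r in auto)
    finally show ?thesis .
  qed
  have fB: "finite_set_lborel B" using B Bf by unfold_locales
  show ?thesis
    unfolding eq[OF A fB] eq[OF _ finite_set_lborel_Ioo, of "{- a / 2<..<a / 2}" b, simplified sets_lborel, OF greaterThanLessThan_borel]
    unfolding a_def b_def using A Af B Bf r by (intro ennreal_leI riesz_interval_kernel) auto
qed

definition lev :: "(real \<Rightarrow> real) \<Rightarrow> real \<Rightarrow> real set" where "lev u t = {x. t < \<bar>u x\<bar>}"

text \<open>The generalised inverse of the distribution function: the levels whose superlevel set is
  longer than the interval from - |x| to |x|. The inserted 0 keeps the supremum from being taken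
  over the empty set.\<close>

definition rearr :: "(real \<Rightarrow> real) \<Rightarrow> real \<Rightarrow> real" where
  "rearr u x = Sup (insert 0 {t. 0 < t \<and> 2 * \<bar>x\<bar> < measure lborel (lev u t)})"

text \<open>The value at the origin is not constrained: minimisers are bounded only a posteriori.\<close>

definition sdec :: "(real \<Rightarrow> real) \<Rightarrow> bool" where
  "sdec u \<longleftrightarrow> (\<forall>x. 0 \<le> u x) \<and> (\<forall>x y. x \<noteq> 0 \<longrightarrow> \<bar>x\<bar> \<le> \<bar>y\<bar> \<longrightarrow> u y \<le> u x)"

context
  fixes u :: "real \<Rightarrow> real"
  assumes u: "u \<in> L2"
begin

lemma lev_borel [measurable]: "lev u t \<in> sets borel"
proof -
  note [measurable] = L2_measurable[OF u]
  show ?thesis unfolding lev_def by measurable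
qed

lemma lev_emeasure_le:
  assumes "0 < t" shows "ennreal (t\<^sup>2) * emeasure lborel (lev u t) \<le> ennreal (ms u)"
proof -
  have "ennreal (t\<^sup>2) * emeasure lborel (lev u t) = (\<integral>\<^sup>+x. ennreal (t\<^sup>2) * indicator (lev u t) x \<partial>lborel)"
    by (rule nn_integral_cmult_indicator[symmetric]) simp
  also have "\<dots> \<le> nsq u"
    unfolding nsq_def
  proof (intro nn_integral_mono)
    fix x
    have "t\<^sup>2 \<le> (u x)\<^sup>2" if "t < \<bar>u x\<bar>" using that assms power_mono[of t "\<bar>u x\<bar>" 2] by simp
    then show "ennreal (t\<^sup>2) * indicator (lev u t) x \<le> ennreal ((norm (u x))\<^sup>2)"
      by (auto simp: lev_def indicator_def intro: ennreal_leI)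
  qed
  also have "\<dots> = ennreal (ms u)" by (rule nsq_ms[OF u])
  finally show ?thesis .
qed

lemma lev_finite: "0 < t \<Longrightarrow> emeasure lborel (lev u t) < \<infinity>"
  using lev_emeasure_le[of t] by (cases "emeasure lborel (lev u t) = \<infinity>") (auto simp: ennreal_mult_top less_top top_unique)

lemma lev_emeasure: "0 < t \<Longrightarrow> emeasure lborel (lev u t) = ennreal (measure lborel (lev u t))"
  using lev_finite[of t] emeasure_eq_ennreal_measure[of lborel "lev u t"] by auto

lemma lev_measure_le: "0 < t \<Longrightarrow> t\<^sup>2 * measure lborel (lev u t) \<le> ms u"
  using lev_emeasure_le[of t] by (simp add: lev_emeasure flip: ennreal_mult)

lemma lev_antimono: "s \<le> t \<Longrightarrow> lev u t \<subseteq> lev u s" by (auto simp: lev_def)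

lemma lev_measure_antimono: "0 < s \<Longrightarrow> s \<le> t \<Longrightarrow> measure lborel (lev u t) \<le> measure lborel (lev u s)"
  using lev_finite[of s] lev_antimono[of s t] by (intro measure_mono_fmeasurable) (auto simp: fmeasurable_def)

lemma rearr_bdd: "x \<noteq> 0 \<Longrightarrow> bdd_above (insert 0 {t. 0 < t \<and> 2 * \<bar>x\<bar> < measure lborel (lev u t)})"
proof (rule bdd_aboveI[of _ "sqrt (ms u / (2 * \<bar>x\<bar>))"])
  fix t assume x: "x \<noteq> 0" and t: "t \<in> insert 0 {t. 0 < t \<and> 2 * \<bar>x\<bar> < measure lborel (lev u t)}"
  show "t \<le> sqrt (ms u / (2 * \<bar>x\<bar>))"
  proof (cases "t = 0")
    case False
    then have t: "0 < t" "2 * \<bar>x\<bar> < measure lborel (lev u t)" using t by auto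
    have "t\<^sup>2 * (2 * \<bar>x\<bar>) \<le> t\<^sup>2 * measure lborel (lev u t)" using t by (intro mult_left_mono) auto
    also have "\<dots> \<le> ms u" by (rule lev_measure_le[OF t(1)])
    finally show ?thesis using x by (intro real_le_rsqrt) (simp add: field_simps)
  qed simp
qed

text \<open>One direction is monotonicity of the distribution function, the other its
  right-continuity in t: the superlevel sets at t + 1 / (n + 1) increase to the one at t. Strict
  inequality on both sides makes the superlevel sets open intervals, up to the origin.\<close>

lemma rearr_gt_iff:
  assumes x: "x \<noteq> 0" and t: "0 < t"
  shows "t < rearr u x \<longleftrightarrow> 2 * \<bar>x\<bar> < measure lborel (lev u t)"
proof
  assume "t < rearr u x"
  then obtain t' where "t' \<in> insert 0 {t. 0 < t \<and> 2 * \<bar>x\<bar> < measure lborel (lev u t)}" "t < t'"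
    unfolding rearr_def using less_cSup_iff[OF _ rearr_bdd[OF x], of t] by blast
  then show "2 * \<bar>x\<bar> < measure lborel (lev u t)"
    using t lev_measure_antimono[OF t, of t'] by auto
next
  assume lt: "2 * \<bar>x\<bar> < measure lborel (lev u t)"
  have "(\<lambda>n. measure lborel (lev u (t + 1 / real (Suc n)))) \<longlonglongrightarrow> measure lborel (\<Union>n. lev u (t + 1 / real (Suc n)))"
  proof (rule Lim_measure_incseq)
    show "incseq (\<lambda>n. lev u (t + 1 / real (Suc n)))"
      by (intro incseq_SucI lev_antimono) (simp add: field_simps)
    have "emeasure lborel (\<Union>n. lev u (t + 1 / real (Suc n))) \<le> emeasure lborel (lev u t)"
      by (intro emeasure_mono UN_least lev_antimono) auto
    then show "emeasure lborel (\<Union>n. lev u (t + 1 / real (Suc n))) \<noteq> \<infinity>"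
      using lev_finite[OF t] by (auto simp: top_unique)
  qed auto
  also have "(\<Union>n. lev u (t + 1 / real (Suc n))) = lev u t"
  proof (intro equalityI subsetI)
    fix y assume "y \<in> lev u t"
    then obtain n where "1 / real (Suc n) < \<bar>u y\<bar> - t"
      using reals_Archimedean[of "\<bar>u y\<bar> - t"] by (auto simp: lev_def inverse_eq_divide)
    then show "y \<in> (\<Union>n. lev u (t + 1 / real (Suc n)))" by (intro UN_I[of n]) (auto simp: lev_def)
  next
    fix y assume "y \<in> (\<Union>n. lev u (t + 1 / real (Suc n)))"
    then obtain n where "t + 1 / real (Suc n) < \<bar>u y\<bar>" by (auto simp: lev_def)
    moreover have "0 < 1 / real (Suc n)" by simp
    ultimately have "t < \<bar>u y\<bar>" by linarith
    then show "y \<in> lev u t" by (simp add: lev_def)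
  qed
  finally have "\<forall>\<^sub>F n in sequentially. 2 * \<bar>x\<bar> < measure lborel (lev u (t + 1 / real (Suc n)))"
    using lt by (rule order_tendstoD(1))
  then obtain n where n: "2 * \<bar>x\<bar> < measure lborel (lev u (t + 1 / real (Suc n)))"
    by (auto simp: eventually_sequentially)
  have "t + 1 / real (Suc n) \<le> rearr u x"
    unfolding rearr_def using n t by (intro cSup_upper rearr_bdd[OF x]) (simp add: add_pos_pos)
  moreover have "0 < 1 / real (Suc n)" by simp
  ultimately show "t < rearr u x" by linarith
qed

lemma rearr_nonneg: "x \<noteq> 0 \<Longrightarrow> 0 \<le> rearr u x"
  unfolding rearr_def by (intro cSup_upper rearr_bdd) auto

lemma rearr_antimono: "x \<noteq> 0 \<Longrightarrow> \<bar>x\<bar> \<le> \<bar>y\<bar> \<Longrightarrow> rearr u y \<le> rearr u x"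
  unfolding rearr_def by (intro cSup_subset_mono rearr_bdd) auto

end

text \<open>At the origin the supremum may be infinite, so the value there is replaced by 0.\<close>

definition srearr :: "(real \<Rightarrow> real) \<Rightarrow> real \<Rightarrow> real" where
  "srearr u x = (if x = 0 then 0 else rearr u x)"

context
  fixes u :: "real \<Rightarrow> real"
  assumes u: "u \<in> L2"
begin

lemma srearr_nonneg: "0 \<le> srearr u x"
  using rearr_nonneg[OF u] by (simp add: srearr_def)

lemma srearr_sdec: "sdec (srearr u)"
  unfolding sdec_def using srearr_nonneg rearr_antimono[OF u] by (auto simp: srearr_def)

lemma srearr_gt_iff: "0 < t \<Longrightarrow> t < srearr u x \<longleftrightarrow> x \<noteq> 0 \<and> 2 * \<bar>x\<bar> < measure lborel (lev u t)"
  using rearr_gt_iff[OF u] by (auto simp: srearr_def)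

lemma srearr_measurable [measurable]: "srearr u \<in> borel_measurable borel"
  unfolding borel_measurable_iff_greater
proof
  fix a :: real
  have pos: "{x. t < srearr u x} \<in> sets borel" if "0 < t" for t
    unfolding srearr_gt_iff[OF that] by measurable
  consider "a > 0" | "a = 0" | "a < 0" by linarith
  then show "{w \<in> space borel. a < srearr u w} \<in> sets borel"
  proof cases
    case 1 then show ?thesis using pos[of a] by simp
  next
    case 2
    have "{x. 0 < srearr u x} = (\<Union>n. {x. 1 / real (Suc n) < srearr u x})"
    proof (intro equalityI subsetI)
      fix x assume "x \<in> {x. 0 < srearr u x}"
      then show "x \<in> (\<Union>n. {x. 1 / real (Suc n) < srearr u x})"
        using reals_Archimedean[of "srearr u x"] by (auto simp: inverse_eq_divide)
    next
      fix x assume "x \<in> (\<Union>n. {x. 1 / real (Suc n) < srearr u x})"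
      then obtain n where "1 / real (Suc n) < srearr u x" by auto
      moreover have "0 < 1 / real (Suc n)" by simp
      ultimately show "x \<in> {x. 0 < srearr u x}" by (simp only: mem_Collect_eq)
    qed
    also have "\<dots> \<in> sets borel" by (intro sets.countable_UN) (use pos in auto)
    finally show ?thesis using 2 by simp
  next
    case 3
    then have "{w \<in> space borel. a < srearr u w} = UNIV" using srearr_nonneg by (auto intro: less_le_trans)
    then show ?thesis by simp
  qed
qed

lemma srearr_lev: "0 < t \<Longrightarrow> lev (srearr u) t = {- measure lborel (lev u t) / 2<..<measure lborel (lev u t) / 2} - {0}"
proof -
  assume t: "0 < t"
  have "lev (srearr u) t = {x. t < srearr u x}" using srearr_nonneg by (simp add: lev_def)
  also have "\<dots> = {x. x \<noteq> 0 \<and> 2 * \<bar>x\<bar> < measure lborel (lev u t)}" by (simp add: srearr_gt_iff[OF t])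
  also have "\<dots> = {- measure lborel (lev u t) / 2<..<measure lborel (lev u t) / 2} - {0}" by auto
  finally show ?thesis .
qed

lemma srearr_lev_AE:
  "0 < t \<Longrightarrow> AE x in lborel. x \<in> lev (srearr u) t \<longleftrightarrow> x \<in> {- measure lborel (lev u t) / 2<..<measure lborel (lev u t) / 2}"
  using AE_lborel_singleton[of 0] by eventually_elim (simp add: srearr_lev)

lemma srearr_lev_emeasure:
  assumes "0 < t" shows "emeasure lborel (lev (srearr u) t) = emeasure lborel (lev u t)"
proof -
  have "emeasure lborel (lev (srearr u) t) = emeasure lborel {- measure lborel (lev u t) / 2<..<measure lborel (lev u t) / 2}"
    by (rule emeasure_eq_AE[OF srearr_lev_AE[OF assms]]) (simp_all add: srearr_lev[OF assms])
  also have "\<dots> = ennreal (measure lborel (lev u t))" by simp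
  finally show ?thesis using lev_emeasure[OF u assms] by simp
qed

text \<open>Up to the origin the superlevel sets are open intervals, and the function decreases on
  the positive half-line. Right-continuity is what Helly's selection theorem asks for in
  \<open>compactness\<close>.\<close>

lemma srearr_right_continuous:
  assumes "0 < x" shows "(srearr u \<longlongrightarrow> srearr u x) (at_right x)"
proof (rule order_tendstoI)
  fix a assume a: "a < srearr u x"
  define a' where "a' = (max a 0 + srearr u x) / 2"
  show "\<forall>\<^sub>F y in at_right x. a < srearr u y"
  proof (cases "a < 0")
    case True
    then show ?thesis using srearr_nonneg by (auto intro: less_le_trans always_eventually)
  next
    case False
    then have a': "a < a'" "0 < a'" "a' < srearr u x" using a by (auto simp: a'_def)
    have "\<forall>\<^sub>F y in at_right x. y < measure lborel (lev u a') / 2"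
      using srearr_gt_iff[OF a'(2), of x] a'(3) assms by (intro eventually_at_rightI[of x "measure lborel (lev u a') / 2"]) auto
    moreover have "\<forall>\<^sub>F y in at_right x. x < y" by (rule eventually_at_right_less)
    ultimately show ?thesis
    proof eventually_elim
      case (elim y)
      then have "a' < srearr u y" using assms srearr_gt_iff[OF a'(2), of y] by auto
      then show ?case using a' by simp
    qed
  qed
next
  fix a assume a: "srearr u x < a"
  have "\<forall>\<^sub>F y in at_right x. x < y" by (rule eventually_at_right_less)
  then show "\<forall>\<^sub>F y in at_right x. srearr u y < a"
  proof eventually_elim
    case (elim y)
    then show ?case using srearr_sdec assms a unfolding sdec_def by (smt (verit))
  qed
qed

end

lemma layer_cake_power:
  assumes [measurable]: "u \<in> borel_measurable borel" and m: "m > 0"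
  shows "(\<integral>\<^sup>+x. ennreal (\<bar>u x\<bar> ^ m) \<partial>lborel)
    = (\<integral>\<^sup>+t. ennreal (real m * t ^ (m - 1)) * indicator {0<..} t * emeasure lborel (lev u t) \<partial>lborel)"
proof -
  let ?f = "\<lambda>t x. ennreal (real m * t ^ (m - 1)) * indicator {0<..} t * (if t < \<bar>u x\<bar> then 1 else 0) :: ennreal"
  have pt: "ennreal (\<bar>u x\<bar> ^ m) = (\<integral>\<^sup>+t. ?f t x \<partial>lborel)" for x
  proof -
    have "(\<integral>\<^sup>+t. ennreal (real m * t ^ (m - 1)) * indicator {0..\<bar>u x\<bar>} t \<partial>lborel) = ennreal (\<bar>u x\<bar> ^ m - 0 ^ m)"
    proof (rule nn_integral_FTC_Icc)
      show "((\<lambda>t. t ^ m) has_real_derivative real m * t ^ (m - 1)) (at t)" for t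
        by (auto intro!: derivative_eq_intros)
    qed auto
    moreover have "(\<integral>\<^sup>+t. ennreal (real m * t ^ (m - 1)) * indicator {0..\<bar>u x\<bar>} t \<partial>lborel) = (\<integral>\<^sup>+t. ?f t x \<partial>lborel)"
    proof (rule nn_integral_cong_AE)
      show "AE t in lborel. ennreal (real m * t ^ (m - 1)) * indicator {0..\<bar>u x\<bar>} t = ?f t x"
        using AE_lborel_singleton[of 0] AE_lborel_singleton[of "\<bar>u x\<bar>"]
        by eventually_elim (auto simp: indicator_def)
    qed
    ultimately show ?thesis using m by (simp add: zero_power)
  qed
  have "(\<integral>\<^sup>+x. ennreal (\<bar>u x\<bar> ^ m) \<partial>lborel) = (\<integral>\<^sup>+x. (\<integral>\<^sup>+t. ?f t x \<partial>lborel) \<partial>lborel)" unfolding pt ..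
  also have "\<dots> = (\<integral>\<^sup>+t. (\<integral>\<^sup>+x. ?f t x \<partial>lborel) \<partial>lborel)" by (rule lborel_pair.Fubini') measurable
  also have "\<dots> = (\<integral>\<^sup>+t. ennreal (real m * t ^ (m - 1)) * indicator {0<..} t * emeasure lborel (lev u t) \<partial>lborel)"
  proof (rule nn_integral_cong)
    fix t
    have "(\<lambda>x. if t < \<bar>u x\<bar> then 1 else 0 :: ennreal) = indicator (lev u t)"
      by (auto simp: lev_def indicator_def)
    moreover have "lev u t \<in> sets borel" unfolding lev_def by measurable
    ultimately show "(\<integral>\<^sup>+x. ?f t x \<partial>lborel) = ennreal (real m * t ^ (m - 1)) * indicator {0<..} t * emeasure lborel (lev u t)"
      by (subst nn_integral_cmult) auto
  qed
  finally show ?thesis .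
qed

lemma srearr_power:
  assumes u: "u \<in> L2" and "m > 0"
  shows "(\<integral>\<^sup>+x. ennreal (\<bar>srearr u x\<bar> ^ m) \<partial>lborel) = (\<integral>\<^sup>+x. ennreal (\<bar>u x\<bar> ^ m) \<partial>lborel)"
  unfolding layer_cake_power[OF srearr_measurable[OF u] \<open>m > 0\<close>] layer_cake_power[OF L2_measurable[OF u] \<open>m > 0\<close>]
  by (intro nn_integral_cong) (auto simp: indicator_def srearr_lev_emeasure[OF u])

lemma nsq_power2: "nsq (u :: real \<Rightarrow> real) = (\<integral>\<^sup>+x. ennreal (\<bar>u x\<bar> ^ 2) \<partial>lborel)"
  by (simp add: nsq_def)

lemma srearr_L2: "u \<in> L2 \<Longrightarrow> srearr u \<in> L2"
  unfolding L2_iff_nsq[of "srearr u"] nsq_power2 using srearr_power[of u 2] srearr_measurable[of u]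
  by (simp add: L2_iff_nsq nsq_def)

lemma srearr_ms: "u \<in> L2 \<Longrightarrow> ms (srearr u) = ms u"
  using nsq_ms[of u] nsq_ms[of "srearr u"] srearr_L2[of u] srearr_power[of u 2]
  by (simp add: nsq_power2)

section \<open>Decrease of the Gagliardo form under rearrangement\<close>

definition Pk :: "real \<Rightarrow> (real \<Rightarrow> real) \<Rightarrow> ennreal" where
  "Pk r u = (\<integral>\<^sup>+x. (\<integral>\<^sup>+y. ennreal \<bar>u x\<bar> * ennreal \<bar>u y\<bar> * kern r x y \<partial>lborel) \<partial>lborel)"

definition Qk :: "real \<Rightarrow> (real \<Rightarrow> real) \<Rightarrow> ennreal" where
  "Qk r u = (\<integral>\<^sup>+x. (\<integral>\<^sup>+y. ennreal ((u x - u y)\<^sup>2) * kern r x y \<partial>lborel) \<partial>lborel)"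

lemma Pk_layers:
  assumes [measurable]: "u \<in> borel_measurable borel"
  shows "Pk r u = (\<integral>\<^sup>+s. (\<integral>\<^sup>+t. indicator {0<..} s * indicator {0<..} t *
     (\<integral>\<^sup>+x. (\<integral>\<^sup>+y. indicator (lev u s) x * indicator (lev u t) y * kern r x y \<partial>lborel) \<partial>lborel) \<partial>lborel) \<partial>lborel)"
proof -
  define a where "a s x = (if 0 < s \<and> s < \<bar>u x\<bar> then 1 else 0 :: ennreal)" for s x
  have [measurable]: "(\<lambda>z. a (f z) (g z)) \<in> borel_measurable M"
    if [measurable]: "f \<in> borel_measurable M" "g \<in> borel_measurable M" for f g and M :: "'z measure"
    unfolding a_def by measurable
  have a_int: "ennreal \<bar>u x\<bar> = (\<integral>\<^sup>+s. a s x \<partial>lborel)" for x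
  proof -
    have "(\<integral>\<^sup>+s. a s x \<partial>lborel) = (\<integral>\<^sup>+s. indicator {0<..<\<bar>u x\<bar>} s \<partial>lborel)"
      by (intro nn_integral_cong) (auto simp: a_def indicator_def)
    then show ?thesis by simp
  qed
  have "Pk r u = (\<integral>\<^sup>+x. (\<integral>\<^sup>+y. (\<integral>\<^sup>+s. (\<integral>\<^sup>+t. a s x * a t y * kern r x y \<partial>lborel) \<partial>lborel) \<partial>lborel) \<partial>lborel)"
    unfolding Pk_def a_int
    by (intro nn_integral_cong) (simp add: nn_integral_cmult nn_integral_multc)
  also have "\<dots> = (\<integral>\<^sup>+x. (\<integral>\<^sup>+s. (\<integral>\<^sup>+y. (\<integral>\<^sup>+t. a s x * a t y * kern r x y \<partial>lborel) \<partial>lborel) \<partial>lborel) \<partial>lborel)"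
    by (intro nn_integral_cong lborel_pair.Fubini') measurable
  also have "\<dots> = (\<integral>\<^sup>+s. (\<integral>\<^sup>+x. (\<integral>\<^sup>+y. (\<integral>\<^sup>+t. a s x * a t y * kern r x y \<partial>lborel) \<partial>lborel) \<partial>lborel) \<partial>lborel)"
    by (rule lborel_pair.Fubini') measurable
  also have "\<dots> = (\<integral>\<^sup>+s. (\<integral>\<^sup>+x. (\<integral>\<^sup>+t. (\<integral>\<^sup>+y. a s x * a t y * kern r x y \<partial>lborel) \<partial>lborel) \<partial>lborel) \<partial>lborel)"
    by (intro nn_integral_cong lborel_pair.Fubini') measurable
  also have "\<dots> = (\<integral>\<^sup>+s. (\<integral>\<^sup>+t. (\<integral>\<^sup>+x. (\<integral>\<^sup>+y. a s x * a t y * kern r x y \<partial>lborel) \<partial>lborel) \<partial>lborel) \<partial>lborel)"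
    by (rule nn_integral_cong, rule lborel_pair.Fubini') measurable
  also have "\<dots> = (\<integral>\<^sup>+s. (\<integral>\<^sup>+t. indicator {0<..} s * indicator {0<..} t *
     (\<integral>\<^sup>+x. (\<integral>\<^sup>+y. indicator (lev u s) x * indicator (lev u t) y * kern r x y \<partial>lborel) \<partial>lborel) \<partial>lborel) \<partial>lborel)"
  proof (rule nn_integral_cong, rule nn_integral_cong)
    fix s t
    have "(\<integral>\<^sup>+x. (\<integral>\<^sup>+y. a s x * a t y * kern r x y \<partial>lborel) \<partial>lborel)
       = (\<integral>\<^sup>+x. (\<integral>\<^sup>+y. (indicator {0<..} s * indicator {0<..} t) * (indicator (lev u s) x * indicator (lev u t) y * kern r x y) \<partial>lborel) \<partial>lborel)"
      by (rule nn_integral_cong, rule nn_integral_cong) (auto simp: a_def indicator_def lev_def)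
    also have "\<dots> = indicator {0<..} s * indicator {0<..} t *
     (\<integral>\<^sup>+x. (\<integral>\<^sup>+y. indicator (lev u s) x * indicator (lev u t) y * kern r x y \<partial>lborel) \<partial>lborel)"
      by (cases "0 < s \<and> 0 < t") auto
    finally show "(\<integral>\<^sup>+x. (\<integral>\<^sup>+y. a s x * a t y * kern r x y \<partial>lborel) \<partial>lborel) = indicator {0<..} s * indicator {0<..} t *
     (\<integral>\<^sup>+x. (\<integral>\<^sup>+y. indicator (lev u s) x * indicator (lev u t) y * kern r x y \<partial>lborel) \<partial>lborel)" .
  qed
  finally show ?thesis .
qed

text \<open>Integration over pairs of levels reduces the product form to pairs of superlevel sets,
  where the Riesz inequality applies. The rearranged superlevel sets lack the origin, hence they
  equal intervals only almost everywhere.\<close>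

lemma Pk_srearr:
  assumes u: "u \<in> L2" and r: "0 < r"
  shows "Pk r u \<le> Pk r (srearr u)"
  unfolding Pk_layers[OF L2_measurable[OF u]] Pk_layers[OF srearr_measurable[OF u]]
proof (rule nn_integral_mono, rule nn_integral_mono)
  fix s t
  let ?I = "\<lambda>A B. (\<integral>\<^sup>+x. (\<integral>\<^sup>+y. indicator A x * indicator B y * kern r x y \<partial>lborel) \<partial>lborel) :: ennreal"
  show "indicator {0<..} s * indicator {0<..} t * ?I (lev u s) (lev u t) \<le> indicator {0<..} s * indicator {0<..} t * ?I (lev (srearr u) s) (lev (srearr u) t)"
  proof (cases "0 < s \<and> 0 < t")
    case True
    let ?S = "\<lambda>s. {- measure lborel (lev u s) / 2<..<measure lborel (lev u s) / 2}"
    have "?I (lev u s) (lev u t) \<le> ?I (?S s) (?S t)"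
      using True r lev_finite[OF u] by (intro riesz_nn lev_borel[OF u]) auto
    also have "\<dots> = ?I (lev (srearr u) s) (lev (srearr u) t)"
    proof (rule nn_integral_cong_AE)
      have aeS: "AE x in lborel. x \<in> lev (srearr u) s \<longleftrightarrow> x \<in> ?S s" and aeT: "AE x in lborel. x \<in> lev (srearr u) t \<longleftrightarrow> x \<in> ?S t"
        using srearr_lev_AE[OF u] True by blast+
      show "AE x in lborel. (\<integral>\<^sup>+y. indicator (?S s) x * indicator (?S t) y * kern r x y \<partial>lborel) = (\<integral>\<^sup>+y. indicator (lev (srearr u) s) x * indicator (lev (srearr u) t) y * kern r x y \<partial>lborel)"
        using aeS
      proof eventually_elim
        case x: (elim x)
        show ?case
        proof (rule nn_integral_cong_AE)
          show "AE y in lborel. indicator (?S s) x * indicator (?S t) y * kern r x y = indicator (lev (srearr u) s) x * indicator (lev (srearr u) t) y * kern r x y"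
            using aeT
          proof eventually_elim
            case (elim y)
            then show ?case unfolding indicator_def using x by (simp only:)
          qed
        qed
      qed
    qed
    finally show ?thesis by (intro mult_left_mono) auto
  qed auto
qed

lemma kern_int_right: "0 \<le> r \<Longrightarrow> (\<integral>\<^sup>+y. kern r x y \<partial>lborel) = ennreal (2 * r)"
proof -
  assume "0 \<le> r"
  have "(\<integral>\<^sup>+y. kern r x y \<partial>lborel) = (\<integral>\<^sup>+y. indicator {x - r<..x + r} y \<partial>lborel)"
    by (intro nn_integral_cong) (auto simp: kern_def indicator_def)
  then show ?thesis using \<open>0 \<le> r\<close> by simp
qed

lemma kern_int_left: "0 \<le> r \<Longrightarrow> (\<integral>\<^sup>+x. kern r x y \<partial>lborel) = ennreal (2 * r)"
proof -
  assume "0 \<le> r"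
  have "(\<integral>\<^sup>+x. kern r x y \<partial>lborel) = (\<integral>\<^sup>+x. indicator {y - r..<y + r} x \<partial>lborel)"
    by (intro nn_integral_cong) (auto simp: kern_def indicator_def)
  then show ?thesis using \<open>0 \<le> r\<close> by simp
qed

text \<open>The square can be expanded because the window has finite mass 2 r in either variable, in
  contrast to the singular kernel. Written as a sum, the identity avoids subtraction of extended
  reals.\<close>

lemma Qk_Pk:
  assumes u: "u \<in> L2" and nn: "\<And>x. 0 \<le> u x" and r: "0 < r"
  shows "Qk r u + 2 * Pk r u = ennreal (4 * r * ms u)"
proof -
  note [measurable] = L2_measurable[OF u]
  have "Qk r u + 2 * Pk r u = (\<integral>\<^sup>+x. (\<integral>\<^sup>+y. ennreal ((u x - u y)\<^sup>2) * kern r x y + 2 * (ennreal \<bar>u x\<bar> * ennreal \<bar>u y\<bar> * kern r x y) \<partial>lborel) \<partial>lborel)"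
    unfolding Qk_def Pk_def by (simp add: nn_integral_add nn_integral_cmult)
  also have "\<dots> = (\<integral>\<^sup>+x. (\<integral>\<^sup>+y. ennreal ((u x)\<^sup>2) * kern r x y + ennreal ((u y)\<^sup>2) * kern r x y \<partial>lborel) \<partial>lborel)"
  proof (rule nn_integral_cong, rule nn_integral_cong)
    fix x y
    have "ennreal ((u x - u y)\<^sup>2) + 2 * (ennreal \<bar>u x\<bar> * ennreal \<bar>u y\<bar>) = ennreal ((u x - u y)\<^sup>2 + 2 * (u x * u y))"
      using nn by (simp add: ennreal_mult)
    also have "\<dots> = ennreal ((u x)\<^sup>2) + ennreal ((u y)\<^sup>2)"
      by (simp add: power2_diff flip: ennreal_plus)
    finally have e: "ennreal ((u x - u y)\<^sup>2) + 2 * (ennreal \<bar>u x\<bar> * ennreal \<bar>u y\<bar>) = ennreal ((u x)\<^sup>2) + ennreal ((u y)\<^sup>2)" .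
    show "ennreal ((u x - u y)\<^sup>2) * kern r x y + 2 * (ennreal \<bar>u x\<bar> * ennreal \<bar>u y\<bar> * kern r x y) = ennreal ((u x)\<^sup>2) * kern r x y + ennreal ((u y)\<^sup>2) * kern r x y"
      unfolding distrib_right[symmetric] e[symmetric] by (simp add: distrib_right mult.assoc)
  qed
  also have "\<dots> = (\<integral>\<^sup>+x. (\<integral>\<^sup>+y. ennreal ((u x)\<^sup>2) * kern r x y \<partial>lborel) \<partial>lborel) + (\<integral>\<^sup>+x. (\<integral>\<^sup>+y. ennreal ((u y)\<^sup>2) * kern r x y \<partial>lborel) \<partial>lborel)"
    by (simp add: nn_integral_add)
  also have "(\<integral>\<^sup>+x. (\<integral>\<^sup>+y. ennreal ((u y)\<^sup>2) * kern r x y \<partial>lborel) \<partial>lborel) = (\<integral>\<^sup>+y. (\<integral>\<^sup>+x. ennreal ((u y)\<^sup>2) * kern r x y \<partial>lborel) \<partial>lborel)"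
    by (rule lborel_pair.Fubini') measurable
  also have "\<dots> = nsq u * ennreal (2 * r)"
    unfolding nsq_def using r by (simp add: nn_integral_cmult nn_integral_multc kern_int_left)
  also have "(\<integral>\<^sup>+x. (\<integral>\<^sup>+y. ennreal ((u x)\<^sup>2) * kern r x y \<partial>lborel) \<partial>lborel) = nsq u * ennreal (2 * r)"
    unfolding nsq_def using r by (simp add: nn_integral_cmult nn_integral_multc kern_int_right)
  also have "nsq u * ennreal (2 * r) + nsq u * ennreal (2 * r) = ennreal (4 * r * ms u)"
    using r unfolding nsq_ms[OF u] by (simp add: mult_ac flip: ennreal_mult ennreal_plus)
  finally show ?thesis .
qed

text \<open>The singular kernel is a superposition of windows: (x - y)^(-2) is the integral of 2 /
  r^3 over r \<ge> |x - y|.\<close>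

lemma gn_Qk:
  assumes [measurable]: "u \<in> borel_measurable borel"
  shows "gn u = (\<integral>\<^sup>+r. ennreal (2 / r ^ 3) * indicator {0<..} r * Qk r u \<partial>lborel)"
proof -
  have pt: "ennreal ((dq u (x, y))\<^sup>2) = (\<integral>\<^sup>+r. ennreal (2 / r ^ 3) * indicator {0<..} r * (ennreal ((u x - u y)\<^sup>2) * kern r x y) \<partial>lborel)" for x y
  proof (cases "x = y")
    case False
    define d where "d = \<bar>x - y\<bar>"
    have d: "d > 0" using False by (simp add: d_def)
    have "(\<integral>\<^sup>+r. ennreal (2 / r ^ 3) * indicator {d..} r \<partial>lborel) = ennreal (0 - (- 1 / d\<^sup>2))"
    proof (rule nn_integral_FTC_atLeast[where f = "\<lambda>r. 2 / r ^ 3" and F = "\<lambda>r. - 1 / r\<^sup>2"])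
      show "((\<lambda>r. - 1 / r\<^sup>2) has_real_derivative 2 / r ^ 3) (at r)" if "d \<le> r" for r
        using that d by (auto intro!: derivative_eq_intros simp: field_simps power2_eq_square power3_eq_cube)
      show "((\<lambda>r::real. - 1 / r\<^sup>2) \<longlongrightarrow> 0) at_top"
        by (intro tendsto_divide_0[OF tendsto_const] filterlim_at_top_imp_at_infinity filterlim_pow_at_top filterlim_ident) auto
    qed (use d in auto)
    then have I: "(\<integral>\<^sup>+r. ennreal (2 / r ^ 3) * indicator {d..} r \<partial>lborel) = ennreal (1 / d\<^sup>2)" by simp
    have "(\<integral>\<^sup>+r. ennreal (2 / r ^ 3) * indicator {0<..} r * (ennreal ((u x - u y)\<^sup>2) * kern r x y) \<partial>lborel)
       = (\<integral>\<^sup>+r. ennreal ((u x - u y)\<^sup>2) * (ennreal (2 / r ^ 3) * indicator {d..} r) \<partial>lborel)"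
    proof (rule nn_integral_cong_AE)
      show "AE r in lborel. ennreal (2 / r ^ 3) * indicator {0<..} r * (ennreal ((u x - u y)\<^sup>2) * kern r x y)
        = ennreal ((u x - u y)\<^sup>2) * (ennreal (2 / r ^ 3) * indicator {d..} r)"
        using AE_lborel_singleton[of d]
        by eventually_elim (use False in \<open>auto simp: d_def kern_def indicator_def mult_ac abs_if split: if_splits\<close>)
    qed
    also have "\<dots> = ennreal ((u x - u y)\<^sup>2) * ennreal (1 / d\<^sup>2)"
      unfolding I[symmetric] by (rule nn_integral_cmult) measurable
    also have "\<dots> = ennreal ((dq u (x, y))\<^sup>2)"
      unfolding d_def dq_def by (simp add: power_divide flip: ennreal_mult)
    finally show ?thesis ..
  qed (simp add: dq_def)
  have "gn u = (\<integral>\<^sup>+x. (\<integral>\<^sup>+y. ennreal ((dq u (x, y))\<^sup>2) \<partial>lborel) \<partial>lborel)"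
    unfolding gn_def by (rule nn_integral_R2) measurable
  also have "\<dots> = (\<integral>\<^sup>+x. (\<integral>\<^sup>+y. (\<integral>\<^sup>+r. ennreal (2 / r ^ 3) * indicator {0<..} r * (ennreal ((u x - u y)\<^sup>2) * kern r x y) \<partial>lborel) \<partial>lborel) \<partial>lborel)"
    unfolding pt ..
  also have "\<dots> = (\<integral>\<^sup>+x. (\<integral>\<^sup>+r. (\<integral>\<^sup>+y. ennreal (2 / r ^ 3) * indicator {0<..} r * (ennreal ((u x - u y)\<^sup>2) * kern r x y) \<partial>lborel) \<partial>lborel) \<partial>lborel)"
    by (rule nn_integral_cong, rule lborel_pair.Fubini') measurable
  also have "\<dots> = (\<integral>\<^sup>+r. (\<integral>\<^sup>+x. (\<integral>\<^sup>+y. ennreal (2 / r ^ 3) * indicator {0<..} r * (ennreal ((u x - u y)\<^sup>2) * kern r x y) \<partial>lborel) \<partial>lborel) \<partial>lborel)"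
    by (rule lborel_pair.Fubini') measurable
  also have "\<dots> = (\<integral>\<^sup>+r. ennreal (2 / r ^ 3) * indicator {0<..} r * Qk r u \<partial>lborel)"
    unfolding Qk_def by (rule nn_integral_cong) (simp add: nn_integral_cmult)
  finally show ?thesis .
qed

lemma gn_abs_le: "gn (\<lambda>x. \<bar>u x\<bar>) \<le> gn u"
  unfolding gn_def
proof (intro nn_integral_mono ennreal_leI)
  fix z :: "real \<times> real"
  have "(\<bar>u (fst z)\<bar> - \<bar>u (snd z)\<bar>)\<^sup>2 \<le> (u (fst z) - u (snd z))\<^sup>2"
    by (rule abs_le_square_iff[THEN iffD1]) linarith
  then show "(dq (\<lambda>x. \<bar>u x\<bar>) z)\<^sup>2 \<le> (dq u z)\<^sup>2" by (simp add: dq_def power_divide divide_right_mono)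
qed

lemma L2_abs: "u \<in> L2 \<Longrightarrow> (\<lambda>x. \<bar>u x :: real\<bar>) \<in> L2"
  by (rule L2_bound) (auto dest: L2_measurable)

lemma ms_abs: "ms (\<lambda>x. \<bar>u x\<bar>) = ms u" by (simp add: ms_def)

text \<open>For each window the sum in \<open>Qk_Pk\<close> depends only on the mass, which
  rearrangement preserves; an increase of \<open>Pk\<close> is therefore a decrease of
  \<open>Qk\<close>.\<close>

lemma gn_srearr_le:
  assumes u: "u \<in> L2" shows "gn (srearr u) \<le> gn u"
proof -
  let ?v = "\<lambda>x. \<bar>u x\<bar>"
  have v: "?v \<in> L2" by (rule L2_abs[OF u])
  have "Qk r (srearr u) \<le> Qk r ?v" if r: "0 < r" for r
  proof -
    have 1: "Qk r (srearr u) + 2 * Pk r (srearr u) = ennreal (4 * r * ms u)"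
      using Qk_Pk[OF srearr_L2[OF u] srearr_nonneg[OF u] r] srearr_ms[OF u] by simp
    have 2: "Qk r ?v + 2 * Pk r u = ennreal (4 * r * ms u)"
      using Qk_Pk[OF v _ r] by (simp add: ms_abs Pk_def)
    \<comment> \<open>Subtraction of extended reals undoes the addition of finite terms
      only.\<close>
    have fin: "2 * Pk r (srearr u) \<noteq> \<infinity>" "2 * Pk r u \<noteq> \<infinity>" using 1 2 by (auto simp: ennreal_mult_eq_top_iff)
    have "Qk r (srearr u) = ennreal (4 * r * ms u) - 2 * Pk r (srearr u)"
      unfolding 1[symmetric] using fin by simp
    also have "\<dots> \<le> ennreal (4 * r * ms u) - 2 * Pk r u"
      by (intro ennreal_minus_mono mult_left_mono Pk_srearr[OF u r]) auto
    also have "\<dots> = Qk r ?v"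
      unfolding 2[symmetric] using fin by simp
    finally show ?thesis .
  qed
  then have "gn (srearr u) \<le> gn ?v"
    unfolding gn_Qk[OF srearr_measurable[OF u]] gn_Qk[OF L2_measurable[OF v]]
    by (intro nn_integral_mono) (auto simp: indicator_def intro: mult_left_mono)
  also have "\<dots> \<le> gn u" by (rule gn_abs_le)
  finally show ?thesis .
qed

lemma srearr_HH: "u \<in> HH \<Longrightarrow> srearr u \<in> HH"
  using gn_srearr_le[of u] srearr_L2[of u] by (auto simp: HH_iff intro: le_less_trans)

lemma srearr_gs: "u \<in> HH \<Longrightarrow> gs (srearr u) \<le> gs u"
  using gn_srearr_le[OF HH_L2, of u] gn_eq[of u] gn_eq[OF srearr_HH, of u] by simp

section \<open>Radially decreasing functions of finite energy\<close>

lemma sdec_nonneg: "sdec v \<Longrightarrow> 0 \<le> v x"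
  by (simp add: sdec_def)

lemma sdec_le: "sdec v \<Longrightarrow> x \<noteq> 0 \<Longrightarrow> \<bar>x\<bar> \<le> \<bar>y\<bar> \<Longrightarrow> v y \<le> v x"
  by (simp add: sdec_def)

lemma sdec_abs: "sdec v \<Longrightarrow> x \<noteq> 0 \<Longrightarrow> v \<bar>x\<bar> = v x"
  by (rule antisym; rule sdec_le) auto

text \<open>On the rectangle (0, s] x [2 s, 3 s], of area s^2, the values differ by at least v(s) -
  v(2 s) and |x - y| is at most 3 s. The factors s^2 cancel, in accordance with the scale invariance
  of the form.\<close>

lemma sdec_doubling:
  assumes v: "v \<in> HH" and d: "sdec v" and s: "0 < s"
  shows "(v s - v (2 * s))\<^sup>2 \<le> 9 * gs v"
proof -
  note [measurable] = HH_measurable[OF v]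
  define c where "c = (v s - v (2 * s))\<^sup>2 / (9 * s\<^sup>2)"
  have c0: "0 \<le> c" by (simp add: c_def)
  have "ennreal (c * s\<^sup>2) = ennreal c * (ennreal s * ennreal s)"
    using s c0 by (simp add: power2_eq_square ennreal_mult)
  also have "\<dots> = (\<integral>\<^sup>+x. ennreal c * ennreal s * indicator {0<..s} x \<partial>lborel)"
    using s by (subst nn_integral_cmult_indicator) (auto simp: mult.assoc)
  also have "\<dots> = (\<integral>\<^sup>+x. (\<integral>\<^sup>+y. ennreal c * indicator {0<..s} x * indicator {2 * s..3 * s} y \<partial>lborel) \<partial>lborel)"
    using s by (intro nn_integral_cong, subst nn_integral_cmult_indicator) (auto simp: mult_ac)
  also have "\<dots> \<le> (\<integral>\<^sup>+x. (\<integral>\<^sup>+y. ennreal ((dq v (x, y))\<^sup>2) \<partial>lborel) \<partial>lborel)"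
  proof (intro nn_integral_mono)
    fix x y
    show "ennreal c * indicator {0<..s} x * indicator {2 * s..3 * s} y \<le> ennreal ((dq v (x, y))\<^sup>2)"
    proof (cases "x \<in> {0<..s} \<and> y \<in> {2 * s..3 * s}")
      case True
      have "v s \<le> v x" using True by (intro sdec_le[OF d]) auto
      moreover have "v y \<le> v (2 * s)" using True s by (intro sdec_le[OF d]) auto
      moreover have "v (2 * s) \<le> v s" using s by (intro sdec_le[OF d]) auto
      ultimately have "(v s - v (2 * s))\<^sup>2 \<le> (v x - v y)\<^sup>2" by (intro power_mono) auto
      moreover have "(x - y)\<^sup>2 \<le> 9 * s\<^sup>2"
      proof -
        have "\<bar>x - y\<bar> \<le> \<bar>3 * s\<bar>" using True by auto
        then have "(x - y)\<^sup>2 \<le> (3 * s)\<^sup>2" by (simp only: abs_le_square_iff)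
        then show ?thesis by (simp add: power_mult_distrib)
      qed
      moreover have "0 < (x - y)\<^sup>2" using True s by auto
      ultimately have "c \<le> (dq v (x, y))\<^sup>2"
        unfolding c_def dq_def power_divide fst_conv snd_conv by (intro frac_le) auto
      then show ?thesis using True by (auto intro: ennreal_leI)
    qed (auto simp: indicator_def)
  qed
  also have "\<dots> = gn v" unfolding gn_def by (rule nn_integral_R2[symmetric]) measurable
  finally have "c * s\<^sup>2 \<le> gs v" by (simp add: gn_eq[OF v])
  moreover have "c * s\<^sup>2 = (v s - v (2 * s))\<^sup>2 / 9" using s by (simp add: c_def)
  ultimately show ?thesis by linarith
qed

lemma sdec_ms:
  assumes v: "v \<in> L2" and d: "sdec v" and s: "0 < s"
  shows "(v s)\<^sup>2 * (2 * s) \<le> ms v"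
proof -
  note [measurable] = L2_measurable[OF v]
  have "ennreal ((v s)\<^sup>2 * (2 * s)) = (\<integral>\<^sup>+x. ennreal ((v s)\<^sup>2) * indicator {- s..s} x \<partial>lborel)"
    using s by (simp add: nn_integral_cmult_indicator ennreal_mult)
  also have "\<dots> \<le> nsq v"
    unfolding nsq_def
  proof (rule nn_integral_mono_AE)
    show "AE x in lborel. ennreal ((v s)\<^sup>2) * indicator {- s..s} x \<le> ennreal ((norm (v x))\<^sup>2)"
      using AE_lborel_singleton[of 0]
    proof eventually_elim
      case (elim x)
      show ?case
      proof (cases "x \<in> {- s..s}")
        case True
        then have "v s \<le> v x" using elim s by (intro sdec_le[OF d]) auto
        then have "(v s)\<^sup>2 \<le> (v x)\<^sup>2" using sdec_nonneg[OF d] by (intro power_mono) auto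
        then show ?thesis using True by (auto intro: ennreal_leI)
      qed simp
    qed
  qed
  finally show ?thesis by (simp add: nsq_ms[OF v])
qed

text \<open>A norm equivalent to \<open>Hhalf_norm\<close> and free of the Fourier
  constants.\<close>

definition hn :: "(real \<Rightarrow> real) \<Rightarrow> real" where "hn u = sqrt (gs u + ms u)"

lemma hn_nonneg [simp]: "0 \<le> hn u" by (simp add: hn_def)

lemma hn_sq: "(hn u)\<^sup>2 = gs u + ms u" by (simp add: hn_def)

lemma gs_le_hn: "gs u \<le> (hn u)\<^sup>2" and ms_le_hn: "ms u \<le> (hn u)\<^sup>2"
  by (simp_all add: hn_sq)

lemma sdec_far:
  assumes v: "v \<in> HH" and d: "sdec v" and s: "0 < s"
  shows "v s \<le> hn v * s powr (-1/2)"
proof -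
  have "(v s)\<^sup>2 * s \<le> (hn v)\<^sup>2"
    using sdec_ms[OF HH_L2[OF v] d s] ms_le_hn[of v] s zero_le_power2[of "v s"] mult_nonneg_nonneg[OF zero_le_power2[of "v s"], of s] by linarith
  moreover have "(s powr (-1/2))\<^sup>2 = 1 / s"
    using s by (simp add: power2_eq_square powr_add[symmetric] powr_minus_divide)
  then have "(hn v * s powr (-1/2))\<^sup>2 = (hn v)\<^sup>2 / s" by (simp only: power_mult_distrib) simp
  ultimately have "(v s)\<^sup>2 \<le> (hn v * s powr (-1/2))\<^sup>2"
    using s by (simp only: pos_le_divide_eq)
  then show ?thesis by (rule power2_le_imp_le) simp
qed

text \<open>Dyadic iteration of \<open>sdec_doubling\<close> gives logarithmic growth at the origin.
  A power with arbitrarily small exponent is weaker, but reproduces itself under one doubling step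
  and leaves any fixed power of \<open>v\<close> integrable near 0.\<close>

lemma sdec_near:
  assumes v: "v \<in> HH" and d: "sdec v" and \<theta>: "0 < \<theta>" and x: "0 < x" "x \<le> 1"
  shows "v x \<le> (2 + 3 / (1 - 2 powr (- \<theta>))) * hn v * x powr (- \<theta>)"
proof -
  \<comment> \<open>The 2 covers the interval (1/2, 1] by \<open>sdec_far\<close>; the other summand
    makes \<open>C * (1 - 2 powr (- \<theta>))\<close> at least 3, the increment of one doubling
    step in units of \<open>hn v\<close>.\<close>
  define C where "C = 2 + 3 / (1 - 2 powr (- \<theta>))"
  have q: "2 powr (- \<theta>) < 1" using \<theta> by (simp add: powr_less_one)
  have "C * (1 - 2 powr (- \<theta>)) = 2 * (1 - 2 powr (- \<theta>)) + 3"
  proof -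
    have "3 / p * p = 3" if "p \<noteq> 0" for p :: real using that by simp
    from this[of "1 - 2 powr (- \<theta>)"] show ?thesis
      unfolding C_def distrib_right using q by linarith
  qed
  then have C: "2 \<le> C" "3 \<le> C * (1 - 2 powr (- \<theta>))" using q by (auto simp: C_def)
  have P: "\<forall>x. (1/2) ^ Suc k < x \<and> x \<le> 1 \<longrightarrow> v x \<le> C * hn v * x powr (- \<theta>)" for k
  proof (induction k)
    case 0
    show ?case
    proof (intro allI impI)
      fix x :: real assume x: "(1/2) ^ Suc 0 < x \<and> x \<le> 1"
      have "x powr (-1/2) \<le> 2"
      proof -
        have "x powr (-1/2) \<le> (1/2) powr (-1/2)" using x by (intro powr_mono2') auto
        also have "\<dots> = sqrt 2" by (simp add: powr_minus_divide powr_half_sqrt real_sqrt_divide)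
        also have "\<dots> \<le> 2" using real_sqrt_le_iff[of 2 4] by simp
        finally show ?thesis .
      qed
      moreover have "1 \<le> x powr (- \<theta>)" using powr_mono'[of "- \<theta>" 0 x] x \<theta> by simp
      moreover have "2 * 1 \<le> C * x powr (- \<theta>)" using C(1) calculation by (intro mult_mono) auto
      ultimately have "hn v * x powr (-1/2) \<le> hn v * (C * x powr (- \<theta>))"
        by (intro mult_left_mono) auto
      then show "v x \<le> C * hn v * x powr (- \<theta>)" using sdec_far[OF v d, of x] x by (simp add: mult_ac)
    qed
  next
    case (Suc k)
    show ?case
    proof (intro allI impI)
      fix x :: real assume x: "(1/2) ^ Suc (Suc k) < x \<and> x \<le> 1"
      show "v x \<le> C * hn v * x powr (- \<theta>)"
      proof (cases "x \<le> 1/2")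
        case False
        have "(1/2) ^ Suc k \<le> (1/2 :: real)" using power_decreasing[of 1 "Suc k" "1/2 :: real"] by simp
        then have "(1/2) ^ Suc k < x" using False by linarith
        then show ?thesis using Suc x by blast
      next
        case True
        have x0: "0 < x" using x less_trans[of 0 "(1/2) ^ Suc (Suc k)" x] by simp
        have "1 \<le> x powr (- \<theta>)" using powr_mono'[of "- \<theta>" 0 x] x x0 \<theta> by simp
        then have "3 * 1 \<le> (C * (1 - 2 powr (- \<theta>))) * x powr (- \<theta>)"
          using C by (intro mult_mono) auto
        then have "hn v * (3 * 1) \<le> hn v * ((C * (1 - 2 powr (- \<theta>))) * x powr (- \<theta>))"
          by (rule mult_left_mono) simp
        then have *: "3 * hn v \<le> C * (1 - 2 powr (- \<theta>)) * hn v * x powr (- \<theta>)"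
          by (simp only: mult_ac mult_1_right)
        have "(v x - v (2 * x))\<^sup>2 \<le> (3 * hn v)\<^sup>2"
          using sdec_doubling[OF v d x0] gs_le_hn[of v] by (simp add: power_mult_distrib)
        then have "v x - v (2 * x) \<le> 3 * hn v" by (rule power2_le_imp_le) simp
        moreover have "v (2 * x) \<le> C * hn v * (2 * x) powr (- \<theta>)" using Suc x True by auto
        moreover have "(2 * x) powr (- \<theta>) = 2 powr (- \<theta>) * x powr (- \<theta>)" using x0 by (simp add: powr_mult)
        ultimately have "v x \<le> 3 * hn v + C * hn v * (2 powr (- \<theta>) * x powr (- \<theta>))" by simp
        also have "\<dots> \<le> C * (1 - 2 powr (- \<theta>)) * hn v * x powr (- \<theta>) + C * hn v * (2 powr (- \<theta>) * x powr (- \<theta>))"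
          using * by simp
        also have "\<dots> = C * hn v * x powr (- \<theta>)" by (simp add: algebra_simps)
        finally show ?thesis .
      qed
    qed
  qed
  obtain k where k: "(1/2) ^ k < x" using real_arch_pow_inv[OF x(1), of "1/2"] by auto
  have "(1/2) ^ Suc k \<le> (1/2 :: real) ^ k" by (rule power_decreasing) auto
  with k have "(1/2) ^ Suc k < x" by (rule le_less_trans[rotated])
  then have "v x \<le> C * hn v * x powr (- \<theta>)" using P[of k] x by blast
  then show ?thesis unfolding C_def .
qed

text \<open>One integrable majorant for all powers m \<ge> 3: at the origin \<open>sdec_near\<close>
  is applied with exponent 1 / (2 m), at infinity \<open>sdec_far\<close> gives decay of order m /
  2.\<close>

definition om :: "real \<Rightarrow> real" where
  "om x = (if \<bar>x\<bar> \<le> 1 then \<bar>x\<bar> powr (-1/2) else \<bar>x\<bar> powr (-3/2))"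

lemma om_nonneg [simp]: "0 \<le> om x" by (simp add: om_def)

lemma om_measurable [measurable]: "om \<in> borel_measurable borel"
  unfolding om_def[abs_def] by measurable

lemma integrable_even:
  fixes f :: "real \<Rightarrow> real"
  assumes [measurable]: "f \<in> borel_measurable borel" and nn: "\<And>x. 0 \<le> f x" and even: "\<And>x. f (- x) = f x"
    and fin: "(\<integral>\<^sup>+x. ennreal (f x) * indicator {0..} x \<partial>lborel) < \<infinity>"
  shows "integrable lborel f"
proof (rule integrableI_bounded)
  have "(\<integral>\<^sup>+x. ennreal (norm (f x)) \<partial>lborel) \<le> (\<integral>\<^sup>+x. ennreal (f x) * indicator {0..} x + ennreal (f x) * indicator {..0} x \<partial>lborel)"
    using nn by (intro nn_integral_mono) (auto simp: indicator_def)
  also have "\<dots> = (\<integral>\<^sup>+x. ennreal (f x) * indicator {0..} x \<partial>lborel) + (\<integral>\<^sup>+x. ennreal (f x) * indicator {..0} x \<partial>lborel)"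
    by (rule nn_integral_add) measurable
  also have "(\<integral>\<^sup>+x. ennreal (f x) * indicator {..0} x \<partial>lborel) = (\<integral>\<^sup>+x. ennreal (f x) * indicator {0..} x \<partial>lborel)"
    by (subst nn_integral_real_affine[where c = "-1" and t = 0]) (auto intro!: nn_integral_cong simp: even indicator_def)
  finally show "(\<integral>\<^sup>+x. ennreal (norm (f x)) \<partial>lborel) < \<infinity>"
    using fin by (auto intro: le_less_trans)
qed simp

lemma om_integrable: "integrable lborel om"
proof (rule integrable_even)
  have 1: "(\<integral>\<^sup>+x. ennreal (indicator {0..1} x * x powr (-1/2)) \<partial>lborel) < \<infinity>"
    using nn_integral_has_integral_lebesgue[OF _ has_integral_powr_from_0[of "-1/2" 1]] by simp
  have 2: "(\<integral>\<^sup>+x. ennreal (x powr (-3/2)) * indicator {1..} x \<partial>lborel) < \<infinity>"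
  proof -
    have "(\<integral>\<^sup>+x. ennreal (x powr (-3/2)) * indicator {1..} x \<partial>lborel) = ennreal (0 - (- 2 * 1 powr (-1/2)))"
    proof (rule nn_integral_FTC_atLeast[where F = "\<lambda>x. - 2 * x powr (-1/2)"])
      show "((\<lambda>x. - 2 * x powr (-1/2)) has_real_derivative x powr (-3/2)) (at x)" if "1 \<le> x" for x :: real
        using that by (auto intro!: derivative_eq_intros)
      have "((\<lambda>x::real. - 2 * x powr (-1/2)) \<longlongrightarrow> - 2 * 0) at_top"
        by (intro tendsto_mult_left tendsto_neg_powr filterlim_ident) auto
      then show "((\<lambda>x::real. - 2 * x powr (-1/2)) \<longlongrightarrow> 0) at_top" by simp
    qed auto
    then show ?thesis by simp
  qed
  have "(\<integral>\<^sup>+x. ennreal (om x) * indicator {0..} x \<partial>lborel)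
     \<le> (\<integral>\<^sup>+x. ennreal (indicator {0..1} x * x powr (-1/2)) + ennreal (x powr (-3/2)) * indicator {1..} x \<partial>lborel)"
    by (intro nn_integral_mono) (auto simp: om_def indicator_def)
  also have "\<dots> = (\<integral>\<^sup>+x. ennreal (indicator {0..1} x * x powr (-1/2)) \<partial>lborel) + (\<integral>\<^sup>+x. ennreal (x powr (-3/2)) * indicator {1..} x \<partial>lborel)"
    by (rule nn_integral_add) measurable
  also have "\<dots> < \<infinity>" using 1 2 by simp
  finally show "(\<integral>\<^sup>+x. ennreal (om x) * indicator {0..} x \<partial>lborel) < \<infinity>" .
qed (auto simp: om_def)

lemma sdec_power_bound:
  assumes m: "3 \<le> m"
  shows "\<exists>C>0. \<forall>v\<in>HH. sdec v \<longrightarrow> (\<forall>x. x \<noteq> 0 \<longrightarrow> v x ^ m \<le> C * hn v ^ m * om x)"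
proof -
  define \<theta> where "\<theta> = 1 / (2 * real m)"
  have \<theta>: "0 < \<theta>" using m by (simp add: \<theta>_def)
  define C where "C = 2 + 3 / (1 - 2 powr (- \<theta>))"
  have q: "2 powr (- \<theta>) < 1" using \<theta> by (simp add: powr_less_one)
  then have C: "1 \<le> C" by (simp add: C_def)
  have "v x ^ m \<le> C ^ m * hn v ^ m * om x" if v: "v \<in> HH" "sdec v" and x: "x \<noteq> 0" for v x
  proof -
    have vx: "v x = v \<bar>x\<bar>" using sdec_abs[OF v(2) x] by simp
    have v0: "0 \<le> v \<bar>x\<bar>" by (rule sdec_nonneg[OF v(2)])
    show ?thesis
    proof (cases "\<bar>x\<bar> \<le> 1")
      case True
      have "v \<bar>x\<bar> \<le> C * hn v * \<bar>x\<bar> powr (- \<theta>)"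
        unfolding C_def using x True by (intro sdec_near[OF v \<theta>]) auto
      then have "v \<bar>x\<bar> ^ m \<le> (C * hn v * \<bar>x\<bar> powr (- \<theta>)) ^ m" using v0 by (rule power_mono)
      also have "(\<bar>x\<bar> powr (- \<theta>)) ^ m = \<bar>x\<bar> powr (-1/2)"
        using x m by (simp add: powr_realpow[symmetric] powr_powr \<theta>_def)
      then have "(C * hn v * \<bar>x\<bar> powr (- \<theta>)) ^ m = C ^ m * hn v ^ m * om x"
        using True by (simp add: power_mult_distrib om_def)
      finally show ?thesis unfolding vx .
    next
      case False
      have "v \<bar>x\<bar> ^ m \<le> (hn v * \<bar>x\<bar> powr (-1/2)) ^ m" using x v0 by (intro power_mono sdec_far[OF v]) auto
      also have "\<dots> = hn v ^ m * (\<bar>x\<bar> powr (- real m / 2))"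
        using x by (simp add: power_mult_distrib powr_realpow[symmetric] powr_powr)
      also have "\<dots> \<le> hn v ^ m * om x"
        using False m by (intro mult_left_mono) (auto simp: om_def intro!: powr_mono)
      also have "\<dots> = 1 * (hn v ^ m * om x)" by simp
      also have "\<dots> \<le> C ^ m * (hn v ^ m * om x)"
        using C by (intro mult_right_mono) auto
      finally show ?thesis unfolding vx by (simp add: mult.assoc)
    qed
  qed
  then show ?thesis using C by (intro exI[of _ "C ^ m"]) auto
qed

section \<open>Sobolev embedding and compactness\<close>

definition Nm :: "nat \<Rightarrow> (real \<Rightarrow> real) \<Rightarrow> real" where "Nm m u = (LINT x|lborel. \<bar>u x\<bar> ^ m)"

lemma Nm_nonneg [simp]: "0 \<le> Nm m u" by (simp add: Nm_def)

lemma hn_srearr: "u \<in> HH \<Longrightarrow> hn (srearr u) \<le> hn u"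
  unfolding hn_def using srearr_gs[of u] srearr_ms[OF HH_L2, of u] by simp

text \<open>Rearrangement keeps the power integral and does not increase \<open>hn\<close>, so only
  radially decreasing functions have to be bounded, and these are majorised by \<open>om\<close>.
  The majorant starts at exponent 3; exponent 2 is contained in \<open>hn\<close> itself.\<close>

lemma embedding:
  assumes m: "2 \<le> m"
  shows "\<exists>C>0. \<forall>u\<in>HH. integrable lborel (\<lambda>x. \<bar>u x\<bar> ^ m) \<and> Nm m u \<le> C * hn u ^ m"
proof (cases "m = 2")
  case True
  have "integrable lborel (\<lambda>x. \<bar>u x\<bar> ^ m) \<and> Nm m u \<le> 1 * hn u ^ m" if "u \<in> HH" for u
    using L2_integrable[OF HH_L2[OF that]] ms_le_hn[of u] True by (simp add: Nm_def ms_def)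
  then show ?thesis by (intro exI[of _ 1]) auto
next
  case False
  then have m: "3 \<le> m" using m by simp
  obtain C where C: "C > 0" "\<And>v x. v \<in> HH \<Longrightarrow> sdec v \<Longrightarrow> x \<noteq> 0 \<Longrightarrow> v x ^ m \<le> C * hn v ^ m * om x"
    using sdec_power_bound[OF m] by blast
  define K where "K = C * integral\<^sup>L lborel om + 1"
  have om0: "0 \<le> integral\<^sup>L lborel om" by simp
  have K: "K > 0" using C(1) om0 unfolding K_def by (intro add_nonneg_pos mult_nonneg_nonneg) auto
  have "integrable lborel (\<lambda>x. \<bar>u x\<bar> ^ m) \<and> Nm m u \<le> K * hn u ^ m" if u: "u \<in> HH" for u
  proof -
    note [measurable] = HH_measurable[OF u]
    let ?v = "srearr u"
    have v: "?v \<in> HH" "sdec ?v" using srearr_HH[OF u] srearr_sdec[OF HH_L2[OF u]] by auto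
    have "(\<integral>\<^sup>+x. ennreal (\<bar>u x\<bar> ^ m) \<partial>lborel) = (\<integral>\<^sup>+x. ennreal (\<bar>?v x\<bar> ^ m) \<partial>lborel)"
      using srearr_power[OF HH_L2[OF u], of m] m by simp
    also have "\<dots> \<le> (\<integral>\<^sup>+x. ennreal (C * hn ?v ^ m * om x) \<partial>lborel)"
    proof (rule nn_integral_mono_AE)
      show "AE x in lborel. ennreal (\<bar>?v x\<bar> ^ m) \<le> ennreal (C * hn ?v ^ m * om x)"
        using AE_lborel_singleton[of 0]
        by eventually_elim (use C(2)[OF v] sdec_nonneg[OF v(2)] in \<open>auto intro!: ennreal_leI\<close>)
    qed
    also have "\<dots> = ennreal (C * hn ?v ^ m * integral\<^sup>L lborel om)"
      using om_integrable C(1) by (subst nn_integral_eq_integral) auto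
    also have "\<dots> \<le> ennreal (K * hn u ^ m)"
    proof (rule ennreal_leI)
      have "hn ?v ^ m \<le> hn u ^ m" by (intro power_mono hn_srearr u) simp
      then have "C * integral\<^sup>L lborel om * hn ?v ^ m \<le> K * hn u ^ m"
        using C(1) om0 by (intro mult_mono) (auto simp: K_def)
      then show "C * hn ?v ^ m * integral\<^sup>L lborel om \<le> K * hn u ^ m" by (simp add: mult_ac)
    qed
    finally have le: "(\<integral>\<^sup>+x. ennreal (\<bar>u x\<bar> ^ m) \<partial>lborel) \<le> ennreal (K * hn u ^ m)" .
    then have "(\<integral>\<^sup>+x. ennreal (\<bar>u x\<bar> ^ m) \<partial>lborel) < \<infinity>" by (auto intro: le_less_trans)
    then have i: "integrable lborel (\<lambda>x. \<bar>u x\<bar> ^ m)"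
      by (intro integrableI_bounded) auto
    have "ennreal (Nm m u) \<le> ennreal (K * hn u ^ m)"
      using le unfolding Nm_def by (subst nn_integral_eq_integral[symmetric, OF i]) auto
    then show ?thesis using i K by (subst (asm) ennreal_le_iff) auto
  qed
  then show ?thesis using K by blast
qed

lemma HH_power_integrable: "u \<in> HH \<Longrightarrow> 2 \<le> m \<Longrightarrow> integrable lborel (\<lambda>x. \<bar>u x\<bar> ^ m)"
  using embedding by blast

lemma Nm_srearr:
  assumes u: "u \<in> HH" and m: "2 \<le> m" shows "Nm m (srearr u) = Nm m u"
proof -
  have "ennreal (Nm m w) = (\<integral>\<^sup>+x. ennreal (\<bar>w x\<bar> ^ m) \<partial>lborel)" if "w \<in> HH" for w
    unfolding Nm_def by (rule nn_integral_eq_integral[symmetric, OF HH_power_integrable[OF that m]]) simp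
  from this[OF u] this[OF srearr_HH[OF u]] have "ennreal (Nm m (srearr u)) = ennreal (Nm m u)"
    using srearr_power[OF HH_L2[OF u], of m] m by simp
  then show ?thesis by simp
qed

text \<open>Helly's theorem provides an a.e. convergent subsequence. Fatou gives the inequalities
  for the two quadratic terms, the majorant \<open>om\<close> gives convergence of the higher
  powers. At exponent 2 mass can escape to infinity.\<close>

lemma compactness:
  fixes v :: "nat \<Rightarrow> real \<Rightarrow> real"
  assumes v: "\<And>n. v n \<in> HH" "\<And>n. sdec (v n)"
    and rc: "\<And>n x. 0 < x \<Longrightarrow> (v n \<longlongrightarrow> v n x) (at_right x)"
    and G: "(\<lambda>n. gs (v n)) \<longlonglongrightarrow> G" and M: "(\<lambda>n. ms (v n)) \<longlonglongrightarrow> M"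
  shows "\<exists>\<sigma> u. strict_mono \<sigma> \<and> u \<in> HH \<and> sdec u \<and> gs u \<le> G \<and> ms u \<le> M
    \<and> (\<forall>m\<ge>3. (\<lambda>n. Nm m (v (\<sigma> n))) \<longlonglongrightarrow> Nm m u)"
proof -
  note [measurable] = HH_measurable[OF v(1)]
  obtain R where R: "R > 0" "\<And>n. hn (v n) \<le> R"
  proof -
    have "(\<lambda>n. hn (v n)) \<longlonglongrightarrow> sqrt (G + M)" unfolding hn_def by (intro tendsto_intros G M)
    then have "convergent (\<lambda>n. hn (v n))" by (auto simp: convergent_def)
    then have "Bseq (\<lambda>n. hn (v n))" by (rule convergent_imp_Bseq)
    then obtain K where "K > 0" "\<And>n. norm (hn (v n)) \<le> K" by (auto simp: Bseq_def)
    then show ?thesis using that[of K] by auto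
  qed
  \<comment> \<open>The logarithmic variable maps the positive half-line onto the real line, and the
    reciprocal turns decreasing values, possibly unbounded near the origin, into bounded increasing
    ones, as Helly's theorem requires.\<close>
  define f where "f n \<xi> = 1 / (1 + v n (exp \<xi>))" for n \<xi>
  have v0: "0 \<le> v n x" for n x by (rule sdec_nonneg[OF v(2)])
  have p: "0 < 1 + v n x" for n x using v0[of n x] by linarith
  have "\<exists>s. strict_mono (s::nat \<Rightarrow> nat) \<and> (\<exists>F. (\<forall>x. continuous (at_right x) F) \<and> mono F \<and> (\<forall>x. \<bar>F x\<bar> \<le> 1) \<and>
    (\<forall>x. continuous (at x) F \<longrightarrow> (\<lambda>n. f (s n) x) \<longlonglongrightarrow> F x))"
  proof (rule Helly_selection)
    show "continuous (at_right x) (f n)" for n x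
    proof -
      have "filterlim exp (at_right (exp x)) (at_right x)"
        unfolding filterlim_at
      proof
        show "(exp \<longlongrightarrow> exp x) (at_right x)" by (intro tendsto_intros)
        show "\<forall>\<^sub>F y in at_right x. exp y \<in> {exp x<..} \<and> exp y \<noteq> exp x"
          using eventually_at_right_less[of x] by eventually_elim auto
      qed
      from filterlim_compose[OF rc[of "exp x" n] this]
      have "((\<lambda>\<xi>. v n (exp \<xi>)) \<longlongrightarrow> v n (exp x)) (at_right x)" by simp
      then show ?thesis
        unfolding continuous_within f_def using p[of n "exp x"] by (intro tendsto_intros) auto
    qed
    show "mono (f n)" for n
    proof (rule monoI)
      fix x y :: real assume "x \<le> y"
      then have "v n (exp y) \<le> v n (exp x)" by (intro sdec_le[OF v(2)]) auto
      then show "f n x \<le> f n y" unfolding f_def using p by (intro divide_left_mono) auto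
    qed
    show "\<bar>f n x\<bar> \<le> 1" for n x using v0[of n "exp x"] by (simp add: f_def)
  qed
  then obtain \<sigma> F where \<sigma>: "strict_mono (\<sigma> :: nat \<Rightarrow> nat)" and F: "mono F" "\<And>x. \<bar>F x\<bar> \<le> 1"
    and lim: "\<And>x. isCont F x \<Longrightarrow> (\<lambda>n. f (\<sigma> n) x) \<longlonglongrightarrow> F x" by blast
  \<comment> \<open>A zero of \<open>F\<close> would be an infinite value of the limit. At points of
    continuity \<open>sdec_far\<close> excludes it, and monotonicity carries positivity to the right
    of such a point.\<close>
  have Fpos: "0 < F x" for x
  proof -
    have "\<exists>y\<in>{..<x}. isCont F y"
    proof (rule ccontr)
      assume "\<not> ?thesis"
      then have "{x - 1<..<x} \<subseteq> {a. \<not> isCont F a}" by auto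
      then have "countable {x - 1<..<x}" using mono_ctble_discont[OF F(1)] countable_subset by blast
      then show False using uncountable_open_interval[of "x - 1" x] by simp
    qed
    then obtain y where y: "y < x" "isCont F y" by auto
    have "1 / (1 + R * exp y powr (-1/2)) \<le> F y"
    proof (rule LIMSEQ_le_const[OF lim[OF y(2)]], intro exI allI impI)
      fix n
      have "v (\<sigma> n) (exp y) \<le> hn (v (\<sigma> n)) * exp y powr (-1/2)" by (intro sdec_far v) simp
      also have "\<dots> \<le> R * exp y powr (-1/2)" using R(2) by (intro mult_right_mono) auto
      finally show "1 / (1 + R * exp y powr (-1/2)) \<le> f (\<sigma> n) y"
        unfolding f_def using p v0 R(1) by (intro divide_left_mono mult_pos_pos add_pos_nonneg) auto
    qed
    moreover have "0 < 1 / (1 + R * exp y powr (-1/2))" using R(1) by (intro divide_pos_pos add_pos_nonneg) auto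
    moreover have "F y \<le> F x" using F(1) y(1) by (auto simp: mono_def)
    ultimately show ?thesis by linarith
  qed
  have F1: "F x \<le> 1" for x using F(2)[of x] by simp
  define u where "u x = (if x = 0 then 0 else 1 / F (ln \<bar>x\<bar>) - 1)" for x
  have [measurable]: "F \<in> borel_measurable borel" by (rule borel_measurable_mono[OF F(1)])
  have [measurable]: "u \<in> borel_measurable borel" unfolding u_def[abs_def] by measurable
  have u0: "0 \<le> u x" for x using Fpos F1 by (auto simp: u_def)
  have sd: "sdec u"
    unfolding sdec_def
  proof (intro conjI allI impI u0)
    fix x y :: real assume xy: "x \<noteq> 0" "\<bar>x\<bar> \<le> \<bar>y\<bar>"
    then have "F (ln \<bar>x\<bar>) \<le> F (ln \<bar>y\<bar>)" using F(1) by (auto simp: mono_def)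
    then have "1 / F (ln \<bar>y\<bar>) \<le> 1 / F (ln \<bar>x\<bar>)" using Fpos by (intro divide_left_mono) auto
    then show "u y \<le> u x" using xy by (auto simp: u_def)
  qed
  \<comment> \<open>Away from the origin, convergence can fail only where \<open>F\<close> is
    discontinuous; a monotone function has countably many discontinuities, and so have their images
    on both half-lines.\<close>
  have ae: "AE x in lborel. x \<noteq> 0 \<and> (\<lambda>n. v (\<sigma> n) x) \<longlonglongrightarrow> u x"
  proof -
    let ?D = "{a. \<not> isCont F a}"
    have "countable ({0} \<union> (exp ` ?D \<union> (\<lambda>d. - exp d) ` ?D))"
      using mono_ctble_discont[OF F(1)] by auto
    then have "AE x in lborel. x \<notin> {0} \<union> (exp ` ?D \<union> (\<lambda>d. - exp d) ` ?D)"
      by (intro AE_not_in countable_imp_null_set_lborel)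
    then show ?thesis
    proof eventually_elim
      case (elim x)
      then have x: "x \<noteq> 0" by auto
      have "isCont F (ln \<bar>x\<bar>)"
      proof (rule ccontr)
        assume "\<not> isCont F (ln \<bar>x\<bar>)"
        then have "exp (ln \<bar>x\<bar>) \<in> exp ` ?D" "- exp (ln \<bar>x\<bar>) \<in> (\<lambda>d. - exp d) ` ?D" by auto
        then show False using elim x by (cases "0 < x") (auto simp: abs_if split: if_splits)
      qed
      from lim[OF this] have "(\<lambda>n. 1 / f (\<sigma> n) (ln \<bar>x\<bar>) - 1) \<longlonglongrightarrow> 1 / F (ln \<bar>x\<bar>) - 1"
        using Fpos[of "ln \<bar>x\<bar>"] by (intro tendsto_intros) auto
      moreover have "1 / f (\<sigma> n) (ln \<bar>x\<bar>) - 1 = v (\<sigma> n) x" for n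
        using x sdec_abs[OF v(2) x, of "\<sigma> n"] by (simp add: f_def)
      ultimately show ?case using x by (simp add: u_def)
    qed
  qed
  have G': "(\<lambda>n. gs (v (\<sigma> n))) \<longlonglongrightarrow> G" using LIMSEQ_subseq_LIMSEQ[OF G \<sigma>] by (simp add: o_def)
  have M': "(\<lambda>n. ms (v (\<sigma> n))) \<longlonglongrightarrow> M" using LIMSEQ_subseq_LIMSEQ[OF M \<sigma>] by (simp add: o_def)
  have "nsq u = (\<integral>\<^sup>+x. liminf (\<lambda>n. ennreal ((norm (v (\<sigma> n) x))\<^sup>2)) \<partial>lborel)"
    unfolding nsq_def
  proof (rule nn_integral_cong_AE, use ae in eventually_elim)
    case (elim x)
    then have "(\<lambda>n. ennreal ((norm (v (\<sigma> n) x))\<^sup>2)) \<longlonglongrightarrow> ennreal ((norm (u x))\<^sup>2)" by (intro tendsto_intros) auto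
    from lim_imp_Liminf[OF _ this] show ?case by simp
  qed
  also have "\<dots> \<le> liminf (\<lambda>n. nsq (v (\<sigma> n)))" unfolding nsq_def by (rule nn_integral_liminf) measurable
  also have "\<dots> = ennreal M"
    unfolding nsq_ms[OF HH_L2[OF v(1)]] by (intro lim_imp_Liminf tendsto_intros M') simp
  finally have uM: "nsq u \<le> ennreal M" .
  then have uL2: "u \<in> L2" by (auto simp: L2_iff_nsq intro: le_less_trans)
  have M0: "0 \<le> M" by (rule LIMSEQ_le_const[OF M]) auto
  have G0: "0 \<le> G" by (rule LIMSEQ_le_const[OF G]) auto
  have msu: "ms u \<le> M" using uM M0 by (simp add: nsq_ms[OF uL2])
  have "gn u = (\<integral>\<^sup>+x. (\<integral>\<^sup>+y. ennreal ((dq u (x, y))\<^sup>2) \<partial>lborel) \<partial>lborel)"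
    unfolding gn_def by (rule nn_integral_R2) measurable
  also have "\<dots> = (\<integral>\<^sup>+x. (\<integral>\<^sup>+y. liminf (\<lambda>n. ennreal ((dq (v (\<sigma> n)) (x, y))\<^sup>2)) \<partial>lborel) \<partial>lborel)"
  proof (rule nn_integral_cong_AE, use ae in eventually_elim)
    case x: (elim x)
    show ?case
    proof (rule nn_integral_cong_AE, use ae in eventually_elim)
      case y: (elim y)
      have "(\<lambda>n. ennreal ((dq (v (\<sigma> n)) (x, y))\<^sup>2)) \<longlonglongrightarrow> ennreal ((dq u (x, y))\<^sup>2)"
      proof (cases "x = y")
        case False
        then show ?thesis unfolding dq_def fst_conv snd_conv using x y by (intro tendsto_intros) auto
      qed (simp add: dq_def)
      from lim_imp_Liminf[OF _ this] show ?case by simp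
    qed
  qed
  also have "\<dots> = (\<integral>\<^sup>+z. liminf (\<lambda>n. ennreal ((dq (v (\<sigma> n)) z)\<^sup>2)) \<partial>lborel)"
    by (rule nn_integral_R2[symmetric]) measurable
  also have "\<dots> \<le> liminf (\<lambda>n. gn (v (\<sigma> n)))" unfolding gn_def by (rule nn_integral_liminf) measurable
  also have "\<dots> = ennreal G"
    unfolding gn_eq[OF v(1)] by (intro lim_imp_Liminf tendsto_intros G') simp
  finally have uG: "gn u \<le> ennreal G" .
  then have uH: "u \<in> HH" using uL2 by (auto simp: HH_iff intro: le_less_trans)
  have gsu: "gs u \<le> G" using uG G0 by (simp add: gn_eq[OF uH])
  have "(\<lambda>n. Nm m (v (\<sigma> n))) \<longlonglongrightarrow> Nm m u" if m: "3 \<le> m" for m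
  proof -
    obtain C where C: "C > 0" "\<And>v x. v \<in> HH \<Longrightarrow> sdec v \<Longrightarrow> x \<noteq> 0 \<Longrightarrow> v x ^ m \<le> C * hn v ^ m * om x"
      using sdec_power_bound[OF m] by blast
    show ?thesis
      unfolding Nm_def
    proof (rule integral_dominated_convergence)
      show "integrable lborel (\<lambda>x. C * R ^ m * om x)" using om_integrable by simp
      show "AE x in lborel. (\<lambda>n. \<bar>v (\<sigma> n) x\<bar> ^ m) \<longlonglongrightarrow> \<bar>u x\<bar> ^ m"
        using ae by eventually_elim (auto intro!: tendsto_intros)
      show "AE x in lborel. norm (\<bar>v (\<sigma> n) x\<bar> ^ m) \<le> C * R ^ m * om x" for n
        using AE_lborel_singleton[of 0]
      proof eventually_elim
        case (elim x)
        have "v (\<sigma> n) x ^ m \<le> C * hn (v (\<sigma> n)) ^ m * om x" by (rule C(2)[OF v elim])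
        also have "\<dots> \<le> C * R ^ m * om x"
          using C(1) R by (intro mult_right_mono mult_left_mono power_mono) auto
        finally show ?case using v0 by simp
      qed
    qed measurable
  qed
  then show ?thesis using \<sigma> uH sd gsu msu by blast
qed

section \<open>Functionals on the energy space\<close>

definition bil :: "(real \<Rightarrow> real) \<Rightarrow> (real \<Rightarrow> real) \<Rightarrow> real" where
  "bil u h = (LINT z|lborel. dq u z * dq h z)"

definition dot :: "(real \<Rightarrow> real) \<Rightarrow> (real \<Rightarrow> real) \<Rightarrow> real" where
  "dot u h = (LINT x|lborel. u x * h x)"

lemma HH_gs_integrable: "u \<in> HH \<Longrightarrow> integrable lborel (\<lambda>z. (dq u z)\<^sup>2)" by (simp add: HH_def)

lemma HH_ms_integrable: "u \<in> HH \<Longrightarrow> integrable lborel (\<lambda>x. (u x)\<^sup>2)"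
  using L2_integrable[OF HH_L2] by simp

lemma abs_mult_le_squares: "\<bar>a * b\<bar> \<le> a\<^sup>2 + (b::real)\<^sup>2"
proof -
  have "2 * (\<bar>a\<bar> * \<bar>b\<bar>) \<le> a\<^sup>2 + b\<^sup>2" using sum_squares_bound[of "\<bar>a\<bar>" "\<bar>b\<bar>"] by simp
  moreover have "0 \<le> \<bar>a\<bar> * \<bar>b\<bar>" by simp
  ultimately show ?thesis unfolding abs_mult by linarith
qed

lemma square_integrable_mult:
  fixes f g :: "'a \<Rightarrow> real"
  assumes [measurable]: "f \<in> borel_measurable M" "g \<in> borel_measurable M"
    and "integrable M (\<lambda>x. (f x)\<^sup>2)" "integrable M (\<lambda>x. (g x)\<^sup>2)"
  shows "integrable M (\<lambda>x. f x * g x)"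
proof (rule Bochner_Integration.integrable_bound)
  show "integrable M (\<lambda>x. (f x)\<^sup>2 + (g x)\<^sup>2)" using assms by simp
  show "AE x in M. norm (f x * g x) \<le> norm ((f x)\<^sup>2 + (g x)\<^sup>2)"
    using abs_mult_le_squares by auto
qed measurable

lemma bil_integrable: "u \<in> HH \<Longrightarrow> h \<in> HH \<Longrightarrow> integrable lborel (\<lambda>z. dq u z * dq h z)"
  by (intro square_integrable_mult HH_gs_integrable) (auto dest: HH_measurable)

lemma dot_integrable: "u \<in> HH \<Longrightarrow> h \<in> HH \<Longrightarrow> integrable lborel (\<lambda>x. u x * h x)"
  by (intro square_integrable_mult HH_ms_integrable) (auto dest: HH_measurable)

lemma dq_add: "dq (\<lambda>x. u x + h x) z = dq u z + dq h z"
  by (simp add: dq_def diff_divide_distrib add_divide_distrib)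

lemma dq_scale: "dq (\<lambda>x. a * u x) z = a * dq u z"
  by (simp add: dq_def right_diff_distrib[symmetric])

lemma HH_add:
  assumes u: "u \<in> HH" and h: "h \<in> HH" shows "(\<lambda>x. u x + h x) \<in> HH"
proof -
  have "(\<lambda>z. (dq (\<lambda>x. u x + h x) z)\<^sup>2) = (\<lambda>z. (dq u z)\<^sup>2 + 2 * (dq u z * dq h z) + (dq h z)\<^sup>2)"
    by (auto simp: dq_add power2_sum)
  then show ?thesis
    using bil_integrable[OF u h] HH_gs_integrable[OF u] HH_gs_integrable[OF h] L2_add[OF HH_L2[OF u] HH_L2[OF h]]
    by (simp add: HH_def)
qed

lemma HH_scale: "u \<in> HH \<Longrightarrow> (\<lambda>x. a * u x) \<in> HH"
  using L2_scaleR[of u a] by (simp add: HH_def dq_scale power_mult_distrib)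

lemma HH_add_scale: "u \<in> HH \<Longrightarrow> h \<in> HH \<Longrightarrow> (\<lambda>x. u x + e * h x) \<in> HH"
  by (intro HH_add HH_scale)

text \<open>Normal contractions act on the energy space; this makes absolute values and truncations
  of \<open>u\<close> admissible as test functions.\<close>

lemma HH_contract:
  assumes u: "u \<in> HH" and [measurable]: "h \<in> borel_measurable borel"
    and le: "\<And>x. \<bar>h x\<bar> \<le> \<bar>u x\<bar>" "\<And>x y. \<bar>h x - h y\<bar> \<le> \<bar>u x - u y\<bar>"
  shows "h \<in> HH" "gs h \<le> gs u"
proof -
  note [measurable] = HH_measurable[OF u]
  have d: "(dq h z)\<^sup>2 \<le> (dq u z)\<^sup>2" for z
    unfolding dq_def power_divide using le(2)[of "fst z" "snd z"] by (intro divide_right_mono) (auto simp: abs_le_square_iff)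
  have "integrable lborel (\<lambda>z. (dq h z)\<^sup>2)"
    by (rule Bochner_Integration.integrable_bound[OF HH_gs_integrable[OF u]]) (use d in auto)
  moreover have "h \<in> L2" by (rule L2_bound[OF HH_L2[OF u]]) (use le in auto)
  ultimately show h: "h \<in> HH" by (simp add: HH_def)
  show "gs h \<le> gs u" unfolding gs_def by (intro integral_mono HH_gs_integrable u h d)
qed

lemma HH_abs:
  assumes u: "u \<in> HH" shows "(\<lambda>x. \<bar>u x\<bar>) \<in> HH" "gs (\<lambda>x. \<bar>u x\<bar>) \<le> gs u"
proof -
  note [measurable] = HH_measurable[OF u]
  have [measurable]: "(\<lambda>x. \<bar>u x\<bar>) \<in> borel_measurable borel" by measurable
  show "(\<lambda>x. \<bar>u x\<bar>) \<in> HH" "gs (\<lambda>x. \<bar>u x\<bar>) \<le> gs u"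
    by (rule HH_contract[OF u]; simp add: abs_triangle_ineq3)+
qed

lemma gs_add: "u \<in> HH \<Longrightarrow> h \<in> HH \<Longrightarrow> gs (\<lambda>x. u x + h x) = gs u + 2 * bil u h + gs h"
  using bil_integrable[of u h] HH_gs_integrable[of u] HH_gs_integrable[of h]
  by (simp add: gs_def bil_def dq_add power2_sum mult.assoc)

lemma ms_add: "u \<in> HH \<Longrightarrow> h \<in> HH \<Longrightarrow> ms (\<lambda>x. u x + h x) = ms u + 2 * dot u h + ms h"
  using dot_integrable[of u h] HH_ms_integrable[of u] HH_ms_integrable[of h]
  by (simp add: ms_def dot_def power2_sum mult.assoc)

lemma gs_scale: "gs (\<lambda>x. a * u x) = a\<^sup>2 * gs u"
  by (simp add: gs_def dq_scale power_mult_distrib)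

lemma ms_scale: "ms (\<lambda>x. a * u x) = a\<^sup>2 * ms u"
  by (simp add: ms_def power_mult_distrib)

lemma Nm_scale: "Nm m (\<lambda>x. a * u x) = \<bar>a\<bar> ^ m * Nm m u"
  by (simp add: Nm_def abs_mult power_mult_distrib)

lemma hn_scale: "hn (\<lambda>x. a * u x) = \<bar>a\<bar> * hn u"
  by (simp add: hn_def gs_scale ms_scale real_sqrt_mult flip: distrib_left)

lemma bil_add: "u \<in> HH \<Longrightarrow> h \<in> HH \<Longrightarrow> k \<in> HH \<Longrightarrow> bil u (\<lambda>x. h x + k x) = bil u h + bil u k"
  using bil_integrable[of u h] bil_integrable[of u k] by (simp add: bil_def dq_add distrib_left)

lemma bil_scale: "bil u (\<lambda>x. a * h x) = a * bil u h"
  by (simp add: bil_def dq_scale mult.left_commute)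

lemma dot_scale: "dot u (\<lambda>x. a * h x) = a * dot u h"
  by (simp add: dot_def mult.left_commute)

lemma bil_self: "bil u u = gs u" by (simp add: bil_def gs_def power2_eq_square)

lemma dot_self: "dot u u = ms u" by (simp add: dot_def ms_def power2_eq_square)

text \<open>The parallelogram identity with the term of the difference dropped.\<close>

lemma hn_add_sq: "u \<in> HH \<Longrightarrow> h \<in> HH \<Longrightarrow> (hn (\<lambda>x. u x + h x))\<^sup>2 \<le> 2 * (hn u)\<^sup>2 + 2 * (hn h)\<^sup>2"
proof -
  assume u: "u \<in> HH" and h: "h \<in> HH"
  have m: "(\<lambda>x. -1 * h x) \<in> HH" by (rule HH_scale[OF h])
  define v where "v = (\<lambda>x. u x + -1 * h x)"
  have 1: "gs (\<lambda>x. u x + h x) + gs v = 2 * gs u + 2 * gs h"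
    unfolding v_def using gs_add[OF u h] gs_add[OF u m] gs_scale[of "-1" h] bil_scale[of u "-1" h] by simp
  have 2: "ms (\<lambda>x. u x + h x) + ms v = 2 * ms u + 2 * ms h"
    unfolding v_def using ms_add[OF u h] ms_add[OF u m] ms_scale[of "-1" h] by (simp add: dot_def)
  have "A + B \<le> 2 * (a + c) + 2 * (b + d)"
    if "A + V = 2 * a + 2 * b" "B + W = 2 * c + 2 * d" "0 \<le> V" "0 \<le> W" for A B V W a b c d :: real
    using that by simp
  from this[OF 1 2 gs_nonneg ms_nonneg] show "(hn (\<lambda>x. u x + h x))\<^sup>2 \<le> 2 * (hn u)\<^sup>2 + 2 * (hn h)\<^sup>2"
    unfolding hn_sq .
qed

section \<open>Second-order expansion of the functionals\<close>

lemma power_remainder: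
  assumes "2 \<le> m"
  shows "\<exists>C\<ge>0. \<forall>s k :: real. \<bar>(s + k) ^ m - s ^ m - real m * s ^ (m - 1) * k\<bar> \<le> C * k\<^sup>2 * (\<bar>s\<bar> + \<bar>k\<bar>) ^ (m - 2)"
  using assms
proof (induction m rule: dec_induct)
  case base
  have "(s + k) ^ 2 - s ^ 2 - real 2 * s ^ (2 - 1) * k = k\<^sup>2" for s k :: real by (simp add: power2_sum)
  then show ?case by (intro exI[of _ 1]) simp
next
  case (step m)
  then obtain C where C: "C \<ge> 0" "\<And>s k :: real. \<bar>(s + k) ^ m - s ^ m - real m * s ^ (m - 1) * k\<bar> \<le> C * k\<^sup>2 * (\<bar>s\<bar> + \<bar>k\<bar>) ^ (m - 2)"
    by blast
  have "\<bar>(s + k) ^ Suc m - s ^ Suc m - real (Suc m) * s ^ (Suc m - 1) * k\<bar> \<le> (C + real m) * k\<^sup>2 * (\<bar>s\<bar> + \<bar>k\<bar>) ^ (Suc m - 2)" for s k :: real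
  proof -
    define M where "M = \<bar>s\<bar> + \<bar>k\<bar>"
    obtain j where j: "m = Suc (Suc j)" using step(1) by (metis add_2_eq_Suc le_Suc_ex)
    \<comment> \<open>Passing to the next exponent multiplies the old remainder by s + k and
      produces one new term, which is already quadratic in k.\<close>
    have "(s + k) ^ Suc m - s ^ Suc m - real (Suc m) * s ^ (Suc m - 1) * k
      = (s + k) * ((s + k) ^ m - s ^ m - real m * s ^ (m - 1) * k) + real m * s ^ (m - 1) * k\<^sup>2"
    proof -
      have "(s + k) * A - s * (s * B) - (r + 1) * (s * B) * k = (s + k) * (A - s * B - r * B * k) + r * B * k\<^sup>2" for A B r :: real
        by (simp add: algebra_simps power2_eq_square)
      from this[of "(s + k) ^ m" "s ^ (m - 1)" "real m"] show ?thesis by (simp add: j add.commute)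
    qed
    also have "\<bar>\<dots>\<bar> \<le> \<bar>s + k\<bar> * \<bar>(s + k) ^ m - s ^ m - real m * s ^ (m - 1) * k\<bar> + real m * \<bar>s\<bar> ^ (m - 1) * k\<^sup>2"
      by (rule order.trans[OF abs_triangle_ineq]) (simp add: abs_mult power_abs)
    also have "\<dots> \<le> M * (C * k\<^sup>2 * M ^ (m - 2)) + real m * M ^ (m - 1) * k\<^sup>2"
      using C unfolding M_def by (intro add_mono mult_mono mult_right_mono mult_left_mono power_mono) auto
    also have "\<dots> = (C + real m) * k\<^sup>2 * M ^ (Suc m - 2)" by (simp add: j algebra_simps)
    finally show ?thesis unfolding M_def .
  qed
  then show ?case using C(1) by (intro exI[of _ "C + real m"]) auto
qed

text \<open>For s \<ge> 0 the absolute value matters only if s + k < 0. Then |s + k| \<le> |k|, so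
  the discrepancy, at most 2 |s + k|^m, is itself of second order in k.\<close>

lemma abs_power_remainder:
  assumes "2 \<le> m"
  shows "\<exists>C\<ge>0. \<forall>s k :: real. 0 \<le> s \<longrightarrow> \<bar>\<bar>s + k\<bar> ^ m - \<bar>s\<bar> ^ m - real m * s ^ (m - 1) * k\<bar> \<le> C * k\<^sup>2 * (\<bar>s\<bar> + \<bar>k\<bar>) ^ (m - 2)"
proof -
  obtain C where C: "C \<ge> 0" "\<And>s k :: real. \<bar>(s + k) ^ m - s ^ m - real m * s ^ (m - 1) * k\<bar> \<le> C * k\<^sup>2 * (\<bar>s\<bar> + \<bar>k\<bar>) ^ (m - 2)"
    using power_remainder[OF assms] by blast
  have "\<bar>\<bar>s + k\<bar> ^ m - \<bar>s\<bar> ^ m - real m * s ^ (m - 1) * k\<bar> \<le> (C + 2) * k\<^sup>2 * (\<bar>s\<bar> + \<bar>k\<bar>) ^ (m - 2)" if s: "0 \<le> s" for s k :: real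
  proof -
    have "\<bar>\<bar>s + k\<bar> ^ m - (s + k) ^ m\<bar> \<le> 2 * (k\<^sup>2 * (\<bar>s\<bar> + \<bar>k\<bar>) ^ (m - 2))"
    proof (cases "0 \<le> s + k")
      case True
      then show ?thesis by simp
    next
      case False
      have "\<bar>\<bar>s + k\<bar> ^ m - (s + k) ^ m\<bar> \<le> \<bar>s + k\<bar> ^ m + \<bar>s + k\<bar> ^ m"
        by (rule order.trans[OF abs_triangle_ineq4]) (simp add: power_abs)
      also have "\<dots> \<le> 2 * \<bar>k\<bar> ^ m" using False s power_mono[of "\<bar>s + k\<bar>" "\<bar>k\<bar>" m] by simp
      also have "\<bar>k\<bar> ^ m = k\<^sup>2 * \<bar>k\<bar> ^ (m - 2)"
      proof -
        have "2 + (m - 2) = m" using assms by simp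
        then have "\<bar>k\<bar> ^ m = \<bar>k\<bar>\<^sup>2 * \<bar>k\<bar> ^ (m - 2)" by (simp only: power_add[symmetric])
        then show ?thesis by (simp only: power2_abs)
      qed
      also have "2 * (k\<^sup>2 * \<bar>k\<bar> ^ (m - 2)) \<le> 2 * (k\<^sup>2 * (\<bar>s\<bar> + \<bar>k\<bar>) ^ (m - 2))"
        by (intro mult_left_mono power_mono) auto
      finally show ?thesis by simp
    qed
    then have "\<bar>\<bar>s + k\<bar> ^ m - (s + k) ^ m\<bar> + \<bar>(s + k) ^ m - s ^ m - real m * s ^ (m - 1) * k\<bar>
      \<le> 2 * (k\<^sup>2 * (\<bar>s\<bar> + \<bar>k\<bar>) ^ (m - 2)) + C * k\<^sup>2 * (\<bar>s\<bar> + \<bar>k\<bar>) ^ (m - 2)"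
      by (rule add_mono[OF _ C(2)])
    moreover have "\<bar>a - c - X\<bar> \<le> \<bar>a - b\<bar> + \<bar>b - c - X\<bar>" for a b c X :: real by linarith
    ultimately have "\<bar>\<bar>s + k\<bar> ^ m - s ^ m - real m * s ^ (m - 1) * k\<bar> \<le> 2 * (k\<^sup>2 * (\<bar>s\<bar> + \<bar>k\<bar>) ^ (m - 2)) + C * k\<^sup>2 * (\<bar>s\<bar> + \<bar>k\<bar>) ^ (m - 2)"
      by (rule order.trans[rotated])
    also have "\<dots> = (C + 2) * k\<^sup>2 * (\<bar>s\<bar> + \<bar>k\<bar>) ^ (m - 2)" by (simp add: algebra_simps)
    finally show ?thesis using s by (simp only: abs_of_nonneg)
  qed
  then show ?thesis using C(1) by (intro exI[of _ "C + 2"]) auto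
qed

lemma mixed_power_integrable:
  assumes u: "u \<in> HH" and h: "h \<in> HH" and m: "1 \<le> m"
  shows "integrable lborel (\<lambda>x. u x ^ m * h x)"
proof (rule Bochner_Integration.integrable_bound)
  note [measurable] = HH_measurable[OF u] HH_measurable[OF h]
  show "integrable lborel (\<lambda>x. \<bar>u x\<bar> ^ (m + 1) + \<bar>h x\<bar> ^ (m + 1))"
    using HH_power_integrable[OF u, of "m + 1"] HH_power_integrable[OF h, of "m + 1"] m by simp
  show "AE x in lborel. norm (u x ^ m * h x) \<le> norm (\<bar>u x\<bar> ^ (m + 1) + \<bar>h x\<bar> ^ (m + 1))"
  proof (rule AE_I2)
    fix x
    have "\<bar>u x\<bar> ^ m * \<bar>h x\<bar> \<le> max \<bar>u x\<bar> \<bar>h x\<bar> ^ m * max \<bar>u x\<bar> \<bar>h x\<bar>"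
      by (intro mult_mono power_mono) auto
    also have "\<dots> \<le> \<bar>u x\<bar> ^ (m + 1) + \<bar>h x\<bar> ^ (m + 1)" by (auto simp: max_def)
    finally show "norm (u x ^ m * h x) \<le> norm (\<bar>u x\<bar> ^ (m + 1) + \<bar>h x\<bar> ^ (m + 1))"
      by (simp add: abs_mult power_abs)
  qed
qed (use HH_measurable[OF u] HH_measurable[OF h] in measurable)

text \<open>One argument covers |s|^m and s^m. The estimate uses an arbitrary radius \<epsilon>
  \<ge> hn h, so that \<open>h\<close> can be divided by a positive number even if
  \<open>hn h\<close> is 0.\<close>

lemma functional_expand:
  fixes \<Phi> :: "real \<Rightarrow> real"
  assumes u: "u \<in> HH" and m: "2 \<le> m" and [measurable]: "\<Phi> \<in> borel_measurable borel"
    and \<Phi>: "\<And>s. \<bar>\<Phi> s\<bar> \<le> \<bar>s\<bar> ^ m"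
    and C: "0 \<le> C" "\<And>x k. \<bar>\<Phi> (u x + k) - \<Phi> (u x) - real m * u x ^ (m - 1) * k\<bar> \<le> C * k\<^sup>2 * (\<bar>u x\<bar> + \<bar>k\<bar>) ^ (m - 2)"
  shows "\<exists>K\<ge>0. \<forall>h\<in>HH. \<forall>\<epsilon>. 0 < \<epsilon> \<longrightarrow> \<epsilon> \<le> 1 \<longrightarrow> hn h \<le> \<epsilon> \<longrightarrow>
    \<bar>(LINT x|lborel. \<Phi> (u x + h x)) - (LINT x|lborel. \<Phi> (u x)) - real m * (LINT x|lborel. u x ^ (m - 1) * h x)\<bar> \<le> K * \<epsilon>\<^sup>2"
proof -
  obtain D where D: "D > 0" "\<And>v. v \<in> HH \<Longrightarrow> integrable lborel (\<lambda>x. \<bar>v x\<bar> ^ m) \<and> Nm m v \<le> D * hn v ^ m"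
    using embedding[OF m] by blast
  have \<Phi>_int: "integrable lborel (\<lambda>x. \<Phi> (v x))" if v: "v \<in> HH" for v
  proof (rule Bochner_Integration.integrable_bound)
    note [measurable] = HH_measurable[OF v]
    show "integrable lborel (\<lambda>x. \<bar>v x\<bar> ^ m)" using D(2)[OF v] by blast
    show "AE x in lborel. norm (\<Phi> (v x)) \<le> norm (\<bar>v x\<bar> ^ m)" using \<Phi> by simp
    show "(\<lambda>x. \<Phi> (v x)) \<in> borel_measurable lborel" by measurable
  qed
  \<comment> \<open>Bounds \<open>hn\<close> of |u| + |g| when hn g \<le> 1, by
    \<open>hn_add_sq\<close>.\<close>
  define B where "B = sqrt (2 * (hn u)\<^sup>2 + 2)"
  define K where "K = C * (D * B ^ m)"
  have K: "K \<ge> 0" using C(1) D(1) by (simp add: K_def B_def)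
  have "\<bar>(LINT x|lborel. \<Phi> (u x + h x)) - (LINT x|lborel. \<Phi> (u x)) - real m * (LINT x|lborel. u x ^ (m - 1) * h x)\<bar> \<le> K * \<epsilon>\<^sup>2"
    if h: "h \<in> HH" and \<epsilon>: "0 < \<epsilon>" "\<epsilon> \<le> 1" "hn h \<le> \<epsilon>" for h \<epsilon>
  proof -
    \<comment> \<open>With h = \<epsilon> g the factor h^2 of the remainder supplies \<epsilon>^2,
      and as \<epsilon> \<le> 1 the other factors are dominated by powers of |u| + |g|.\<close>
    define g where "g x = (1 / \<epsilon>) * h x" for x
    have g: "g \<in> HH" unfolding g_def[abs_def] by (rule HH_scale[OF h])
    have hg: "h x = \<epsilon> * g x" for x using \<epsilon> by (simp add: g_def)
    have hng: "hn g \<le> 1" unfolding g_def[abs_def] hn_scale using \<epsilon> by (simp add: field_simps)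
    define w where "w x = \<bar>u x\<bar> + \<bar>g x\<bar>" for x
    have w: "w \<in> HH" unfolding w_def[abs_def] by (intro HH_add HH_abs u g)
    have hn_abs: "hn (\<lambda>x. \<bar>v x\<bar>) \<le> hn v" if "v \<in> HH" for v
      unfolding hn_def using HH_abs(2)[OF that] by (simp add: ms_abs)
    have "(hn w)\<^sup>2 \<le> 2 * (hn (\<lambda>x. \<bar>u x\<bar>))\<^sup>2 + 2 * (hn (\<lambda>x. \<bar>g x\<bar>))\<^sup>2"
      unfolding w_def[abs_def] by (intro hn_add_sq HH_abs u g)
    also have "\<dots> \<le> 2 * (hn u)\<^sup>2 + 2 * 1\<^sup>2"
      using hn_abs[OF u] hn_abs[OF g] hng by (intro add_mono mult_left_mono power_mono) auto
    finally have "hn w \<le> B" unfolding B_def by (intro real_le_rsqrt) simp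
    have "Nm m w \<le> D * hn w ^ m" using D(2)[OF w] by blast
    also have "\<dots> \<le> D * B ^ m" using D(1) \<open>hn w \<le> B\<close> by (intro mult_left_mono power_mono) auto
    finally have NW: "Nm m w \<le> D * B ^ m" .
    have uh: "integrable lborel (\<lambda>x. u x ^ (m - 1) * h x)" using m by (intro mixed_power_integrable u h) simp
    have "(LINT x|lborel. \<Phi> (u x + h x)) - (LINT x|lborel. \<Phi> (u x)) - real m * (LINT x|lborel. u x ^ (m - 1) * h x)
      = (LINT x|lborel. \<Phi> (u x + h x) - \<Phi> (u x) - real m * (u x ^ (m - 1) * h x))"
      using \<Phi>_int[OF HH_add[OF u h]] \<Phi>_int[OF u] uh by simp
    also have "\<bar>\<dots>\<bar> \<le> (LINT x|lborel. norm (\<Phi> (u x + h x) - \<Phi> (u x) - real m * (u x ^ (m - 1) * h x)))"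
      using integral_norm_bound[of lborel "\<lambda>x. \<Phi> (u x + h x) - \<Phi> (u x) - real m * (u x ^ (m - 1) * h x)"] by (simp only: real_norm_def)
    also have "\<dots> \<le> (LINT x|lborel. C * \<epsilon>\<^sup>2 * \<bar>w x\<bar> ^ m)"
    proof (rule integral_mono)
      show "integrable lborel (\<lambda>x. norm (\<Phi> (u x + h x) - \<Phi> (u x) - real m * (u x ^ (m - 1) * h x)))"
        using \<Phi>_int[OF HH_add[OF u h]] \<Phi>_int[OF u] uh by simp
      show "integrable lborel (\<lambda>x. C * \<epsilon>\<^sup>2 * \<bar>w x\<bar> ^ m)" using D(2)[OF w] by simp
      fix x
      have "\<bar>h x\<bar> \<le> \<bar>g x\<bar>" unfolding hg abs_mult using \<epsilon> by (simp add: mult_left_le_one_le)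
      then have "\<bar>\<Phi> (u x + h x) - \<Phi> (u x) - real m * u x ^ (m - 1) * h x\<bar> \<le> C * (h x)\<^sup>2 * w x ^ (m - 2)"
        using C(1) by (intro order.trans[OF C(2)] mult_left_mono power_mono) (auto simp: w_def)
      also have "\<dots> = C * \<epsilon>\<^sup>2 * ((g x)\<^sup>2 * w x ^ (m - 2))" by (simp add: hg power_mult_distrib)
      also have "\<dots> \<le> C * \<epsilon>\<^sup>2 * ((w x)\<^sup>2 * w x ^ (m - 2))"
        using C(1) by (intro mult_left_mono mult_right_mono) (auto simp: w_def abs_le_square_iff[symmetric])
      also have "(w x)\<^sup>2 * w x ^ (m - 2) = \<bar>w x\<bar> ^ m"
      proof -
        have "2 + (m - 2) = m" using m by simp
        then have "(w x)\<^sup>2 * w x ^ (m - 2) = w x ^ m" by (simp only: power_add[symmetric])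
        moreover have "\<bar>w x\<bar> = w x" by (simp add: w_def)
        ultimately show ?thesis by simp
      qed
      finally show "norm (\<Phi> (u x + h x) - \<Phi> (u x) - real m * (u x ^ (m - 1) * h x)) \<le> C * \<epsilon>\<^sup>2 * \<bar>w x\<bar> ^ m"
        by (simp add: mult.assoc)
    qed
    also have "\<dots> = (C * \<epsilon>\<^sup>2) * Nm m w" by (simp add: Nm_def)
    also have "\<dots> \<le> (C * \<epsilon>\<^sup>2) * (D * B ^ m)" using NW C(1) by (intro mult_left_mono) auto
    also have "\<dots> = K * \<epsilon>\<^sup>2" by (simp add: K_def)
    finally show ?thesis .
  qed
  then show ?thesis using K by blast
qed

lemma Nm_expand:
  assumes u: "u \<in> HH" and nn: "\<And>x. 0 \<le> u x" and m: "2 \<le> m"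
  shows "\<exists>K\<ge>0. \<forall>h\<in>HH. \<forall>\<epsilon>. 0 < \<epsilon> \<longrightarrow> \<epsilon> \<le> 1 \<longrightarrow> hn h \<le> \<epsilon> \<longrightarrow>
    \<bar>Nm m (\<lambda>x. u x + h x) - Nm m u - real m * (LINT x|lborel. u x ^ (m - 1) * h x)\<bar> \<le> K * \<epsilon>\<^sup>2"
proof -
  obtain C where C: "C \<ge> 0" "\<And>s k :: real. 0 \<le> s \<Longrightarrow> \<bar>\<bar>s + k\<bar> ^ m - \<bar>s\<bar> ^ m - real m * s ^ (m - 1) * k\<bar> \<le> C * k\<^sup>2 * (\<bar>s\<bar> + \<bar>k\<bar>) ^ (m - 2)"
    using abs_power_remainder[OF m] by blast
  show ?thesis unfolding Nm_def
    by (rule functional_expand[OF u m _ _ C(1) C(2)[OF nn]]) auto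
qed

lemma signed_expand:
  assumes u: "u \<in> HH" and m: "2 \<le> m"
  shows "\<exists>K\<ge>0. \<forall>h\<in>HH. \<forall>\<epsilon>. 0 < \<epsilon> \<longrightarrow> \<epsilon> \<le> 1 \<longrightarrow> hn h \<le> \<epsilon> \<longrightarrow>
    \<bar>(LINT x|lborel. (u x + h x) ^ m) - (LINT x|lborel. u x ^ m) - real m * (LINT x|lborel. u x ^ (m - 1) * h x)\<bar> \<le> K * \<epsilon>\<^sup>2"
proof -
  obtain C where C: "C \<ge> 0" "\<And>s k :: real. \<bar>(s + k) ^ m - s ^ m - real m * s ^ (m - 1) * k\<bar> \<le> C * k\<^sup>2 * (\<bar>s\<bar> + \<bar>k\<bar>) ^ (m - 2)"
    using power_remainder[OF m] by blast
  show ?thesis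
    by (rule functional_expand[OF u m, where \<Phi> = "\<lambda>s. s ^ m", OF _ _ C(1) C(2)]) (auto simp: power_abs)
qed

text \<open>The common shape of all objectives and constraints, so that existence and the multiplier
  rule are proved once.\<close>

definition fn :: "real \<Rightarrow> real \<Rightarrow> real \<Rightarrow> real \<Rightarrow> nat \<Rightarrow> nat \<Rightarrow> (real \<Rightarrow> real) \<Rightarrow> real" where
  "fn a b c d p q u = a * gs u + b * ms u + c * Nm (p + 1) u + d * Nm (q + 1) u"

text \<open>The derivative of \<open>fn\<close> at a nonnegative \<open>u\<close>; for other
  \<open>u\<close> the derivative of |u|^m would involve the sign of \<open>u\<close>.\<close>

definition dfn :: "real \<Rightarrow> real \<Rightarrow> real \<Rightarrow> real \<Rightarrow> nat \<Rightarrow> nat \<Rightarrow> (real \<Rightarrow> real) \<Rightarrow> (real \<Rightarrow> real) \<Rightarrow> real" where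
  "dfn a b c d p q u h = 2 * a * bil u h + 2 * b * dot u h
     + c * (real (p + 1) * (LINT x|lborel. u x ^ p * h x)) + d * (real (q + 1) * (LINT x|lborel. u x ^ q * h x))"

lemma dfn_linear:
  assumes u: "u \<in> HH" and h: "h \<in> HH" "k \<in> HH" and pq: "1 \<le> p" "1 \<le> q"
  shows "dfn a b c d p q u (\<lambda>x. h x + t * k x) = dfn a b c d p q u h + t * dfn a b c d p q u k"
proof -
  have k': "(\<lambda>x. t * k x) \<in> HH" by (rule HH_scale[OF h(2)])
  have "(LINT x|lborel. u x ^ m * (h x + t * k x)) = (LINT x|lborel. u x ^ m * h x) + t * (LINT x|lborel. u x ^ m * k x)"
    if "1 \<le> m" for m
  proof -
    have "(LINT x|lborel. u x ^ m * (h x + t * k x)) = (LINT x|lborel. u x ^ m * h x + t * (u x ^ m * k x))"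
      by (intro Bochner_Integration.integral_cong) (auto simp: algebra_simps)
    then show ?thesis using mixed_power_integrable[OF u h(1) that] mixed_power_integrable[OF u h(2) that] by simp
  qed
  from this[OF pq(1)] this[OF pq(2)]
  have i: "(LINT x|lborel. u x ^ p * (h x + t * k x)) = (LINT x|lborel. u x ^ p * h x) + t * (LINT x|lborel. u x ^ p * k x)"
    "(LINT x|lborel. u x ^ q * (h x + t * k x)) = (LINT x|lborel. u x ^ q * h x) + t * (LINT x|lborel. u x ^ q * k x)" .
  have "dot u (\<lambda>x. h x + t * k x) = (LINT x|lborel. u x * h x + t * (u x * k x))"
    unfolding dot_def by (intro Bochner_Integration.integral_cong) (auto simp: algebra_simps)
  then have "dot u (\<lambda>x. h x + t * k x) = dot u h + t * dot u k"
    using dot_integrable[OF u h(1)] dot_integrable[OF u h(2)] by (simp add: dot_def)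
  moreover have "bil u (\<lambda>x. h x + t * k x) = bil u h + t * bil u k"
    using bil_add[OF u h(1) k'] by (simp add: bil_scale)
  ultimately show ?thesis unfolding dfn_def i by (simp add: algebra_simps)
qed

lemma dfn_scale:
  assumes u: "u \<in> HH" and h: "h \<in> HH" and pq: "1 \<le> p" "1 \<le> q"
  shows "dfn a b c d p q u (\<lambda>x. t * h x) = t * dfn a b c d p q u h"
  using dfn_linear[OF u HH_scale[OF h, of 0] h pq, of a b c d t] dfn_linear[OF u h h pq, of a b c d "-1"]
  by simp

lemma fn_expand:
  assumes u: "u \<in> HH" and nn: "\<And>x. 0 \<le> u x" and pq: "1 \<le> p" "1 \<le> q"
  shows "\<exists>K\<ge>0. \<forall>h\<in>HH. \<forall>\<epsilon>. 0 < \<epsilon> \<longrightarrow> \<epsilon> \<le> 1 \<longrightarrow> hn h \<le> \<epsilon> \<longrightarrow>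
    \<bar>fn a b c d p q (\<lambda>x. u x + h x) - fn a b c d p q u - dfn a b c d p q u h\<bar> \<le> K * \<epsilon>\<^sup>2"
proof -
  obtain K1 where K1: "K1 \<ge> 0" "\<And>h \<epsilon>. h \<in> HH \<Longrightarrow> 0 < \<epsilon> \<Longrightarrow> \<epsilon> \<le> 1 \<Longrightarrow> hn h \<le> \<epsilon> \<Longrightarrow>
    \<bar>Nm (p + 1) (\<lambda>x. u x + h x) - Nm (p + 1) u - real (p + 1) * (LINT x|lborel. u x ^ p * h x)\<bar> \<le> K1 * \<epsilon>\<^sup>2"
    using Nm_expand[OF u nn, of "p + 1"] pq by auto
  obtain K2 where K2: "K2 \<ge> 0" "\<And>h \<epsilon>. h \<in> HH \<Longrightarrow> 0 < \<epsilon> \<Longrightarrow> \<epsilon> \<le> 1 \<Longrightarrow> hn h \<le> \<epsilon> \<Longrightarrow>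
    \<bar>Nm (q + 1) (\<lambda>x. u x + h x) - Nm (q + 1) u - real (q + 1) * (LINT x|lborel. u x ^ q * h x)\<bar> \<le> K2 * \<epsilon>\<^sup>2"
    using Nm_expand[OF u nn, of "q + 1"] pq by auto
  define K where "K = \<bar>a\<bar> + \<bar>b\<bar> + \<bar>c\<bar> * K1 + \<bar>d\<bar> * K2"
  have "\<bar>fn a b c d p q (\<lambda>x. u x + h x) - fn a b c d p q u - dfn a b c d p q u h\<bar> \<le> K * \<epsilon>\<^sup>2"
    if h: "h \<in> HH" and \<epsilon>: "0 < \<epsilon>" "\<epsilon> \<le> 1" "hn h \<le> \<epsilon>" for h \<epsilon>
  proof -
    define P where "P = Nm (p + 1) (\<lambda>x. u x + h x) - Nm (p + 1) u - real (p + 1) * (LINT x|lborel. u x ^ p * h x)"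
    define Q where "Q = Nm (q + 1) (\<lambda>x. u x + h x) - Nm (q + 1) u - real (q + 1) * (LINT x|lborel. u x ^ q * h x)"
    have e2: "(hn h)\<^sup>2 \<le> \<epsilon>\<^sup>2" using \<epsilon> by (intro power_mono) auto
    have g: "\<bar>gs h\<bar> \<le> \<epsilon>\<^sup>2" "\<bar>ms h\<bar> \<le> \<epsilon>\<^sup>2" using gs_le_hn[of h] ms_le_hn[of h] e2 by auto
    have "fn a b c d p q (\<lambda>x. u x + h x) - fn a b c d p q u - dfn a b c d p q u h = (a * gs h + b * ms h) + (c * P + d * Q)"
      unfolding fn_def dfn_def P_def Q_def gs_add[OF u h] ms_add[OF u h] by (simp only: algebra_simps)
    also have "\<bar>\<dots>\<bar> \<le> (\<bar>a\<bar> * \<bar>gs h\<bar> + \<bar>b\<bar> * \<bar>ms h\<bar>) + (\<bar>c\<bar> * \<bar>P\<bar> + \<bar>d\<bar> * \<bar>Q\<bar>)"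
      by (intro order.trans[OF abs_triangle_ineq] add_mono) (simp_all add: abs_mult)
    also have "\<dots> \<le> (\<bar>a\<bar> * \<epsilon>\<^sup>2 + \<bar>b\<bar> * \<epsilon>\<^sup>2) + (\<bar>c\<bar> * (K1 * \<epsilon>\<^sup>2) + \<bar>d\<bar> * (K2 * \<epsilon>\<^sup>2))"
      unfolding P_def Q_def by (intro add_mono mult_left_mono g K1 K2 h \<epsilon>) auto
    also have "\<dots> = K * \<epsilon>\<^sup>2" by (simp add: K_def algebra_simps)
    finally show ?thesis .
  qed
  moreover have "K \<ge> 0" using K1 K2 by (simp add: K_def)
  ultimately show ?thesis by blast
qed

lemma fn_direction:
  assumes u: "u \<in> HH" and nn: "\<And>x. 0 \<le> u x" and pq: "1 \<le> p" "1 \<le> q" and h: "h \<in> HH"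
  shows "\<exists>K\<ge>0. \<exists>\<delta>>0. \<forall>e. 0 < e \<longrightarrow> e < \<delta> \<longrightarrow>
    \<bar>fn a b c d p q (\<lambda>x. u x + e * h x) - fn a b c d p q u - e * dfn a b c d p q u h\<bar> \<le> K * e\<^sup>2"
proof -
  obtain K where K: "K \<ge> 0" "\<And>h \<epsilon>. h \<in> HH \<Longrightarrow> 0 < \<epsilon> \<Longrightarrow> \<epsilon> \<le> 1 \<Longrightarrow> hn h \<le> \<epsilon> \<Longrightarrow>
    \<bar>fn a b c d p q (\<lambda>x. u x + h x) - fn a b c d p q u - dfn a b c d p q u h\<bar> \<le> K * \<epsilon>\<^sup>2"
    using fn_expand[OF u nn pq] by blast
  define r where "r = hn h + 1"
  have r: "r > 0" "hn h \<le> r" using hn_nonneg[of h] by (auto simp: r_def intro: add_nonneg_pos)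
  have "\<bar>fn a b c d p q (\<lambda>x. u x + e * h x) - fn a b c d p q u - e * dfn a b c d p q u h\<bar> \<le> (K * r\<^sup>2) * e\<^sup>2"
    if e: "0 < e" "e < 1 / r" for e
  proof -
    have "\<bar>fn a b c d p q (\<lambda>x. u x + e * h x) - fn a b c d p q u - dfn a b c d p q u (\<lambda>x. e * h x)\<bar> \<le> K * (e * r)\<^sup>2"
      using e r by (intro K HH_scale h) (auto simp: hn_scale field_simps intro: mult_right_mono)
    then show ?thesis unfolding dfn_scale[OF u h pq] by (simp add: power_mult_distrib mult_ac)
  qed
  moreover have "K * r\<^sup>2 \<ge> 0" "1 / r > 0" using K r by auto
  ultimately show ?thesis by blast
qed

section \<open>Constrained minimisation\<close>

lemma quadratic_small:
  fixes K :: real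
  assumes "K \<ge> 0" "s > 0"
  shows "\<exists>\<delta>>0. \<forall>e. 0 < e \<longrightarrow> e < \<delta> \<longrightarrow> K * e\<^sup>2 \<le> s * e"
proof (intro exI conjI allI impI)
  show "s / (K + 1) > 0" using assms by simp
  fix e assume e: "0 < e" "e < s / (K + 1)"
  then have "e * (K + 1) < s" using assms by (simp add: pos_less_divide_eq)
  then have "K * e \<le> s" using e assms by (simp add: algebra_simps)
  then have "(K * e) * e \<le> s * e" using e by (intro mult_right_mono) auto
  then show "K * e\<^sup>2 \<le> s * e" by (simp add: power2_eq_square mult.assoc)
qed

text \<open>The minimiser is nonnegative but competitors may change sign. Every direction is thus
  admissible, which yields an equation and not merely a variational inequality.\<close>

locale constrained_minimiser =
  fixes f1 f2 f3 f4 e1 e2 e3 e4 :: real and p q :: nat and u :: "real \<Rightarrow> real"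
  assumes pq: "1 \<le> p" "1 \<le> q" and u: "u \<in> HH" and nn: "\<And>x. 0 \<le> u x"
    and ms_pos: "0 < ms u" and feasible: "fn e1 e2 e3 e4 p q u \<le> 0"
    and minimal: "\<And>v. v \<in> HH \<Longrightarrow> 0 < ms v \<Longrightarrow> fn e1 e2 e3 e4 p q v \<le> 0 \<Longrightarrow> fn f1 f2 f3 f4 p q u \<le> fn f1 f2 f3 f4 p q v"
begin

abbreviation "F \<equiv> fn f1 f2 f3 f4 p q"
abbreviation "E \<equiv> fn e1 e2 e3 e4 p q"
abbreviation "dF \<equiv> dfn f1 f2 f3 f4 p q u"
abbreviation "dE \<equiv> dfn e1 e2 e3 e4 p q u"

text \<open>A direction in which the constraint decreases to first order stays feasible for small
  steps, the remainder being quadratic; the objective cannot then decrease to first order.\<close>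

lemma descent:
  assumes h: "h \<in> HH" and neg: "dE h < 0" shows "0 \<le> dF h"
proof (rule ccontr)
  assume "\<not> 0 \<le> dF h"
  then have Fneg: "dF h < 0" by simp
  obtain KE \<delta>E where KE: "KE \<ge> 0" "\<delta>E > 0" "\<And>e. 0 < e \<Longrightarrow> e < \<delta>E \<Longrightarrow> \<bar>E (\<lambda>x. u x + e * h x) - E u - e * dE h\<bar> \<le> KE * e\<^sup>2"
    using fn_direction[OF u nn pq h] by metis
  obtain KF \<delta>F where KF: "KF \<ge> 0" "\<delta>F > 0" "\<And>e. 0 < e \<Longrightarrow> e < \<delta>F \<Longrightarrow> \<bar>F (\<lambda>x. u x + e * h x) - F u - e * dF h\<bar> \<le> KF * e\<^sup>2"
    using fn_direction[OF u nn pq h] by metis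
  obtain a where a: "a > 0" "\<And>e. 0 < e \<Longrightarrow> e < a \<Longrightarrow> KE * e\<^sup>2 \<le> - dE h * e"
    using quadratic_small[OF KE(1), of "- dE h"] neg by auto
  obtain b where b: "b > 0" "\<And>e. 0 < e \<Longrightarrow> e < b \<Longrightarrow> KF * e\<^sup>2 \<le> (- dF h / 2) * e"
    using quadratic_small[OF KF(1), of "- dF h / 2"] Fneg by auto
  \<comment> \<open>The mass along the segment; by continuity it stays positive for small steps, as
    membership in the competing class requires.\<close>
  define g where "g e = ms u + 2 * e * dot u h + e\<^sup>2 * ms h" for e
  have "(g \<longlongrightarrow> ms u + 2 * 0 * dot u h + 0\<^sup>2 * ms h) (at_right 0)"
    unfolding g_def by (intro tendsto_intros)
  then have "\<forall>\<^sub>F e in at_right 0. 0 < g e" using ms_pos by (intro order_tendstoD(1)) auto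
  then obtain r where r: "r > 0" "\<And>e. 0 < e \<Longrightarrow> e < r \<Longrightarrow> 0 < g e"
    unfolding eventually_at_right_field by auto
  define e where "e = min (min \<delta>E \<delta>F) (min (min a b) r) / 2"
  have e: "0 < e" "e < \<delta>E" "e < \<delta>F" "e < a" "e < b" "e < r"
    using KE(2) KF(2) a(1) b(1) r(1) by (auto simp: e_def min_def)
  let ?v = "\<lambda>x. u x + e * h x"
  have v: "?v \<in> HH" by (rule HH_add_scale[OF u h])
  have "ms ?v = g e"
    using ms_add[OF u HH_scale[OF h, of e]] by (simp add: g_def ms_scale dot_scale)
  then have mv: "0 < ms ?v" using r(2)[OF e(1,6)] by simp
  have "E ?v \<le> E u + e * dE h + KE * e\<^sup>2" using KE(3)[OF e(1,2)] by linarith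
  also have "\<dots> \<le> E u" using a(2)[OF e(1,4)] by (simp add: algebra_simps)
  finally have "E ?v \<le> 0" using feasible by simp
  then have "F u \<le> F ?v" by (rule minimal[OF v mv])
  also have "F ?v \<le> F u + e * dF h + KF * e\<^sup>2" using KF(3)[OF e(1,3)] by linarith
  also have "\<dots> \<le> F u + e * dF h / 2" using b(2)[OF e(1,5)] by (simp add: algebra_simps)
  finally have "0 \<le> e * dF h" by simp
  then show False using e(1) Fneg by (simp add: zero_le_mult_iff)
qed

text \<open>The Karush-Kuhn-Tucker condition for one constraint. The direction \<open>k\<close> is
  the constraint qualification.\<close>

lemma multiplier:
  assumes e0: "k \<in> HH" "dE k < 0"
  shows "\<exists>l\<ge>0. \<forall>h\<in>HH. dF h + l * dE h = 0"
proof -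
  define l where "l = dF k / (- dE k)"
  have "l \<ge> 0" using descent[OF e0] e0(2) by (simp add: l_def divide_nonneg_neg)
  have zero: "0 \<le> dF h" if h: "h \<in> HH" and "dE h = 0" for h
  proof (rule field_le_epsilon)
    fix \<eta> :: real assume \<eta>: "\<eta> > 0"
    \<comment> \<open>A direction tangent to the constraint is tilted by a small multiple of
      \<open>k\<close>, which makes \<open>descent\<close> applicable; the tilt costs at most
      \<eta>.\<close>
    define t where "t = \<eta> / (dF k + 1)"
    have k0: "0 \<le> dF k" by (rule descent[OF e0])
    have t: "t > 0" using \<eta> k0 by (simp add: t_def)
    have "dE (\<lambda>x. h x + t * k x) < 0"
      using dfn_linear[OF u h e0(1) pq] that(2) t e0(2) by (simp add: mult_pos_neg)
    from descent[OF HH_add_scale[OF h e0(1)] this] have "0 \<le> dF h + t * dF k"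
      using dfn_linear[OF u h e0(1) pq] by simp
    also have "t * dF k \<le> \<eta>" using k0 \<eta> by (simp add: t_def field_simps)
    finally show "0 \<le> dF h + \<eta>" by simp
  qed
  have "dF h + l * dE h = 0" if h: "h \<in> HH" for h
  proof -
    \<comment> \<open>\<open>h\<close> is projected along \<open>k\<close> onto the kernel of
      \<open>dE\<close>. There both signs of a direction are allowed, so \<open>dF\<close>
      vanishes.\<close>
    define t where "t = - dE h / dE k"
    let ?w = "\<lambda>x. h x + t * k x"
    have w: "?w \<in> HH" by (rule HH_add_scale[OF h e0(1)])
    have "dE ?w = dE h + t * dE k" by (rule dfn_linear[OF u h e0(1) pq])
    also have "t * dE k = - dE h" using e0(2) by (simp add: t_def)
    finally have "dE ?w = 0" by simp
    moreover have "dE (\<lambda>x. -1 * ?w x) = 0" using dfn_scale[OF u w pq, of _ _ _ _ "-1"] calculation by simp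
    ultimately have "0 \<le> dF ?w" "0 \<le> dF (\<lambda>x. -1 * ?w x)" using zero w HH_scale[OF w] by blast+
    then have "dF ?w = 0" using dfn_scale[OF u w pq, of _ _ _ _ "-1"] by simp
    then have "dF h + t * dF k = 0" using dfn_linear[OF u h e0(1) pq] by simp
    then show ?thesis using e0(2) by (simp add: t_def l_def field_simps)
  qed
  then show ?thesis using \<open>l \<ge> 0\<close> by blast
qed

end

lemma ms_pos_of_Nm:
  assumes u: "u \<in> HH" and "0 < Nm m u" "0 < m" shows "0 < ms u"
proof (rule ccontr)
  assume "\<not> 0 < ms u"
  then have "ms u = 0" using ms_nonneg[of u] by linarith
  then have "AE x in lborel. (u x)\<^sup>2 = 0"
    unfolding ms_def by (subst (asm) integral_nonneg_eq_0_iff_AE[OF HH_ms_integrable[OF u]]) auto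
  then have "Nm m u = (LINT x|(lborel :: real measure). 0)"
    unfolding Nm_def using HH_measurable[OF u] assms(3) by (intro integral_cong_AE) auto
  then show False using assms by simp
qed

lemma Nm_pos_of_ms:
  assumes u: "u \<in> HH" and m: "0 < ms u" "2 \<le> m" shows "0 < Nm m u"
proof (rule ccontr)
  assume "\<not> 0 < Nm m u"
  then have "Nm m u = 0" using Nm_nonneg[of m u] by linarith
  then have "AE x in lborel. \<bar>u x\<bar> ^ m = 0"
    unfolding Nm_def by (subst (asm) integral_nonneg_eq_0_iff_AE[OF HH_power_integrable[OF u m(2)]]) auto
  then have "ms u = (LINT x|(lborel :: real measure). 0)"
    unfolding ms_def using HH_measurable[OF u] by (intro integral_cong_AE) auto
  then show False using m by simp
qed

text \<open>The direct method. Nonnegative coefficients of the quadratic terms are what Fatou and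
  rearrangement need; the power integrals converge, so their coefficients in the constraint may have
  any sign. \<open>normal\<close> replaces a competitor by one of bounded energy, for compactness,
  whose power integrals are at least \<eta>, which keeps the limit from vanishing.\<close>

lemma minimiser_exists:
  fixes f1 f2 f3 f4 e1 e2 e3 e4 :: real
  assumes f: "0 \<le> f1" "0 \<le> f2" "0 \<le> f3" "0 \<le> f4" and e: "0 \<le> e1" "0 \<le> e2" and pq: "2 \<le> p" "2 \<le> q"
    and "v0 \<in> HH" "0 < ms v0" "fn e1 e2 e3 e4 p q v0 \<le> 0"
    and normal: "\<And>v. v \<in> HH \<Longrightarrow> 0 < ms v \<Longrightarrow> fn e1 e2 e3 e4 p q v \<le> 0 \<Longrightarrow>
      \<exists>w\<in>HH. 0 < ms w \<and> fn e1 e2 e3 e4 p q w \<le> 0 \<and> fn f1 f2 f3 f4 p q w \<le> fn f1 f2 f3 f4 p q v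
        \<and> gs w + ms w \<le> A * fn f1 f2 f3 f4 p q v + B \<and> \<eta> \<le> Nm (p + 1) w + Nm (q + 1) w"
    and AB: "0 \<le> A" "0 < \<eta>"
  shows "\<exists>u\<in>HH. sdec u \<and> 0 < ms u \<and> fn e1 e2 e3 e4 p q u \<le> 0 \<and>
    (\<forall>v\<in>HH. 0 < ms v \<longrightarrow> fn e1 e2 e3 e4 p q v \<le> 0 \<longrightarrow> fn f1 f2 f3 f4 p q u \<le> fn f1 f2 f3 f4 p q v)"
proof -
  let ?F = "fn f1 f2 f3 f4 p q" and ?E = "fn e1 e2 e3 e4 p q"
  define S where "S = {v \<in> HH. 0 < ms v \<and> ?E v \<le> 0}"
  have v0: "v0 \<in> S" using assms by (simp add: S_def)
  have F0: "0 \<le> ?F v" for v using f by (simp add: fn_def)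
  define d where "d = Inf (?F ` S)"
  have bdd: "bdd_below (?F ` S)" using F0 by (intro bdd_belowI[of _ 0]) auto
  have d_le: "d \<le> ?F v" if "v \<in> S" for v unfolding d_def using that bdd by (intro cInf_lower) auto
  have "\<exists>v\<in>S. ?F v < d + 1 / real (Suc n)" for n
  proof -
    have "Inf (?F ` S) < d + 1 / real (Suc n)" unfolding d_def by simp
    then show ?thesis using cInf_less_iff[OF _ bdd] v0 by auto
  qed
  then obtain v where v: "\<And>n. v n \<in> S" "\<And>n. ?F (v n) < d + 1 / real (Suc n)" by metis
  have "\<exists>w. w \<in> S \<and> ?F w \<le> ?F (v n) \<and> gs w + ms w \<le> A * ?F (v n) + B \<and> \<eta> \<le> Nm (p + 1) w + Nm (q + 1) w" for n
    using normal[of "v n"] v(1)[of n] unfolding S_def by blast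
  then obtain w where w: "\<And>n. w n \<in> S" "\<And>n. ?F (w n) \<le> ?F (v n)" "\<And>n. gs (w n) + ms (w n) \<le> A * ?F (v n) + B"
    "\<And>n. \<eta> \<le> Nm (p + 1) (w n) + Nm (q + 1) (w n)" by metis
  have wH: "w n \<in> HH" for n using w(1) by (simp add: S_def)
  define r where "r n = srearr (w n)" for n
  have rH: "r n \<in> HH" and rd: "sdec (r n)" for n
    unfolding r_def using srearr_HH[OF wH] srearr_sdec[OF HH_L2[OF wH]] by auto
  have r_eq: "gs (r n) \<le> gs (w n)" "ms (r n) = ms (w n)" "Nm (p + 1) (r n) = Nm (p + 1) (w n)" "Nm (q + 1) (r n) = Nm (q + 1) (w n)" for n
    unfolding r_def using srearr_gs[OF wH] srearr_ms[OF HH_L2[OF wH]] Nm_srearr[OF wH] pq by auto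
  have rF: "?F (r n) \<le> ?F (w n)" and rE: "?E (r n) \<le> 0" for n
  proof -
    show "?F (r n) \<le> ?F (w n)" unfolding fn_def r_eq using r_eq(1)[of n] f by (simp add: mult_left_mono)
    have "?E (r n) \<le> ?E (w n)" unfolding fn_def r_eq using r_eq(1)[of n] e by (simp add: mult_left_mono)
    also have "\<dots> \<le> 0" using w(1)[of n] by (simp add: S_def)
    finally show "?E (r n) \<le> 0" .
  qed
  define R where "R = A * (d + 1) + B"
  have bR: "gs (r n) + ms (r n) \<le> R" for n
  proof -
    have "1 / real (Suc n) \<le> 1" by simp
    then have "?F (v n) \<le> d + 1" using v(2)[of n] by linarith
    then have "A * ?F (v n) \<le> A * (d + 1)" using AB by (intro mult_left_mono) auto
    then show ?thesis using w(3)[of n] r_eq(1,2)[of n] by (simp add: R_def)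
  qed
  \<comment> \<open>The two quadratic terms are made to converge separately, because objective and
    constraint weigh them differently.\<close>
  have "bounded (range (\<lambda>n. (gs (r n), ms (r n))))"
  proof (rule boundedI)
    fix z assume "z \<in> range (\<lambda>n. (gs (r n), ms (r n)))"
    then obtain n where z: "z = (gs (r n), ms (r n))" by auto
    have "norm z \<le> norm (gs (r n)) + norm (ms (r n))" unfolding z by (rule norm_Pair_le)
    also have "\<dots> \<le> R" using bR[of n] by simp
    finally show "norm z \<le> R" .
  qed
  from bounded_imp_convergent_subsequence[OF this]
  obtain l \<rho> where \<rho>: "strict_mono \<rho>" "((\<lambda>n. (gs (r n), ms (r n))) \<circ> \<rho>) \<longlonglongrightarrow> l" by blast
  have G: "(\<lambda>n. gs (r (\<rho> n))) \<longlonglongrightarrow> fst l" and M: "(\<lambda>n. ms (r (\<rho> n))) \<longlonglongrightarrow> snd l"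
    using tendsto_fst[OF \<rho>(2)] tendsto_snd[OF \<rho>(2)] by (auto simp: o_def)
  have rc: "(r (\<rho> n) \<longlongrightarrow> r (\<rho> n) x) (at_right x)" if "0 < x" for n x
    unfolding r_def by (rule srearr_right_continuous[OF HH_L2[OF wH] that])
  obtain \<sigma> u where \<sigma>: "strict_mono \<sigma>" and u: "u \<in> HH" "sdec u" "gs u \<le> fst l" "ms u \<le> snd l"
    and Nlim: "\<And>m. 3 \<le> m \<Longrightarrow> (\<lambda>n. Nm m (r (\<rho> (\<sigma> n)))) \<longlonglongrightarrow> Nm m u"
    using compactness[of "\<lambda>n. r (\<rho> n)", OF rH rd rc G M] by blast
  define s where "s n = r (\<rho> (\<sigma> n))" for n
  have G': "(\<lambda>n. gs (s n)) \<longlonglongrightarrow> fst l" and M': "(\<lambda>n. ms (s n)) \<longlonglongrightarrow> snd l"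
    using LIMSEQ_subseq_LIMSEQ[OF G \<sigma>] LIMSEQ_subseq_LIMSEQ[OF M \<sigma>] by (auto simp: o_def s_def)
  have N': "(\<lambda>n. Nm (p + 1) (s n)) \<longlonglongrightarrow> Nm (p + 1) u" "(\<lambda>n. Nm (q + 1) (s n)) \<longlonglongrightarrow> Nm (q + 1) u"
    using Nlim[of "p + 1"] Nlim[of "q + 1"] pq by (auto simp: s_def)
  have "\<eta> \<le> Nm (p + 1) u + Nm (q + 1) u"
    using w(4) r_eq(3,4) by (intro LIMSEQ_le_const[OF tendsto_add[OF N']]) (auto simp: s_def)
  then have "0 < Nm (p + 1) u \<or> 0 < Nm (q + 1) u" using AB(2) by linarith
  then have msu: "0 < ms u" using ms_pos_of_Nm[OF u(1)] by auto
  have Eu: "?E u \<le> 0"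
  proof -
    have "?E u \<le> e1 * fst l + e2 * snd l + e3 * Nm (p + 1) u + e4 * Nm (q + 1) u"
      unfolding fn_def using mult_left_mono[OF u(3) e(1)] mult_left_mono[OF u(4) e(2)] by linarith
    also have "\<dots> \<le> 0"
    proof (rule LIMSEQ_le_const2)
      show "(\<lambda>n. ?E (s n)) \<longlonglongrightarrow> e1 * fst l + e2 * snd l + e3 * Nm (p + 1) u + e4 * Nm (q + 1) u"
        unfolding fn_def by (intro tendsto_intros G' M' N')
    qed (use rE in \<open>auto simp: s_def\<close>)
    finally show ?thesis .
  qed
  have Fu: "?F u \<le> d"
  proof -
    have "?F u \<le> f1 * fst l + f2 * snd l + f3 * Nm (p + 1) u + f4 * Nm (q + 1) u"
      unfolding fn_def using u f by (intro add_mono mult_left_mono) auto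
    also have "\<dots> \<le> d + 0"
    proof (rule LIMSEQ_le)
      show "(\<lambda>n. ?F (s n)) \<longlonglongrightarrow> f1 * fst l + f2 * snd l + f3 * Nm (p + 1) u + f4 * Nm (q + 1) u"
        unfolding fn_def by (intro tendsto_intros G' M' N')
      show "(\<lambda>n. d + 1 / real (Suc n)) \<longlonglongrightarrow> d + 0" by (intro tendsto_intros LIMSEQ_Suc[OF lim_1_over_n])
      have "?F (s n) \<le> d + 1 / real (Suc n)" for n
      proof -
        have "n \<le> \<rho> (\<sigma> n)" using seq_suble[OF \<rho>(1), of "\<sigma> n"] seq_suble[OF \<sigma>, of n] by linarith
        then have "1 / real (Suc (\<rho> (\<sigma> n))) \<le> 1 / real (Suc n)" by (intro divide_left_mono) auto
        then show ?thesis using rF[of "\<rho> (\<sigma> n)"] w(2)[of "\<rho> (\<sigma> n)"] v(2)[of "\<rho> (\<sigma> n)"] unfolding s_def by linarith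
      qed
      then show "\<exists>N. \<forall>n\<ge>N. ?F (s n) \<le> d + 1 / real (Suc n)" by blast
    qed
    finally show ?thesis by simp
  qed
  have "?F u \<le> ?F v" if "v \<in> HH" "0 < ms v" "?E v \<le> 0" for v
    using Fu d_le[of v] that by (simp add: S_def)
  then show ?thesis using u msu Eu by blast
qed

section \<open>Existence of weak solutions\<close>

text \<open>In the translation form of the energy, the squared difference is of order h^2 for |h|
  \<le> 1 by the Lipschitz bound and at most four times the mass for every h; divided by h^2 this is
  dominated by a multiple of 1 / (1 + h^2).\<close>

lemma lipschitz_HH:
  assumes [measurable]: "u \<in> borel_measurable borel" and L: "0 \<le> L" "\<And>x y. \<bar>u x - u y\<bar> \<le> L * \<bar>x - y\<bar>"
    and R: "0 \<le> R" "\<And>x. R < \<bar>x\<bar> \<Longrightarrow> u x = 0"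
  shows "u \<in> HH"
proof -
  have bd: "\<bar>u x\<bar> \<le> L * (2 * R + 1)" for x
  proof (cases "\<bar>x\<bar> \<le> R")
    case True
    have "\<bar>u x\<bar> \<le> L * \<bar>x - (R + 1)\<bar>" using L(2)[of x "R + 1"] R by simp
    also have "\<dots> \<le> L * (2 * R + 1)" using True R L(1) by (intro mult_left_mono) auto
    finally show ?thesis .
  next
    case False
    then show ?thesis using L(1) R by simp
  qed
  have uL2: "u \<in> L2"
  proof -
    have "nsq u \<le> (\<integral>\<^sup>+x. ennreal ((L * (2 * R + 1))\<^sup>2) * indicator {- R..R} x \<partial>lborel)"
      unfolding nsq_def
    proof (rule nn_integral_mono)
      fix x
      have "(norm (u x))\<^sup>2 \<le> (L * (2 * R + 1))\<^sup>2" using bd[of x] by (intro power_mono) auto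
      then show "ennreal ((norm (u x))\<^sup>2) \<le> ennreal ((L * (2 * R + 1))\<^sup>2) * indicator {- R..R} x"
        using R(2)[of x] by (auto simp: indicator_def intro!: ennreal_leI)
    qed
    also have "\<dots> < \<infinity>" using R by (simp add: nn_integral_cmult_indicator ennreal_mult_less_top)
    finally show ?thesis by (simp add: L2_iff_nsq)
  qed
  define C where "C = L\<^sup>2 * (2 * R + 2) + 4 * ms u"
  have C: "0 \<le> C" using R by (simp add: C_def)
  have tr: "nsq (\<lambda>x. u (h + x) - u x) \<le> ennreal (L\<^sup>2 * (2 * R + 2) * h\<^sup>2)" if h: "\<bar>h\<bar> \<le> 1" for h
  proof -
    have "nsq (\<lambda>x. u (h + x) - u x) \<le> (\<integral>\<^sup>+x. ennreal (L\<^sup>2 * h\<^sup>2) * indicator {- (R + 1)..R + 1} x \<partial>lborel)"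
      unfolding nsq_def
    proof (rule nn_integral_mono)
      fix x
      have "\<bar>u (h + x) - u x\<bar> \<le> \<bar>L * h\<bar>" using L(2)[of "h + x" x] L(1) by (simp add: abs_mult)
      then have "(norm (u (h + x) - u x))\<^sup>2 \<le> (L * h)\<^sup>2" by (simp add: abs_le_square_iff)
      moreover have "u (h + x) - u x = 0" if "x \<notin> {- (R + 1)..R + 1}" using R(2)[of x] R(2)[of "h + x"] that h by auto
      ultimately show "ennreal ((norm (u (h + x) - u x))\<^sup>2) \<le> ennreal (L\<^sup>2 * h\<^sup>2) * indicator {- (R + 1)..R + 1} x"
        by (auto simp: indicator_def power_mult_distrib intro!: ennreal_leI)
    qed
    also have "\<dots> = ennreal (L\<^sup>2 * h\<^sup>2) * ennreal (2 * R + 2)"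
      using R by (subst nn_integral_cmult_indicator) (auto simp: algebra_simps)
    also have "\<dots> = ennreal ((L\<^sup>2 * h\<^sup>2) * (2 * R + 2))" using R by (intro ennreal_mult[symmetric]) auto
    also have "(L\<^sup>2 * h\<^sup>2) * (2 * R + 2) = L\<^sup>2 * (2 * R + 2) * h\<^sup>2" by simp
    finally show ?thesis .
  qed
  have tr2: "nsq (\<lambda>x. u (h + x) - u x) \<le> ennreal (4 * ms u)" for h
  proof -
    have "nsq (\<lambda>x. u (h + x) + - u x) \<le> 2 * nsq (\<lambda>x. u (h + x)) + 2 * nsq (\<lambda>x. - u x)"
      by (rule nsq_add_le) measurable
    also have "nsq (\<lambda>x. u (h + x)) = nsq u"
      unfolding nsq_def using nn_integral_real_affine[of "\<lambda>x. ennreal ((norm (u x))\<^sup>2)" 1 h] by simp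
    also have "2 * nsq u + 2 * nsq (\<lambda>x. - u x) = ennreal (4 * ms u)"
      by (simp add: nsq_ms[OF uL2] flip: ennreal_plus ennreal_numeral ennreal_mult')
    finally show ?thesis by simp
  qed
  have "gn u \<le> (\<integral>\<^sup>+h. ennreal (2 * C * inverse (1 + h\<^sup>2)) \<partial>lborel)"
    unfolding gn_translates[OF assms(1)]
  proof (rule nn_integral_mono)
    fix h :: real
    show "ennreal (1 / h\<^sup>2) * nsq (\<lambda>x. u (h + x) - u x) \<le> ennreal (2 * C * inverse (1 + h\<^sup>2))"
    proof (cases "h = 0")
      case False
      then have h2: "0 < h\<^sup>2" by simp
      have "ennreal (1 / h\<^sup>2) * nsq (\<lambda>x. u (h + x) - u x) \<le> ennreal (C * min 1 (1 / h\<^sup>2))"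
      proof (cases "\<bar>h\<bar> \<le> 1")
        case True
        then have "h\<^sup>2 \<le> 1" by (simp add: abs_square_le_1)
        then have m: "min 1 (1 / h\<^sup>2) = 1" using h2 by (simp add: min_def field_simps)
        have "ennreal (1 / h\<^sup>2) * nsq (\<lambda>x. u (h + x) - u x) \<le> ennreal (1 / h\<^sup>2) * ennreal (L\<^sup>2 * (2 * R + 2) * h\<^sup>2)"
          by (intro mult_left_mono tr True) simp
        also have "\<dots> = ennreal (L\<^sup>2 * (2 * R + 2))" using h2 R by (simp flip: ennreal_mult)
        also have "\<dots> \<le> ennreal (C * min 1 (1 / h\<^sup>2))" unfolding m C_def by (intro ennreal_leI) simp
        finally show ?thesis .
      next
        case False
        then have "1 \<le> h\<^sup>2" using abs_le_square_iff[of 1 h] by simp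
        then have m: "min 1 (1 / h\<^sup>2) = 1 / h\<^sup>2" using h2 by (simp add: min_def field_simps)
        have "ennreal (1 / h\<^sup>2) * nsq (\<lambda>x. u (h + x) - u x) \<le> ennreal (1 / h\<^sup>2) * ennreal (4 * ms u)"
          by (intro mult_left_mono tr2) simp
        also have "\<dots> = ennreal (4 * ms u * (1 / h\<^sup>2))" by (simp add: mult_ac flip: ennreal_mult)
        also have "\<dots> \<le> ennreal (C * min 1 (1 / h\<^sup>2))" unfolding m C_def using R by (intro ennreal_leI mult_right_mono) auto
        finally show ?thesis .
      qed
      also have "C * min 1 (1 / h\<^sup>2) \<le> C * (2 * inverse (1 + h\<^sup>2))"
      proof (rule mult_left_mono[OF _ C])
        have p: "0 < 1 + h\<^sup>2" using h2 by linarith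
        show "min 1 (1 / h\<^sup>2) \<le> 2 * inverse (1 + h\<^sup>2)"
        proof (cases "h\<^sup>2 \<le> 1")
          case True
          then have "1 \<le> 2 * inverse (1 + h\<^sup>2)" using p by (simp add: field_simps)
          then show ?thesis by simp
        next
          case False
          then have "1 / h\<^sup>2 \<le> 2 * inverse (1 + h\<^sup>2)" using p h2 by (simp add: field_simps)
          then show ?thesis by simp
        qed
      qed
      then have "ennreal (C * min 1 (1 / h\<^sup>2)) \<le> ennreal (2 * C * inverse (1 + h\<^sup>2))" by (intro ennreal_leI) simp
      finally show ?thesis .
    qed (use C in simp)
  qed
  also have "\<dots> < \<infinity>"
  proof -
    have "integrable lborel (\<lambda>s::real. inverse (1 + s\<^sup>2))"
      using integrable_inverse_1_plus_square by (simp add: set_integrable_def)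
    from integrable_mult_right[OF this, of "2 * C"] have "(\<integral>\<^sup>+s. ennreal (norm (2 * C * inverse (1 + s\<^sup>2 :: real))) \<partial>lborel) < \<infinity>"
      unfolding integrable_iff_bounded by blast
    moreover have "norm (2 * C * inverse (1 + s\<^sup>2)) = 2 * C * inverse (1 + s\<^sup>2)" for s :: real
      using C by (simp add: abs_mult add_nonneg_nonneg)
    ultimately show ?thesis by (simp only:)
  qed
  finally show ?thesis using uL2 by (simp add: HH_iff)
qed

text \<open>A Lipschitz substitute for a multiple of an indicator function, whose energy would be
  infinite because of its jumps.\<close>

definition plateau :: "real \<Rightarrow> real \<Rightarrow> real \<Rightarrow> real" where
  "plateau R s x = s * max 0 (min 1 (R + 1 - \<bar>x\<bar>))"

lemma plateau_bounds: "0 \<le> s \<Longrightarrow> 0 \<le> plateau R s x" "0 \<le> s \<Longrightarrow> plateau R s x \<le> s"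
  "\<bar>x\<bar> \<le> R \<Longrightarrow> plateau R s x = s" "R + 1 < \<bar>x\<bar> \<Longrightarrow> plateau R s x = 0"
  by (auto simp: plateau_def mult_left_le)

lemma plateau_measurable [measurable]: "plateau R s \<in> borel_measurable borel"
  unfolding plateau_def[abs_def] by measurable

lemma plateau_HH:
  assumes "0 \<le> R" "0 \<le> s" shows "plateau R s \<in> HH"
proof (rule lipschitz_HH[where L = s and R = "R + 1"])
  show "\<bar>plateau R s x - plateau R s y\<bar> \<le> s * \<bar>x - y\<bar>" for x y
  proof -
    define g where "g a = max 0 (min 1 (R + 1 - \<bar>a\<bar>))" for a :: real
    have m: "max 0 (min 1 a) \<le> max 0 (min 1 b) + t" if "0 \<le> t" "a \<le> b + t" for a b t :: real
      using that by (auto simp: max_def min_def)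
    have "g a \<le> g b + \<bar>a - b\<bar>" for a b
      unfolding g_def by (rule m) linarith+
    from this[of x y] this[of y x] have "\<bar>g x - g y\<bar> \<le> \<bar>x - y\<bar>" by linarith
    from mult_left_mono[OF this assms(2)] have "\<bar>s * g x - s * g y\<bar> \<le> s * \<bar>x - y\<bar>"
      unfolding right_diff_distrib[symmetric] abs_mult abs_of_nonneg[OF assms(2)] .
    moreover have "plateau R s a = s * g a" for a unfolding plateau_def g_def ..
    ultimately show ?thesis by (simp only:)
  qed
qed (use assms plateau_bounds(4) in auto)

lemma plateau_ms_pos:
  assumes "0 < R" "0 < s" shows "0 < ms (plateau R s)"
proof -
  have "0 < s\<^sup>2 * (2 * R)" using assms by simp
  also have "\<dots> = (LINT x|lborel. s\<^sup>2 * indicator {- R..R} x)" using assms by simp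
  also have "\<dots> \<le> ms (plateau R s)"
    unfolding ms_def
  proof (rule integral_mono)
    show "integrable lborel (\<lambda>x. s\<^sup>2 * indicator {- R..R} x)"
      by (intro integrable_mult_right integrable_real_indicator) (auto simp: emeasure_lborel_Icc_eq)
    show "integrable lborel (\<lambda>x. (plateau R s x)\<^sup>2)" using plateau_HH[of R s] assms by (intro HH_ms_integrable) auto
    show "s\<^sup>2 * indicator {- R..R} x \<le> (plateau R s x)\<^sup>2" for x
      using plateau_bounds(3)[of x R s] by (auto simp: indicator_def)
  qed
  finally show ?thesis .
qed

text \<open>For t \<ge> 1 the two lower terms are at most t^q times A + P, and t Q \<ge> A + P lets
  the top term dominate.\<close>

lemma nehari_feasible:
  fixes A P Q a :: real
  assumes "0 \<le> A" "0 \<le> P" "0 < Q" "\<bar>a\<bar> \<le> 1" "1 \<le> p" "p < q"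
  shows "\<exists>t>0. t\<^sup>2 * A + a * (t ^ (p + 1) * P) - t ^ (q + 1) * Q \<le> 0"
proof -
  define t where "t = max 1 ((A + P) / Q)"
  have t: "1 \<le> t" "A + P \<le> t * Q" using assms by (auto simp: t_def max_def field_simps)
  have "t\<^sup>2 * A \<le> t ^ q * A" using t assms by (intro mult_right_mono power_increasing) auto
  moreover have "a * (t ^ (p + 1) * P) \<le> 1 * (t ^ q * P)"
  proof (rule mult_mono)
    show "t ^ (p + 1) * P \<le> t ^ q * P" using t assms by (intro mult_right_mono power_increasing) auto
  qed (use t assms in auto)
  moreover have "t ^ q * (A + P) \<le> t ^ q * (t * Q)" using t by (intro mult_left_mono) auto
  ultimately have "t\<^sup>2 * A + a * (t ^ (p + 1) * P) - t ^ (q + 1) * Q \<le> 0" by (simp add: algebra_simps)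
  then show ?thesis using t by (intro exI[of _ t]) auto
qed

text \<open>The weak equation for a profile of either sign: \<open>a\<close> and \<open>b\<close>
  absorb the signs that the powers acquire when the profile is multiplied by -1, see
  \<open>SP_solution_of_weq\<close>.\<close>

definition weq :: "real \<Rightarrow> real \<Rightarrow> real \<Rightarrow> nat \<Rightarrow> nat \<Rightarrow> (real \<Rightarrow> real) \<Rightarrow> bool" where
  "weq c a b p q u \<longleftrightarrow> (\<forall>h\<in>HH. kap * bil u h + c * dot u h
     + a * (LINT x|lborel. u x ^ p * h x) - b * (LINT x|lborel. u x ^ q * h x) = 0)"

lemma fn_scale: "fn a b c d p q (\<lambda>x. t * u x) = t\<^sup>2 * (a * gs u + b * ms u) + c * (\<bar>t\<bar> ^ (p + 1) * Nm (p + 1) u) + d * (\<bar>t\<bar> ^ (q + 1) * Nm (q + 1) u)"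
  by (simp only: fn_def gs_scale ms_scale Nm_scale) (simp add: algebra_simps)

lemma dfn_self:
  assumes "\<And>x. 0 \<le> u x"
  shows "dfn a b c d p q u u = 2 * (a * gs u + b * ms u) + c * (real (p + 1) * Nm (p + 1) u) + d * (real (q + 1) * Nm (q + 1) u)"
proof -
  have "(LINT x|lborel. u x ^ m * u x) = Nm (m + 1) u" for m
    using assms by (simp add: Nm_def mult.commute)
  then show ?thesis by (simp add: dfn_def bil_self dot_self algebra_simps)
qed

text \<open>
  For nonnegative functions \<open>NK\<close> is the derivative of the action in the direction of its argument, \<open>a\<close> being
  the sign of the lower order power. Subtracting \<open>NK / Nn\<close> from the action gives \<open>NI\<close>, and \<open>Nn\<close> is chosen
  such that all coefficients of \<open>NI\<close> are nonnegative.
\<close>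

definition NK :: "real \<Rightarrow> real \<Rightarrow> nat \<Rightarrow> nat \<Rightarrow> (real \<Rightarrow> real) \<Rightarrow> real" where
  "NK c a p q = fn kap c a (-1) p q"

definition Nn :: "real \<Rightarrow> nat \<Rightarrow> nat \<Rightarrow> real" where
  "Nn a p q = (if a = 1 then real q + 1 else real p + 1)"

definition NI :: "real \<Rightarrow> real \<Rightarrow> nat \<Rightarrow> nat \<Rightarrow> (real \<Rightarrow> real) \<Rightarrow> real" where
  "NI c a p q = fn (kap * (1/2 - 1 / Nn a p q)) (c * (1/2 - 1 / Nn a p q)) (a * (1 / (real p + 1) - 1 / Nn a p q)) (1 / Nn a p q - 1 / (real q + 1)) p q"

lemma NI_NK: "NI c a p q u = kap / 2 * gs u + c / 2 * ms u + a / (real p + 1) * Nm (p + 1) u - 1 / (real q + 1) * Nm (q + 1) u - NK c a p q u / Nn a p q"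
proof -
  have "(k * (1/2 - x) * g + c * (1/2 - x) * m) + a * (y - x) * P + (x - z) * Q
      = k / 2 * g + c / 2 * m + a * y * P - z * Q - (k * g + c * m + a * P + (-1) * Q) * x" for k g m P Q x y z :: real
    by (simp add: algebra_simps)
  from this[of kap "1 / Nn a p q" "gs u" "ms u" "1 / (real p + 1)" "Nm (p + 1) u" "1 / (real q + 1)" "Nm (q + 1) u"]
  show ?thesis unfolding NI_def NK_def fn_def by simp
qed

text \<open>The constraint NK \<le> 0 survives rearrangement and limits. Equality at the minimiser
  follows from scaling, and the multiplier turns out to be 1 / Nn. This turns the derivative of
  \<open>NI\<close> back into that of the action, so no multiplier is left in the equation.\<close>

theorem nehari_minimiser:
  assumes c: "0 < c" and a: "a = 1 \<or> a = -1" and pq: "2 \<le> p" "p < q"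
  shows "\<exists>u\<in>HH. sdec u \<and> 0 < ms u \<and> NK c a p q u = 0 \<and> weq c a 1 p q u
    \<and> (\<forall>v\<in>HH. 0 < ms v \<longrightarrow> NK c a p q v \<le> 0 \<longrightarrow> NI c a p q u \<le> NI c a p q v)
    \<and> (\<forall>v\<in>HH. 0 < ms v \<longrightarrow> NK c a p q v < 0 \<longrightarrow> NI c a p q u < NI c a p q v)"
proof -
  define n where "n = Nn a p q"
  have n: "3 \<le> n" using pq by (auto simp: n_def Nn_def)
  define \<theta> where "\<theta> = 1/2 - 1/n"
  have \<theta>: "0 < \<theta>" using n by (simp add: \<theta>_def field_simps)
  define f3 where "f3 = a * (1 / (real p + 1) - 1 / n)"
  define f4 where "f4 = 1 / n - 1 / (real q + 1)"
  have f34: "0 \<le> f3" "0 \<le> f4" using a pq by (auto simp: f3_def f4_def n_def Nn_def field_simps)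
  have I_eq: "NI c a p q = fn (kap * \<theta>) (c * \<theta>) f3 f4 p q" by (simp add: NI_def \<theta>_def f3_def f4_def n_def)
  have K_eq: "NK c a p q = fn kap c a (-1) p q" by (simp add: NK_def)
  have kp: "0 < kap" by (rule kap_pos)
  define k0 where "k0 = min kap c"
  have k0: "0 < k0" "k0 \<le> kap" "k0 \<le> c" using c kp by (auto simp: k0_def)
  have coer: "k0 * (hn v)\<^sup>2 \<le> kap * gs v + c * ms v" for v
    unfolding hn_sq distrib_left using k0 by (intro add_mono mult_right_mono) auto
  have msh: "0 < hn v" if "0 < ms v" for v using that gs_nonneg[of v] unfolding hn_def by (simp add: add_nonneg_pos)
  obtain C1 where C1: "C1 > 0" "\<And>u. u \<in> HH \<Longrightarrow> Nm (p + 1) u \<le> C1 * hn u ^ (p + 1)" using embedding[of "p + 1"] pq by auto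
  obtain C2 where C2: "C2 > 0" "\<And>u. u \<in> HH \<Longrightarrow> Nm (q + 1) u \<le> C2 * hn u ^ (q + 1)" using embedding[of "q + 1"] pq by auto
  \<comment> \<open>On the constraint set the quadratic part is controlled by powers of degree at
    least 3, so \<open>hn\<close> is bounded away from 0. This gives the lower bound \<eta> of
    \<open>minimiser_exists\<close>.\<close>
  define \<rho> where "\<rho> = min 1 (k0 / (C1 + C2))"
  have \<rho>: "0 < \<rho>" using k0 C1 C2 by (simp add: \<rho>_def)
  have lower: "k0 * \<rho>\<^sup>2 \<le> Nm (p + 1) v + Nm (q + 1) v" if v: "v \<in> HH" "0 < ms v" "NK c a p q v \<le> 0" for v
  proof -
    have "- (a * Nm (p + 1) v) \<le> Nm (p + 1) v" using a Nm_nonneg[of "p + 1" v] by auto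
    then have 1: "k0 * (hn v)\<^sup>2 \<le> Nm (p + 1) v + Nm (q + 1) v"
      using coer[of v] v(3) unfolding K_eq fn_def by linarith
    have "\<rho> \<le> hn v"
    proof (cases "1 \<le> hn v")
      case True
      then show ?thesis by (simp add: \<rho>_def)
    next
      case False
      have h: "0 < hn v" "hn v \<le> 1" using msh[OF v(2)] False by auto
      have "k0 * (hn v)\<^sup>2 \<le> C1 * hn v ^ (p + 1) + C2 * hn v ^ (q + 1)" using 1 C1(2)[OF v(1)] C2(2)[OF v(1)] by linarith
      also have "\<dots> \<le> C1 * hn v ^ 3 + C2 * hn v ^ 3"
        using h C1(1) C2(1) pq by (intro add_mono mult_left_mono power_decreasing) auto
      also have "\<dots> = ((C1 + C2) * hn v) * (hn v)\<^sup>2" by (simp add: power2_eq_square power3_eq_cube algebra_simps)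
      finally have "k0 \<le> (C1 + C2) * hn v" using h by simp
      then have "k0 / (C1 + C2) \<le> hn v" using C1(1) C2(1) by (simp add: pos_divide_le_eq mult.commute)
      then show ?thesis by (simp add: \<rho>_def)
    qed
    then have "k0 * \<rho>\<^sup>2 \<le> k0 * (hn v)\<^sup>2" using \<rho> k0 by (intro mult_left_mono power_mono) auto
    then show ?thesis using 1 by linarith
  qed
  let ?v = "plateau 1 1"
  have v: "?v \<in> HH" "0 < ms ?v" using plateau_HH[of 1 1] plateau_ms_pos[of 1 1] by auto
  have vq: "0 < Nm (q + 1) ?v" using pq by (intro Nm_pos_of_ms v) auto
  have "\<exists>t>0. t\<^sup>2 * (kap * gs ?v + c * ms ?v) + a * (t ^ (p + 1) * Nm (p + 1) ?v) - t ^ (q + 1) * Nm (q + 1) ?v \<le> 0"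
    using kp c a pq vq by (intro nehari_feasible) auto
  then obtain t where t: "0 < t" "t\<^sup>2 * (kap * gs ?v + c * ms ?v) + a * (t ^ (p + 1) * Nm (p + 1) ?v) - t ^ (q + 1) * Nm (q + 1) ?v \<le> 0" by blast
  have feas: "(\<lambda>x. t * ?v x) \<in> HH" "0 < ms (\<lambda>x. t * ?v x)" "fn kap c a (-1) p q (\<lambda>x. t * ?v x) \<le> 0"
    using HH_scale[OF v(1), of t] v(2) t by (auto simp: ms_scale fn_scale)
  have I_lower: "k0 * \<theta> * (gs v + ms v) \<le> fn (kap * \<theta>) (c * \<theta>) f3 f4 p q v" for v
  proof -
    have "\<theta> * (k0 * (hn v)\<^sup>2) \<le> \<theta> * (kap * gs v + c * ms v)" using \<theta> coer[of v] by (intro mult_left_mono) auto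
    moreover have "0 \<le> f3 * Nm (p + 1) v" "0 \<le> f4 * Nm (q + 1) v" using f34 by auto
    ultimately show ?thesis unfolding fn_def hn_sq by (simp add: algebra_simps)
  qed
  have k\<theta>: "0 < k0 * \<theta>" using k0 \<theta> by simp
  have "\<exists>u\<in>HH. sdec u \<and> 0 < ms u \<and> fn kap c a (-1) p q u \<le> 0 \<and>
    (\<forall>v\<in>HH. 0 < ms v \<longrightarrow> fn kap c a (-1) p q v \<le> 0 \<longrightarrow> fn (kap * \<theta>) (c * \<theta>) f3 f4 p q u \<le> fn (kap * \<theta>) (c * \<theta>) f3 f4 p q v)"
  proof (rule minimiser_exists[where A = "1 / (k0 * \<theta>)" and B = 0 and \<eta> = "k0 * \<rho>\<^sup>2", OF _ _ f34 _ _ _ _ feas])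
    fix v assume v: "v \<in> HH" "0 < ms v" "fn kap c a (-1) p q v \<le> 0"
    have "gs v + ms v \<le> 1 / (k0 * \<theta>) * fn (kap * \<theta>) (c * \<theta>) f3 f4 p q v + 0"
      using I_lower[of v] k\<theta> by (simp add: pos_le_divide_eq mult.commute)
    then show "\<exists>w\<in>HH. 0 < ms w \<and> fn kap c a (-1) p q w \<le> 0 \<and> fn (kap * \<theta>) (c * \<theta>) f3 f4 p q w \<le> fn (kap * \<theta>) (c * \<theta>) f3 f4 p q v
        \<and> gs w + ms w \<le> 1 / (k0 * \<theta>) * fn (kap * \<theta>) (c * \<theta>) f3 f4 p q v + 0 \<and> k0 * \<rho>\<^sup>2 \<le> Nm (p + 1) w + Nm (q + 1) w"
      using v lower[of v] by (auto simp: K_eq)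
  qed (use kp c \<theta> k\<theta> k0 \<rho> pq in auto)
  then obtain u where u: "u \<in> HH" "sdec u" "0 < ms u" "NK c a p q u \<le> 0"
    and min: "\<And>v. v \<in> HH \<Longrightarrow> 0 < ms v \<Longrightarrow> NK c a p q v \<le> 0 \<Longrightarrow> NI c a p q u \<le> NI c a p q v"
    unfolding I_eq K_eq by blast
  \<comment> \<open>A strict inequality persists for t v with t slightly below 1. All terms of
    \<open>NI\<close> have nonnegative coefficients and degree at least 2, so \<open>NI\<close>
    falls at least by the factor t^2.\<close>
  have strict: "NI c a p q u < NI c a p q v" if v: "v \<in> HH" "0 < ms v" "NK c a p q v < 0" for v
  proof -
    define g where "g t = t\<^sup>2 * (kap * gs v + c * ms v) + a * (\<bar>t\<bar> ^ (p + 1) * Nm (p + 1) v) + (-1) * (\<bar>t\<bar> ^ (q + 1) * Nm (q + 1) v)" for t :: real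
    have gK: "NK c a p q (\<lambda>x. t * v x) = g t" for t unfolding K_eq fn_scale g_def ..
    have "(g \<longlongrightarrow> 1\<^sup>2 * (kap * gs v + c * ms v) + a * (\<bar>1\<bar> ^ (p + 1) * Nm (p + 1) v) + (-1) * (\<bar>1\<bar> ^ (q + 1) * Nm (q + 1) v)) (at_left 1)"
      unfolding g_def by (intro tendsto_intros)
    moreover have "1\<^sup>2 * (kap * gs v + c * ms v) + a * (\<bar>1\<bar> ^ (p + 1) * Nm (p + 1) v) + (-1) * (\<bar>1\<bar> ^ (q + 1) * Nm (q + 1) v) < 0"
      using v(3) unfolding K_eq fn_def by simp
    ultimately have "\<forall>\<^sub>F t in at_left 1. g t < 0" by (rule order_tendstoD(2))
    moreover have "\<forall>\<^sub>F t in at_left (1::real). t \<in> {0<..<1}" by (rule eventually_at_leftI[of 0]) auto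
    ultimately have "\<forall>\<^sub>F t in at_left (1::real). g t < 0 \<and> t \<in> {0<..<1}" by eventually_elim auto
    then obtain t where t: "g t < 0" "0 < t" "t < 1"
      using eventually_happens'[of "at_left (1::real)"] by (auto simp: trivial_limit_at_left_real)
    have tv: "(\<lambda>x. t * v x) \<in> HH" "0 < ms (\<lambda>x. t * v x)" using HH_scale[OF v(1)] v(2) t by (auto simp: ms_scale)
    have "NI c a p q u \<le> NI c a p q (\<lambda>x. t * v x)" using t by (intro min tv) (simp add: gK)
    also have "\<dots> \<le> t\<^sup>2 * NI c a p q v"
    proof -
      have "\<bar>t\<bar> ^ (m + 1) * Nm (m + 1) v \<le> t\<^sup>2 * Nm (m + 1) v" if "1 \<le> m" for m
        using t that power_decreasing[of 2 "m + 1" t] by (intro mult_right_mono) auto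
      from mult_left_mono[OF this[of p] f34(1)] mult_left_mono[OF this[of q] f34(2)]
      show ?thesis unfolding I_eq fn_scale fn_def using pq by (simp add: algebra_simps)
    qed
    also have "\<dots> < 1 * NI c a p q v"
    proof (rule mult_strict_right_mono)
      show "t\<^sup>2 < 1" using t by (simp add: power_less_one_iff abs_square_less_1)
      have "0 < k0 * \<theta> * (gs v + ms v)" by (rule mult_pos_pos[OF k\<theta> add_nonneg_pos[OF gs_nonneg v(2)]])
      then show "0 < NI c a p q v" using I_lower[of v] unfolding I_eq by linarith
    qed
    finally show ?thesis by simp
  qed
  have K0: "NK c a p q u = 0" using strict[OF u(1,3)] u(4) by force
  have nn: "0 \<le> u x" for x by (rule sdec_nonneg[OF u(2)])
  interpret M: constrained_minimiser "kap * \<theta>" "c * \<theta>" f3 f4 kap c a "-1" p q u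
    by unfold_locales (use u nn pq min in \<open>auto simp: I_eq K_eq\<close>)
  define P where "P = Nm (p + 1) u"
  define Q where "Q = Nm (q + 1) u"
  have Q: "0 < Q" unfolding Q_def using pq by (intro Nm_pos_of_ms u) auto
  have P: "0 \<le> P" by (simp add: P_def)
  have A: "kap * gs u + c * ms u = Q - a * P" using K0 unfolding K_eq fn_def P_def Q_def by simp
  have A0: "0 \<le> kap * gs u + c * ms u" using kp c by simp
  \<comment> \<open>On NK u = 0 the quadratic part equals Q - a P and is eliminated. For a = 1 its
    nonnegativity gives P \<le> Q, which decides the sign.\<close>
  have dE: "M.dE u = a * ((real p - 1) * P) - (real q - 1) * Q"
    unfolding dfn_self[OF nn] A P_def[symmetric] Q_def[symmetric] by (simp add: algebra_simps)
  have dEneg: "M.dE u < 0"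
  proof -
    have "(real p - 1) * Q < (real q - 1) * Q" using Q pq by simp
    moreover have "a * ((real p - 1) * P) \<le> (real p - 1) * Q"
    proof (cases "a = 1")
      case True
      then have "P \<le> Q" using A A0 by simp
      then show ?thesis using True pq by (simp add: mult_left_mono)
    next
      case False
      then have "a * ((real p - 1) * P) \<le> 0" using a P pq by simp
      also have "0 \<le> (real p - 1) * Q" using Q pq by simp
      finally show ?thesis .
    qed
    ultimately show ?thesis unfolding dE by linarith
  qed
  obtain l where l: "\<And>h. h \<in> HH \<Longrightarrow> M.dF h + l * M.dE h = 0" using M.multiplier[OF u(1) dEneg] by blast
  \<comment> \<open>The derivative of the action for this sign pattern. Testing with
    \<open>u\<close> gives dS u = NK u = 0, which determines the multiplier.\<close>
  define dS where "dS h = kap * bil u h + c * dot u h + a * (LINT x|lborel. u x ^ p * h x) - (LINT x|lborel. u x ^ q * h x)" for h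
  have dF: "M.dF h = dS h - M.dE h / n" for h
  proof -
    have i: "1 / (r + 1) * ((r + 1) * X) = X" if "0 \<le> r" for r X :: real using that by simp
    have "real (p + 1) = real p + 1" "real (q + 1) = real q + 1" by auto
    then have 3: "f3 * (real (p + 1) * X) = a * X - a * (real (p + 1) * X) / n"
      and 4: "f4 * (real (q + 1) * Y) = (real (q + 1) * Y) / n - Y" for X Y
      unfolding f3_def f4_def mult.assoc left_diff_distrib i[OF of_nat_0_le_iff] by (simp_all add: right_diff_distrib left_diff_distrib i add.commute[of 1])
    show ?thesis unfolding dfn_def dS_def 3 4 \<theta>_def
      by (simp add: left_diff_distrib right_diff_distrib add_divide_distrib diff_divide_distrib del: of_nat_add)
  qed
  have "dS u = NK c a p q u"
  proof -
    have "(LINT x|lborel. u x ^ m * u x) = Nm (m + 1) u" for m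
      using nn by (simp add: Nm_def mult.commute)
    then show ?thesis unfolding dS_def K_eq fn_def by (simp add: bil_self dot_self)
  qed
  then have "dS u = 0" using K0 by simp
  then have "(l - 1 / n) * M.dE u = 0" using l[OF u(1)] unfolding dF by (simp add: algebra_simps)
  then have "l = 1 / n" using dEneg by simp
  then have "dS h = 0" if "h \<in> HH" for h using l[OF that] unfolding dF by simp
  then have "weq c a 1 p q u" unfolding weq_def dS_def by simp
  then show ?thesis using u K0 min strict by blast
qed

section \<open>Dilation invariance and nondegeneracy of the Gagliardo form\<close>

lemma gn_dilate:
  assumes \<mu>: "0 < \<mu>" and [measurable]: "u \<in> borel_measurable borel"
  shows "gn (\<lambda>x. u (\<mu> * x)) = gn u"
proof -
  have "gn u = (\<integral>\<^sup>+x. (\<integral>\<^sup>+y. ennreal ((dq u (x, y))\<^sup>2) \<partial>lborel) \<partial>lborel)"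
    unfolding gn_def by (rule nn_integral_R2) measurable
  also have "\<dots> = (\<integral>\<^sup>+x. ennreal \<mu> * (\<integral>\<^sup>+y. ennreal ((dq u (x, \<mu> * y))\<^sup>2) \<partial>lborel) \<partial>lborel)"
  proof (rule nn_integral_cong)
    fix x :: real
    have "(\<lambda>y. ennreal ((dq u (x, y))\<^sup>2)) \<in> borel_measurable borel" unfolding dq_def fst_conv snd_conv by measurable
    from nn_integral_real_affine[OF this, of \<mu> 0] \<mu>
    show "(\<integral>\<^sup>+y. ennreal ((dq u (x, y))\<^sup>2) \<partial>lborel) = ennreal \<mu> * (\<integral>\<^sup>+y. ennreal ((dq u (x, \<mu> * y))\<^sup>2) \<partial>lborel)" by simp
  qed
  also have "\<dots> = ennreal \<mu> * (\<integral>\<^sup>+x. ennreal \<mu> * (\<integral>\<^sup>+y. ennreal ((dq u (\<mu> * x, \<mu> * y))\<^sup>2) \<partial>lborel) \<partial>lborel)"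
  proof -
    have "(\<lambda>x. ennreal \<mu> * (\<integral>\<^sup>+y. ennreal ((dq u (x, \<mu> * y))\<^sup>2) \<partial>lborel)) \<in> borel_measurable borel"
      unfolding dq_def fst_conv snd_conv by measurable
    from nn_integral_real_affine[OF this, of \<mu> 0] \<mu> show ?thesis by simp
  qed
  also have "\<dots> = (\<integral>\<^sup>+x. (\<integral>\<^sup>+y. ennreal ((dq (\<lambda>x. u (\<mu> * x)) (x, y))\<^sup>2) \<partial>lborel) \<partial>lborel)"
  proof -
    have "(\<integral>\<^sup>+y. ennreal ((dq (\<lambda>x. u (\<mu> * x)) (x, y))\<^sup>2) \<partial>lborel) = ennreal \<mu> * (ennreal \<mu> * (\<integral>\<^sup>+y. ennreal ((dq u (\<mu> * x, \<mu> * y))\<^sup>2) \<partial>lborel))" for x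
    proof -
      have "(\<integral>\<^sup>+y. ennreal ((dq (\<lambda>x. u (\<mu> * x)) (x, y))\<^sup>2) \<partial>lborel) = (\<integral>\<^sup>+y. ennreal (\<mu> * \<mu>) * ennreal ((dq u (\<mu> * x, \<mu> * y))\<^sup>2) \<partial>lborel)"
      proof (rule nn_integral_cong)
        fix y
        have "dq (\<lambda>x. u (\<mu> * x)) (x, y) = \<mu> * dq u (\<mu> * x, \<mu> * y)"
          using \<mu> by (simp add: dq_def right_diff_distrib[symmetric])
        then show "ennreal ((dq (\<lambda>x. u (\<mu> * x)) (x, y))\<^sup>2) = ennreal (\<mu> * \<mu>) * ennreal ((dq u (\<mu> * x, \<mu> * y))\<^sup>2)"
          using \<mu> by (simp add: power_mult_distrib power2_eq_square[of \<mu>] ennreal_mult)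
      qed
      also have "\<dots> = ennreal (\<mu> * \<mu>) * (\<integral>\<^sup>+y. ennreal ((dq u (\<mu> * x, \<mu> * y))\<^sup>2) \<partial>lborel)"
        unfolding dq_def fst_conv snd_conv by (rule nn_integral_cmult) measurable
      finally show ?thesis using \<mu> by (simp add: ennreal_mult mult.assoc)
    qed
    moreover have "(\<lambda>x. ennreal \<mu> * (\<integral>\<^sup>+y. ennreal ((dq u (\<mu> * x, \<mu> * y))\<^sup>2) \<partial>lborel)) \<in> borel_measurable lborel"
      unfolding dq_def fst_conv snd_conv by measurable
    ultimately show ?thesis by (simp add: nn_integral_cmult)
  qed
  also have "\<dots> = gn (\<lambda>x. u (\<mu> * x))"
    unfolding gn_def by (rule nn_integral_R2[symmetric]) measurable
  finally show ?thesis ..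
qed

lemma LINT_dilate: "0 < \<mu> \<Longrightarrow> (LINT x|lborel. f (\<mu> * x) :: real) = (LINT x|lborel. f x) / \<mu>"
  using lborel_integral_real_affine[of \<mu> f 0] by simp

text \<open>The kernel of degree -2 compensates the two factors from the plane measure, so the form
  is invariant while single integrals scale by 1 / \<mu>. In \<open>zero_mass_minimiser\<close> this
  serves both to normalise the mass and to remove the multiplier.\<close>

lemma dilate:
  assumes \<mu>: "0 < \<mu>" and u: "u \<in> HH"
  shows "(\<lambda>x. u (\<mu> * x)) \<in> HH" "gs (\<lambda>x. u (\<mu> * x)) = gs u" "ms (\<lambda>x. u (\<mu> * x)) = ms u / \<mu>"
    "Nm m (\<lambda>x. u (\<mu> * x)) = Nm m u / \<mu>"
proof -
  have g: "gn (\<lambda>x. u (\<mu> * x)) = gn u" by (rule gn_dilate[OF \<mu> HH_measurable[OF u]])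
  have L: "(\<lambda>x. u (\<mu> * x)) \<in> L2" using L2_affine[OF HH_L2[OF u], of \<mu> 0] \<mu> by simp
  show H: "(\<lambda>x. u (\<mu> * x)) \<in> HH" using u L g by (simp add: HH_iff)
  show "gs (\<lambda>x. u (\<mu> * x)) = gs u" using g by (simp add: gn_eq[OF u] gn_eq[OF H])
  show "ms (\<lambda>x. u (\<mu> * x)) = ms u / \<mu>" unfolding ms_def by (rule LINT_dilate[OF \<mu>])
  show "Nm m (\<lambda>x. u (\<mu> * x)) = Nm m u / \<mu>" unfolding Nm_def by (rule LINT_dilate[OF \<mu>])
qed

lemma bil_dilate:
  assumes \<mu>: "0 < \<mu>" and u: "u \<in> HH" and h: "h \<in> HH"
  shows "bil (\<lambda>x. u (\<mu> * x)) (\<lambda>x. h (\<mu> * x)) = bil u h"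
  using gs_add[OF u h] gs_add[OF dilate(1)[OF \<mu> u] dilate(1)[OF \<mu> h]] dilate(2)[OF \<mu> HH_add[OF u h]] dilate(2)[OF \<mu> u] dilate(2)[OF \<mu> h]
  by simp

text \<open>By scale invariance the integrals up to a and up to 2 a agree, yet the interval from a
  to 2 a contributes at least 1/2, which no finite value permits.\<close>

lemma nn_integral_inverse_infinite:
  assumes "0 < (a::real)"
  shows "(\<integral>\<^sup>+h. ennreal (1 / h) * indicator {0<..<a} h \<partial>lborel) = \<infinity>"
proof (rule ccontr)
  let ?I = "\<lambda>a. \<integral>\<^sup>+h. ennreal (1 / h) * indicator {0<..<a} h \<partial>lborel"
  assume "?I a \<noteq> \<infinity>"
  then have fin: "?I a < \<infinity>" by (simp add: less_top)
  have "?I (2 * a) = ennreal 2 * (\<integral>\<^sup>+h. ennreal (1 / (0 + 2 * h)) * indicator {0<..<2 * a} (0 + 2 * h) \<partial>lborel)"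
    using nn_integral_real_affine[of "\<lambda>h. ennreal (1 / h) * indicator {0<..<2 * a} h" 2 0] by simp
  also have "\<dots> = (\<integral>\<^sup>+h. ennreal 2 * (ennreal (1 / (0 + 2 * h)) * indicator {0<..<2 * a} (0 + 2 * h)) \<partial>lborel)"
    by (rule nn_integral_cmult[symmetric]) measurable
  also have "\<dots> = ?I a"
  proof (intro nn_integral_cong)
    fix h :: real
    show "ennreal 2 * (ennreal (1 / (0 + 2 * h)) * indicator {0<..<2 * a} (0 + 2 * h)) = ennreal (1 / h) * indicator {0<..<a} h"
    proof (cases "0 < h \<and> h < a")
      case True
      then have "ennreal 2 * ennreal (1 / (0 + 2 * h)) = ennreal (2 * (1 / (0 + 2 * h)))" by (intro ennreal_mult[symmetric]) auto
      then show ?thesis using True by simp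
    qed auto
  qed
  finally have eq: "?I (2 * a) = ?I a" .
  have "?I a + ennreal (1 / 2) \<le> ?I (2 * a)"
  proof -
    have "ennreal (1 / 2) = ennreal (1 / (2 * a)) * emeasure lborel {a..<2 * a}"
      using assms by (simp flip: ennreal_mult)
    also have "\<dots> = (\<integral>\<^sup>+h. ennreal (1 / (2 * a)) * indicator {a..<2 * a} h \<partial>lborel)"
      by (rule nn_integral_cmult_indicator[symmetric]) simp
    finally have "?I a + ennreal (1 / 2) = (\<integral>\<^sup>+h. ennreal (1 / h) * indicator {0<..<a} h + ennreal (1 / (2 * a)) * indicator {a..<2 * a} h \<partial>lborel)"
      by (simp only:) (rule nn_integral_add[symmetric]; measurable)
    also have "\<dots> \<le> ?I (2 * a)"
      using assms by (intro nn_integral_mono) (auto simp: indicator_def intro!: ennreal_leI divide_left_mono)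
    finally show ?thesis .
  qed
  then have "?I a + ennreal (1 / 2) \<le> ?I a + 0" unfolding eq by simp
  then show False using fin by (subst (asm) ennreal_add_left_cancel_le) (auto simp: ennreal_eq_0_iff)
qed

text \<open>A jump of height \<open>\<sigma>\<close> would contribute \<open>\<integral> \<sigma>\<^sup>2 / h dh = \<infinity>\<close> to the energy.\<close>

lemma no_jump:
  assumes u: "u \<in> HH" and d: "sdec u" and m: "0 < ms u" and \<sigma>: "0 < \<sigma>"
    and ae: "AE x in lborel. u x = 0 \<or> \<sigma> \<le> u x"
  shows False
proof -
  note [measurable] = HH_measurable[OF u]
  define Z where "Z = {x. 0 < x \<and> \<sigma> \<le> u x}"
  have "\<exists>x. x \<noteq> 0 \<and> u x \<noteq> 0 \<and> \<sigma> \<le> u x"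
  proof (rule ccontr)
    assume "\<not> ?thesis"
    then have "AE x in lborel. (u x)\<^sup>2 = 0" using ae AE_lborel_singleton[of 0] by (auto elim!: eventually_elim2)
    then have "ms u = (LINT x|(lborel :: real measure). 0)" unfolding ms_def by (intro integral_cong_AE) auto
    then show False using m by simp
  qed
  then obtain x1 where x1: "x1 \<noteq> 0" "\<sigma> \<le> u x1" by blast
  then have Zne: "\<bar>x1\<bar> \<in> Z" using sdec_abs[OF d x1(1)] by (simp add: Z_def)
  have bdd: "bdd_above Z"
  proof (rule bdd_aboveI[of _ "ms u / \<sigma>\<^sup>2"])
    fix x assume x: "x \<in> Z"
    then have x': "0 < x" "\<sigma>\<^sup>2 \<le> (u x)\<^sup>2" using \<sigma> by (auto simp: Z_def intro: power_mono)
    have "\<sigma>\<^sup>2 * x \<le> (u x)\<^sup>2 * (2 * x)" using x' by (intro mult_mono) auto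
    also have "\<dots> \<le> ms u" using x' by (intro sdec_ms HH_L2 u d) auto
    finally show "x \<le> ms u / \<sigma>\<^sup>2" using \<sigma> by (simp add: pos_le_divide_eq mult.commute)
  qed
  \<comment> \<open>The right end of the set where u \<ge> \<sigma>; beyond it \<open>u\<close>
    vanishes almost everywhere.\<close>
  define a where "a = Sup Z"
  have a: "0 < a" using cSup_upper[OF Zne bdd] x1 unfolding a_def by (auto intro: less_le_trans[of 0 "\<bar>x1\<bar>"])
  have above: "\<sigma> \<le> u x" if x: "0 < x" "x < a" for x
  proof -
    obtain z where "z \<in> Z" "x < z" using x(2) less_cSup_iff[OF _ bdd] Zne unfolding a_def by blast
    then show ?thesis using sdec_le[OF d, of x z] x by (auto simp: Z_def)
  qed
  have below: "AE x in lborel. a < x \<longrightarrow> u x = 0"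
    using ae
  proof eventually_elim
    case (elim x)
    then show ?case using cSup_upper[OF _ bdd, of x] a unfolding a_def[symmetric] by (force simp: Z_def)
  qed
  have "(\<integral>\<^sup>+h. ennreal (\<sigma>\<^sup>2) * (ennreal (1 / h) * indicator {0<..<a} h) \<partial>lborel) \<le> gn u"
    unfolding gn_translates[OF HH_measurable[OF u]]
  proof (rule nn_integral_mono)
    fix h
    show "ennreal (\<sigma>\<^sup>2) * (ennreal (1 / h) * indicator {0<..<a} h) \<le> ennreal (1 / h\<^sup>2) * nsq (\<lambda>x. u (h + x) - u x)"
    proof (cases "h \<in> {0<..<a}")
      case True
      have bh: "AE x in lborel. a < h + 1 * x \<longrightarrow> u (h + 1 * x) = 0"
        by (rule AE_borel_affine[OF _ _ below]) auto
      \<comment> \<open>For 0 < h < a the points at distance less than h to the left of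
        \<open>a\<close> are moved across the jump, which contributes \<sigma>^2 h to the squared
        translation difference.\<close>
      have "ennreal (\<sigma>\<^sup>2 * h) = (\<integral>\<^sup>+x. ennreal (\<sigma>\<^sup>2) * indicator {a - h<..<a} x \<partial>lborel)"
        using True by (subst nn_integral_cmult_indicator) (auto simp: ennreal_mult)
      also have "\<dots> \<le> nsq (\<lambda>x. u (h + x) - u x)"
        unfolding nsq_def
      proof (rule nn_integral_mono_AE, use bh in eventually_elim)
        case (elim x)
        show ?case
        proof (cases "x \<in> {a - h<..<a}")
          case x: True
          then have "\<sigma> \<le> u x" using True by (intro above) auto
          moreover have "u (h + x) = 0" using elim x by simp
          ultimately have "\<sigma>\<^sup>2 \<le> (norm (u (h + x) - u x))\<^sup>2" using \<sigma> by (auto intro!: power_mono)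
          then show ?thesis using x by (auto intro!: ennreal_leI)
        qed simp
      qed
      finally have "ennreal (1 / h\<^sup>2) * ennreal (\<sigma>\<^sup>2 * h) \<le> ennreal (1 / h\<^sup>2) * nsq (\<lambda>x. u (h + x) - u x)"
        by (rule mult_left_mono) simp
      moreover have "ennreal (1 / h\<^sup>2) * ennreal (\<sigma>\<^sup>2 * h) = ennreal (\<sigma>\<^sup>2) * ennreal (1 / h)"
        using True by (simp add: power2_eq_square flip: ennreal_mult)
      ultimately show ?thesis using True by simp
    qed simp
  qed
  also have "(\<integral>\<^sup>+h. ennreal (\<sigma>\<^sup>2) * (ennreal (1 / h) * indicator {0<..<a} h) \<partial>lborel) = ennreal (\<sigma>\<^sup>2) * \<infinity>"
    unfolding nn_integral_inverse_infinite[OF a, symmetric] by (rule nn_integral_cmult) measurable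
  finally have "gn u = \<infinity>" using \<sigma> by (simp add: ennreal_mult_top top_unique)
  then show False using gn_eq[OF u] by simp
qed

text \<open>With zero energy \<open>sdec_doubling\<close> makes the values at x and 2 x equal, hence
  those at all 2^k x, and the mass bound at these points forces the common value to be 0.\<close>

lemma sdec_gs_pos:
  assumes u: "u \<in> HH" and d: "sdec u" and m: "0 < ms u" shows "0 < gs u"
proof (rule ccontr)
  assume "\<not> 0 < gs u"
  then have g: "gs u = 0" using gs_nonneg[of u] by linarith
  have eq: "u x = u (2 * x)" if "0 < x" for x using sdec_doubling[OF u d that] by (simp add: g)
  have eqn: "u x = u (2 ^ k * x)" if "0 < x" for x k
  proof (induction k)
    case (Suc k)
    then show ?case using eq[of "2 ^ k * x"] that by (simp add: mult.assoc)
  qed simp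
  have zero: "u x = 0" if x: "0 < x" for x
  proof -
    have "(u x)\<^sup>2 * (2 * x) * 2 ^ k \<le> ms u" for k
      using sdec_ms[OF HH_L2[OF u] d, of "2 ^ k * x"] x eqn[OF x, of k] by (simp add: mult_ac)
    then have "(u x)\<^sup>2 * (2 * x) \<le> ms u * (1/2) ^ k" for k by (simp add: field_simps power_divide)
    moreover have "(\<lambda>k. ms u * (1/2) ^ k) \<longlonglongrightarrow> ms u * 0" by (intro tendsto_intros LIMSEQ_power_zero) auto
    ultimately have "(u x)\<^sup>2 * (2 * x) \<le> ms u * 0" by (intro LIMSEQ_le_const) auto
    then show ?thesis using x by (simp add: mult_le_0_iff)
  qed
  have "AE x in lborel. (u x)\<^sup>2 = 0"
    using AE_lborel_singleton[of 0]
  proof eventually_elim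
    case (elim x)
    then show ?case using sdec_abs[OF d, of x] zero[of "\<bar>x\<bar>"] by simp
  qed
  then have "ms u = (LINT x|(lborel :: real measure). 0)" unfolding ms_def using HH_measurable[OF u] by (intro integral_cong_AE) auto
  then show False using m by simp
qed

section \<open>The case of two even powers\<close>

text \<open>Half of \<open>c0\<close> is the maximum over s > 0 of s^(p-1) / (p+1) - s^(q-1) /
  (q+1); setting the derivative to zero gives s^(q-p) = \<rho>, whence the choice of
  \<open>s\<close>.\<close>

lemma c0_below:
  fixes c :: real
  assumes c: "c < c0 p q" and pq: "2 \<le> p" "p < q"
  shows "\<exists>s>0. c / 2 * s\<^sup>2 - s ^ (p + 1) / (real p + 1) + s ^ (q + 1) / (real q + 1) < 0"
proof -
  define P where "P = real p"
  define Q where "Q = real q"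
  have P: "1 < P" "P < Q" using pq by (auto simp: P_def Q_def)
  define \<beta> where "\<beta> = (P - 1) / (Q - P)"
  define \<rho> where "\<rho> = ((P - 1) * (Q + 1)) / ((P + 1) * (Q - 1))"
  have \<rho>: "0 < \<rho>" using P by (simp add: \<rho>_def)
  define s where "s = \<rho> powr (1 / (Q - P))"
  have s: "0 < s" using \<rho> by (simp add: s_def)
  have c0: "c0 p q = 2 * (Q - P) / ((P + 1) * (Q - 1)) * \<rho> powr \<beta>"
  proof -
    have \<alpha>: "(Q - 1) / (Q - P) = \<beta> + 1" using P by (simp add: \<beta>_def field_simps)
    have "\<rho> powr \<beta> = ((P - 1) powr \<beta> * (Q + 1) powr \<beta>) / ((P + 1) powr \<beta> * (Q - 1) powr \<beta>)"
      using P by (simp add: \<rho>_def powr_divide powr_mult)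
    moreover have "(P + 1) powr (\<beta> + 1) = (P + 1) powr \<beta> * (P + 1)" "(Q - 1) powr (\<beta> + 1) = (Q - 1) powr \<beta> * (Q - 1)"
      using P by (simp_all add: powr_add)
    ultimately show ?thesis
      unfolding c0_def Let_def P_def[symmetric] Q_def[symmetric] \<alpha> \<beta>_def[symmetric] by (simp add: mult_ac)
  qed
  have spow: "s ^ n = \<rho> powr (real n / (Q - P))" for n
    using s by (simp add: s_def powr_powr flip: powr_realpow)
  have s1: "s ^ (p - 1) = \<rho> powr \<beta>" using pq by (simp add: spow \<beta>_def P_def of_nat_diff)
  have s2: "s ^ (q - p) = \<rho>" using pq P \<rho> by (simp add: spow P_def Q_def of_nat_diff)
  have e1: "s ^ (p + 1) = s\<^sup>2 * s ^ (p - 1)" using pq by (simp flip: power_add)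
  have e2: "s ^ (q + 1) = s\<^sup>2 * (s ^ (p - 1) * s ^ (q - p))" using pq by (simp flip: power_add)
  have k: "1 / (P + 1) - \<rho> / (Q + 1) = (Q - P) / ((P + 1) * (Q - 1))"
  proof -
    have "\<rho> / (Q + 1) = (P - 1) / ((P + 1) * (Q - 1))" using P by (simp add: \<rho>_def)
    moreover have "1 / (P + 1) = (Q - 1) / ((P + 1) * (Q - 1))" using P by simp
    ultimately have "1 / (P + 1) - \<rho> / (Q + 1) = ((Q - 1) - (P - 1)) / ((P + 1) * (Q - 1))" by (simp only: diff_divide_distrib)
    then show ?thesis by simp
  qed
  have "c / 2 * s\<^sup>2 - s ^ (p + 1) / (real p + 1) + s ^ (q + 1) / (real q + 1)
    = s\<^sup>2 / 2 * (c - 2 * (1 / (P + 1) - \<rho> / (Q + 1)) * \<rho> powr \<beta>)"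
    unfolding e1 e2 s1 s2 P_def[symmetric] Q_def[symmetric] by (simp add: field_simps)
  also have "\<dots> = s\<^sup>2 / 2 * (c - c0 p q)" unfolding k c0 by simp
  also have "\<dots> < 0" using s c by (simp add: mult_pos_neg)
  finally show ?thesis using s by blast
qed

text \<open>The slopes occupy two intervals of length 1, whence the difference of 2 between the
  bounds.\<close>

lemma plateau_Nm:
  assumes R: "0 \<le> R" and s: "0 \<le> s" and m: "2 \<le> m"
  shows "s ^ m * (2 * R) \<le> Nm m (plateau R s)" "Nm m (plateau R s) \<le> s ^ m * (2 * R + 2)"
proof -
  have i: "integrable lborel (\<lambda>x. s ^ m * indicator {- r..r} x)" for r :: real
    by (intro integrable_mult_right integrable_real_indicator) (auto simp: emeasure_lborel_Icc_eq)
  have v: "(LINT x|lborel. s ^ m * indicator {- r..r} x) = s ^ m * (2 * r)" if "0 \<le> r" for r using that by simp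
  have p: "integrable lborel (\<lambda>x. \<bar>plateau R s x\<bar> ^ m)" by (rule HH_power_integrable[OF plateau_HH[OF R s] m])
  have "s ^ m * indicator {- R..R} x \<le> \<bar>plateau R s x\<bar> ^ m" for x
    using plateau_bounds(3)[of x R s] s by (auto simp: indicator_def)
  from integral_mono[OF i p this] show "s ^ m * (2 * R) \<le> Nm m (plateau R s)" unfolding v[OF R] Nm_def .
  have "\<bar>plateau R s x\<bar> ^ m \<le> s ^ m * indicator {- (R + 1)..R + 1} x" for x
  proof (cases "\<bar>x\<bar> \<le> R + 1")
    case True
    have "\<bar>plateau R s x\<bar> ^ m \<le> s ^ m" using plateau_bounds(1,2)[OF s] by (intro power_mono) auto
    then show ?thesis using True by (auto simp: indicator_def)
  next
    case False
    then show ?thesis using plateau_bounds(4)[of R x s] m s by (auto simp: indicator_def power_0_left)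
  qed
  from integral_mono[OF p i this] show "Nm m (plateau R s) \<le> s ^ m * (2 * R + 2)"
    unfolding v[OF add_nonneg_nonneg[OF R zero_le_one]] Nm_def by (simp add: distrib_left)
qed

text \<open>The objective and the sign of the constraint functional are invariant under dilation.
  The mass is not controlled by the objective, but it can be set to 1 by this invariance, which
  restores compactness. Once the multiplier is known to be positive, a second dilation adjusts the
  ratio between the form and the single integrals.\<close>

theorem zero_mass_minimiser:
  assumes c: "0 < c" and pq: "2 \<le> p" "p < q" and "c < c0 p q"
  shows "\<exists>u\<in>HH. sdec u \<and> 0 < ms u \<and> weq c (-1) (-1) p q u"
proof -
  define P where "P = real p + 1"
  define Q where "Q = real q + 1"
  have PQ: "0 < P" "0 < Q" by (auto simp: P_def Q_def)
  obtain s where s: "0 < s" "c / 2 * s\<^sup>2 - s ^ (p + 1) / P + s ^ (q + 1) / Q < 0"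
    using c0_below[OF assms(4) pq] unfolding P_def Q_def by blast
  define B where "B = c / 2 * s\<^sup>2 + s ^ (q + 1) / Q"
  define g where "g = - (c / 2 * s\<^sup>2 - s ^ (p + 1) / P + s ^ (q + 1) / Q)"
  have g: "0 < g" using s(2) by (simp add: g_def)
  have B: "0 < B" unfolding B_def using c s PQ by (intro add_pos_pos) auto
  \<comment> \<open>A plateau of this size gains 2 R g on its flat part and loses at most 2 B on its
    slopes; this \<open>R\<close> balances the two.\<close>
  define R where "R = B / g"
  have R: "0 < R" using g B by (simp add: R_def)
  let ?E = "fn 0 (c / 2) (- (1 / P)) (1 / Q) p q"
  let ?F = "fn 1 0 0 0 p q"
  let ?v = "plateau R s"
  have feas: "?v \<in> HH" "0 < ms ?v" "?E ?v \<le> 0"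
  proof -
    show "?v \<in> HH" "0 < ms ?v" using plateau_HH[of R s] plateau_ms_pos[of R s] R s by auto
    have N: "s ^ m * (2 * R) \<le> Nm m ?v" "Nm m ?v \<le> s ^ m * (2 * R + 2)" if "2 \<le> m" for m
      using plateau_Nm[of R s m] that R s by auto
    have m2: "ms ?v = Nm 2 ?v" by (simp add: ms_def Nm_def)
    have "c / 2 * ms ?v \<le> c / 2 * (s\<^sup>2 * (2 * R + 2))" unfolding m2 using c by (intro mult_left_mono N) auto
    moreover have "1 / P * (s ^ (p + 1) * (2 * R)) \<le> 1 / P * Nm (p + 1) ?v" using PQ pq by (intro mult_left_mono N) auto
    moreover have "1 / Q * Nm (q + 1) ?v \<le> 1 / Q * (s ^ (q + 1) * (2 * R + 2))" using PQ pq by (intro mult_left_mono N) auto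
    ultimately have "?E ?v \<le> c / 2 * (s\<^sup>2 * (2 * R + 2)) - 1 / P * (s ^ (p + 1) * (2 * R)) + 1 / Q * (s ^ (q + 1) * (2 * R + 2))"
      unfolding fn_def by linarith
    also have "\<dots> = 2 * (B - R * g)" by (simp add: B_def g_def algebra_simps)
    also have "\<dots> = 0" using g by (simp add: R_def)
    finally show "?E ?v \<le> 0" .
  qed
  have "\<exists>u\<in>HH. sdec u \<and> 0 < ms u \<and> ?E u \<le> 0 \<and> (\<forall>v\<in>HH. 0 < ms v \<longrightarrow> ?E v \<le> 0 \<longrightarrow> ?F u \<le> ?F v)"
  proof (rule minimiser_exists[where A = 1 and B = 1 and \<eta> = "c * P / 2", OF _ _ _ _ _ _ _ _ feas])
    fix v assume v: "v \<in> HH" "0 < ms v" "?E v \<le> 0"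
    \<comment> \<open>The competitor dilated to mass 1. As the term of degree q + 1 is nonnegative,
      the constraint then forces the integral of |w|^(p+1) to be at least c P / 2.\<close>
    define w where "w x = v (ms v * x)" for x
    have w: "w \<in> HH" "gs w = gs v" "ms w = 1" "Nm m w = Nm m v / ms v" for m
      using dilate[OF v(2,1)] v(2) unfolding w_def[abs_def] by auto
    have Ew: "?E w \<le> 0"
    proof -
      have "?E w = ?E v / ms v" unfolding fn_def w using v(2) by (simp add: add_divide_distrib diff_divide_distrib)
      then show ?thesis using v(2,3) by (simp add: divide_le_0_iff)
    qed
    moreover have "c * P / 2 \<le> Nm (p + 1) w + Nm (q + 1) w"
    proof -
      have "0 \<le> 1 / Q * Nm (q + 1) w" using PQ by simp
      then have "c / 2 \<le> Nm (p + 1) w / P" using Ew unfolding fn_def w(3) by simp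
      then have "c / 2 * P \<le> Nm (p + 1) w" using PQ by (simp add: pos_le_divide_eq)
      then show ?thesis using Nm_nonneg[of "q + 1" w] by linarith
    qed
    ultimately show "\<exists>w\<in>HH. 0 < ms w \<and> ?E w \<le> 0 \<and> ?F w \<le> ?F v \<and> gs w + ms w \<le> 1 * ?F v + 1 \<and> c * P / 2 \<le> Nm (p + 1) w + Nm (q + 1) w"
      by (intro bexI[of _ w] conjI w(1)) (simp_all only: w(2,3), simp_all add: fn_def w(2))
  qed (use c PQ pq in auto)
  then obtain u where u: "u \<in> HH" "sdec u" "0 < ms u" "?E u \<le> 0"
    and min: "\<And>v. v \<in> HH \<Longrightarrow> 0 < ms v \<Longrightarrow> ?E v \<le> 0 \<Longrightarrow> ?F u \<le> ?F v" by blast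
  have nn: "0 \<le> u x" for x by (rule sdec_nonneg[OF u(2)])
  note [measurable] = HH_measurable[OF u(1)]
  interpret M: constrained_minimiser 1 0 0 0 0 "c / 2" "- (1 / P)" "1 / Q" p q u
    by unfold_locales (use u nn pq min in auto)
  have dE: "M.dE h = c * dot u h - (LINT x|lborel. u x ^ p * h x) + (LINT x|lborel. u x ^ q * h x)" for h
  proof -
    have "real (p + 1) = P" "real (q + 1) = Q" by (auto simp: P_def Q_def)
    then show ?thesis unfolding dfn_def using PQ by simp
  qed
  have dF: "M.dF h = 2 * bil u h" for h unfolding dfn_def by simp
  \<comment> \<open>Constraint qualification. Otherwise the derivative vanishes at a truncation of
    \<open>u\<close> that is positive exactly where 0 < u < \<sigma>. The integrand is positive
    there, so \<open>u\<close> has almost no values in this range, which \<open>no_jump\<close>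
    excludes.\<close>
  have "\<exists>k\<in>HH. M.dE k < 0"
  proof (rule ccontr)
    assume "\<not> ?thesis"
    then have nonneg: "0 \<le> M.dE h" if "h \<in> HH" for h using that by force
    \<comment> \<open>For 0 < t < min 1 c one has t^p \<le> t^2 < c t, so that c t - t^p + t^q is
      positive.\<close>
    define \<sigma> where "\<sigma> = min 1 c"
    have \<sigma>: "0 < \<sigma>" using c by (simp add: \<sigma>_def)
    define h where "h x = max 0 (min (u x) (\<sigma> - u x))" for x
    have h: "h \<in> HH"
    proof (rule HH_contract(1)[OF u(1)])
      show "h \<in> borel_measurable borel" unfolding h_def[abs_def] by measurable
      show "\<bar>h x\<bar> \<le> \<bar>u x\<bar>" for x using nn[of x] by (simp add: h_def max_def min_def)
      have "max 0 (min a (\<sigma> - a)) \<le> max 0 (min b (\<sigma> - b)) + \<bar>a - b\<bar>" for a b :: real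
      proof -
        have *: "max 0 (min a (\<sigma> - a)) \<le> max 0 (min b (\<sigma> - b)) + t" if "0 \<le> t" "a \<le> b + t" "b \<le> a + t" for t
          using that by (auto simp: max_def min_def)
        show ?thesis by (rule *) linarith+
      qed
      then have "h x \<le> h y + \<bar>u x - u y\<bar>" for x y unfolding h_def .
      then show "\<bar>h x - h y\<bar> \<le> \<bar>u x - u y\<bar>" for x y
        using abs_minus_commute[of "u y" "u x"] by (smt (verit))
    qed
    have "M.dE h = 0"
      using nonneg[OF h] nonneg[OF HH_scale[OF h, of "-1"]] dfn_scale[OF u(1) h M.pq, of _ _ _ _ "-1"] by simp
    moreover have iG: "integrable lborel (\<lambda>x. (c * u x - u x ^ p + u x ^ q) * h x)"
      and "M.dE h = (LINT x|lborel. (c * u x - u x ^ p + u x ^ q) * h x)"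
    proof -
      have i: "integrable lborel (\<lambda>x. c * (u x * h x))" "integrable lborel (\<lambda>x. u x ^ p * h x)" "integrable lborel (\<lambda>x. u x ^ q * h x)"
        using dot_integrable[OF u(1) h] mixed_power_integrable[OF u(1) h] pq by auto
      have eq: "(\<lambda>x. (c * u x - u x ^ p + u x ^ q) * h x) = (\<lambda>x. c * (u x * h x) - u x ^ p * h x + u x ^ q * h x)"
        by (simp add: algebra_simps)
      show "integrable lborel (\<lambda>x. (c * u x - u x ^ p + u x ^ q) * h x)" unfolding eq using i by simp
      show "M.dE h = (LINT x|lborel. (c * u x - u x ^ p + u x ^ q) * h x)" unfolding eq dE dot_def using i by simp
    qed
    moreover have pos: "0 < c * t - t ^ p + t ^ q" if t: "0 < t" "t < \<sigma>" for t
    proof -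
      have "t ^ p \<le> t\<^sup>2" using t pq by (intro power_decreasing) (auto simp: \<sigma>_def)
      also have "t\<^sup>2 < c * t" using t by (simp add: power2_eq_square \<sigma>_def)
      finally show ?thesis using zero_less_power[OF t(1), of q] by linarith
    qed
    moreover have nnG: "0 \<le> (c * u x - u x ^ p + u x ^ q) * h x" for x
    proof (cases "0 < u x \<and> u x < \<sigma>")
      case True
      then show ?thesis using pos[of "u x"] by (simp add: h_def)
    next
      case False
      then have "h x = 0" using nn[of x] by (auto simp: h_def)
      then show ?thesis by simp
    qed
    ultimately have "AE x in lborel. (c * u x - u x ^ p + u x ^ q) * h x = 0"
      using integral_nonneg_eq_0_iff_AE[OF iG] by simp
    then have "AE x in lborel. u x = 0 \<or> \<sigma> \<le> u x"
    proof eventually_elim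
      case (elim x)
      show ?case
      proof (rule ccontr)
        assume "\<not> ?thesis"
        then have "0 < u x" "u x < \<sigma>" using nn[of x] by auto
        moreover from this have "0 < h x" by (simp add: h_def)
        ultimately show False using elim pos[of "u x"] by simp
      qed
    qed
    from no_jump[OF u(1-3) \<sigma> this] show False .
  qed
  then obtain k where "k \<in> HH" "M.dE k < 0" by blast
  then obtain l where l: "0 \<le> l" "\<And>h. h \<in> HH \<Longrightarrow> M.dF h + l * M.dE h = 0" using M.multiplier by blast
  \<comment> \<open>A vanishing multiplier would force the energy of \<open>u\<close> to be
    zero.\<close>
  have "M.dF u \<noteq> 0" using sdec_gs_pos[OF u(1-3)] by (simp add: dF bil_self)
  then have l0: "0 < l" using l(1) l(2)[OF u(1)] by (cases "l = 0") auto
  \<comment> \<open>Dilation keeps the form and divides single integrals by \<mu>; this value turns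
    2 bil + l dE = 0 into kap bil + dE / \<mu> = 0.\<close>
  define \<mu> where "\<mu> = 2 / (l * kap)"
  have \<mu>: "0 < \<mu>" using l0 kap_pos by (simp add: \<mu>_def)
  define w where "w x = u (\<mu> * x)" for x
  have w: "w \<in> HH" "ms w = ms u / \<mu>" unfolding w_def[abs_def] by (rule dilate[OF \<mu> u(1)])+
  have "weq c (-1) (-1) p q w"
    unfolding weq_def
  proof
    fix h assume h: "h \<in> HH"
    define k where "k x = h (1 / \<mu> * x)" for x
    have k: "k \<in> HH" unfolding k_def[abs_def] using \<mu> by (intro dilate(1) h) auto
    have hk: "h x = k (\<mu> * x)" for x using \<mu> by (simp add: k_def)
    have b: "bil w h = bil u k" unfolding w_def[abs_def] hk[abs_def] by (rule bil_dilate[OF \<mu> u(1) k])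
    have d: "(LINT x|lborel. f (w x) * h x) = (LINT x|lborel. f (u x) * k x) / \<mu>" for f :: "real \<Rightarrow> real"
      unfolding w_def hk using LINT_dilate[OF \<mu>, of "\<lambda>x. f (u x) * k x"] .
    have "2 * bil u k + l * M.dE k = 0" using l(2)[OF k] unfolding dF .
    then have "kap / 2 * (2 * bil u k + l * M.dE k) = 0" by simp
    then have "kap * bil u k + M.dE k / \<mu> = 0" by (simp add: \<mu>_def algebra_simps)
    then show "kap * bil w h + c * dot w h + - 1 * (LINT x|lborel. w x ^ p * h x) - - 1 * (LINT x|lborel. w x ^ q * h x) = 0"
      using d[of "\<lambda>t. t"] d[of "\<lambda>t. t ^ p"] d[of "\<lambda>t. t ^ q"] unfolding b dE dot_def
      by (simp add: add_divide_distrib diff_divide_distrib)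
  qed
  moreover have "sdec w"
    using u(2) \<mu> unfolding sdec_def w_def by (auto simp: abs_mult)
  moreover have "0 < ms w" using w(2) u(3) \<mu> by simp
  ultimately show ?thesis using w(1) by blast
qed

section \<open>Boundedness and positivity of decreasing weak solutions\<close>

text \<open>Near the origin \<open>om\<close> is homogeneous of degree -1/2, so its integral over an
  interval of radius r scales like sqrt r.\<close>

lemma om_local:
  assumes r: "0 < r" "r \<le> 1"
  shows "(LINT x|lborel. indicator {- r<..<r} x * om x) = sqrt r * (LINT x|lborel. indicator {- 1<..<1} x * om x)"
proof -
  let ?f = "\<lambda>x. indicator {- 1<..<1} x * om x"
  define e where "e = r powr (-1/2)"
  have e: "0 < e" using r by (simp add: e_def)
  have "?f (1 / r * x) = indicator {- r<..<r} x * om x / e" for x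
  proof (cases "\<bar>x\<bar> < r")
    case True
    then have "om (1 / r * x) = \<bar>x\<bar> powr (-1/2) / e" "om x = \<bar>x\<bar> powr (-1/2)"
      using r unfolding om_def e_def by (auto simp: abs_mult powr_divide)
    moreover have "1 / r * x \<in> {- 1<..<1}" "x \<in> {- r<..<r}" using True r by (auto simp: field_simps)
    ultimately show ?thesis by (simp del: times_divide_eq_left)
  next
    case False
    then have "1 / r * x \<notin> {- 1<..<1}" "x \<notin> {- r<..<r}" using r by (auto simp: field_simps)
    then show ?thesis by (simp del: times_divide_eq_left)
  qed
  then have "(LINT x|lborel. indicator {- r<..<r} x * om x) / e = (LINT x|lborel. ?f (1 / r * x))"
    by (simp only: integral_divide_zero)
  also have "\<dots> = (LINT x|lborel. ?f x) / (1 / r)" using r by (intro LINT_dilate) auto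
  finally have "(LINT x|lborel. indicator {- r<..<r} x * om x) = (r * e) * (LINT x|lborel. ?f x)" using e by (simp add: field_simps)
  moreover have "r * e = sqrt r" using r powr_mult_base[of r "-1/2"] by (simp add: e_def powr_half_sqrt)
  ultimately show ?thesis by simp
qed

text \<open>The equation is tested with the part \<open>h\<close> of \<open>u\<close> between the
  levels u(2 r) and u(r), which lives on |x| < 2 r. The energy of \<open>h\<close> is bounded below
  by the square of its height, through \<open>sdec_doubling\<close>, and above by its height times
  an integral of powers of \<open>u\<close> over |x| < 2 r, which is of order sqrt r. One factor of
  the height cancels.\<close>

lemma weq_step:
  assumes c: "0 < c" and ab: "\<bar>a\<bar> \<le> 1" "\<bar>b\<bar> \<le> 1" and pq: "2 \<le> p" "p < q"
    and u: "u \<in> HH" and d: "sdec u" and eq: "weq c a b p q u"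
  shows "\<exists>C\<ge>0. \<forall>r. 0 < r \<longrightarrow> r \<le> 1 / 2 \<longrightarrow> u r - u (2 * r) \<le> C * sqrt r"
proof -
  note [measurable] = HH_measurable[OF u]
  have nn: "0 \<le> u x" for x by (rule sdec_nonneg[OF d])
  obtain C1 where C1: "C1 > 0" "\<And>x. x \<noteq> 0 \<Longrightarrow> u x ^ q \<le> C1 * hn u ^ q * om x"
    using sdec_power_bound[of q] pq u d by auto
  define D where "D = 1 + 2 * (C1 * hn u ^ q)"
  have D: "0 \<le> D" using C1(1) by (simp add: D_def)
  \<comment> \<open>The lower power is at most 1 + u^q, the upper one is dominated by
    \<open>om\<close>, and \<open>om\<close> is at least 1 on this range.\<close>
  have powers: "u x ^ p + u x ^ q \<le> D * om x" if "x \<noteq> 0" "\<bar>x\<bar> \<le> 1" for x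
  proof -
    have "1 \<le> om x"
    proof -
      have "\<bar>x\<bar> powr (1/2) \<le> 1" using that powr_le_one_le[of "\<bar>x\<bar>" 1] by (simp add: powr_half_sqrt)
      then show ?thesis using that by (simp add: om_def powr_minus_divide)
    qed
    moreover have "u x ^ p \<le> 1 + u x ^ q"
    proof (cases "u x \<le> 1")
      case True
      then have "u x ^ p \<le> 1" using nn[of x] by (simp add: power_le_one)
      then show ?thesis using nn[of x] by (simp add: add_increasing2)
    next
      case False
      then have "u x ^ p \<le> u x ^ q" using pq by (intro power_increasing) auto
      then show ?thesis by linarith
    qed
    moreover have "u x ^ q \<le> C1 * hn u ^ q * om x" by (rule C1(2)[OF that(1)])
    ultimately show ?thesis unfolding D_def by (simp add: distrib_right)
  qed
  define J where "J = (LINT x|lborel. indicator {- 1<..<1} x * om x)"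
  have J: "0 \<le> J" unfolding J_def by (intro integral_nonneg_AE) auto
  define C where "C = 9 / kap * (D * J * sqrt 2)"
  have "u r - u (2 * r) \<le> C * sqrt r" if r: "0 < r" "r \<le> 1 / 2" for r
  proof -
    define t where "t = u r"
    define s where "s = u (2 * r)"
    have st: "0 \<le> s" "s \<le> t" unfolding s_def t_def using nn sdec_le[OF d, of r "2 * r"] r by auto
    define h where "h x = max 0 (min (u x - s) (t - s))" for x
    have [measurable]: "h \<in> borel_measurable borel" unfolding h_def[abs_def] by measurable
    have mono: "h y \<le> h x" if "u y \<le> u x" for x y using that unfolding h_def by (intro max.mono min.mono) auto
    have lip: "h x - h y \<le> u x - u y" if "u y \<le> u x" for x y using that unfolding h_def by (auto simp: max_def min_def)
    have h0: "0 \<le> h x" "h x \<le> t - s" for x using st by (auto simp: h_def)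
    have hH: "h \<in> HH"
    proof (rule HH_contract(1)[OF u])
      show "\<bar>h x\<bar> \<le> \<bar>u x\<bar>" for x using nn[of x] st by (auto simp: h_def max_def min_def)
      show "\<bar>h x - h y\<bar> \<le> \<bar>u x - u y\<bar>" for x y
        using mono[of x y] mono[of y x] lip[of x y] lip[of y x] by (cases "u x \<le> u y") auto
    qed measurable
    have "sdec h" using d h0(1) mono unfolding sdec_def by blast
    from sdec_doubling[OF hH this r(1)] have 1: "(t - s)\<^sup>2 \<le> 9 * gs h" using st by (simp add: h_def t_def s_def)
    \<comment> \<open>\<open>h\<close> is a nondecreasing contraction of \<open>u\<close>: its
      differences have the sign of those of \<open>u\<close> and are no larger.\<close>
    have "gs h \<le> bil u h"
      unfolding gs_def bil_def
    proof (intro integral_mono HH_gs_integrable bil_integrable u hH)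
      fix z
      have "(h x - h y) * (h x - h y) \<le> (u x - u y) * (h x - h y)" for x y
        using mono[of x y] mono[of y x] lip[of x y] lip[of y x]
        by (cases "u x \<le> u y") (auto intro: mult_right_mono mult_right_mono_neg)
      then show "(dq h z)\<^sup>2 \<le> dq u z * dq h z"
        unfolding dq_def power2_eq_square times_divide_times_eq by (intro divide_right_mono) auto
    qed
    then have 2: "kap * gs h \<le> kap * bil u h" using kap_pos by simp
    have up: "integrable lborel (\<lambda>x. u x ^ p * h x)" "integrable lborel (\<lambda>x. u x ^ q * h x)"
      using mixed_power_integrable[OF u hH] pq by auto
    have 3: "kap * bil u h \<le> (LINT x|lborel. u x ^ p * h x) + (LINT x|lborel. u x ^ q * h x)"
    proof -
      have nnp: "0 \<le> (LINT x|lborel. u x ^ m * h x)" for m using nn h0 by (intro integral_nonneg_AE) auto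
      have "0 \<le> dot u h" unfolding dot_def using nn h0 by (intro integral_nonneg_AE) auto
      then have "0 \<le> c * dot u h" using c by simp
      moreover have "- a * (LINT x|lborel. u x ^ p * h x) \<le> 1 * (LINT x|lborel. u x ^ p * h x)"
        using ab nnp by (intro mult_right_mono) auto
      moreover have "b * (LINT x|lborel. u x ^ q * h x) \<le> 1 * (LINT x|lborel. u x ^ q * h x)"
        using ab nnp by (intro mult_right_mono) auto
      moreover have "kap * bil u h + c * dot u h + a * (LINT x|lborel. u x ^ p * h x) - b * (LINT x|lborel. u x ^ q * h x) = 0"
        using eq hH unfolding weq_def by blast
      ultimately show ?thesis by simp
    qed
    also have "\<dots> = (LINT x|lborel. (u x ^ p + u x ^ q) * h x)" using up by (simp add: distrib_right)
    also have "\<dots> \<le> (LINT x|lborel. ((t - s) * D) * (indicator {- (2 * r)<..<2 * r} x * om x))"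
    proof (rule integral_mono_AE)
      show "integrable lborel (\<lambda>x. (u x ^ p + u x ^ q) * h x)" using up by (simp add: distrib_right)
      show "integrable lborel (\<lambda>x. ((t - s) * D) * (indicator {- (2 * r)<..<2 * r} x * om x))"
        by (rule integrable_mult_right, rule Bochner_Integration.integrable_bound[OF om_integrable]) (auto simp: indicator_def)
      show "AE x in lborel. (u x ^ p + u x ^ q) * h x \<le> ((t - s) * D) * (indicator {- (2 * r)<..<2 * r} x * om x)"
        using AE_lborel_singleton[of 0]
      proof eventually_elim
        case (elim x)
        show ?case
        proof (cases "\<bar>x\<bar> < 2 * r")
          case True
          have "(u x ^ p + u x ^ q) * h x \<le> (D * om x) * (t - s)"
            using elim True r h0 D by (intro mult_mono powers) auto
          moreover have "x \<in> {- (2 * r)<..<2 * r}" using True by auto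
          ultimately show ?thesis by (simp add: mult_ac)
        next
          case False
          then have "u x \<le> s" unfolding s_def using r by (intro sdec_le[OF d]) auto
          then have "h x = 0" by (simp add: h_def)
          moreover have "x \<notin> {- (2 * r)<..<2 * r}" using False by auto
          ultimately show ?thesis by simp
        qed
      qed
    qed
    also have "\<dots> = ((t - s) * D) * (sqrt (2 * r) * J)" unfolding J_def using om_local[of "2 * r"] r by simp
    finally have "kap * gs h \<le> (t - s) * (D * J * sqrt 2 * sqrt r)" using 2 by (simp add: real_sqrt_mult mult_ac)
    then have "gs h \<le> (t - s) * (D * J * sqrt 2 * sqrt r) / kap" using kap_pos by (simp add: pos_le_divide_eq mult.commute)
    then have "9 * gs h \<le> 9 * ((t - s) * (D * J * sqrt 2 * sqrt r) / kap)" by simp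
    also have "\<dots> = (t - s) * (C * sqrt r)" by (simp add: C_def)
    finally have "(t - s) * (t - s) \<le> (t - s) * (C * sqrt r)" using 1 by (simp only: power2_eq_square)
    moreover have "0 \<le> C * sqrt r" using D J kap_pos r by (simp add: C_def)
    ultimately have "t - s \<le> C * sqrt r" using st by (cases "t = s") auto
    then show ?thesis by (simp add: t_def s_def)
  qed
  moreover have "0 \<le> C" using D J kap_pos by (simp add: C_def)
  ultimately show ?thesis by blast
qed

text \<open>The increments of \<open>weq_step\<close> over dyadic scales form a convergent geometric
  series. It is summed by showing that u(r) + K sqrt r does not increase when r is halved.\<close>

lemma weq_bounded:
  assumes "0 < c" "\<bar>a\<bar> \<le> 1" "\<bar>b\<bar> \<le> 1" "2 \<le> p" "p < q" "u \<in> HH" and d: "sdec u" and "weq c a b p q u"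
  shows "\<exists>B. \<forall>x. x \<noteq> 0 \<longrightarrow> u x \<le> B"
proof -
  obtain C where C: "C \<ge> 0" "\<And>r. 0 < r \<Longrightarrow> r \<le> 1 / 2 \<Longrightarrow> u r - u (2 * r) \<le> C * sqrt r"
    using weq_step[OF assms] by blast
  \<comment> \<open>The solution of K sqrt 2 = K + C, which makes one halving step close
    exactly.\<close>
  define K where "K = C / (sqrt 2 - 1)"
  have s2: "0 < sqrt 2 - 1" by simp
  have K: "0 \<le> K" using C(1) by (simp add: K_def)
  have KC: "K * sqrt 2 = K + C" using s2 by (simp add: K_def field_simps)
  have base: "u r + K * sqrt r \<le> u (1/2) + K" if "1 / 2 \<le> r" "r \<le> 1" for r
    using sdec_le[OF d, of "1/2" r] that K by (intro add_mono) (auto simp: mult_left_le)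
  have small: "(1/2) ^ Suc n \<le> r \<Longrightarrow> r \<le> 1 \<Longrightarrow> u r + K * sqrt r \<le> u (1/2) + K" for n r
  proof (induction n arbitrary: r)
    case 0
    then show ?case using base[of r] by simp
  next
    case (Suc n)
    show ?case
    proof (cases "1 / 2 \<le> r")
      case False
      have r: "0 < r" using Suc.prems(1) by (rule less_le_trans[rotated]) simp
      have "u r + K * sqrt r \<le> u (2 * r) + (K + C) * sqrt r" using C(2)[of r] r False by (simp add: algebra_simps)
      also have "\<dots> = u (2 * r) + K * sqrt (2 * r)" by (simp add: real_sqrt_mult flip: KC)
      also have "\<dots> \<le> u (1/2) + K" using Suc.prems(1) False by (intro Suc.IH) auto
      finally show ?thesis .
    qed (use base Suc.prems in blast)
  qed
  have "u x \<le> u (1/2) + K" if x: "x \<noteq> 0" for x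
  proof (cases "\<bar>x\<bar> \<le> 1")
    case True
    obtain n where n: "(1/2) ^ n < \<bar>x\<bar>" using real_arch_pow_inv[of "\<bar>x\<bar>" "1/2"] x by auto
    have "(1/2) ^ Suc n \<le> ((1/2) ^ n :: real)" by simp
    then have "u \<bar>x\<bar> + K * sqrt \<bar>x\<bar> \<le> u (1/2) + K" using n True by (intro small[of n]) linarith+
    moreover have "0 \<le> K * sqrt \<bar>x\<bar>" using K by simp
    ultimately show ?thesis using sdec_abs[OF d x] by linarith
  next
    case False
    then have "u x \<le> u (1/2)" by (intro sdec_le[OF d]) auto
    then show ?thesis using K by linarith
  qed
  then show ?thesis by blast
qed

text \<open>
  Where a decreasing solution vanishes, testing with a bump supported in its zero set leaves only the
  nonlocal cross term, which is strictly negative.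
\<close>

lemma weq_positive:
  assumes pq: "2 \<le> p" "p < q" and u: "u \<in> HH" and d: "sdec u" and m: "0 < ms u"
    and eq: "weq c a b p q u" and x0: "x0 \<noteq> 0"
  shows "0 < u x0"
proof (rule ccontr)
  note [measurable] = HH_measurable[OF u]
  have nn: "0 \<le> u x" for x by (rule sdec_nonneg[OF d])
  assume "\<not> 0 < u x0"
  then have ux0: "u x0 = 0" using nn[of x0] by simp
  \<comment> \<open>The bump below is supported in [A - 1, A + 1], at distance 1 from the interval
    outside which \<open>u\<close> is known to vanish.\<close>
  define A where "A = \<bar>x0\<bar> + 2"
  have zero: "u x = 0" if "\<bar>x0\<bar> \<le> \<bar>x\<bar>" for x using sdec_le[OF d x0 that] nn[of x] ux0 by simp
  define h where "h x = max 0 (1 - \<bar>x - A\<bar>)" for x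
  have [measurable]: "h \<in> borel_measurable borel" unfolding h_def[abs_def] by measurable
  have h0: "0 \<le> h x" for x by (simp add: h_def)
  have hH: "h \<in> HH"
  proof (rule lipschitz_HH[where L = 1 and R = "A + 1"])
    have m: "max 0 a \<le> max 0 b + t" if "0 \<le> t" "a \<le> b + t" for a b t :: real using that by (auto simp: max_def)
    have "h x \<le> h y + \<bar>x - y\<bar>" for x y unfolding h_def by (rule m) linarith+
    then show "\<bar>h x - h y\<bar> \<le> 1 * \<bar>x - y\<bar>" for x y using abs_minus_commute[of x y] by (smt (verit))
    show "h x = 0" if "A + 1 < \<bar>x\<bar>" for x using that by (simp add: h_def A_def max_def)
  qed (auto simp: A_def)
  have uh: "u x * h x = 0" for x
  proof (cases "\<bar>x0\<bar> \<le> \<bar>x\<bar>")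
    case True
    then show ?thesis using zero by simp
  next
    case False
    then have "h x = 0" by (simp add: h_def A_def max_def)
    then show ?thesis by simp
  qed
  have upow: "(\<lambda>x. u x ^ n * h x) = (\<lambda>x. 0)" if "1 \<le> n" for n
  proof
    fix x
    have "u x ^ n * h x = u x ^ (n - 1) * (u x * h x)" using that by (cases n) (simp_all add: mult_ac)
    then show "u x ^ n * h x = 0" by (simp add: uh)
  qed
  have "kap * bil u h = 0"
    using eq hH pq unfolding weq_def dot_def by (auto simp: upow uh)
  then have bil0: "bil u h = 0" using kap_pos by simp
  \<comment> \<open>As u h vanishes identically, only the cross terms of the product remain, and
    these are nonpositive.\<close>
  have prod: "dq u z * dq h z = - ((u (fst z) * h (snd z) + u (snd z) * h (fst z)) / (fst z - snd z)\<^sup>2)" for z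
  proof -
    have "(u x - u y) * (h x - h y) = u x * h x + u y * h y - (u x * h y + u y * h x)" for x y by (simp add: algebra_simps)
    then have e: "(u x - u y) * (h x - h y) = - (u x * h y + u y * h x)" for x y unfolding uh by simp
    show ?thesis unfolding dq_def times_divide_times_eq power2_eq_square e by (rule minus_divide_left[symmetric])
  qed
  have le: "dq u z * dq h z \<le> 0" for z unfolding prod using nn h0 by simp
  have "AE z in lborel. - (dq u z * dq h z) = 0"
  proof (subst integral_nonneg_eq_0_iff_AE[symmetric])
    show "integrable lborel (\<lambda>z. - (dq u z * dq h z))" using bil_integrable[OF u hH] by simp
    show "(LINT z|lborel. - (dq u z * dq h z)) = 0" using bil0 by (simp add: bil_def)
  qed (use le in auto)
  then have "AE z in lborel. u (fst z) * h (snd z) = 0"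
  proof eventually_elim
    case (elim z)
    show ?case
    proof (cases "fst z = snd z")
      case False
      then have "(fst z - snd z)\<^sup>2 \<noteq> 0" by simp
      then have "u (fst z) * h (snd z) + u (snd z) * h (fst z) = 0" using elim unfolding prod by simp
      moreover have "0 \<le> u (fst z) * h (snd z)" "0 \<le> u (snd z) * h (fst z)" using nn h0 by auto
      ultimately show ?thesis by linarith
    qed (use uh in simp)
  qed
  \<comment> \<open>Squaring the vanishing cross term and integrating over the plane separates the
    variables, so \<open>u\<close> or \<open>h\<close> must have zero norm.\<close>
  then have "(\<integral>\<^sup>+z. ennreal ((u (fst z) * h (snd z))\<^sup>2) \<partial>lborel) = (\<integral>\<^sup>+z. 0 \<partial>(lborel :: (real \<times> real) measure))"
    by (intro nn_integral_cong_AE) auto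
  moreover have "(\<integral>\<^sup>+z. ennreal ((u (fst z) * h (snd z))\<^sup>2) \<partial>lborel) = nsq u * nsq h"
  proof -
    have [measurable]: "(\<lambda>z. ennreal ((u (fst z) * h (snd z))\<^sup>2)) \<in> borel_measurable (borel \<Otimes>\<^sub>M borel)" by measurable
    have "(\<integral>\<^sup>+z. ennreal ((u (fst z) * h (snd z))\<^sup>2) \<partial>lborel) = (\<integral>\<^sup>+x. (\<integral>\<^sup>+y. ennreal ((u x)\<^sup>2) * ennreal ((h y)\<^sup>2) \<partial>lborel) \<partial>lborel)"
      by (subst nn_integral_R2) (simp_all add: power_mult_distrib ennreal_mult flip: borel_prod)
    also have "\<dots> = (\<integral>\<^sup>+x. ennreal ((u x)\<^sup>2) * nsq h \<partial>lborel)"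
      unfolding nsq_def by (simp add: nn_integral_cmult)
    also have "\<dots> = nsq u * nsq h" unfolding nsq_def by (simp add: nn_integral_multc)
    finally show ?thesis .
  qed
  ultimately have "nsq u * nsq h = 0" by simp
  then have "nsq h = 0" using m by (simp add: nsq_ms[OF HH_L2[OF u]])
  moreover have "ennreal (1/4) \<le> nsq h"
  proof -
    have "ennreal (1/4) = (\<integral>\<^sup>+x. ennreal (1/4) * indicator {A - 1/2..A + 1/2} x \<partial>lborel)"
      by (subst nn_integral_cmult_indicator) auto
    also have "\<dots> \<le> nsq h"
      unfolding nsq_def
    proof (rule nn_integral_mono)
      fix x
      show "ennreal (1/4) * indicator {A - 1/2..A + 1/2} x \<le> ennreal ((norm (h x))\<^sup>2)"
      proof (cases "x \<in> {A - 1/2..A + 1/2}")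
        case True
        then have "x - A \<le> 1/2" "A - x \<le> 1/2" by auto
        then have "1/2 \<le> h x" unfolding h_def by (intro max.coboundedI2) linarith
        then have "(1/2)\<^sup>2 \<le> (h x)\<^sup>2" by (intro power_mono) auto
        then show ?thesis using True by (auto simp: power2_eq_square intro!: ennreal_leI)
      qed simp
    qed
    finally show ?thesis .
  qed
  ultimately show False by (simp add: ennreal_eq_0_iff)
qed

text \<open>A change at the origin affects difference quotients only on the two coordinate axes, a
  null set of the plane.\<close>

lemma HH_modify:
  assumes u: "u \<in> HH" and h: "h \<in> HH" and f [measurable]: "f \<in> borel_measurable borel" and w: "\<And>x. x \<noteq> 0 \<Longrightarrow> w x = u x"
  shows "w \<in> HH" "gs w = gs u" "ms w = ms u" "Nm m w = Nm m u" "bil w h = bil u h"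
    "(LINT x|lborel. f (w x) * h x) = (LINT x|lborel. f (u x) * h x :: real)"
proof -
  note [measurable] = HH_measurable[OF u] HH_measurable[OF h]
  have "w = (\<lambda>x. if x = 0 then w 0 else u x)" using w by auto
  moreover have "(\<lambda>x. if x = 0 then w 0 else u x) \<in> borel_measurable borel" by measurable
  ultimately have [measurable]: "w \<in> borel_measurable borel" by simp
  have ae: "AE x in lborel. w x = u x" using AE_lborel_singleton[of 0] by eventually_elim (rule w)
  have "AE z in lborel. (z :: real \<times> real) \<bullet> (1, 0) \<noteq> 0" "AE z in lborel. (z :: real \<times> real) \<bullet> (0, 1) \<noteq> 0"
    by (rule AE_lborel_inner_neq; simp add: Basis_prod_def)+
  then have ae2: "AE z in lborel. dq w z = dq u z"
    by eventually_elim (auto simp: dq_def w)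
  show "gs w = gs u" unfolding gs_def using ae2 by (intro integral_cong_AE) auto
  show "ms w = ms u" unfolding ms_def using ae by (intro integral_cong_AE) auto
  show "Nm m w = Nm m u" unfolding Nm_def using ae by (intro integral_cong_AE) auto
  show "bil w h = bil u h" unfolding bil_def using ae2 by (intro integral_cong_AE) auto
  show "(LINT x|lborel. f (w x) * h x) = (LINT x|lborel. f (u x) * h x)" using ae by (intro integral_cong_AE) auto
  have "nsq w = nsq u" unfolding nsq_def using ae by (intro nn_integral_cong_AE) auto
  moreover have "gn w = gn u" unfolding gn_def using ae2 by (intro nn_integral_cong_AE) auto
  ultimately show "w \<in> HH" using u by (simp add: HH_iff L2_iff_nsq)
qed

text \<open>The value at the origin is set to the bound \<open>B\<close> of all other values, which
  turns \<open>sdec\<close> into monotonicity at every point.\<close>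

theorem positive_profile:
  assumes c: "0 < c" and ab: "\<bar>a\<bar> \<le> 1" "\<bar>b\<bar> \<le> 1" and pq: "2 \<le> p" "p < q"
    and u: "u \<in> HH" "sdec u" "0 < ms u" "weq c a b p q u"
  shows "\<exists>w\<in>HH. (\<forall>x. 0 < w x) \<and> even_function w \<and> decreasing_in_abs w \<and> weq c a b p q w
    \<and> gs w = gs u \<and> ms w = ms u \<and> (\<forall>m. Nm m w = Nm m u)"
proof -
  obtain B where B: "\<And>x. x \<noteq> 0 \<Longrightarrow> u x \<le> B" using weq_bounded[OF c ab pq u(1,2,4)] by blast
  have pos: "0 < u x" if "x \<noteq> 0" for x by (rule weq_positive[OF pq u that])
  define w where "w x = (if x = 0 then B else u x)" for x
  have wu: "w x = u x" if "x \<noteq> 0" for x using that by (simp add: w_def)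
  note mod = HH_modify[OF u(1) _ _ wu]
  have Bpos: "0 < B" using pos[of 1] B[of 1] by simp
  have w: "w \<in> HH" "gs w = gs u" "ms w = ms u" "Nm m w = Nm m u" for m
    using mod(1)[OF u(1) borel_measurable_const[of 0]] mod(2)[OF u(1) borel_measurable_const[of 0]]
      mod(3)[OF u(1) borel_measurable_const[of 0]] mod(4)[OF u(1) borel_measurable_const[of 0], of m] by auto
  have "weq c a b p q w"
    unfolding weq_def
  proof
    fix h assume h: "h \<in> HH"
    have b: "bil w h = bil u h" by (rule mod(5)[OF h borel_measurable_const[of 0]])
    have l: "dot w h = dot u h" unfolding dot_def using mod(6)[OF h, of "\<lambda>t. t"] by simp
    have n: "(LINT x|lborel. w x ^ m * h x) = (LINT x|lborel. u x ^ m * h x)" for m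
      using mod(6)[OF h, of "\<lambda>t. t ^ m"] by simp
    show "kap * bil w h + c * dot w h + a * (LINT x|lborel. w x ^ p * h x) - b * (LINT x|lborel. w x ^ q * h x) = 0"
      unfolding b l n using u(4) h unfolding weq_def by blast
  qed
  moreover have "\<forall>x. 0 < w x" using pos Bpos by (simp add: w_def)
  moreover have "even_function w"
    unfolding even_function_def w_def using sdec_abs[OF u(2)] by (metis abs_minus_cancel neg_equal_0_iff_equal)
  moreover have "decreasing_in_abs w"
    unfolding decreasing_in_abs_def w_def using sdec_le[OF u(2)] B by auto
  ultimately show ?thesis using w by blast
qed

section \<open>Critical points of the action\<close>

definition dA :: "real \<Rightarrow> nat \<Rightarrow> nat \<Rightarrow> (real \<Rightarrow> real) \<Rightarrow> (real \<Rightarrow> real) \<Rightarrow> real" where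
  "dA c p q v h = kap * bil v h + c * dot v h + (LINT x|lborel. v x ^ p * h x) - (LINT x|lborel. v x ^ q * h x)"

lemma action_HH:
  assumes u: "u \<in> HH"
  shows "action c p q u = kap / 2 * gs u + c / 2 * ms u + 1 / (real p + 1) * (LINT x|lborel. u x ^ (p + 1))
    - 1 / (real q + 1) * (LINT x|lborel. u x ^ (q + 1))"
  unfolding action_def Hhalf_facts(2)[OF HH_L2[OF u] u] ms_L2_norm[symmetric] by simp

text \<open>Expansions such as \<open>signed_expand\<close> are stated for a positive radius e \<ge>
  d. This puts d itself in its place, by a limit in the case d = 0.\<close>

lemma le_square_limit:
  fixes X K d :: real
  assumes "0 \<le> K" and "0 \<le> d" "d \<le> 1" and le: "\<And>e. 0 < e \<Longrightarrow> e \<le> 1 \<Longrightarrow> d \<le> e \<Longrightarrow> X \<le> K * e\<^sup>2"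
  shows "X \<le> K * d\<^sup>2"
proof (cases "d = 0")
  case True
  have "X \<le> 0"
  proof (rule field_le_epsilon)
    fix t :: real assume t: "0 < t"
    define e where "e = min 1 (t / (K + 1))"
    have e: "0 < e" "e \<le> 1" "e \<le> t / (K + 1)" using assms(1) t by (auto simp: e_def)
    have "X \<le> K * e\<^sup>2" using e True by (intro le) auto
    also have "\<dots> \<le> (K + 1) * e" unfolding power2_eq_square using e assms(1) by (intro mult_mono) (auto simp: mult_left_le)
    also have "\<dots> \<le> t" using e(3) assms(1) by (simp add: pos_le_divide_eq mult.commute)
    finally show "X \<le> 0 + t" by simp
  qed
  then show ?thesis using True by simp
qed (use assms in auto)

lemma action_expand:
  assumes v: "v \<in> HH" and pq: "1 \<le> p" "1 \<le> q"
  shows "\<exists>K\<ge>0. \<forall>h\<in>HH. hn h \<le> 1 \<longrightarrow> \<bar>action c p q (\<lambda>x. v x + h x) - action c p q v - dA c p q v h\<bar> \<le> K * (hn h)\<^sup>2"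
proof -
  define I where "I m w = (LINT x|lborel. w x ^ m)" for m and w :: "real \<Rightarrow> real"
  obtain K1 where K1: "K1 \<ge> 0" "\<And>h \<epsilon>. h \<in> HH \<Longrightarrow> 0 < \<epsilon> \<Longrightarrow> \<epsilon> \<le> 1 \<Longrightarrow> hn h \<le> \<epsilon> \<Longrightarrow>
    \<bar>I (p + 1) (\<lambda>x. v x + h x) - I (p + 1) v - real (p + 1) * (LINT x|lborel. v x ^ p * h x)\<bar> \<le> K1 * \<epsilon>\<^sup>2"
    using signed_expand[OF v, of "p + 1"] pq unfolding I_def by auto
  obtain K2 where K2: "K2 \<ge> 0" "\<And>h \<epsilon>. h \<in> HH \<Longrightarrow> 0 < \<epsilon> \<Longrightarrow> \<epsilon> \<le> 1 \<Longrightarrow> hn h \<le> \<epsilon> \<Longrightarrow>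
    \<bar>I (q + 1) (\<lambda>x. v x + h x) - I (q + 1) v - real (q + 1) * (LINT x|lborel. v x ^ q * h x)\<bar> \<le> K2 * \<epsilon>\<^sup>2"
    using signed_expand[OF v, of "q + 1"] pq unfolding I_def by auto
  define P where "P = real p + 1"
  define Q where "Q = real q + 1"
  have PQ: "0 < P" "0 < Q" "real (p + 1) = P" "real (q + 1) = Q" by (auto simp: P_def Q_def)
  define K where "K = kap / 2 + \<bar>c\<bar> / 2 + 1 / P * K1 + 1 / Q * K2"
  have "\<bar>action c p q (\<lambda>x. v x + h x) - action c p q v - dA c p q v h\<bar> \<le> K * (hn h)\<^sup>2" if h: "h \<in> HH" "hn h \<le> 1" for h
  proof -
    define A where "A = I (p + 1) (\<lambda>x. v x + h x) - I (p + 1) v - P * (LINT x|lborel. v x ^ p * h x)"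
    define B where "B = I (q + 1) (\<lambda>x. v x + h x) - I (q + 1) v - Q * (LINT x|lborel. v x ^ q * h x)"
    have A: "\<bar>A\<bar> \<le> K1 * (hn h)\<^sup>2"
      by (rule le_square_limit[OF K1(1) hn_nonneg h(2)]) (unfold A_def PQ(3)[symmetric], rule K1(2)[OF h(1)])
    have B: "\<bar>B\<bar> \<le> K2 * (hn h)\<^sup>2"
      by (rule le_square_limit[OF K2(1) hn_nonneg h(2)]) (unfold B_def PQ(4)[symmetric], rule K2(2)[OF h(1)])
    have i: "1 / r * (a - b - r * x) = 1 / r * a - 1 / r * b - x" if "0 < r" for r a b x :: real using that by (simp add: field_simps)
    have "action c p q (\<lambda>x. v x + h x) - action c p q v - dA c p q v h = (kap / 2 * gs h + c / 2 * ms h) + (1 / P * A - 1 / Q * B)"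
      unfolding action_HH[OF v] action_HH[OF HH_add[OF v h(1)]] dA_def gs_add[OF v h(1)] ms_add[OF v h(1)] A_def B_def i[OF PQ(1)] i[OF PQ(2)]
        P_def[symmetric] Q_def[symmetric] I_def[symmetric] by (simp add: distrib_left)
    also have "\<bar>\<dots>\<bar> \<le> (kap / 2 * gs h + \<bar>c\<bar> / 2 * ms h) + (1 / P * \<bar>A\<bar> + 1 / Q * \<bar>B\<bar>)"
    proof -
      have "\<bar>kap / 2 * gs h + c / 2 * ms h\<bar> \<le> kap / 2 * gs h + \<bar>c\<bar> / 2 * ms h"
        using kap_pos by (intro order.trans[OF abs_triangle_ineq]) (simp add: abs_mult)
      moreover have "\<bar>1 / P * A - 1 / Q * B\<bar> \<le> 1 / P * \<bar>A\<bar> + 1 / Q * \<bar>B\<bar>"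
        using PQ by (intro order.trans[OF abs_triangle_ineq4]) (simp add: abs_mult)
      ultimately show ?thesis by (rule order.trans[OF abs_triangle_ineq add_mono])
    qed
    also have "\<dots> \<le> (kap / 2 * (hn h)\<^sup>2 + \<bar>c\<bar> / 2 * (hn h)\<^sup>2) + (1 / P * (K1 * (hn h)\<^sup>2) + 1 / Q * (K2 * (hn h)\<^sup>2))"
      using kap_pos PQ by (intro add_mono mult_left_mono A B gs_le_hn ms_le_hn) auto
    also have "\<dots> = K * (hn h)\<^sup>2" by (simp add: K_def algebra_simps)
    finally show ?thesis .
  qed
  moreover have "0 \<le> K" using kap_pos PQ K1 K2 by (simp add: K_def)
  ultimately show ?thesis by blast
qed

lemma Hhalf_norm_nonneg: "0 \<le> Hhalf_norm h"
  unfolding Hhalf_norm_def by (intro real_sqrt_ge_zero integral_nonneg_AE) auto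

text \<open>This half of the equivalence of norms controls quadratic remainders; the other half
  enters through \<open>Hhalf_norm_scale_le\<close>, which keeps small multiples of a test function
  small.\<close>

lemma hn_le_Hhalf_norm: "\<exists>C>0. \<forall>h\<in>HH. hn h \<le> C * Hhalf_norm h"
proof -
  define C where "C = sqrt (1 / (2 * pi * kap) + 1 / (2 * pi))"
  have C2: "C\<^sup>2 = 1 / (2 * pi * kap) + 1 / (2 * pi)" unfolding C_def using kap_pos by (intro real_sqrt_pow2) auto
  have C: "0 < C" unfolding C_def using kap_pos by (intro real_sqrt_gt_zero add_pos_pos) auto
  have "hn h \<le> C * Hhalf_norm h" if h: "h \<in> HH" for h
  proof (rule power2_le_imp_le)
    note f = Hhalf_facts(3,4)[OF HH_L2[OF h] h]
    have "gs h \<le> (Hhalf_norm h)\<^sup>2 / (2 * pi * kap)" using f(2) kap_pos by (simp add: pos_le_divide_eq mult.commute mult.left_commute)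
    moreover have "ms h \<le> (Hhalf_norm h)\<^sup>2 / (2 * pi)" using f(1) by (simp add: pos_le_divide_eq mult.commute mult.left_commute)
    ultimately show "(hn h)\<^sup>2 \<le> (C * Hhalf_norm h)\<^sup>2" unfolding hn_sq power_mult_distrib C2 by (simp add: distrib_right)
  qed (use C Hhalf_norm_nonneg in simp)
  then show ?thesis using C by blast
qed

lemma Hhalf_norm_scale_le:
  assumes h: "h \<in> HH" shows "\<exists>M>0. \<forall>e>0. Hhalf_norm (\<lambda>x. e * h x) \<le> e * M"
proof -
  define M where "M = sqrt (2 * pi * (ms h + kap * gs h)) + 1"
  have nn: "0 \<le> 2 * pi * (ms h + kap * gs h)" using kap_pos by simp
  have "Hhalf_norm (\<lambda>x. e * h x) \<le> e * M" if e: "0 < e" for e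
  proof -
    have "Hhalf_norm (\<lambda>x. e * h x) \<le> e * sqrt (2 * pi * (ms h + kap * gs h))"
    proof (rule power2_le_imp_le)
      have "(Hhalf_norm (\<lambda>x. e * h x))\<^sup>2 \<le> 2 * pi * (ms (\<lambda>x. e * h x) + kap * gs (\<lambda>x. e * h x))"
        by (rule Hhalf_facts(5)[OF HH_L2 HH_scale[OF h]]) (rule HH_scale[OF h])
      also have "\<dots> = e\<^sup>2 * (2 * pi * (ms h + kap * gs h))" by (simp add: ms_scale gs_scale algebra_simps)
      also have "\<dots> = (e * sqrt (2 * pi * (ms h + kap * gs h)))\<^sup>2" unfolding power_mult_distrib real_sqrt_pow2[OF nn] ..
      finally show "(Hhalf_norm (\<lambda>x. e * h x))\<^sup>2 \<le> (e * sqrt (2 * pi * (ms h + kap * gs h)))\<^sup>2" .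
    qed (use e nn in simp)
    also have "\<dots> \<le> e * M" using e by (simp add: M_def)
    finally show ?thesis .
  qed
  moreover have "0 < M" unfolding M_def using real_sqrt_ge_zero[OF nn] by linarith
  ultimately show ?thesis by blast
qed

lemma dA_scale: "dA c p q v (\<lambda>x. e * h x) = e * dA c p q v h"
  unfolding dA_def bil_scale dot_scale mult.left_commute[of _ e] by (simp add: algebra_simps)

text \<open>The action expands with linear part \<open>dA\<close> and a quadratic remainder. At a
  critical point, small multiples of a test function force the linear part to vanish; conversely,
  without a linear part only the quadratic remainder is left, so 0 is the derivative.\<close>

lemma SP_solution_iff:
  assumes pq: "1 \<le> p" "1 \<le> q"
  shows "SP_solution c p q v \<longleftrightarrow> v \<in> HH \<and> (\<forall>h\<in>HH. dA c p q v h = 0)"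
proof (intro iffI conjI ballI)
  assume s: "SP_solution c p q v"
  then show v: "v \<in> HH" by (simp add: SP_solution_def Hhalf_eq_HH)
  fix h assume h: "h \<in> HH"
  obtain K where K: "K \<ge> 0" "\<And>h. h \<in> HH \<Longrightarrow> hn h \<le> 1 \<Longrightarrow> \<bar>action c p q (\<lambda>x. v x + h x) - action c p q v - dA c p q v h\<bar> \<le> K * (hn h)\<^sup>2"
    using action_expand[OF v pq] by blast
  obtain M where M: "M > 0" "\<And>e. 0 < e \<Longrightarrow> Hhalf_norm (\<lambda>x. e * h x) \<le> e * M" using Hhalf_norm_scale_le[OF h] by blast
  define r where "r = hn h + 1"
  have r: "0 < r" "hn h \<le> r" using hn_nonneg[of h] by (auto simp: r_def intro: add_nonneg_pos)
  have "\<bar>dA c p q v h\<bar> \<le> 0"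
  proof (rule field_le_epsilon)
    fix t :: real assume t: "0 < t"
    define \<eta> where "\<eta> = t / (2 * M)"
    have \<eta>: "0 < \<eta>" using t M by (simp add: \<eta>_def)
    obtain \<delta> where \<delta>: "\<delta> > 0" "\<And>k. k \<in> HH \<Longrightarrow> Hhalf_norm k < \<delta> \<Longrightarrow> \<bar>action c p q (\<lambda>x. v x + k x) - action c p q v\<bar> \<le> \<eta> * Hhalf_norm k"
      using s \<eta> unfolding SP_solution_def has_Hhalf_derivative_def Hhalf_eq_HH by auto
    \<comment> \<open>The three bounds keep e h within the radius \<delta>, keep it in the unit ball
      of the expansion, and make the quadratic remainder divided by e at most t / 2.\<close>
    define e where "e = min (\<delta> / (2 * M)) (min (1 / r) (t / (2 * (K * r\<^sup>2 + 1))))"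
    have Kr: "0 < K * r\<^sup>2 + 1" using K by (intro add_nonneg_pos) auto
    have e: "0 < e" "e \<le> \<delta> / (2 * M)" "e \<le> 1 / r" "e \<le> t / (2 * (K * r\<^sup>2 + 1))"
      using \<delta> M r t Kr by (auto simp: e_def)
    define k where "k x = e * h x" for x
    have k: "k \<in> HH" unfolding k_def[abs_def] by (rule HH_scale[OF h])
    have N: "Hhalf_norm k \<le> e * M" unfolding k_def[abs_def] by (rule M(2)[OF e(1)])
    have "e * M \<le> \<delta> / 2" using e(2) M(1) by (simp add: pos_le_divide_eq mult_ac)
    then have Nd: "Hhalf_norm k < \<delta>" using N \<delta>(1) by linarith
    have hk: "hn k \<le> e * r" unfolding k_def[abs_def] hn_scale using e(1) r by simp
    also have "\<dots> \<le> 1" using e(3) r by (simp add: pos_le_divide_eq)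
    finally have hk1: "hn k \<le> 1" .
    have "\<bar>dA c p q v k\<bar> \<le> \<eta> * Hhalf_norm k + K * (hn k)\<^sup>2" using \<delta>(2)[OF k Nd] K(2)[OF k hk1] by linarith
    also have "\<dots> \<le> \<eta> * (e * M) + K * (e * r)\<^sup>2" using \<eta> K(1) N hk by (intro add_mono mult_left_mono power_mono) auto
    also have "\<dots> = e * (t / 2 + K * r\<^sup>2 * e)" using M(1) by (simp add: \<eta>_def power2_eq_square algebra_simps)
    finally have "e * \<bar>dA c p q v h\<bar> \<le> e * (t / 2 + K * r\<^sup>2 * e)" unfolding k_def[abs_def] dA_scale using e(1) by (simp add: abs_mult)
    then have "\<bar>dA c p q v h\<bar> \<le> t / 2 + K * r\<^sup>2 * e" using e(1) by simp
    also have "K * r\<^sup>2 * e \<le> (K * r\<^sup>2 + 1) * e" using e(1) by simp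
    also have "\<dots> \<le> t / 2" using e(4) Kr by (simp add: pos_le_divide_eq mult_ac)
    finally show "\<bar>dA c p q v h\<bar> \<le> 0 + t" by simp
  qed
  then show "dA c p q v h = 0" by simp
next
  assume "v \<in> HH \<and> (\<forall>h\<in>HH. dA c p q v h = 0)"
  then have v: "v \<in> HH" and d: "\<And>h. h \<in> HH \<Longrightarrow> dA c p q v h = 0" by auto
  obtain K where K: "K \<ge> 0" "\<And>h. h \<in> HH \<Longrightarrow> hn h \<le> 1 \<Longrightarrow> \<bar>action c p q (\<lambda>x. v x + h x) - action c p q v - dA c p q v h\<bar> \<le> K * (hn h)\<^sup>2"
    using action_expand[OF v pq] by blast
  obtain C where C: "C > 0" "\<And>h. h \<in> HH \<Longrightarrow> hn h \<le> C * Hhalf_norm h" using hn_le_Hhalf_norm by blast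
  have "\<exists>\<delta>>0. \<forall>h\<in>HH. Hhalf_norm h < \<delta> \<longrightarrow> \<bar>action c p q (\<lambda>x. v x + h x) - action c p q v - 0\<bar> \<le> \<eta> * Hhalf_norm h"
    if \<eta>: "0 < \<eta>" for \<eta>
  proof (intro exI conjI ballI impI)
    have KC: "0 < K * C\<^sup>2 + 1" using K(1) by (intro add_nonneg_pos) auto
    show "0 < min (1 / C) (\<eta> / (K * C\<^sup>2 + 1))" using C(1) \<eta> KC by simp
    fix h assume h: "h \<in> HH" and lt: "Hhalf_norm h < min (1 / C) (\<eta> / (K * C\<^sup>2 + 1))"
    define N where "N = Hhalf_norm h"
    have N: "0 \<le> N" "N < 1 / C" "N < \<eta> / (K * C\<^sup>2 + 1)" using lt Hhalf_norm_nonneg by (auto simp: N_def)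
    have hN: "hn h \<le> C * N" unfolding N_def by (rule C(2)[OF h])
    also have "\<dots> \<le> 1" using N(2) C(1) by (simp add: pos_less_divide_eq mult.commute)
    finally have h1: "hn h \<le> 1" .
    have "\<bar>action c p q (\<lambda>x. v x + h x) - action c p q v - 0\<bar> \<le> K * (hn h)\<^sup>2" using K(2)[OF h h1] d[OF h] by simp
    also have "\<dots> \<le> K * (C * N)\<^sup>2" using K(1) hN by (intro mult_left_mono power_mono) auto
    also have "\<dots> = (K * C\<^sup>2 * N) * N" by (simp add: power2_eq_square)
    also have "\<dots> \<le> \<eta> * N"
    proof (rule mult_right_mono[OF _ N(1)])
      have "K * C\<^sup>2 * N \<le> (K * C\<^sup>2 + 1) * N" using N(1) by (simp add: distrib_right)
      also have "\<dots> \<le> \<eta>" using N(3) KC by (simp add: pos_less_divide_eq mult.commute)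
      finally show "K * C\<^sup>2 * N \<le> \<eta>" .
    qed
    finally show "\<bar>action c p q (\<lambda>x. v x + h x) - action c p q v - 0\<bar> \<le> \<eta> * Hhalf_norm h" unfolding N_def .
  qed
  then show "SP_solution c p q v"
    unfolding SP_solution_def has_Hhalf_derivative_def Hhalf_eq_HH using v by (auto intro: exI[of _ 0])
qed

text \<open>Since s^2 = 1, the factor s^m equals s times s^(m+1); a common factor s can be taken out
  of the equation, and the signs s^(m+1) remain at the powers.\<close>

lemma SP_solution_of_weq:
  assumes pq: "1 \<le> p" "1 \<le> q" and s: "s = 1 \<or> s = -1" and w: "w \<in> HH" "weq c (s ^ (p + 1)) (s ^ (q + 1)) p q w"
  shows "SP_solution c p q (\<lambda>x. s * w x)"
  unfolding SP_solution_iff[OF pq]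
proof (intro conjI ballI)
  show "(\<lambda>x. s * w x) \<in> HH" by (rule HH_scale[OF w(1)])
  fix h assume h: "h \<in> HH"
  have ss: "s * s = 1" using s by auto
  have b: "bil (\<lambda>x. s * w x) h = s * bil w h" by (simp add: bil_def dq_scale mult.assoc)
  have l: "dot (\<lambda>x. s * w x) h = s * dot w h" by (simp add: dot_def mult.assoc)
  have n: "(LINT x|lborel. (s * w x) ^ m * h x) = s * (s ^ (m + 1) * (LINT x|lborel. w x ^ m * h x))" for m
  proof -
    have "s * (s ^ (m + 1) * X) = s ^ m * X" for X using ss by (simp flip: mult.assoc)
    then show ?thesis by (simp add: power_mult_distrib mult.assoc)
  qed
  have "dA c p q (\<lambda>x. s * w x) h = s * (kap * bil w h + c * dot w h
     + s ^ (p + 1) * (LINT x|lborel. w x ^ p * h x) - s ^ (q + 1) * (LINT x|lborel. w x ^ q * h x))"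
    unfolding dA_def b l n by (simp add: algebra_simps)
  also have "\<dots> = 0" using w(2) h unfolding weq_def by simp
  finally show "dA c p q (\<lambda>x. s * w x) h = 0" .
qed

lemma ms_eq_0_iff:
  assumes v: "v \<in> HH" shows "ms v = 0 \<longleftrightarrow> (AE x in lborel. v x = 0)"
  unfolding ms_def using integral_nonneg_eq_0_iff_AE[OF HH_ms_integrable[OF v]] by simp

text \<open>The equation tested with the solution itself: the Nehari identity.\<close>

lemma SP_identity:
  assumes pq: "1 \<le> p" "1 \<le> q" and v: "SP_solution c p q v"
  shows "kap * gs v + c * ms v + (LINT x|lborel. v x ^ (p + 1)) - (LINT x|lborel. v x ^ (q + 1)) = 0"
proof -
  have "dA c p q v v = 0" using v unfolding SP_solution_iff[OF pq] by blast
  then show ?thesis unfolding dA_def bil_self dot_self by (simp add: mult.commute)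
qed

lemma power_integral_le_Nm: "\<bar>LINT x|lborel. v x ^ m\<bar> \<le> Nm m v"
  using integral_norm_bound[of lborel "\<lambda>x. v x ^ m"] by (simp add: Nm_def power_abs)

lemma power_integral_even: "even m \<Longrightarrow> (LINT x|lborel. v x ^ m) = Nm m v"
  by (simp add: Nm_def power_even_abs)

text \<open>Links arbitrary solutions, possibly sign-changing, to the minimisation. The odd power
  that \<open>a\<close> selects has an integral of even degree, equal to the one with absolute
  values; the other integral is at most that with absolute values, and the Nehari identity makes
  \<open>NK\<close> nonpositive. \<open>Nn\<close> is the degree of this other integral, so that it
  cancels in \<open>NI\<close>.\<close>

lemma nehari_of_solution:
  assumes pq: "2 \<le> p" "p < q" and a: "a = 1 \<and> odd p \<or> a = -1 \<and> odd q" and v: "SP_solution c p q v"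
  shows "NK c a p q v \<le> 0" "action c p q v = NI c a p q v"
proof -
  have pq1: "1 \<le> p" "1 \<le> q" using pq by auto
  have vH: "v \<in> HH" using v unfolding SP_solution_iff[OF pq1] by blast
  note id = SP_identity[OF pq1 v]
  define X where "X = (LINT x|lborel. v x ^ (p + 1))"
  define Y where "Y = (LINT x|lborel. v x ^ (q + 1))"
  have K: "NK c a p q v = kap * gs v + c * ms v + a * Nm (p + 1) v - Nm (q + 1) v" unfolding NK_def fn_def by simp
  have act: "action c p q v = kap / 2 * gs v + c / 2 * ms v + 1 / (real p + 1) * X - 1 / (real q + 1) * Y"
    unfolding action_HH[OF vH] X_def Y_def ..
  have XY: "\<bar>X\<bar> \<le> Nm (p + 1) v" "\<bar>Y\<bar> \<le> Nm (q + 1) v" unfolding X_def Y_def by (rule power_integral_le_Nm)+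
  have id': "kap * gs v + c * ms v + X - Y = 0" using id unfolding X_def Y_def .
  consider "a = 1" "X = Nm (p + 1) v" | "a = -1" "Y = Nm (q + 1) v"
    using a power_integral_even[of "p + 1" v] power_integral_even[of "q + 1" v] unfolding X_def Y_def by auto
  then have "NK c a p q v \<le> 0 \<and> action c p q v = NI c a p q v"
  proof cases
    case 1
    have "NK c a p q v = Y - Nm (q + 1) v" using K id' 1 by simp
    moreover have "NI c a p q v = action c p q v + (Y - Nm (q + 1) v - NK c a p q v) / (real q + 1)"
      unfolding NI_NK act Nn_def using 1 by (simp add: diff_divide_distrib)
    ultimately show ?thesis using XY by simp
  next
    case 2
    have "- NK c a p q v = X + Nm (p + 1) v" using K id' 2 by simp
    moreover have "0 \<le> X + Nm (p + 1) v"
      using XY(1) by linarith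
    moreover have "NI c a p q v = action c p q v + (- X - Nm (p + 1) v - NK c a p q v) / (real p + 1)"
      unfolding NI_NK act Nn_def using 2 by (simp add: diff_divide_distrib)
    ultimately show ?thesis by simp
  qed
  then show "NK c a p q v \<le> 0" "action c p q v = NI c a p q v" by auto
qed

theorem nehari_solution:
  assumes c: "0 < c" and pq: "2 \<le> p" "p < q" and a: "a = 1 \<or> a = -1" and s: "s = 1 \<or> s = -1" "s ^ (p + 1) = a" "s ^ (q + 1) = 1"
  shows "\<exists>w\<in>HH. (\<forall>x. 0 < w x) \<and> even_function w \<and> decreasing_in_abs w \<and> 0 < ms w \<and> SP_solution c p q (\<lambda>x. s * w x)
    \<and> (\<forall>v\<in>HH. 0 < ms v \<longrightarrow> NK c a p q v \<le> 0 \<longrightarrow> NI c a p q (\<lambda>x. s * w x) \<le> NI c a p q v)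
    \<and> (\<forall>v\<in>HH. 0 < ms v \<longrightarrow> NK c a p q v < 0 \<longrightarrow> NI c a p q (\<lambda>x. s * w x) < NI c a p q v)"
proof -
  obtain u where u: "u \<in> HH" "sdec u" "0 < ms u" "weq c a 1 p q u"
    and min: "\<forall>v\<in>HH. 0 < ms v \<longrightarrow> NK c a p q v \<le> 0 \<longrightarrow> NI c a p q u \<le> NI c a p q v"
      "\<forall>v\<in>HH. 0 < ms v \<longrightarrow> NK c a p q v < 0 \<longrightarrow> NI c a p q u < NI c a p q v"
    using nehari_minimiser[OF c a pq] by blast
  obtain w where w: "w \<in> HH" "\<forall>x. 0 < w x" "even_function w" "decreasing_in_abs w" "weq c a 1 p q w"
    and eq: "gs w = gs u" "ms w = ms u" "\<And>m. Nm m w = Nm m u"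
    using positive_profile[OF c _ _ pq u] a by force
  have s1: "\<bar>s\<bar> = 1" "s\<^sup>2 = 1" using s(1) by auto
  have I: "NI c a p q (\<lambda>x. s * w x) = NI c a p q u"
    unfolding NI_def fn_scale unfolding fn_def eq s1 power_one mult_1 ..
  have SP: "SP_solution c p q (\<lambda>x. s * w x)"
  proof (rule SP_solution_of_weq[OF _ _ s(1) w(1)])
    show "weq c (s ^ (p + 1)) (s ^ (q + 1)) p q w" unfolding s(2,3) by (rule w(5))
  qed (use pq in auto)
  have m: "0 < ms w" using u(3) eq(2) by simp
  show ?thesis by (rule bexI[OF _ w(1)]) (intro conjI w(2-4) m SP; unfold I; rule min)
qed

lemma nontrivial_solutions_iff:
  assumes "1 \<le> p" "1 \<le> q"
  shows "v \<in> nontrivial_solutions c p q \<longleftrightarrow> SP_solution c p q v \<and> v \<in> HH \<and> 0 < ms v"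
proof -
  have "v \<in> HH" if "SP_solution c p q v" using that unfolding SP_solution_iff[OF assms] by blast
  moreover have "0 < ms v \<longleftrightarrow> ms v \<noteq> 0" using ms_nonneg[of v] by linarith
  ultimately show ?thesis unfolding nontrivial_solutions_def using ms_eq_0_iff by auto
qed

text \<open>Every nontrivial solution is feasible for the minimisation, with action equal to
  \<open>NI\<close>. The strict comparison is recorded in order to exclude positive ground states
  later.\<close>

theorem nehari_ground_state:
  assumes c: "0 < c" and pq: "2 \<le> p" "p < q" and a: "a = 1 \<and> odd p \<or> a = -1 \<and> odd q" and s: "s = 1 \<or> s = -1" "s ^ (p + 1) = a" "s ^ (q + 1) = 1"
  shows "\<exists>w. (\<forall>x. 0 < w x) \<and> even_function w \<and> decreasing_in_abs w \<and> ground_state c p q (\<lambda>x. s * w x)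
    \<and> (\<forall>v \<in> nontrivial_solutions c p q. NK c a p q v < 0 \<longrightarrow> action c p q (\<lambda>x. s * w x) < action c p q v)"
proof -
  have pq1: "1 \<le> p" "1 \<le> q" using pq by auto
  have a': "a = 1 \<or> a = -1" using a by blast
  obtain w where w: "w \<in> HH" "\<forall>x. 0 < w x" "even_function w" "decreasing_in_abs w" "0 < ms w" "SP_solution c p q (\<lambda>x. s * w x)"
    and min: "\<forall>v\<in>HH. 0 < ms v \<longrightarrow> NK c a p q v \<le> 0 \<longrightarrow> NI c a p q (\<lambda>x. s * w x) \<le> NI c a p q v"
      "\<forall>v\<in>HH. 0 < ms v \<longrightarrow> NK c a p q v < 0 \<longrightarrow> NI c a p q (\<lambda>x. s * w x) < NI c a p q v"
    using nehari_solution[OF c pq a' s] by blast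
  note N = nehari_of_solution[OF pq a]
  have "(\<lambda>x. s * w x) \<in> nontrivial_solutions c p q"
    unfolding nontrivial_solutions_iff[OF pq1] using w(6) HH_scale[OF w(1), of s] w(5) s(1) by (auto simp: ms_scale)
  moreover have "action c p q (\<lambda>x. s * w x) \<le> action c p q v" if "v \<in> nontrivial_solutions c p q" for v
    using that min(1) N[of c v] N(2)[OF w(6)] unfolding nontrivial_solutions_iff[OF pq1] by auto
  moreover have "action c p q (\<lambda>x. s * w x) < action c p q v" if "v \<in> nontrivial_solutions c p q" "NK c a p q v < 0" for v
    using that min(2) N[of c v] N(2)[OF w(6)] unfolding nontrivial_solutions_iff[OF pq1] by auto
  ultimately show ?thesis using w(2-4) unfolding ground_state_def by blast
qed

lemma mirrored:
  assumes "\<forall>x. 0 < w x" "even_function w" "decreasing_in_abs w"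
  shows "(\<forall>x. - 1 * w x < 0) \<and> even_function (\<lambda>x. - 1 * w x) \<and> increasing_in_abs (\<lambda>x. - 1 * w x)"
  using assms by (simp add: even_function_def decreasing_in_abs_def increasing_in_abs_def)

lemma signed_solution_ms_pos:
  assumes "v \<in> HH" and "AE x in lborel. v x \<noteq> 0" shows "0 < ms v"
proof (rule ccontr)
  assume "\<not> 0 < ms v"
  then have "ms v = 0" using ms_nonneg[of v] by linarith
  then have "AE x in lborel. v x = 0" using ms_eq_0_iff[OF assms(1)] by blast
  with assms(2) have "AE x in (lborel :: real measure). False" by eventually_elim simp
  then have "ae_filter (lborel :: real measure) = bot" by (simp add: trivial_limit_def)
  then show False by (simp add: ae_filter_eq_bot_iff)
qed

theorem theorem2p5:
  fixes c :: real and p q :: nat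
  assumes "c > 0" and "2 \<le> p" and "p < q"
  shows
   "(odd p \<and> odd q \<longrightarrow>
       (\<exists>\<phi>. ground_state c p q \<phi> \<and> (\<forall>x. \<phi> x > 0) \<and> even_function \<phi> \<and> decreasing_in_abs \<phi>) \<and>
       (\<exists>\<phi>. ground_state c p q \<phi> \<and> (\<forall>x. \<phi> x < 0) \<and> even_function \<phi> \<and> increasing_in_abs \<phi>)) \<and>
    (odd p \<and> even q \<longrightarrow>
       (\<exists>\<phi>. ground_state c p q \<phi> \<and> (\<forall>x. \<phi> x > 0) \<and> even_function \<phi> \<and> decreasing_in_abs \<phi>) \<and>
       \<not> (\<exists>\<phi>. SP_solution c p q \<phi> \<and> (AE x in lborel. \<phi> x < 0))) \<and>
    (even p \<and> odd q \<longrightarrow>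
       (\<exists>\<phi>. SP_solution c p q \<phi> \<and> (\<forall>x. \<phi> x > 0) \<and> even_function \<phi> \<and> decreasing_in_abs \<phi>) \<and>
       (\<exists>\<phi>. ground_state c p q \<phi> \<and> (\<forall>x. \<phi> x < 0) \<and> even_function \<phi> \<and> increasing_in_abs \<phi>) \<and>
       (\<forall>\<phi>. SP_solution c p q \<phi> \<and> (AE x in lborel. \<phi> x > 0) \<longrightarrow> \<not> ground_state c p q \<phi>)) \<and>
    (even p \<and> even q \<longrightarrow>
       (\<exists>\<phi>. SP_solution c p q \<phi> \<and> (\<forall>x. \<phi> x > 0) \<and> even_function \<phi> \<and> decreasing_in_abs \<phi>) \<and>
       (c < c0 p q \<longrightarrow>
         (\<exists>\<phi>. SP_solution c p q \<phi> \<and> (\<forall>x. \<phi> x < 0) \<and> even_function \<phi> \<and> increasing_in_abs \<phi>)))"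
proof -
  note pq = assms(2,3) and c = assms(1)
  have pq1: "1 \<le> p" "1 \<le> q" using pq by auto
  \<comment> \<open>With a = 1 and s = 1 the sign conditions hold for all parities.\<close>
  have pos: "\<exists>\<phi>. SP_solution c p q \<phi> \<and> (\<forall>x. \<phi> x > 0) \<and> even_function \<phi> \<and> decreasing_in_abs \<phi>"
    using nehari_solution[OF c pq, of 1 1] by auto
  have pos_ground: "\<exists>\<phi>. ground_state c p q \<phi> \<and> (\<forall>x. \<phi> x > 0) \<and> even_function \<phi> \<and> decreasing_in_abs \<phi>" if "odd p"
    using nehari_ground_state[OF c pq, of 1 1] that by auto
  \<comment> \<open>For s = -1 the lower power acquires the sign (-1)^(p+1), and q must be odd for
    the top power to keep its sign.\<close>
  have neg_ground: "\<exists>\<phi>. ground_state c p q \<phi> \<and> (\<forall>x. \<phi> x < 0) \<and> even_function \<phi> \<and> increasing_in_abs \<phi>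
      \<and> (\<forall>v \<in> nontrivial_solutions c p q. NK c a p q v < 0 \<longrightarrow> action c p q \<phi> < action c p q v)"
    if a: "a = 1 \<and> odd p \<or> a = -1 \<and> even p" and q: "odd q" for a
  proof -
    have "a = 1 \<and> odd p \<or> a = -1 \<and> odd q" "(-1) ^ (p + 1) = a" "(-1) ^ (q + 1) = (1 :: real)" using a q by auto
    then obtain w where w: "\<forall>x. 0 < w x" "even_function w" "decreasing_in_abs w" "ground_state c p q (\<lambda>x. -1 * w x)"
      "\<forall>v \<in> nontrivial_solutions c p q. NK c a p q v < 0 \<longrightarrow> action c p q (\<lambda>x. -1 * w x) < action c p q v"
      using nehari_ground_state[OF c pq, of a "-1"] by blast
    show ?thesis using mirrored[OF w(1-3)] w(4,5) by blast
  qed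
  \<comment> \<open>For a negative function both power terms enter the Nehari identity as
    nonnegative quantities, next to a strictly positive mass term.\<close>
  have no_neg: False if pq': "odd p" "even q" and \<phi>: "SP_solution c p q \<phi>" "AE x in lborel. \<phi> x < 0" for \<phi>
  proof -
    have H: "\<phi> \<in> HH" using \<phi>(1) unfolding SP_solution_iff[OF pq1] by blast
    have "AE x in lborel. \<phi> x \<noteq> 0" using \<phi>(2) by eventually_elim simp
    then have "0 < c * ms \<phi>" using c signed_solution_ms_pos[OF H] by simp
    moreover have "0 \<le> kap * gs \<phi>" using kap_pos by simp
    moreover have "0 \<le> (LINT x|lborel. \<phi> x ^ (p + 1))" using pq' by (subst power_integral_even) auto
    moreover have "0 \<le> (LINT x|lborel. - (\<phi> x ^ (q + 1)))"
    proof (rule integral_nonneg_AE)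
      show "AE x in lborel. 0 \<le> - (\<phi> x ^ (q + 1))"
        using \<phi>(2)
      proof eventually_elim
        case (elim x)
        then show ?case using pq' by (simp add: mult_nonpos_nonneg zero_le_even_power del: zero_le_mult_iff mult_le_0_iff)
      qed
    qed
    then have "(LINT x|lborel. \<phi> x ^ (q + 1)) \<le> 0" by simp
    ultimately show False using SP_identity[OF pq1 \<phi>(1)] by linarith
  qed
  \<comment> \<open>On a positive solution the lower power has the sign opposite to the one in the
    negative problem; the Nehari identity makes \<open>NK\<close> equal to -2 times its integral,
    and the negative ground state has strictly smaller action.\<close>
  have no_pos_ground: "\<not> ground_state c p q \<phi>" if pq': "even p" "odd q" and \<phi>: "SP_solution c p q \<phi>" "AE x in lborel. \<phi> x > 0" for \<phi>
  proof -
    have H: "\<phi> \<in> HH" using \<phi>(1) unfolding SP_solution_iff[OF pq1] by blast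
    have "AE x in lborel. \<phi> x \<noteq> 0" using \<phi>(2) by eventually_elim simp
    then have m: "0 < ms \<phi>" by (rule signed_solution_ms_pos[OF H])
    have "(LINT x|lborel. \<phi> x ^ (p + 1)) = Nm (p + 1) \<phi>"
      unfolding Nm_def using HH_measurable[OF H] \<phi>(2) by (intro integral_cong_AE) auto
    moreover have "(LINT x|lborel. \<phi> x ^ (q + 1)) = Nm (q + 1) \<phi>" using pq' by (intro power_integral_even) simp
    moreover have "0 < Nm (p + 1) \<phi>" using pq by (intro Nm_pos_of_ms H m) auto
    ultimately have K: "NK c (-1) p q \<phi> < 0"
      using SP_identity[OF pq1 \<phi>(1)] unfolding NK_def fn_def by linarith
    have nt: "\<phi> \<in> nontrivial_solutions c p q" unfolding nontrivial_solutions_iff[OF pq1] using \<phi>(1) H m by blast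
    obtain \<psi> where \<psi>: "ground_state c p q \<psi>" "action c p q \<psi> < action c p q \<phi>"
      using neg_ground[of "-1"] pq' nt K by blast
    then show ?thesis unfolding ground_state_def by force
  qed
  have neg: "\<exists>\<phi>. SP_solution c p q \<phi> \<and> (\<forall>x. \<phi> x < 0) \<and> even_function \<phi> \<and> increasing_in_abs \<phi>"
    if pq': "even p" "even q" and cc: "c < c0 p q"
  proof -
    obtain u where u: "u \<in> HH" "sdec u" "0 < ms u" "weq c (-1) (-1) p q u"
      using zero_mass_minimiser[OF c pq cc] by blast
    obtain w where w: "w \<in> HH" "\<forall>x. 0 < w x" "even_function w" "decreasing_in_abs w" "weq c (-1) (-1) p q w"
      using positive_profile[OF c _ _ pq u] by auto
    have "SP_solution c p q (\<lambda>x. -1 * w x)" using w(5) pq' by (intro SP_solution_of_weq pq1 w(1)) auto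
    then show ?thesis using mirrored[OF w(2-4)] by blast
  qed
  show ?thesis
    using pos pos_ground neg_ground[of 1] neg_ground[of "-1"] no_neg no_pos_ground neg by blast
qed

end
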